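(* Let $F:\mathbb R^{\mathbb N}\to\mathbb R$. Assume that there exist $\delta\in[1,\tfrac32)$, $p\in(0,\delta^{-1})$, a positive sequence $\boldsymbol{\mathsf b}=(\mathsf b_j)_{j\in\mathbb N}\in\ell^p$, a sequence of positive functions $\boldsymbol\beta(\boldsymbol\xi)=(\beta_j(\xi_j))_{j\in\mathbb N}$, and a function $C_F(\boldsymbol\xi)=\prod_{j\ge1}C_j(\xi_j)<\infty$ with $C_j(\xi_j)\ge1$, such that: (i) $|\partial^{\boldsymbol\nu}F(\boldsymbol\xi)|\le C_F(\boldsymbol\xi)\,\boldsymbol\beta(\boldsymbol\xi)^{\boldsymbol\nu}\,\boldsymbol{\mathsf b}^{\boldsymbol\nu}(|\boldsymbol\nu|!)^\delta$ for all $\boldsymbol\xi\in\mathbb R^{\mathbb N}$ and $\boldsymbol\nu\in\mathcal F$; (ii) $K:=\prod_{j=1}^s\int_{\mathbb R}C_j(\xi_j)w(\xi_j)\,d\xi_j<\infty$; (iii) $\rho:=\max_{j\in\mathbb N}\Big(\int_{\mathbb R}C_j(\xi_j)^2\beta_j(\xi_j)^2\psi_j^2(\xi_j)\,d\xi_j\Big)^{1/2}<\infty$. Let $$\vartheta:=\begin{cases}\omega\ \text{ for some }\omega\in\big(\tfrac12,\tfrac1{2\delta-1}\big),&p\in(0,\tfrac23],\\[2pt]\dfrac{p}{2-p},&p\in(\tfrac23,\tfrac1\delta),\end{cases}\qquad \gamma_{\mathfrak u}:=\Big((|\mathfrak u|!)^\delta\prod_{j\in\mathfrak u}\frac{\rho\,\mathsf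 b_j}{\sqrt{\varrho_j(\vartheta)}}\Big)^{\frac2{1+\vartheta}},\quad\mathfrak u\subseteq\{1,\dots,s\},$$ where the sequence $(\tau_j)_{j\in\mathbb N}$ is suitably chosen so that $\varrho_j(\vartheta)\le\varrho_{\max}(\vartheta)<\infty$ for all $j\ge1$. Let $n=2^m$, $m\in\mathbb N$, and consider the approximation of $I_s(F)$ by the randomly shifted lattice rule $Q^\Delta_{s,n}(F)$ whose generating vector is constructed by the component-by-component algorithm with the weights $\gamma_{\mathfrak u}$. Then $F\in\mathcal W_{\boldsymbol\gamma}(\mathbb R^s)$ and there exists a constant $C_{\gamma,\vartheta}>0$, independent of both the dimension $s$ and the number of points $n$, such that $$\sqrt{\mathbb E_\Delta\big(|I_s(F)-Q^\Delta_{s,n}(F)|^2\big)}\le C_{\gamma,\vartheta}^{1/2}\,n^{-\frac1{2\vartheta}}.$$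
   Context: $\mathcal F$: sequences $\boldsymbol\nu=(\nu_j)_{j\in\mathbb N}$ of non-negative integers with finitely many nonzero entries; $|\boldsymbol\nu|=\sum_j\nu_j$; $\boldsymbol R^{\boldsymbol\nu}=\prod_jR_j^{\nu_j}$; $\partial^{\boldsymbol\nu}$ is the mixed partial derivative of order $\nu_j$ in the $j$-th variable. $F$ is infinitely differentiable (all $\partial^{\boldsymbol\nu}F$ exist and are continuous). $s\in\mathbb N$ is the truncation dimension; $\boldsymbol y_s=(y_1,\dots,y_s,0,0,\dots)$, and $F$ is regarded as a function on $\mathbb R^s$ via $F(\boldsymbol y_s)$. $w(\xi)=e^{-\xi^2/2}/\sqrt{2\pi}$, $\mathfrak w$ is its cumulative distribution function, $\Phi^{-1}$ applies $\mathfrak w^{-1}$ componentwise. $I_s(F)=\int_{\mathbb R^s}F(\boldsymbol y_s)\prod_{j=1}^sw(y_j)\,d\boldsymbol y_s$. Randomly shifted lattice rule with generating vector $\boldsymbol{\mathsf z}_s\in\mathbb N^s$ and shift $\Delta$ uniform on $(0,1)^s$: $Q^\Delta_{s,n}(F)=\frac1n\sum_{j=1}^nF\big(\Phi^{-1}(\{j\boldsymbol{\mathsf z}_s/n+\Delta\})\big)$, with $\{\cdot\}$ the componentwise fractional part. $\mathbb E_\Delta$ is expectation over $\Delta$. $\psi_j(\xi)=\exp(-\tau_j|\xi|)$ with parameters $\tau_j>0$, and for $\vartheta\in(1/2,1]$ $$\varrho_j(\vartheta)=2\Big(\frac{\sqrt{2\pi}\exp(\tau_j^2/\varsigma)}{\pi^{2-2\varsigma}(1-\varsigma)\varsigma}\Big)^{\vartheta}\zeta\big(\vartheta+\tfrac12\big),\qquad\varsigma=\frac{2\vartheta-1}{4\vartheta},$$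 where $\zeta$ is the Riemann zeta function. For positive weights $\boldsymbol\gamma=(\gamma_{\mathfrak u})_{\mathfrak u\subseteq\{1,\dots,s\}}$, $\mathcal W_{\boldsymbol\gamma}(\mathbb R^s)$ is the space of functions $G:\mathbb R^s\to\mathbb R$ with $$\|G\|^2_{\mathcal W_{\boldsymbol\gamma}(\mathbb R^s)}=\sum_{\mathfrak u\subseteq\{1,\dots,s\}}\frac1{\gamma_{\mathfrak u}}\int_{\mathbb R^{|\mathfrak u|}}\Big(\int_{\mathbb R^{s-|\mathfrak u|}}\frac{\partial^{|\mathfrak u|}G}{\partial\boldsymbol\xi_{\mathfrak u}}(\boldsymbol\xi)\prod_{j\notin\mathfrak u}w(\xi_j)\,d\boldsymbol\xi_{\bar{\mathfrak u}}\Big)^2\prod_{j\in\mathfrak u}\psi_j^2(\xi_j)\,d\boldsymbol\xi_{\mathfrak u}<\infty,$$ where $\bar{\mathfrak u}=\{1,\dots,s\}\setminus\mathfrak u$ and $\partial^{|\mathfrak u|}G/\partial\boldsymbol\xi_{\mathfrak u}$ is the mixed first derivative in the variables $\xi_j$, $j\in\mathfrak u$. Component-by-component (CBC) algorithm: $\mathsf z_1=1$, and for $d=2,\dots,s$, with $\mathsf z_1,\dots,\mathsf z_{d-1}$ fixed, $\mathsf z_d\in\{1,\dots,n-1\}$ with $\gcd(\mathsf z_d,n)=1$ is chosen to minimize the shift-averaged worst-case error $\big(\int_{(0,1)^d}\sup_{\|G\|_{\mathcal W_{\boldsymbol\gamma}(\mathbb R^d)}\le1}|I_d(G)-Q^\Delta_{d,n}(G)|^2\,d\Delta\big)^{1/2}$.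 *)

theory Defs
  imports "HOL-Probability.Probability"
begin

text \<open>
  Coordinates are numbered from 0, so the variables \<open>1, \<dots>, s\<close> of the mathematical text are
  the indices in \<open>{..<s}\<close>. Points of \<open>\<real>\<^sup>\<nat>\<close> have type \<open>nat \<Rightarrow> real\<close>, with the product topology.
  The space \<open>\<real>\<^sup>d\<close> is identified with the set \<open>Rn d\<close> of sequences that vanish from index \<open>d\<close> on,
  and a function on \<open>\<real>\<^sup>d\<close> is a function on sequences of which only the values on \<open>Rn d\<close>
  are used. Thus a function \<open>F\<close> on \<open>\<real>\<^sup>\<nat>\<close> is itself, without conversion, the function
  \<open>F(y\<^sub>1, \<dots>, y\<^sub>s, 0, 0, \<dots>)\<close> on \<open>\<real>\<^sup>s\<close>. Integrals over \<open>\<real>\<^sup>d\<close> are taken over the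
  product measure on \<open>{..<d}\<close>, whose points are made into elements of \<open>Rn d\<close> by \<open>trunc d\<close>.
\<close>

definition Rn :: "nat \<Rightarrow> (nat \<Rightarrow> real) set" where
  "Rn d = {x. \<forall>j\<ge>d. x j = 0}"

definition trunc :: "nat \<Rightarrow> (nat \<Rightarrow> real) \<Rightarrow> nat \<Rightarrow> real" where
  "trunc d y = (\<lambda>j. if j < d then y j else 0)"

definition partial_deriv :: "nat \<Rightarrow> ((nat \<Rightarrow> real) \<Rightarrow> real) \<Rightarrow> (nat \<Rightarrow> real) \<Rightarrow> real" where
  "partial_deriv j F x = deriv (\<lambda>t. F (x(j := t))) (x j)"

definition partial_derivs :: "nat list \<Rightarrow> ((nat \<Rightarrow> real) \<Rightarrow> real) \<Rightarrow> (nat \<Rightarrow> real) \<Rightarrow> real" where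
  "partial_derivs js F = foldr partial_deriv js F"

text \<open>
  The derivative \<open>\<partial>\<^sup>\<nu>F\<close> for a finitely supported multi-index \<open>\<nu>\<close>. The variables are listed in
  increasing order; for the regularity classes below the order is immaterial.
\<close>

definition multi_deriv ::
  "(nat \<Rightarrow> nat) \<Rightarrow> ((nat \<Rightarrow> real) \<Rightarrow> real) \<Rightarrow> (nat \<Rightarrow> real) \<Rightarrow> real" where
  "multi_deriv \<nu> F =
     partial_derivs (concat (map (\<lambda>j. replicate (\<nu> j) j) (sorted_list_of_set {j. \<nu> j \<noteq> 0}))) F"

text \<open>
  Infinite differentiability: every iterated partial derivative, taken in any order, exists and
  is continuous. Existence is stated separately because \<open>deriv\<close> is total.
\<close>

definition infinitely_differentiable :: "((nat \<Rightarrow> real) \<Rightarrow> real) \<Rightarrow> bool" where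
  "infinitely_differentiable F \<longleftrightarrow>
     (\<forall>js. continuous_on UNIV (partial_derivs js F) \<and>
           (\<forall>j x. (\<lambda>t. partial_derivs js F (x(j := t))) differentiable (at (x j))))"

text \<open>
  All mixed first derivatives, i.e. those of order at most one in each of the variables
  \<open>j < d\<close>, exist and are continuous on \<open>\<real>\<^sup>d\<close>.
\<close>

definition mixed_differentiable :: "nat \<Rightarrow> ((nat \<Rightarrow> real) \<Rightarrow> real) \<Rightarrow> bool" where
  "mixed_differentiable d G \<longleftrightarrow>
     (\<forall>js. distinct js \<and> set js \<subseteq> {..<d} \<longrightarrow>
        continuous_on (Rn d) (partial_derivs js G) \<and>
        (\<forall>j\<in>{..<d} - set js. \<forall>x\<in>Rn d.
           (\<lambda>t. partial_derivs js G (x(j := t))) differentiable (at (x j))))"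

abbreviation lborel_on :: "nat set \<Rightarrow> (nat \<Rightarrow> real) measure" where
  "lborel_on u \<equiv> Pi\<^sub>M u (\<lambda>_. lborel)"

definition Phi_inv :: "real \<Rightarrow> real" where
  "Phi_inv = inv (cdf (density lborel std_normal_density))"

definition gauss_integral :: "nat \<Rightarrow> ((nat \<Rightarrow> real) \<Rightarrow> real) \<Rightarrow> real" where
  "gauss_integral d G =
     (\<integral>y. G (trunc d y) * (\<Prod>j<d. std_normal_density (y j)) \<partial>lborel_on {..<d})"

text \<open>
  \<open>Phi_inv\<close> has an unspecified value at 0; it is used there only for shifts \<open>\<Delta>\<close> in a null set.
\<close>

definition lattice_rule ::
  "nat \<Rightarrow> nat \<Rightarrow> (nat \<Rightarrow> nat) \<Rightarrow> (nat \<Rightarrow> real) \<Rightarrow> ((nat \<Rightarrow> real) \<Rightarrow> real) \<Rightarrow> real" where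
  "lattice_rule d n z \<Delta> G =
     1 / real n * (\<Sum>k=1..n. G (trunc d (\<lambda>i. Phi_inv (frac (real k * real (z i) / real n + \<Delta> i)))))"

definition unif_shift :: "nat \<Rightarrow> (nat \<Rightarrow> real) measure" where
  "unif_shift d = Pi\<^sub>M {..<d} (\<lambda>_. uniform_measure lborel {0<..<1})"

definition psi :: "real \<Rightarrow> real \<Rightarrow> real" where
  "psi t \<xi> = exp (- t * \<bar>\<xi>\<bar>)"

definition real_zeta :: "real \<Rightarrow> real" where
  "real_zeta x = (\<Sum>k. 1 / real (Suc k) powr x)"

definition varrho :: "real \<Rightarrow> real \<Rightarrow> real" where
  "varrho t \<theta> = (let \<sigma> = (2 * \<theta> - 1) / (4 * \<theta>) in
     2 * ((sqrt (2 * pi) * exp (t\<^sup>2 / \<sigma>)) / (pi powr (2 - 2 * \<sigma>) * (1 - \<sigma>) * \<sigma>)) powr \<theta>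
       * real_zeta (\<theta> + 1 / 2))"

definition ennsqrt :: "ennreal \<Rightarrow> ennreal" where
  "ennsqrt x = (if x = \<infinity> then \<infinity> else ennreal (sqrt (enn2real x)))"

text \<open>
  The integrand over \<open>\<real>\<^sup>\<bar>\<^sup>u\<^sup>\<bar>\<close> and \<open>\<real>\<^sup>d\<^sup>-\<^sup>\<bar>\<^sup>u\<^sup>\<bar>\<close>: the mixed first derivative in the variables in \<open>u\<close>, at
  the point with coordinates \<open>x\<close> in \<open>u\<close> and \<open>y\<close> in the complement, times the Gaussian
  weights of the latter.
\<close>

definition W_integrand ::
  "nat \<Rightarrow> nat set \<Rightarrow> ((nat \<Rightarrow> real) \<Rightarrow> real) \<Rightarrow> (nat \<Rightarrow> real) \<Rightarrow> (nat \<Rightarrow> real) \<Rightarrow> real" where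
  "W_integrand d u G x y =
     multi_deriv (indicator u) G (trunc d (merge u ({..<d} - u) (x, y)))
       * (\<Prod>j\<in>{..<d} - u. std_normal_density (y j))"

definition W_norm ::
  "nat \<Rightarrow> (nat set \<Rightarrow> real) \<Rightarrow> (nat \<Rightarrow> real) \<Rightarrow> ((nat \<Rightarrow> real) \<Rightarrow> real) \<Rightarrow> ennreal" where
  "W_norm d \<gamma> \<tau> G = ennsqrt (\<Sum>u\<in>Pow {..<d}. ennreal (1 / \<gamma> u) *
     (\<integral>\<^sup>+x. ennreal ((\<integral>y. W_integrand d u G x y \<partial>lborel_on ({..<d} - u))\<^sup>2
                   * (\<Prod>j\<in>u. (psi (\<tau> j) (x j))\<^sup>2)) \<partial>lborel_on u))"

text \<open>
  The inner integrals are required to exist almost everywhere, since the Bochner integral of a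
  non-integrable function is 0.
\<close>

definition W_space ::
  "nat \<Rightarrow> (nat set \<Rightarrow> real) \<Rightarrow> (nat \<Rightarrow> real) \<Rightarrow> ((nat \<Rightarrow> real) \<Rightarrow> real) set" where
  "W_space d \<gamma> \<tau> = {G. mixed_differentiable d G \<and>
     (\<forall>u\<subseteq>{..<d}. AE x in lborel_on u.
        integrable (lborel_on ({..<d} - u)) (W_integrand d u G x)) \<and>
     W_norm d \<gamma> \<tau> G < \<infinity>}"

definition shift_avg_wce ::
  "nat \<Rightarrow> nat \<Rightarrow> (nat set \<Rightarrow> real) \<Rightarrow> (nat \<Rightarrow> real) \<Rightarrow> (nat \<Rightarrow> nat) \<Rightarrow> ennreal" where
  "shift_avg_wce d n \<gamma> \<tau> z = ennsqrt (\<integral>\<^sup>+\<Delta>.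
     (SUP G\<in>{G \<in> W_space d \<gamma> \<tau>. W_norm d \<gamma> \<tau> G \<le> 1}.
        ennreal (\<bar>gauss_integral d G - lattice_rule d n z \<Delta> G\<bar>\<^sup>2)) \<partial>unif_shift d)"

text \<open>
  The possible outputs \<open>z\<close> (relevant on \<open>{..<s}\<close>) of the component-by-component algorithm;
  ties in the minimization may be broken arbitrarily. Only the components up to \<open>d\<close> enter
  the error in dimension \<open>Suc d\<close>.
\<close>

definition cbc_vector ::
  "nat \<Rightarrow> nat \<Rightarrow> (nat set \<Rightarrow> real) \<Rightarrow> (nat \<Rightarrow> real) \<Rightarrow> (nat \<Rightarrow> nat) \<Rightarrow> bool" where
  "cbc_vector s n \<gamma> \<tau> z \<longleftrightarrow> z 0 = 1 \<and>
     (\<forall>d\<in>{1..<s}. is_arg_min (\<lambda>k. shift_avg_wce (Suc d) n \<gamma> \<tau> (z(d := k)))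
                              (\<lambda>k. k \<in> {1..n - 1} \<and> coprime k n) (z d))"

end

theory Submission
  imports Defs
begin

text \<open>
  Writing the fundamental theorem of calculus from an anchor point and averaging the anchor over
  the Gaussian measure gives, at every point \<open>t\<close> and for every \<open>G\<close> in the weighted space,
  a representation of \<open>G t\<close> as a sum over \<open>u\<close> of integrals of the averaged derivative \<open>WM d u G\<close>
  against products of one-dimensional kernels \<open>kap\<close>. By the Cauchy-Schwarz inequality the squared
  worst-case error is at most an explicit kernel sum \<open>E2\<close>. Smooth approximations of the
  representer show that it is equal to \<open>E2\<close>, although the space of continuously
  differentiable functions is not complete. So the component-by-component algorithm minimizes the
  shift average of \<open>E2\<close>.

  A discrete Fourier transform in each variable turns this average into a sum of nonnegative
  products over the dual lattice. Its power \<open>\<theta>\<close> is at most the sum of the powers, and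
  the average of the latter over all candidates for the new component is of order \<open>1 / n\<close>,
  because the Fourier coefficients decay like \<open>h powr (- 1 - 1 / (2 * \<theta>))\<close>. The exact
  constants in \<open>varrho\<close> are not needed: a bound for \<open>varrho\<close> is a bound for \<open>\<tau>\<close>,
  hence makes the decay uniform in the variable.

  With the given weights both sums over \<open>u\<close>, in the error and in the norm of \<open>F\<close>, are
  dominated by sums of \<open>(|u|!) powr r\<close> times products of a summable sequence, with \<open>r < 1\<close>.
\<close>

section \<open>The Gaussian distribution function\<close>

text \<open>A finite norm controls only squares of signed Gaussian means of the derivatives, not the
  derivatives themselves. Hence exchanging the anchor average with the integrals of the
  representation is the first obstacle. It is overcome by descending from the full set of variables:
  the deviation of a derivative from its mean is bounded, through an L1 Efron-Stein inequality, by
  derivatives with one more variable, integrated against the density \<open>ncc\<close> in that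
  variable. The rate comes from an interpolation. A Fourier coefficient of the kernel is bounded by
  a Gaussian tail probability and by the reciprocal of its frequency. A share
  \<open>q = 1 - 1 / (2 * \<theta>)\<close> of the tail pays for the weight
  \<open>exp (2 * \<tau> * \<bar>x\<bar>)\<close>; the remaining exponent \<open>2 - q\<close> falls
  on the frequency, and its \<open>\<theta>\<close>-th power sums like a zeta series at
  \<open>\<theta> + 1 / 2\<close>. A constant independent of the dimension needs the products of the
  Gaussian means of the \<open>C j\<close> to be bounded in \<open>s\<close>. This is extracted from
  the convergence of the product of the \<open>C j\<close> at every single point.\<close>

abbreviation "stdN \<equiv> density lborel std_normal_density"

definition ncdf :: "real \<Rightarrow> real" where "ncdf = cdf stdN"

interpretation stdN: prob_space stdN
  by (rule prob_space_normal_density) simp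

interpretation stdN: real_distribution stdN
  by standard auto

lemma measure_stdN_singleton: "measure stdN {x} = 0"
  by (simp add: measure_def emeasure_density nn_integral_indicator_singleton' nn_integral_null_measure)

lemma continuous_ncdf: "continuous_on A ncdf"
  unfolding ncdf_def
  by (intro continuous_at_imp_continuous_on ballI) (simp add: stdN.isCont_cdf measure_stdN_singleton)

lemma measurable_ncdf [measurable]: "ncdf \<in> borel_measurable borel"
  by (intro borel_measurable_continuous_onI continuous_ncdf)

lemma measure_stdN_pos:
  assumes "a < b" shows "0 < measure stdN {a<..<b}"
proof -
  have "emeasure stdN {a<..<b} \<noteq> 0"
  proof
    assume "emeasure stdN {a<..<b} = 0"
    then have "AE x in lborel. x \<in> {a<..<b} \<longrightarrow> ennreal (std_normal_density x) = 0"
      by (subst (asm) emeasure_density) (auto simp: nn_integral_0_iff_AE)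
    then have "AE x in lborel. x \<notin> {a<..<b}"
      by eventually_elim (use normal_density_pos[of 1 0] in \<open>auto simp: ennreal_eq_0_iff not_le[symmetric]\<close>)
    then have "emeasure lborel {a<..<b} = 0"
      by (subst (asm) AE_iff_measurable[OF _ refl]) (auto simp: greaterThanLessThan_eq[symmetric] greaterThanLessThan_def greaterThan_def lessThan_def Int_def)
    then show False using assms by simp
  qed
  then show ?thesis
    by (simp add: stdN.emeasure_eq_measure zero_less_measure_iff)
qed

lemma ncdf_strict_mono: "x < y \<Longrightarrow> ncdf x < ncdf y"
proof -
  assume "x < y"
  have "ncdf y - ncdf x = measure stdN {x<..y}"
    unfolding ncdf_def by (rule stdN.cdf_diff_eq) fact
  moreover have "measure stdN {x<..<y} \<le> measure stdN {x<..y}"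
    by (rule stdN.finite_measure_mono) auto
  ultimately show ?thesis using measure_stdN_pos[OF \<open>x < y\<close>] by simp
qed

lemma ncdf_less_iff: "ncdf x < ncdf y \<longleftrightarrow> x < y"
  using ncdf_strict_mono[of x y] ncdf_strict_mono[of y x] by (cases x y rule: linorder_cases) auto

lemma ncdf_pos: "0 < ncdf x"
  using ncdf_strict_mono[of "x - 1" x] stdN.cdf_nonneg[of "x - 1"] by (simp add: ncdf_def)

lemma ncdf_less_1: "ncdf x < 1"
  using ncdf_strict_mono[of x "x + 1"] stdN.cdf_bounded_prob[of "x + 1"] by (simp add: ncdf_def)

lemma ncdf_surj: assumes "0 < v" "v < 1" shows "\<exists>x. ncdf x = v"
proof -
  have "eventually (\<lambda>x. ncdf x < v) at_bot"
    using order_tendstoD(2)[OF stdN.cdf_lim_at_bot assms(1)] by (simp add: ncdf_def)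
  then obtain a where a: "ncdf a < v" by (auto simp: eventually_at_bot_linorder)
  have "eventually (\<lambda>x. v < ncdf x) at_top"
    using order_tendstoD(1)[OF stdN.cdf_lim_at_top_prob assms(2)] by (simp add: ncdf_def)
  then obtain b where b: "v < ncdf b" by (auto simp: eventually_at_top_linorder)
  have "a < b" using a b ncdf_less_iff by (metis less_trans)
  then show ?thesis
    using IVT'[of ncdf a v b] a b continuous_ncdf by auto
qed

lemma Phi_inv_eq: "Phi_inv = inv ncdf"
  by (simp add: Phi_inv_def ncdf_def)

lemma ncdf_Phi_inv: assumes "0 < v" "v < 1" shows "ncdf (Phi_inv v) = v"
  unfolding Phi_inv_eq using ncdf_surj[OF assms] by (metis f_inv_into_f rangeI)

lemma less_Phi_inv_iff: assumes "0 < v" "v < 1" shows "x < Phi_inv v \<longleftrightarrow> ncdf x < v"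
  using ncdf_less_iff[of x "Phi_inv v"] ncdf_Phi_inv[OF assms] by simp

text \<open>\<open>ncdf\<close> takes values only in the open unit interval, so outside it
  \<open>inv\<close> chooses from an empty preimage and returns one fixed unspecified real. That
  constancy is what makes \<open>Phi_inv\<close> Borel measurable on the whole line.\<close>

lemma Phi_inv_outside: assumes "\<not> (0 < v \<and> v < 1)" shows "Phi_inv v = (SOME x. False)"
proof -
  have "ncdf x \<noteq> v" for x using assms ncdf_pos[of x] ncdf_less_1[of x] by auto
  then show ?thesis by (simp add: Phi_inv_eq inv_into_def)
qed

lemma measurable_Phi_inv [measurable]: "Phi_inv \<in> borel_measurable borel"
proof -
  have eq: "Phi_inv v = (if v \<in> {0<..<1} then Phi_inv v else (SOME x. False))" for v
    using Phi_inv_outside[of v] by auto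
  have "mono_on {0<..<1} Phi_inv"
    by (rule mono_onI) (metis Phi_inv_eq greaterThanLessThan_iff less_Phi_inv_iff linorder_not_less ncdf_Phi_inv ncdf_less_iff)
  then have "Phi_inv \<in> borel_measurable (restrict_space borel {0<..<1})"
    by (rule borel_measurable_mono_on_fnc)
  then have "(\<lambda>v. indicator {0<..<1} v *\<^sub>R Phi_inv v) \<in> borel_measurable borel"
    by (subst (asm) borel_measurable_restrict_space_iff) auto
  then have "(\<lambda>v. indicator {0<..<1} v *\<^sub>R Phi_inv v + indicator (- {0<..<1}) v * (SOME x. False)) \<in> borel_measurable borel"
    by measurable
  also have "(\<lambda>v. indicator {0<..<1} v *\<^sub>R Phi_inv v + indicator (- {0<..<1}) v * (SOME x. False)) = Phi_inv"
    using Phi_inv_outside by (auto simp: fun_eq_iff indicator_def)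
  finally show ?thesis .
qed

lemma ncdf_eq_integral: "ncdf x = (\<integral>t. indicator {..x} t * std_normal_density t \<partial>lborel)"
proof -
  have "ncdf x = (\<integral>t. indicator {..x} t \<partial>stdN)" by (simp add: ncdf_def cdf_def)
  also have "\<dots> = (\<integral>t. indicator {..x} t * std_normal_density t \<partial>lborel)"
    by (subst integral_density) (auto simp: mult.commute)
  finally show ?thesis .
qed

lemma ncdf_minus: "ncdf (- x) = 1 - ncdf x"
proof -
  have i: "integrable lborel (\<lambda>t. indicator A t * std_normal_density t)" if "A \<in> sets borel" for A
    using integrable_mult_indicator[of A lborel std_normal_density] that by auto
  have "ncdf (-x) = (\<integral>t. indicator {..-x} (0 + (-1) * t) * std_normal_density (0 + (-1) * t) \<partial>lborel)"
    unfolding ncdf_eq_integral by (subst lborel_integral_real_affine[where c="-1" and t=0]) auto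
  also have "\<dots> = (\<integral>t. indicator {x..} t * std_normal_density t \<partial>lborel)"
    by (intro Bochner_Integration.integral_cong) (auto simp: indicator_def std_normal_density_def)
  also have "\<dots> = (\<integral>t. std_normal_density t - indicator {..x} t * std_normal_density t \<partial>lborel)"
    using AE_lborel_singleton[of x] by (intro integral_cong_AE) (auto simp: indicator_def)
  also have "\<dots> = 1 - ncdf x"
    unfolding ncdf_eq_integral by (subst Bochner_Integration.integral_diff) (auto intro: i)
  finally show ?thesis .
qed

lemma ncdf_tail: assumes "x \<le> 0" shows "ncdf x \<le> exp (- x\<^sup>2 / 2)"
proof -
  have "ncdf x = (\<integral>t. indicator {..x} (x + 1 * t) * std_normal_density (x + 1 * t) \<partial>lborel)"
    unfolding ncdf_eq_integral by (subst lborel_integral_real_affine[where c=1 and t=x]) auto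
  also have "\<dots> \<le> (\<integral>t. exp (- x\<^sup>2 / 2) * std_normal_density t \<partial>lborel)"
  proof (rule integral_mono)
    show "integrable lborel (\<lambda>t. indicator {..x} (x + 1 * t) * std_normal_density (x + 1 * t))"
      using lborel_integrable_real_affine[of "\<lambda>t. indicator {..x} t * std_normal_density t" 1 x]
        integrable_mult_indicator[of "{..x}" lborel std_normal_density] by auto
    fix t :: real
    show "indicator {..x} (x + 1 * t) * std_normal_density (x + 1 * t) \<le> exp (- x\<^sup>2 / 2) * std_normal_density t"
    proof (cases "t \<le> 0")
      case True
      then have "0 \<le> x * t" using assms by (simp add: mult_nonpos_nonpos)
      then have "- (x + t)\<^sup>2 / 2 \<le> - x\<^sup>2 / 2 + - t\<^sup>2 / 2" by (simp add: power2_sum field_simps)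
      then have "exp (- (x + t)\<^sup>2 / 2) \<le> exp (- x\<^sup>2 / 2) * exp (- t\<^sup>2 / 2)"
        by (simp add: exp_add[symmetric])
      then show ?thesis using True
        by (simp add: std_normal_density_def divide_right_mono)
    qed (auto simp: indicator_def)
  qed auto
  also have "\<dots> = exp (- x\<^sup>2 / 2)" by simp
  finally show ?thesis .
qed

section \<open>Gaussian tails and integrals against an exponential weight\<close>

definition ntail :: "real \<Rightarrow> real" where "ntail x = min (ncdf x) (1 - ncdf x)"

lemma ntail_pos: "0 < ntail x" and ntail_less_1: "ntail x < 1"
  using ncdf_pos[of x] ncdf_less_1[of x] by (auto simp: ntail_def)

lemma measurable_ntail [measurable]: "ntail \<in> borel_measurable borel"
  unfolding ntail_def by measurable

lemma ntail_le: "ntail x \<le> exp (- x\<^sup>2 / 2)"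
proof (cases "x \<le> 0")
  case True
  then show ?thesis using ncdf_tail[of x] by (auto simp: ntail_def)
next
  case False
  then show ?thesis using ncdf_tail[of "-x"] by (auto simp: ntail_def ncdf_minus)
qed

text \<open>The variance of the indicator that a Gaussian variable is at most \<open>x\<close>. It
  returns as half the probability that \<open>x\<close> separates two independent samples, and as
  the integral of the squared kernel over a uniform shift.\<close>

definition ncc :: "real \<Rightarrow> real" where "ncc x = ncdf x * (1 - ncdf x)"

lemma ncc_pos: "0 < ncc x" by (simp add: ncc_def ncdf_pos ncdf_less_1)

lemma measurable_ncc [measurable]: "ncc \<in> borel_measurable borel"
  unfolding ncc_def by measurable

lemma ncc_le_ntail: "ncc x \<le> ntail x"
  using ncdf_pos[of x] ncdf_less_1[of x] by (auto simp: ncc_def ntail_def min_def mult_left_le mult_left_le_one_le)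

text \<open>The kernel of the representation \<open>f t = (\<integral>y. f y * w y) + (\<integral>x. f' x * kap t x)\<close>, with \<open>w\<close> the standard normal density.\<close>

definition kap :: "real \<Rightarrow> real \<Rightarrow> real" where
  "kap t x = (if x < t then ncdf x else ncdf x - 1)"

lemma measurable_kap [measurable]: "kap t \<in> borel_measurable borel"
  unfolding kap_def by measurable

text \<open>For \<open>x < t\<close> the factor \<open>1 - ncdf x\<close> of \<open>ncc x\<close> is
  at least \<open>1 - ncdf t\<close>, hence at least \<open>ntail t\<close>; the other side is
  symmetric. The bound separates \<open>x\<close> from \<open>t\<close>, so kernels at arbitrary
  nodes are all dominated by multiples of \<open>ncc\<close>.\<close>

lemma abs_kap_le: "\<bar>kap t x\<bar> \<le> ncc x / ntail t"
proof (cases "x < t")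
  case True
  then have "ncdf x * ntail t \<le> ncc x"
    using ncdf_strict_mono[of x t] ncdf_pos[of x] by (auto simp: ncc_def ntail_def intro!: mult_left_mono)
  then show ?thesis using True ntail_pos[of t] ncdf_pos[of x] by (simp add: kap_def field_simps)
next
  case False
  then have "ncdf t \<le> ncdf x" using ncdf_less_iff[of x t] by simp
  then have "(1 - ncdf x) * ntail t \<le> (1 - ncdf x) * ncdf x"
    using ncdf_less_1[of x] by (auto simp: ntail_def intro!: mult_left_mono)
  then show ?thesis using False ntail_pos[of t] ncdf_less_1[of x] by (simp add: kap_def ncc_def field_simps)
qed

text \<open>Half of the quadratic exponent absorbs the linear one, by expanding
  \<open>(q * \<bar>x\<bar> - 2 * \<tau>)\<^sup>2 \<ge> 0\<close>. The bound is kept explicit in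
  \<open>\<tau>\<close> so that a common bound for all parameters yields a common constant.\<close>

lemma integrable_gauss_exp:
  fixes q \<tau> :: real assumes "0 < q"
  shows "integrable lborel (\<lambda>x. exp (- q * x\<^sup>2) * exp (2 * \<tau> * \<bar>x\<bar>))"
    and "(\<integral>x. exp (- q * x\<^sup>2) * exp (2 * \<tau> * \<bar>x\<bar>) \<partial>lborel)
      \<le> exp (2 * \<tau>\<^sup>2 / q) * (\<integral>x. exp (- (q / 2) * x\<^sup>2) \<partial>lborel)"
proof -
  define \<sigma> where "\<sigma> = 1 / sqrt q"
  have s: "0 < \<sigma>" "\<sigma>\<^sup>2 = 1 / q" using assms by (auto simp: \<sigma>_def power_divide)
  have i: "integrable lborel (\<lambda>x. exp (- (q / 2) * x\<^sup>2))"
  proof -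
    have "integrable lborel (\<lambda>x. sqrt (2 * pi * \<sigma>\<^sup>2) * normal_density 0 \<sigma> x)"
      using s by (intro integrable_mult_right integrable_normal_density)
    also have "(\<lambda>x. sqrt (2 * pi * \<sigma>\<^sup>2) * normal_density 0 \<sigma> x) = (\<lambda>x. exp (- (q / 2) * x\<^sup>2))"
      using s assms by (auto simp: normal_density_def fun_eq_iff)
    finally show ?thesis .
  qed
  have b: "exp (- q * x\<^sup>2) * exp (2 * \<tau> * \<bar>x\<bar>) \<le> exp (2 * \<tau>\<^sup>2 / q) * exp (- (q / 2) * x\<^sup>2)" for x
  proof -
    have "0 \<le> (q * \<bar>x\<bar> - 2 * \<tau>)\<^sup>2 / (2 * q)" using assms by simp
    also have "\<dots> = q / 2 * x\<^sup>2 - 2 * \<tau> * \<bar>x\<bar> + 2 * \<tau>\<^sup>2 / q"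
      using assms by (simp add: power2_diff field_simps power2_eq_square)
    finally have "- q * x\<^sup>2 + 2 * \<tau> * \<bar>x\<bar> \<le> 2 * \<tau>\<^sup>2 / q + - (q / 2) * x\<^sup>2" by simp
    then show ?thesis by (simp add: exp_add[symmetric])
  qed
  show I: "integrable lborel (\<lambda>x. exp (- q * x\<^sup>2) * exp (2 * \<tau> * \<bar>x\<bar>))"
    by (rule Bochner_Integration.integrable_bound[OF integrable_mult_right[OF i, of "exp (2 * \<tau>\<^sup>2 / q)"]]) (use b in auto)
  show "(\<integral>x. exp (- q * x\<^sup>2) * exp (2 * \<tau> * \<bar>x\<bar>) \<partial>lborel)
      \<le> exp (2 * \<tau>\<^sup>2 / q) * (\<integral>x. exp (- (q / 2) * x\<^sup>2) \<partial>lborel)"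
    using integral_mono[OF I integrable_mult_right[OF i, of "exp (2 * \<tau>\<^sup>2 / q)"]] b by simp
qed

lemma ntail_powr_le: assumes "0 < q" shows "ntail x powr q \<le> exp (- (q / 2) * x\<^sup>2)"
proof -
  have "ntail x powr q \<le> exp (- x\<^sup>2 / 2) powr q"
    using assms ntail_le[of x] ntail_pos[of x] by (intro powr_mono2) auto
  also have "\<dots> = exp (- (q / 2) * x\<^sup>2)" by (simp add: powr_def field_simps)
  finally show ?thesis .
qed

lemma integrable_ntail_exp:
  fixes q \<tau> :: real assumes "0 < q"
  shows "integrable lborel (\<lambda>x. ntail x powr q * exp (2 * \<tau> * \<bar>x\<bar>))"
    and "(\<integral>x. ntail x powr q * exp (2 * \<tau> * \<bar>x\<bar>) \<partial>lborel)
      \<le> exp (4 * \<tau>\<^sup>2 / q) * (\<integral>x. exp (- (q / 4) * x\<^sup>2) \<partial>lborel)"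
proof -
  have i: "integrable lborel (\<lambda>x. exp (- (q / 2) * x\<^sup>2) * exp (2 * \<tau> * \<bar>x\<bar>))"
    using integrable_gauss_exp(1)[of "q/2" \<tau>] assms by simp
  have b: "ntail x powr q * exp (2 * \<tau> * \<bar>x\<bar>) \<le> exp (- (q / 2) * x\<^sup>2) * exp (2 * \<tau> * \<bar>x\<bar>)" for x
    using ntail_powr_le[OF assms] by (intro mult_right_mono) auto
  show I: "integrable lborel (\<lambda>x. ntail x powr q * exp (2 * \<tau> * \<bar>x\<bar>))"
    by (rule Bochner_Integration.integrable_bound[OF i]) (use b in auto)
  show "(\<integral>x. ntail x powr q * exp (2 * \<tau> * \<bar>x\<bar>) \<partial>lborel)
      \<le> exp (4 * \<tau>\<^sup>2 / q) * (\<integral>x. exp (- (q / 4) * x\<^sup>2) \<partial>lborel)"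
    using integral_mono[OF I i b] integrable_gauss_exp(2)[of "q/2" \<tau>] assms by (simp add: mult.commute)
qed

lemma integrable_ncc_sq: "integrable lborel (\<lambda>x. (ncc x)\<^sup>2 * exp (2 * \<tau> * \<bar>x\<bar>))"
proof (rule Bochner_Integration.integrable_bound[OF integrable_ntail_exp(1)[of 2 \<tau>]])
  show "AE x in lborel. norm ((ncc x)\<^sup>2 * exp (2 * \<tau> * \<bar>x\<bar>)) \<le> norm (ntail x powr 2 * exp (2 * \<tau> * \<bar>x\<bar>))"
    using ncc_le_ntail ntail_pos by (auto intro!: AE_I2 mult_right_mono simp: power_mono ncc_pos less_imp_le powr_numeral)
qed auto

text \<open>By \<open>abs_kap_le\<close> both kernels are dominated by multiples of
  \<open>ncc\<close>, whose square decays fast enough to beat the exponential weight.\<close>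

lemma integrable_kap_kap: "integrable lborel (\<lambda>x. kap s x * kap t x * exp (2 * \<tau> * \<bar>x\<bar>))"
proof (rule Bochner_Integration.integrable_bound[OF integrable_mult_right[OF integrable_ncc_sq, of "1 / (ntail s * ntail t)"]])
  show "AE x in lborel. norm (kap s x * kap t x * exp (2 * \<tau> * \<bar>x\<bar>))
    \<le> norm (1 / (ntail s * ntail t) * ((ncc x)\<^sup>2 * exp (2 * \<tau> * \<bar>x\<bar>)))"
  proof (rule AE_I2)
    fix x
    have "\<bar>kap s x\<bar> * \<bar>kap t x\<bar> \<le> (ncc x / ntail s) * (ncc x / ntail t)"
      by (intro mult_mono abs_kap_le) (auto simp: ncc_pos ntail_pos less_imp_le)
    then have "\<bar>kap s x\<bar> * \<bar>kap t x\<bar> * exp (2 * \<tau> * \<bar>x\<bar>) \<le> (ncc x / ntail s) * (ncc x / ntail t) * exp (2 * \<tau> * \<bar>x\<bar>)"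
      by (rule mult_right_mono) auto
    then show "norm (kap s x * kap t x * exp (2 * \<tau> * \<bar>x\<bar>)) \<le> norm (1 / (ntail s * ntail t) * ((ncc x)\<^sup>2 * exp (2 * \<tau> * \<bar>x\<bar>)))"
      using ncc_pos[of x] ntail_pos[of s] ntail_pos[of t] by (simp add: abs_mult power2_eq_square field_simps)
  qed
qed auto

section \<open>An L1 Efron-Stein inequality\<close>

lemma measurable_comp_coords:
  fixes H :: "(nat \<Rightarrow> real) \<Rightarrow> real"
  assumes "H \<in> borel_measurable borel" "\<And>j. (\<lambda>x. f x j) \<in> borel_measurable N"
  shows "(\<lambda>x. H (f x)) \<in> borel_measurable N"
  using measurable_compose[OF measurable_coordinatewise_then_product[OF assms(2)] assms(1)] .

text \<open>Outside \<open>J\<close> the elements of the product space are undefined, but constant.\<close>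

lemma measurable_PiM_coord:
  assumes f: "f \<in> measurable N (Pi\<^sub>M J M)" and s: "\<And>i. i \<in> J \<Longrightarrow> sets (M i) = sets (borel :: real measure)"
  shows "(\<lambda>x. f x j) \<in> borel_measurable N"
proof (cases "j \<in> J")
  case True
  then have "(\<lambda>x. f x j) \<in> measurable N (M j)"
    by (intro measurable_compose[OF f]) measurable
  then show ?thesis using s[OF True] by (simp cong: measurable_cong_sets)
next
  case False
  then have "f x j = undefined" if "x \<in> space N" for x
    using measurable_space[OF f that] by (auto simp: space_PiM PiE_def extensional_def)
  then have "(\<lambda>x. f x j) \<in> borel_measurable N \<longleftrightarrow> (\<lambda>x. undefined :: real) \<in> borel_measurable N"
    by (intro measurable_cong) auto
  then show ?thesis by simp
qed

lemma measurable_comp_PiM: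
  fixes H :: "(nat \<Rightarrow> real) \<Rightarrow> real"
  assumes "H \<in> borel_measurable borel" "f \<in> measurable N (Pi\<^sub>M J M)"
    "\<And>i. i \<in> J \<Longrightarrow> sets (M i) = sets borel"
  shows "(\<lambda>x. H (f x)) \<in> borel_measurable N"
  by (intro measurable_comp_coords[OF assms(1)] measurable_PiM_coord[OF assms(2,3)])

lemma measurable_comp_PiM_upd:
  fixes H :: "(nat \<Rightarrow> real) \<Rightarrow> real"
  assumes "H \<in> borel_measurable borel" "f \<in> measurable N (Pi\<^sub>M J M)" "h \<in> borel_measurable N"
    "\<And>i. i \<in> J \<Longrightarrow> sets (M i) = sets borel"
  shows "(\<lambda>x. H ((f x)(i := h x))) \<in> borel_measurable N"
proof (intro measurable_comp_coords[OF assms(1)])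
  show "(\<lambda>x. ((f x)(i := h x)) j) \<in> borel_measurable N" for j
    using assms(3) measurable_PiM_coord[OF assms(2,4)] by (cases "j = i") auto
qed

lemma measurable_comp_PiM_upd2:
  fixes H :: "(nat \<Rightarrow> real) \<Rightarrow> real"
  assumes "H \<in> borel_measurable borel" "f \<in> measurable N (Pi\<^sub>M J M)" "h \<in> borel_measurable N" "k \<in> borel_measurable N"
    "\<And>i. i \<in> J \<Longrightarrow> sets (M i) = sets borel"
  shows "(\<lambda>x. H ((f x)(i := h x, i' := k x))) \<in> borel_measurable N"
proof (intro measurable_comp_coords[OF assms(1)])
  show "(\<lambda>x. ((f x)(i := h x, i' := k x)) j) \<in> borel_measurable N" for j
    using assms(3,4) measurable_PiM_coord[OF assms(2,5)] by (cases "j = i"; cases "j = i'") auto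
qed

lemma measurable_comp_upd_const:
  fixes H :: "(nat \<Rightarrow> real) \<Rightarrow> real"
  assumes "H \<in> borel_measurable borel" "h \<in> borel_measurable N"
  shows "(\<lambda>x. H (z(i := h x))) \<in> borel_measurable N"
proof (intro measurable_comp_coords[OF assms(1)])
  show "(\<lambda>x. (z(i := h x)) j) \<in> borel_measurable N" for j
    using assms(2) by (cases "j = i") auto
qed

lemma nn_integral_swap:
  assumes "sigma_finite_measure M1" "sigma_finite_measure M2"
    and "(\<lambda>p. f (fst p) (snd p)) \<in> borel_measurable (M1 \<Otimes>\<^sub>M M2)"
  shows "(\<integral>\<^sup>+x. (\<integral>\<^sup>+y. f x y \<partial>M2) \<partial>M1) = (\<integral>\<^sup>+y. (\<integral>\<^sup>+x. f x y \<partial>M1) \<partial>M2)"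
proof -
  interpret pair_sigma_finite M1 M2 using assms(1,2) by (simp add: pair_sigma_finite_def)
  show ?thesis using Fubini'[of f] assms(3) by (simp add: split_def)
qed

text \<open>Induction on the coordinates with the triangle inequality through
  \<open>y(i := a)\<close>: going there from \<open>t(i := a)\<close> changes only coordinates in
  \<open>J\<close>, which the induction hypothesis covers for each frozen \<open>a\<close>; going on
  to \<open>y(i := b)\<close> changes only coordinate \<open>i\<close>. So the mean distance between
  two independent samples is controlled by one-coordinate resamplings.\<close>

lemma efron_stein_L1:
  fixes H :: "(nat \<Rightarrow> real) \<Rightarrow> real" and M :: "real measure"
  assumes M: "prob_space M" and sM [measurable_cong]: "sets M = sets borel" and J: "finite J"
    and H: "H \<in> borel_measurable borel"
  shows "(\<integral>\<^sup>+t. \<integral>\<^sup>+y. ennreal \<bar>H t - H y\<bar> \<partial>Pi\<^sub>M J (\<lambda>_. M) \<partial>Pi\<^sub>M J (\<lambda>_. M))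
    \<le> (\<Sum>i\<in>J. \<integral>\<^sup>+y. \<integral>\<^sup>+s. ennreal \<bar>H (y(i := s)) - H y\<bar> \<partial>M \<partial>Pi\<^sub>M J (\<lambda>_. M))"
  using J H
proof (induction J arbitrary: H)
  case empty
  interpret M: prob_space M by fact
  interpret product_prob_space "\<lambda>_::nat. M" by standard
  show ?case by (simp add: nn_integral_empty)
next
  case (insert i J)
  interpret M: prob_space M by fact
  interpret P: product_prob_space "\<lambda>_::nat. M" by standard
  interpret J: prob_space "Pi\<^sub>M J (\<lambda>_. M)" by (rule prob_space_PiM) (simp add: M)
  note H = insert.prems
  let ?P = "Pi\<^sub>M J (\<lambda>_. M)" and ?Q = "Pi\<^sub>M (insert i J) (\<lambda>_. M)"
  note [measurable (raw)] = measurable_comp_PiM_upd[OF H _ _ sM] measurable_comp_PiM_upd2[OF H _ _ _ sM]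
    measurable_comp_PiM[OF H _ sM] measurable_comp_upd_const[OF H]
  have sfM: "sigma_finite_measure M" and sfP: "sigma_finite_measure ?P"
    by (rule M.sigma_finite_measure_axioms, rule J.sigma_finite_measure_axioms)
  have [measurable]: "H \<in> borel_measurable ?Q" by measurable
  have "(\<integral>\<^sup>+t. \<integral>\<^sup>+y. ennreal \<bar>H t - H y\<bar> \<partial>?Q \<partial>?Q)
      = (\<integral>\<^sup>+t. \<integral>\<^sup>+a. \<integral>\<^sup>+y. \<integral>\<^sup>+b. ennreal \<bar>H (t(i := a)) - H (y(i := b))\<bar> \<partial>M \<partial>?P \<partial>M \<partial>?P)"
    using insert.hyps by (simp add: P.product_nn_integral_insert)
  also have "\<dots> \<le> (\<integral>\<^sup>+t. \<integral>\<^sup>+a. \<integral>\<^sup>+y. \<integral>\<^sup>+b. ennreal \<bar>H (t(i := a)) - H (y(i := a))\<bar>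
       + ennreal \<bar>H (y(i := a)) - H (y(i := b))\<bar> \<partial>M \<partial>?P \<partial>M \<partial>?P)"
    by (intro nn_integral_mono) (simp del: ennreal_plus add: ennreal_plus[symmetric])
  also have "\<dots> = (\<integral>\<^sup>+t. \<integral>\<^sup>+a. \<integral>\<^sup>+y. ennreal \<bar>H (t(i := a)) - H (y(i := a))\<bar> \<partial>?P \<partial>M \<partial>?P)
       + (\<integral>\<^sup>+t. \<integral>\<^sup>+a. \<integral>\<^sup>+y. \<integral>\<^sup>+b. ennreal \<bar>H (y(i := a)) - H (y(i := b))\<bar> \<partial>M \<partial>?P \<partial>M \<partial>?P)"
    by (simp add: nn_integral_add M.emeasure_space_1 J.emeasure_space_1)
  also have "(\<integral>\<^sup>+t. \<integral>\<^sup>+a. \<integral>\<^sup>+y. ennreal \<bar>H (t(i := a)) - H (y(i := a))\<bar> \<partial>?P \<partial>M \<partial>?P)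
      = (\<integral>\<^sup>+a. \<integral>\<^sup>+t. \<integral>\<^sup>+y. ennreal \<bar>H (t(i := a)) - H (y(i := a))\<bar> \<partial>?P \<partial>?P \<partial>M)"
    by (rule nn_integral_swap[OF sfP sfM]) measurable
  also have "\<dots> \<le> (\<integral>\<^sup>+a. (\<Sum>j\<in>J. \<integral>\<^sup>+y. \<integral>\<^sup>+s. ennreal \<bar>H (y(j := s, i := a)) - H (y(i := a))\<bar> \<partial>M \<partial>?P) \<partial>M)"
  proof (rule nn_integral_mono)
    fix a
    have "(\<lambda>y. H (y(i := a))) \<in> borel_measurable borel"
    proof (rule measurable_comp_coords[OF H])
      show "(\<lambda>x. (x(i := a)) j) \<in> borel_measurable borel" for j by (cases "j = i") auto
    qed
    from insert.IH[OF this]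
    show "(\<integral>\<^sup>+t. \<integral>\<^sup>+y. ennreal \<bar>H (t(i := a)) - H (y(i := a))\<bar> \<partial>?P \<partial>?P)
      \<le> (\<Sum>j\<in>J. \<integral>\<^sup>+y. \<integral>\<^sup>+s. ennreal \<bar>H (y(j := s, i := a)) - H (y(i := a))\<bar> \<partial>M \<partial>?P)" .
  qed
  also have "\<dots> = (\<Sum>j\<in>J. \<integral>\<^sup>+a. \<integral>\<^sup>+y. \<integral>\<^sup>+s. ennreal \<bar>H (y(j := s, i := a)) - H (y(i := a))\<bar> \<partial>M \<partial>?P \<partial>M)"
    by (rule nn_integral_sum) measurable
  also have "\<dots> = (\<Sum>j\<in>J. \<integral>\<^sup>+y. \<integral>\<^sup>+s. ennreal \<bar>H (y(j := s)) - H y\<bar> \<partial>M \<partial>?Q)"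
  proof (rule sum.cong[OF refl])
    fix j assume j: "j \<in> J"
    then have ji: "j \<noteq> i" using insert.hyps by auto
    have "(\<integral>\<^sup>+a. \<integral>\<^sup>+y. \<integral>\<^sup>+s. ennreal \<bar>H (y(j := s, i := a)) - H (y(i := a))\<bar> \<partial>M \<partial>?P \<partial>M)
      = (\<integral>\<^sup>+y. \<integral>\<^sup>+a. \<integral>\<^sup>+s. ennreal \<bar>H (y(j := s, i := a)) - H (y(i := a))\<bar> \<partial>M \<partial>M \<partial>?P)"
      by (rule nn_integral_swap[OF sfM sfP]) measurable
    also have "\<dots> = (\<integral>\<^sup>+y. \<integral>\<^sup>+s. ennreal \<bar>H (y(j := s)) - H y\<bar> \<partial>M \<partial>?Q)"
      using ji insert.hyps by (simp add: P.product_nn_integral_insert fun_upd_twist)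
    finally show "(\<integral>\<^sup>+a. \<integral>\<^sup>+y. \<integral>\<^sup>+s. ennreal \<bar>H (y(j := s, i := a)) - H (y(i := a))\<bar> \<partial>M \<partial>?P \<partial>M)
      = (\<integral>\<^sup>+y. \<integral>\<^sup>+s. ennreal \<bar>H (y(j := s)) - H y\<bar> \<partial>M \<partial>?Q)" .
  qed
  also have "(\<integral>\<^sup>+t. \<integral>\<^sup>+a. \<integral>\<^sup>+y. \<integral>\<^sup>+b. ennreal \<bar>H (y(i := a)) - H (y(i := b))\<bar> \<partial>M \<partial>?P \<partial>M \<partial>?P)
     = (\<integral>\<^sup>+a. \<integral>\<^sup>+y. \<integral>\<^sup>+b. ennreal \<bar>H (y(i := a)) - H (y(i := b))\<bar> \<partial>M \<partial>?P \<partial>M)"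
    by (simp add: J.emeasure_space_1)
  also have "\<dots> = (\<integral>\<^sup>+y. \<integral>\<^sup>+a. \<integral>\<^sup>+b. ennreal \<bar>H (y(i := a)) - H (y(i := b))\<bar> \<partial>M \<partial>M \<partial>?P)"
    by (rule nn_integral_swap[OF sfM sfP]) measurable
  also have "\<dots> = (\<integral>\<^sup>+y. \<integral>\<^sup>+s. ennreal \<bar>H (y(i := s)) - H y\<bar> \<partial>M \<partial>?Q)"
    using insert.hyps by (simp add: P.product_nn_integral_insert abs_minus_commute)
  finally show ?case
    unfolding sum.insert[OF insert.hyps] by (simp only: add.commute add_mono)
qed

text \<open>The signed indicator with \<open>f b - f a = (\<integral>s. sg a b s * f' s)\<close>. Averaging over a Gaussian anchor \<open>a\<close> gives \<open>kap b s\<close>.\<close>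

definition sg :: "real \<Rightarrow> real \<Rightarrow> real \<Rightarrow> real" where
  "sg a b s = indicator {a..<b} s - indicator {b..<a} s"

lemma sg_alt: "sg a b s = (if s < b then indicator {..s} a else - indicator {s<..} a)"
  by (auto simp: sg_def indicator_def)

lemma measurable_sg [measurable (raw)]:
  assumes [measurable]: "f \<in> borel_measurable N" "h \<in> borel_measurable N" "k \<in> borel_measurable N"
  shows "(\<lambda>x. sg (f x) (h x) (k x)) \<in> borel_measurable N"
  unfolding sg_def indicator_def of_bool_def atLeastLessThan_iff by measurable

lemma abs_sg_le_1: "\<bar>sg a b s\<bar> \<le> 1"
  by (auto simp: sg_def indicator_def)

lemma measure_stdN_Ioi: "measure stdN {s<..} = 1 - ncdf s"
proof -
  have "measure stdN (space stdN - {..s}) = 1 - measure stdN {..s}"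
    by (rule stdN.prob_compl) auto
  then show ?thesis by (simp add: ncdf_def cdf_def Compl_eq_Diff_UNIV[symmetric] not_le Compl_atMost)
qed

lemma integral_sg: "(\<integral>a. sg a b s \<partial>stdN) = kap b s"
  by (cases "s < b") (simp_all add: sg_alt kap_def measure_stdN_Ioi ncdf_def cdf_def2)

lemma integrable_sg: "integrable stdN (\<lambda>a. sg a b s)"
  by (rule stdN.integrable_const_bound[of _ 1]) (auto simp: abs_sg_le_1)

lemma nn_integral_sg: "(\<integral>\<^sup>+a. ennreal \<bar>sg a b s\<bar> \<partial>stdN) = ennreal \<bar>kap b s\<bar>"
proof -
  have "(\<integral>\<^sup>+a. ennreal \<bar>sg a b s\<bar> \<partial>stdN) = ennreal (\<integral>a. \<bar>sg a b s\<bar> \<partial>stdN)"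
    by (intro nn_integral_eq_integral integrable_abs integrable_sg) auto
  also have "(\<integral>a. \<bar>sg a b s\<bar> \<partial>stdN) = \<bar>kap b s\<bar>"
    using ncdf_pos[of s] ncdf_less_1[of s]
    by (cases "s < b") (simp_all add: sg_alt kap_def measure_stdN_Ioi ncdf_def[symmetric] cdf_def2[symmetric])
  finally show ?thesis .
qed

text \<open>\<open>sg a b s\<close> is nonzero exactly when \<open>a\<close> and \<open>b\<close>
  lie on different sides of \<open>s\<close>, with \<open>s\<close> itself counted to the left. Two
  independent Gaussian samples do so with probability
  \<open>2 * ncdf s * (1 - ncdf s)\<close>.\<close>

lemma nn_integral_sg_sg: "(\<integral>\<^sup>+b. \<integral>\<^sup>+a. ennreal \<bar>sg a b s\<bar> \<partial>stdN \<partial>stdN) = ennreal (2 * ncc s)"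
proof -
  have eq: "\<bar>kap b s\<bar> = ncdf s * indicator {s<..} b + (1 - ncdf s) * indicator {..s} b" for b
    using ncdf_pos[of s] ncdf_less_1[of s] by (auto simp: kap_def indicator_def)
  have i: "integrable stdN (\<lambda>b. \<bar>kap b s\<bar>)"
    unfolding eq by (intro Bochner_Integration.integrable_add integrable_mult_right integrable_real_indicator) (auto simp: stdN.emeasure_eq_measure)
  have "(\<integral>\<^sup>+b. \<integral>\<^sup>+a. ennreal \<bar>sg a b s\<bar> \<partial>stdN \<partial>stdN) = ennreal (\<integral>b. \<bar>kap b s\<bar> \<partial>stdN)"
    using i by (simp add: nn_integral_sg nn_integral_eq_integral)
  also have "(\<integral>b. \<bar>kap b s\<bar> \<partial>stdN) = 2 * ncc s"
    unfolding eq by (subst Bochner_Integration.integral_add)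
      (auto simp: measure_stdN_Ioi ncdf_def[symmetric] cdf_def2[symmetric] ncc_def stdN.emeasure_eq_measure)
  finally show ?thesis .
qed

section \<open>Families of mixed derivatives and their integral representation\<close>

lemma PiM_density:
  fixes M :: "real measure" and f :: "nat \<Rightarrow> real \<Rightarrow> ennreal"
  assumes I: "finite I" and M: "sigma_finite_measure M" and f: "\<And>i. f i \<in> borel_measurable M"
    and sf: "\<And>i. sigma_finite_measure (density M (f i))"
  shows "Pi\<^sub>M I (\<lambda>i. density M (f i)) = density (Pi\<^sub>M I (\<lambda>_. M)) (\<lambda>x. \<Prod>i\<in>I. f i (x i))"
proof -
  interpret P: product_sigma_finite "\<lambda>i::nat. density M (f i)" by (simp add: product_sigma_finite_def sf)
  interpret Q: product_sigma_finite "\<lambda>i::nat. M" by (simp add: product_sigma_finite_def M)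
  note [measurable] = f
  show ?thesis
  proof (rule P.PiM_eqI[OF I, symmetric])
    show "sets (density (Pi\<^sub>M I (\<lambda>_. M)) (\<lambda>x. \<Prod>i\<in>I. f i (x i))) = sets (Pi\<^sub>M I (\<lambda>i. density M (f i)))"
      by (simp, intro sets_PiM_cong) auto
    fix A assume A: "\<And>i. i \<in> I \<Longrightarrow> A i \<in> sets (density M (f i))"
    then have AM [measurable]: "\<And>i. i \<in> I \<Longrightarrow> A i \<in> sets M" by simp
    have "emeasure (density (Pi\<^sub>M I (\<lambda>_. M)) (\<lambda>x. \<Prod>i\<in>I. f i (x i))) (Pi\<^sub>E I A)
      = (\<integral>\<^sup>+x. (\<Prod>i\<in>I. f i (x i)) * indicator (Pi\<^sub>E I A) x \<partial>Pi\<^sub>M I (\<lambda>_. M))"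
      using I AM by (intro emeasure_density sets_PiM_I_finite) auto
    also have "\<dots> = (\<integral>\<^sup>+x. (\<Prod>i\<in>I. f i (x i) * indicator (A i) (x i)) \<partial>Pi\<^sub>M I (\<lambda>_. M))"
    proof (rule nn_integral_cong)
      fix x assume x: "x \<in> space (Pi\<^sub>M I (\<lambda>_. M))"
      have "(indicator (Pi\<^sub>E I A) x :: ennreal) = (\<Prod>i\<in>I. indicator (A i) (x i))"
      proof (cases "x \<in> Pi\<^sub>E I A")
        case False
        then obtain i where "i \<in> I" "x i \<notin> A i" using x by (auto simp: space_PiM PiE_iff)
        then show ?thesis using False I by (subst prod_zero) (auto intro!: bexI[of _ i])
      qed (auto simp: PiE_iff)
      then show "(\<Prod>i\<in>I. f i (x i)) * indicator (Pi\<^sub>E I A) x = (\<Prod>i\<in>I. f i (x i) * indicator (A i) (x i))"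
        by (simp add: prod.distrib)
    qed
    also have "\<dots> = (\<Prod>i\<in>I. \<integral>\<^sup>+x. f i x * indicator (A i) x \<partial>M)"
      using I by (intro Q.product_nn_integral_prod) auto
    also have "\<dots> = (\<Prod>i\<in>I. emeasure (density M (f i)) (A i))"
      by (intro prod.cong refl) (simp add: emeasure_density AM)
    finally show "emeasure (density (Pi\<^sub>M I (\<lambda>_. M)) (\<lambda>x. \<Prod>i\<in>I. f i (x i))) (Pi\<^sub>E I A)
      = (\<Prod>i\<in>I. emeasure (density M (f i)) (A i))" .
  qed
qed

text \<open>The measure for differentiated coordinates. By \<open>nn_integral_sg_sg\<close>,
  integrating the absolute derivative against it bounds the mean Gaussian oscillation of the
  function, up to a factor 2.\<close>

abbreviation "Cm \<equiv> density lborel ncc"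

lemma finite_measure_Cm: "finite_measure Cm"
proof
  have "(\<integral>\<^sup>+x. ennreal (ncc x) \<partial>lborel) \<le> (\<integral>\<^sup>+x. ennreal (ntail x powr 1 * exp (2 * 0 * \<bar>x\<bar>)) \<partial>lborel)"
    using ncc_le_ntail ntail_pos by (intro nn_integral_mono) (auto simp: less_imp_le)
  also have "\<dots> < \<infinity>"
    using integrable_ntail_exp(1)[of 1 0] ntail_pos by (subst nn_integral_eq_integral) auto
  finally show "emeasure Cm (space Cm) \<noteq> \<infinity>" by (simp add: emeasure_density)
qed

interpretation Cm: finite_measure Cm by (rule finite_measure_Cm)

interpretation PN: product_sigma_finite "\<lambda>_::nat. stdN" by standard

interpretation PC: product_sigma_finite "\<lambda>_::nat. Cm" by standard

interpretation PL: product_sigma_finite "\<lambda>_::nat. lborel :: real measure" by standard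

lemma PiM_stdN: "finite J \<Longrightarrow> Pi\<^sub>M J (\<lambda>_. stdN) = density (lborel_on J) (\<lambda>x. ennreal (\<Prod>i\<in>J. std_normal_density (x i)))"
  by (subst PiM_density) (auto simp: prod_ennreal lborel.sigma_finite_measure_axioms stdN.sigma_finite_measure_axioms)

lemma PiM_Cm: "finite J \<Longrightarrow> Pi\<^sub>M J (\<lambda>_. Cm) = density (lborel_on J) (\<lambda>x. ennreal (\<Prod>i\<in>J. ncc (x i)))"
  by (subst PiM_density) (auto simp: prod_ennreal lborel.sigma_finite_measure_axioms Cm.sigma_finite_measure_axioms less_imp_le[OF ncc_pos])

lemma sets_PiM_lborel_like:
  "sets (Pi\<^sub>M J (\<lambda>_. stdN)) = sets (lborel_on J)" "sets (Pi\<^sub>M J (\<lambda>_. Cm)) = sets (lborel_on J)"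
  by (intro sets_PiM_cong; simp)+

lemma compact_box: "compact {z :: nat \<Rightarrow> real. \<forall>j. z j \<in> S j}" if "\<And>j. compact (S j)"
proof -
  have "compactin (product_topology (\<lambda>i. euclidean) UNIV) (PiE UNIV S)"
    using that by (subst compactin_PiE) (auto simp: compactin_euclidean_iff)
  moreover have "PiE UNIV S = {z. \<forall>j. z j \<in> S j}" by (auto simp: PiE_def)
  ultimately show ?thesis by (simp add: euclidean_product_topology compactin_euclidean_iff)
qed

text \<open>Valid for every \<open>f\<close>: without integrability the left side is the default
  value 0.\<close>

lemma ennreal_abs_integral_le: "ennreal \<bar>\<integral>x. f x \<partial>M\<bar> \<le> (\<integral>\<^sup>+x. ennreal \<bar>f x\<bar> \<partial>M)"
proof (cases "integrable M f")
  case True then show ?thesis using integral_norm_bound_ennreal[OF True] by simp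
qed (simp add: not_integrable_integral_eq)

text \<open>The family \<open>g u\<close> stands for the mixed first derivatives of \<open>g {}\<close> in the variables in \<open>u\<close>.\<close>

locale mixed_family =
  fixes I :: "nat set" and g :: "nat set \<Rightarrow> (nat \<Rightarrow> real) \<Rightarrow> real"
  assumes fin: "finite I"
    and cont: "u \<subseteq> I \<Longrightarrow> continuous_on UNIV (g u)"
    and loc: "u \<subseteq> I \<Longrightarrow> (\<And>j. j \<in> I \<Longrightarrow> x j = y j) \<Longrightarrow> g u x = g u y"
    and ftc: "u \<subseteq> I \<Longrightarrow> i \<in> I \<Longrightarrow> i \<notin> u \<Longrightarrow>
      g u (x(i := b)) - g u (x(i := a)) = (\<integral>s. sg a b s * g (insert i u) (x(i := s)) \<partial>lborel)"
begin

lemma fin_sub: "u \<subseteq> I \<Longrightarrow> finite u" using fin by (rule finite_subset[rotated])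

lemma g_borel: "u \<subseteq> I \<Longrightarrow> g u \<in> borel_measurable borel"
  by (intro borel_measurable_continuous_onI cont)

definition mu :: "nat set \<Rightarrow> nat \<Rightarrow> real measure" where "mu u j = (if j \<in> u then Cm else stdN)"

lemma sets_mu [simp, measurable_cong]: "sets (mu u j) = sets borel" by (simp add: mu_def)

lemma sf_mu: "product_sigma_finite (mu u)"
  by (simp add: product_sigma_finite_def mu_def Cm.sigma_finite_measure_axioms stdN.sigma_finite_measure_axioms)

definition Abs :: "nat set \<Rightarrow> ennreal" where
  "Abs u = (\<integral>\<^sup>+x. ennreal \<bar>g u x\<bar> \<partial>Pi\<^sub>M I (mu u))"

text \<open>The inner integral of the norm, with the Gaussian densities moved into the measure. It
  is signed, so cancellation may make it small where \<open>g u\<close> is large.\<close>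

definition Mean :: "nat set \<Rightarrow> (nat \<Rightarrow> real) \<Rightarrow> real" where
  "Mean u x = (\<integral>y. g u (merge u (I - u) (x, y)) \<partial>Pi\<^sub>M (I - u) (\<lambda>_. stdN))"

text \<open>By \<open>ftc\<close> the increment in coordinate \<open>i\<close> is the next
  derivative integrated against \<open>sg\<close>. Averaging over both endpoints before integrating
  over \<open>s\<close>, which Tonelli permits, replaces the weight \<open>sg\<close> by
  \<open>2 * ncc s\<close>. Thus coordinate \<open>i\<close> passes from the Gaussian measure to
  \<open>Cm\<close>.\<close>

lemma coordinate_step:
  assumes u: "u \<subseteq> I" and i: "i \<in> I" "i \<notin> u"
  shows "(\<integral>\<^sup>+z. \<integral>\<^sup>+t. ennreal \<bar>g u (z(i := t)) - g u z\<bar> \<partial>stdN \<partial>Pi\<^sub>M I (mu u)) \<le> 2 * Abs (insert i u)"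
proof -
  interpret A: product_sigma_finite "mu u" by (rule sf_mu)
  interpret B: product_sigma_finite "mu (insert i u)" by (rule sf_mu)
  let ?J = "I - {i}"
  have I: "I = insert i ?J" and J: "finite ?J" "i \<notin> ?J" using i fin by auto
  note H = g_borel[OF u] 
  have iu: "insert i u \<subseteq> I" using u i by auto
  note H' = g_borel[OF iu]
  note [measurable (raw)] = measurable_comp_PiM_upd[OF H _ _ sets_mu] measurable_comp_PiM_upd2[OF H _ _ _ sets_mu]
    measurable_comp_PiM[OF H _ sets_mu] measurable_comp_PiM_upd[OF H' _ _ sets_mu] measurable_comp_PiM[OF H' _ sets_mu]
  have PJ: "Pi\<^sub>M ?J (mu u) = Pi\<^sub>M ?J (mu (insert i u))"
    by (rule PiM_cong) (auto simp: mu_def)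
  have mi: "mu u i = stdN" "mu (insert i u) i = Cm" using i by (auto simp: mu_def)
  have m: "(\<lambda>z. \<integral>\<^sup>+t. ennreal \<bar>g u (z(i := t)) - g u z\<bar> \<partial>stdN) \<in> borel_measurable (Pi\<^sub>M (insert i ?J) (mu u))"
    by measurable
  have "(\<integral>\<^sup>+z. \<integral>\<^sup>+t. ennreal \<bar>g u (z(i := t)) - g u z\<bar> \<partial>stdN \<partial>Pi\<^sub>M I (mu u))
    = (\<integral>\<^sup>+z. \<integral>\<^sup>+t. ennreal \<bar>g u (z(i := t)) - g u z\<bar> \<partial>stdN \<partial>Pi\<^sub>M (insert i ?J) (mu u))"
    using I by simp
  also have "\<dots> = (\<integral>\<^sup>+z. \<integral>\<^sup>+a. \<integral>\<^sup>+t. ennreal \<bar>g u (z(i := t)) - g u (z(i := a))\<bar> \<partial>stdN \<partial>stdN \<partial>Pi\<^sub>M ?J (mu u))"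
    by (subst A.product_nn_integral_insert[OF J m]) (simp add: mi)
  also have "\<dots> \<le> (\<integral>\<^sup>+z. 2 * (\<integral>\<^sup>+s. ennreal \<bar>g (insert i u) (z(i := s))\<bar> \<partial>Cm) \<partial>Pi\<^sub>M ?J (mu u))"
  proof (rule nn_integral_mono)
    fix z assume z: "z \<in> space (Pi\<^sub>M ?J (mu u))"
    define h where "h s = ennreal \<bar>g (insert i u) (z(i := s))\<bar>" for s
    have [measurable]: "(\<lambda>s. g (insert i u) (z(i := s))) \<in> borel_measurable borel"
    proof (rule measurable_comp_coords[OF H'])
      show "(\<lambda>s. (z(i := s)) j) \<in> borel_measurable borel" for j by (cases "j = i") auto
    qed
    have hm [measurable]: "h \<in> borel_measurable borel" unfolding h_def[abs_def] by measurable
    have "(\<integral>\<^sup>+a. \<integral>\<^sup>+t. ennreal \<bar>g u (z(i := t)) - g u (z(i := a))\<bar> \<partial>stdN \<partial>stdN)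
      \<le> (\<integral>\<^sup>+a. \<integral>\<^sup>+t. \<integral>\<^sup>+s. ennreal \<bar>sg a t s\<bar> * h s \<partial>lborel \<partial>stdN \<partial>stdN)"
    proof (intro nn_integral_mono)
      fix a t :: real
      have "ennreal \<bar>g u (z(i := t)) - g u (z(i := a))\<bar> \<le> (\<integral>\<^sup>+s. ennreal \<bar>sg a t s * g (insert i u) (z(i := s))\<bar> \<partial>lborel)"
        unfolding ftc[OF u i] by (rule ennreal_abs_integral_le)
      then show "ennreal \<bar>g u (z(i := t)) - g u (z(i := a))\<bar> \<le> (\<integral>\<^sup>+s. ennreal \<bar>sg a t s\<bar> * h s \<partial>lborel)"
        by (simp add: h_def abs_mult ennreal_mult)
    qed
    also have "\<dots> = (\<integral>\<^sup>+a. \<integral>\<^sup>+s. \<integral>\<^sup>+t. ennreal \<bar>sg a t s\<bar> * h s \<partial>stdN \<partial>lborel \<partial>stdN)"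
      by (intro nn_integral_cong nn_integral_swap stdN.sigma_finite_measure_axioms lborel.sigma_finite_measure_axioms) measurable
    also have "\<dots> = (\<integral>\<^sup>+s. \<integral>\<^sup>+a. \<integral>\<^sup>+t. ennreal \<bar>sg a t s\<bar> * h s \<partial>stdN \<partial>stdN \<partial>lborel)"
      by (intro nn_integral_swap stdN.sigma_finite_measure_axioms lborel.sigma_finite_measure_axioms) measurable
    also have "\<dots> = (\<integral>\<^sup>+s. ennreal (2 * ncc s) * h s \<partial>lborel)"
    proof (rule nn_integral_cong)
      fix s :: real
      have "(\<integral>\<^sup>+a. \<integral>\<^sup>+t. ennreal \<bar>sg a t s\<bar> \<partial>stdN \<partial>stdN) = (\<integral>\<^sup>+t. \<integral>\<^sup>+a. ennreal \<bar>sg a t s\<bar> \<partial>stdN \<partial>stdN)"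
        by (intro nn_integral_swap stdN.sigma_finite_measure_axioms) measurable
      then show "(\<integral>\<^sup>+a. \<integral>\<^sup>+t. ennreal \<bar>sg a t s\<bar> * h s \<partial>stdN \<partial>stdN) = ennreal (2 * ncc s) * h s"
        by (simp add: nn_integral_multc nn_integral_sg_sg)
    qed
    also have "\<dots> = 2 * (\<integral>\<^sup>+s. h s \<partial>Cm)"
      by (subst nn_integral_density)
        (auto simp: less_imp_le[OF ncc_pos] ennreal_mult mult.assoc nn_integral_cmult)
    finally show "(\<integral>\<^sup>+a. \<integral>\<^sup>+t. ennreal \<bar>g u (z(i := t)) - g u (z(i := a))\<bar> \<partial>stdN \<partial>stdN)
      \<le> 2 * (\<integral>\<^sup>+s. ennreal \<bar>g (insert i u) (z(i := s))\<bar> \<partial>Cm)"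
      by (simp add: h_def)
  qed
  also have "\<dots> = 2 * (\<integral>\<^sup>+z. \<integral>\<^sup>+s. ennreal \<bar>g (insert i u) (z(i := s))\<bar> \<partial>mu (insert i u) i \<partial>Pi\<^sub>M ?J (mu (insert i u)))"
    unfolding PJ mi by (rule nn_integral_cmult) measurable
  also have "(\<integral>\<^sup>+z. \<integral>\<^sup>+s. ennreal \<bar>g (insert i u) (z(i := s))\<bar> \<partial>mu (insert i u) i \<partial>Pi\<^sub>M ?J (mu (insert i u)))
     = (\<integral>\<^sup>+z. ennreal \<bar>g (insert i u) z\<bar> \<partial>Pi\<^sub>M (insert i ?J) (mu (insert i u)))"
    by (rule B.product_nn_integral_insert[OF J, symmetric]) measurable
  also have "\<dots> = Abs (insert i u)" unfolding Abs_def using I by simp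
  finally show ?thesis .
qed

lemma Mean_measurable: 
  assumes u: "u \<subseteq> I" and sM: "\<And>j. j \<in> u \<Longrightarrow> sets (M j) = sets borel"
  shows "Mean u \<in> borel_measurable (Pi\<^sub>M u M)"
proof -
  interpret S: prob_space "Pi\<^sub>M (I - u) (\<lambda>_. stdN)" by (rule prob_space_PiM) (rule stdN.prob_space_axioms)
  have "(\<lambda>(x, y). g u (merge u (I - u) (x, y))) \<in> borel_measurable (Pi\<^sub>M u M \<Otimes>\<^sub>M Pi\<^sub>M (I - u) (\<lambda>_. stdN))"
  proof -
    have "merge u (I - u) \<in> measurable (Pi\<^sub>M u (\<lambda>j. if j \<in> u then M j else stdN) \<Otimes>\<^sub>M Pi\<^sub>M (I - u) (\<lambda>j. if j \<in> u then M j else stdN)) 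
         (Pi\<^sub>M (u \<union> (I - u)) (\<lambda>j. if j \<in> u then M j else stdN))"
      by measurable
    also have "Pi\<^sub>M u (\<lambda>j. if j \<in> u then M j else stdN) = Pi\<^sub>M u M" by (rule PiM_cong) auto
    also have "Pi\<^sub>M (I - u) (\<lambda>j. if j \<in> u then M j else stdN) = Pi\<^sub>M (I - u) (\<lambda>_. stdN)" by (rule PiM_cong) auto
    finally show ?thesis unfolding split_def prod.collapse
      by (rule measurable_comp_PiM[OF g_borel[OF u]]) (auto simp: sM)
  qed
  then show ?thesis unfolding Mean_def by (rule S.borel_measurable_lebesgue_integral)
qed

text \<open>For fixed differentiated coordinates, the distance of a function from its mean is at
  most its mean distance from an independent copy. \<open>efron_stein_L1\<close> splits that
  distance into single coordinates, and \<open>coordinate_step\<close> trades each of them for one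
  more derivative.\<close>

lemma Abs_step:
  assumes u: "u \<subseteq> I"
    and int: "AE x in lborel_on u. integrable (Pi\<^sub>M (I - u) (\<lambda>_. stdN)) (\<lambda>y. g u (merge u (I - u) (x, y)))"
  shows "Abs u \<le> (\<integral>\<^sup>+x. ennreal \<bar>Mean u x\<bar> \<partial>Pi\<^sub>M u (\<lambda>_. Cm)) + 2 * (\<Sum>i\<in>I - u. Abs (insert i u))"
proof -
  interpret A: product_sigma_finite "mu u" by (rule sf_mu)
  let ?J = "I - u"
  let ?U = "Pi\<^sub>M u (\<lambda>_. Cm)" and ?N = "Pi\<^sub>M ?J (\<lambda>_. stdN)"
  interpret S: prob_space ?N by (rule prob_space_PiM) (rule stdN.prob_space_axioms)
  have I: "I = u \<union> ?J" and fu: "finite u" and fJ: "finite ?J" and dj: "u \<inter> ?J = {}"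
    using u fin fin_sub[OF u] by auto
  have Pu: "Pi\<^sub>M u (mu u) = ?U" and PJ: "Pi\<^sub>M ?J (mu u) = ?N"
    by (rule PiM_cong; auto simp: mu_def)+
  note H = g_borel[OF u]
  note [measurable (raw)] = measurable_comp_PiM_upd[OF H _ _ sets_mu] measurable_comp_PiM_upd2[OF H _ _ _ sets_mu]
    measurable_comp_PiM[OF H _ sets_mu]
  have fold: "(\<integral>\<^sup>+x. f x \<partial>Pi\<^sub>M I (mu u)) = (\<integral>\<^sup>+x. \<integral>\<^sup>+y. f (merge u ?J (x, y)) \<partial>?N \<partial>?U)"
    if "f \<in> borel_measurable (Pi\<^sub>M (u \<union> ?J) (mu u))" for f
    using A.product_nn_integral_fold[OF dj fu fJ that] by (simp only: I[symmetric] Pu PJ)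
  have AE: "AE x in ?U. integrable ?N (\<lambda>y. g u (merge u ?J (x, y)))"
    unfolding PiM_Cm[OF fu] using int by (subst AE_density) auto
  let ?R = "\<lambda>x i. \<integral>\<^sup>+y. \<integral>\<^sup>+s. ennreal \<bar>g u ((merge u ?J (x, y))(i := s)) - g u (merge u ?J (x, y))\<bar> \<partial>stdN \<partial>?N"
  have mg: "merge u ?J \<in> measurable (?U \<Otimes>\<^sub>M ?N) (Pi\<^sub>M I (mu u))"
    using measurable_merge[of u ?J "mu u"] by (simp only: Pu PJ I[symmetric])
  have mR: "(\<lambda>x. ?R x i) \<in> borel_measurable ?U" for i
  proof -
    have "(\<lambda>z. \<integral>\<^sup>+s. ennreal \<bar>g u (z(i := s)) - g u z\<bar> \<partial>stdN) \<in> borel_measurable (Pi\<^sub>M I (mu u))"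
      by measurable
    from measurable_compose[OF mg this] show ?thesis
      using S.borel_measurable_nn_integral_fst by simp
  qed
  have "Abs u = (\<integral>\<^sup>+x. \<integral>\<^sup>+y. ennreal \<bar>g u (merge u ?J (x, y))\<bar> \<partial>?N \<partial>?U)"
    unfolding Abs_def by (rule fold) measurable
  also have "\<dots> \<le> (\<integral>\<^sup>+x. ennreal \<bar>Mean u x\<bar> + (\<Sum>i\<in>?J. ?R x i) \<partial>?U)"
  proof (rule nn_integral_mono_AE)
    show "AE x in ?U. (\<integral>\<^sup>+y. ennreal \<bar>g u (merge u ?J (x, y))\<bar> \<partial>?N) \<le> ennreal \<bar>Mean u x\<bar> + (\<Sum>i\<in>?J. ?R x i)"
      using AE AE_space
    proof eventually_elim
      case (elim x)
      define h where "h y = g u (merge u ?J (x, y))" for y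
      have hb: "h \<in> borel_measurable borel" unfolding h_def
      proof (rule measurable_comp_coords[OF H])
        show "(\<lambda>y. merge u ?J (x, y) j) \<in> borel_measurable borel" for j
          by (cases "j \<in> u"; cases "j \<in> ?J") (auto simp: merge_def)
      qed
      have hi: "integrable ?N h" using elim by (simp add: h_def[abs_def])
      have [measurable]: "h \<in> borel_measurable ?N" using hi by auto
      have "(\<integral>\<^sup>+t. ennreal \<bar>h t\<bar> \<partial>?N) \<le> (\<integral>\<^sup>+t. ennreal \<bar>Mean u x\<bar> + (\<integral>\<^sup>+y. ennreal \<bar>h t - h y\<bar> \<partial>?N) \<partial>?N)"
      proof (rule nn_integral_mono)
        fix t
        have "Mean u x = (\<integral>y. h y \<partial>?N)" by (simp add: Mean_def h_def)
        then have "h t - Mean u x = (\<integral>y. h t - h y \<partial>?N)"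
          using hi by (simp add: S.prob_space)
        then have "ennreal \<bar>h t - Mean u x\<bar> \<le> (\<integral>\<^sup>+y. ennreal \<bar>h t - h y\<bar> \<partial>?N)"
          using ennreal_abs_integral_le by metis
        moreover have "ennreal \<bar>h t\<bar> \<le> ennreal \<bar>Mean u x\<bar> + ennreal \<bar>h t - Mean u x\<bar>"
          by (simp del: ennreal_plus add: ennreal_plus[symmetric])
        ultimately show "ennreal \<bar>h t\<bar> \<le> ennreal \<bar>Mean u x\<bar> + (\<integral>\<^sup>+y. ennreal \<bar>h t - h y\<bar> \<partial>?N)"
          by (metis add_left_mono order_trans)
      qed
      also have "\<dots> = ennreal \<bar>Mean u x\<bar> + (\<integral>\<^sup>+t. \<integral>\<^sup>+y. ennreal \<bar>h t - h y\<bar> \<partial>?N \<partial>?N)"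
        by (subst nn_integral_add) (auto simp: S.emeasure_space_1)
      also have "\<dots> \<le> ennreal \<bar>Mean u x\<bar> + (\<Sum>i\<in>?J. \<integral>\<^sup>+y. \<integral>\<^sup>+s. ennreal \<bar>h (y(i := s)) - h y\<bar> \<partial>stdN \<partial>?N)"
        by (intro add_left_mono efron_stein_L1 stdN.prob_space_axioms hb fJ) auto
      also have "(\<Sum>i\<in>?J. \<integral>\<^sup>+y. \<integral>\<^sup>+s. ennreal \<bar>h (y(i := s)) - h y\<bar> \<partial>stdN \<partial>?N) = (\<Sum>i\<in>?J. ?R x i)"
      proof (intro sum.cong refl nn_integral_cong)
        fix i y s assume "i \<in> ?J"
        then have "merge u ?J (x, y(i := s)) = (merge u ?J (x, y))(i := s)"
          by (auto simp: merge_def fun_eq_iff)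
        then show "ennreal \<bar>h (y(i := s)) - h y\<bar> = ennreal \<bar>g u ((merge u ?J (x, y))(i := s)) - g u (merge u ?J (x, y))\<bar>"
          by (simp add: h_def)
      qed
      finally show ?case by (simp add: h_def)
    qed
  qed
  also have "\<dots> = (\<integral>\<^sup>+x. ennreal \<bar>Mean u x\<bar> \<partial>?U) + (\<Sum>i\<in>?J. \<integral>\<^sup>+x. ?R x i \<partial>?U)"
    using Mean_measurable[OF u, of "\<lambda>_. Cm"] mR
    by (subst nn_integral_add) (auto simp: nn_integral_sum)
  also have "(\<Sum>i\<in>?J. \<integral>\<^sup>+x. ?R x i \<partial>?U)
     = (\<Sum>i\<in>?J. \<integral>\<^sup>+z. \<integral>\<^sup>+s. ennreal \<bar>g u (z(i := s)) - g u z\<bar> \<partial>stdN \<partial>Pi\<^sub>M I (mu u))"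
    by (intro sum.cong refl, subst fold) measurable
  also have "\<dots> \<le> (\<Sum>i\<in>?J. 2 * Abs (insert i u))"
    by (intro sum_mono coordinate_step u) auto
  finally show ?thesis by (simp add: sum_distrib_left add_left_mono)
qed

text \<open>Only the signed means \<open>Mean u\<close> are controlled by the hypotheses. Absolute integrability of \<open>g u\<close> comes from the top: the oscillation of \<open>g u\<close> is bounded by the families with one more derivative.\<close>

lemma Abs_finite:
  assumes int: "\<And>u. u \<subseteq> I \<Longrightarrow> AE x in lborel_on u. integrable (Pi\<^sub>M (I - u) (\<lambda>_. stdN)) (\<lambda>y. g u (merge u (I - u) (x, y)))"
    and D: "\<And>u. u \<subseteq> I \<Longrightarrow> (\<integral>\<^sup>+x. ennreal \<bar>Mean u x\<bar> \<partial>Pi\<^sub>M u (\<lambda>_. Cm)) < \<infinity>"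
    and u: "u \<subseteq> I"
  shows "Abs u < \<infinity>"
  using u
proof (induction "card (I - u)" arbitrary: u rule: less_induct)
  case less
  have "Abs (insert i u) < \<infinity>" if "i \<in> I - u" for i
    using that less.prems fin by (intro less.hyps psubset_card_mono) auto
  then have "2 * (\<Sum>i\<in>I - u. Abs (insert i u)) < \<infinity>"
    using fin by (auto simp: ennreal_mult_less_top)
  then show ?case
    using D[OF less.prems] by (intro le_less_trans[OF Abs_step[OF less.prems int[OF less.prems]]]) simp
qed

end

section \<open>Expansion about an anchor and its Gaussian average\<close>

context mixed_family
begin

lemma integrable_sg_g:
  assumes u: "u \<subseteq> I"
  shows "integrable (lborel_on u) (\<lambda>x. (\<Prod>j\<in>u. sg (a j) (b j) (x j)) * g u (\<lambda>j. if j \<in> u then x j else c j))"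
proof -
  let ?h = "\<lambda>x. g u (\<lambda>j. if j \<in> u then x j else c j)"
  let ?p = "\<lambda>x. \<Prod>j\<in>u. sg (a j) (b j) (x j)"
  let ?S = "\<lambda>j. if j \<in> u then {min (a j) (b j)..max (a j) (b j)} else {c j}"
  have fu: "finite u" by (rule fin_sub[OF u])
  have "compact (g u ` {z. \<forall>j. z j \<in> ?S j})"
    by (intro compact_continuous_image compact_box continuous_on_subset[OF cont[OF u]]) auto
  then obtain B where B: "\<And>z. (\<And>j. z j \<in> ?S j) \<Longrightarrow> \<bar>g u z\<bar> \<le> B"
    using bounded_iff[of "g u ` {z. \<forall>j. z j \<in> ?S j}"] compact_imp_bounded by (auto simp del: all_simps)
  have "emeasure lborel {a..<b} < \<infinity>" for a b :: real by (cases "a \<le> b") auto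
  then have sgi: "integrable lborel (\<lambda>s. sg a b s)" for a b
    unfolding sg_def by (intro Bochner_Integration.integrable_diff integrable_real_indicator) auto
  have pi: "integrable (lborel_on u) ?p"
    by (rule PL.product_integrable_prod[OF fu]) (rule sgi)
  show ?thesis
  proof (rule Bochner_Integration.integrable_bound[OF integrable_mult_left[OF pi, of B]])
    have "?h \<in> borel_measurable (lborel_on u)"
    proof (rule measurable_comp_coords[OF g_borel[OF u]])
      show "(\<lambda>x. if j \<in> u then x j else c j) \<in> borel_measurable (lborel_on u)" for j
        by (cases "j \<in> u") auto
    qed
    then show "(\<lambda>x. ?p x * ?h x) \<in> borel_measurable (lborel_on u)"
      using pi by auto
    show "AE x in lborel_on u. norm (?p x * ?h x) \<le> norm (?p x * B)"
    proof (rule AE_I2)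
      fix x
      show "norm (?p x * ?h x) \<le> norm (?p x * B)"
      proof (cases "?p x = 0")
        case False
        then have nz: "sg (a j) (b j) (x j) \<noteq> 0" if "j \<in> u" for j using fu that by auto
        have "x j \<in> {min (a j) (b j)..max (a j) (b j)}" if "j \<in> u" for j
          using nz[OF that] by (simp add: sg_def indicator_def of_bool_def min_def max_def split: if_splits)
        then have "\<bar>?h x\<bar> \<le> B" by (intro B) auto
        then show ?thesis by (auto simp: abs_mult intro!: mult_left_mono)
      qed simp
    qed
  qed
qed

text \<open>The coordinates in \<open>K\<close> are anchored at \<open>y\<close>, the others are still at \<open>t\<close>; each new anchor splits every term by the fundamental theorem of calculus.\<close>

lemma anchored:
  assumes "K \<subseteq> I"
  shows "g {} t = (\<Sum>u\<in>Pow K. \<integral>x. (\<Prod>j\<in>u. sg (y j) (t j) (x j)) *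
     g u (\<lambda>j. if j \<in> u then x j else if j \<in> K then y j else t j) \<partial>lborel_on u)"
proof -
  have "finite K" using assms fin finite_subset by auto
  then show ?thesis using assms
  proof (induction K)
    case empty
    interpret E: prob_space "lborel_on {}" by (rule prob_space_PiM) auto
    show ?case using E.prob_space by simp
  next
    case (insert i K)
    let ?G = "\<lambda>K u x. (\<Prod>j\<in>u. sg (y j) (t j) (x j)) * g u (\<lambda>j. if j \<in> u then x j else if j \<in> K then y j else t j)"
    have KI: "K \<subseteq> I" "i \<in> I" using insert.prems by auto
    have step: "(\<integral>x. ?G K u x \<partial>lborel_on u) = (\<integral>x. ?G (insert i K) u x \<partial>lborel_on u)
       + (\<integral>x. ?G (insert i K) (insert i u) x \<partial>lborel_on (insert i u))" if uK: "u \<in> Pow K" for u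
    proof -
      have u: "u \<subseteq> I" "insert i u \<subseteq> I" "i \<notin> u" using uK KI insert.hyps by auto
      have fu: "finite u" by (rule fin_sub[OF u(1)])
      note i1 = integrable_sg_g[OF u(1), of y t "\<lambda>j. if j \<in> K then y j else t j"]
      note i2 = integrable_sg_g[OF u(1), of y t "\<lambda>j. if j \<in> insert i K then y j else t j"]
      note i3 = integrable_sg_g[OF u(2), of y t "\<lambda>j. if j \<in> insert i K then y j else t j"]
      have "(\<integral>x. ?G K u x \<partial>lborel_on u) - (\<integral>x. ?G (insert i K) u x \<partial>lborel_on u)
        = (\<integral>x. ?G K u x - ?G (insert i K) u x \<partial>lborel_on u)"
        using i1 i2 by simp
      also have "\<dots> = (\<integral>x. \<integral>s. ?G (insert i K) (insert i u) (x(i := s)) \<partial>lborel \<partial>lborel_on u)"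
      proof (rule Bochner_Integration.integral_cong[OF refl])
        fix x
        define z where "z = (\<lambda>j. if j \<in> u then x j else if j \<in> K then y j else t j)"
        have z1: "(\<lambda>j. if j \<in> u then x j else if j \<in> insert i K then y j else t j) = z(i := y i)"
          using u insert.hyps by (auto simp: z_def fun_eq_iff)
        have z2: "z = z(i := t i)" using u insert.hyps by (auto simp: z_def fun_eq_iff)
        have z3: "(\<lambda>j. if j \<in> insert i u then (x(i := s)) j else if j \<in> insert i K then y j else t j) = z(i := s)" for s
          using u insert.hyps by (auto simp: z_def fun_eq_iff)
        have pe: "(\<Prod>j\<in>insert i u. sg (y j) (t j) ((x(i := s)) j)) = (\<Prod>j\<in>u. sg (y j) (t j) (x j)) * sg (y i) (t i) s" for s
        proof -
          have "(\<Prod>j\<in>u. sg (y j) (t j) ((x(i := s)) j)) = (\<Prod>j\<in>u. sg (y j) (t j) (x j))"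
            using u by (intro prod.cong) auto
          then show ?thesis using fu u by simp
        qed
        have "?G K u x - ?G (insert i K) u x = (\<Prod>j\<in>u. sg (y j) (t j) (x j)) * (g u z - g u (z(i := y i)))"
          unfolding z1 by (simp add: z_def algebra_simps)
        also have "g u z - g u (z(i := y i)) = (\<integral>s. sg (y i) (t i) s * g (insert i u) (z(i := s)) \<partial>lborel)"
          by (subst z2) (rule ftc[OF u(1) KI(2) u(3)])
        also have "(\<Prod>j\<in>u. sg (y j) (t j) (x j)) * (\<integral>s. sg (y i) (t i) s * g (insert i u) (z(i := s)) \<partial>lborel)
          = (\<integral>s. ?G (insert i K) (insert i u) (x(i := s)) \<partial>lborel)"
          unfolding z3 pe by (subst integral_mult_right_zero[symmetric]) (simp add: mult.assoc)
        finally show "?G K u x - ?G (insert i K) u x = (\<integral>s. ?G (insert i K) (insert i u) (x(i := s)) \<partial>lborel)" .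
      qed
      also have "\<dots> = (\<integral>x. ?G (insert i K) (insert i u) x \<partial>lborel_on (insert i u))"
        by (rule PL.product_integral_insert[OF fu u(3) i3, symmetric])
      finally show ?thesis by simp
    qed
    have "g {} t = (\<Sum>u\<in>Pow K. \<integral>x. ?G K u x \<partial>lborel_on u)" by (rule insert.IH[OF KI(1)])
    also have "\<dots> = (\<Sum>u\<in>Pow K. \<integral>x. ?G (insert i K) u x \<partial>lborel_on u)
       + (\<Sum>u\<in>Pow K. \<integral>x. ?G (insert i K) (insert i u) x \<partial>lborel_on (insert i u))"
      by (simp only: step sum.distrib cong: sum.cong)
    also have "(\<Sum>u\<in>Pow K. \<integral>x. ?G (insert i K) (insert i u) x \<partial>lborel_on (insert i u))
      = (\<Sum>u\<in>insert i ` Pow K. \<integral>x. ?G (insert i K) u x \<partial>lborel_on u)"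
    proof (subst sum.reindex)
      show "inj_on (insert i) (Pow K)" using insert.hyps by (auto simp: inj_on_def)
    qed (simp only: o_def)
    also have "(\<Sum>u\<in>Pow K. \<integral>x. ?G (insert i K) u x \<partial>lborel_on u) + \<dots>
      = (\<Sum>u\<in>Pow (insert i K). \<integral>x. ?G (insert i K) u x \<partial>lborel_on u)"
      unfolding Pow_insert using insert.hyps by (subst sum.union_disjoint) auto
    finally show ?case .
  qed
qed

text \<open>In \<open>anchored\<close> with \<open>K = I\<close> the left side does not depend on
  the anchor \<open>y\<close>, so both sides may be averaged over Gaussian \<open>y\<close>. For
  each \<open>u\<close> the anchor coordinates in \<open>u\<close> occur only in \<open>sg\<close>
  and average to \<open>kap\<close>; the remaining ones occur only in \<open>g u\<close> and average
  to \<open>Mean u\<close>. Fubini is justified by \<open>Abs_finite\<close>.\<close>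

lemma representation:
  assumes int: "\<And>u. u \<subseteq> I \<Longrightarrow> AE x in lborel_on u. integrable (Pi\<^sub>M (I - u) (\<lambda>_. stdN)) (\<lambda>y. g u (merge u (I - u) (x, y)))"
    and D: "\<And>u. u \<subseteq> I \<Longrightarrow> (\<integral>\<^sup>+x. ennreal \<bar>Mean u x\<bar> \<partial>Pi\<^sub>M u (\<lambda>_. Cm)) < \<infinity>"
  shows "g {} t = (\<Sum>u\<in>Pow I. \<integral>x. (\<Prod>j\<in>u. kap (t j) (x j)) * Mean u x \<partial>lborel_on u)"
proof -
  let ?N = "Pi\<^sub>M I (\<lambda>_. stdN)"
  interpret N: prob_space ?N by (rule prob_space_PiM) (rule stdN.prob_space_axioms)
  let ?f = "\<lambda>u y x. (\<Prod>j\<in>u. sg (y j) (t j) (x j)) * g u (\<lambda>j. if j \<in> u then x j else if j \<in> I then y j else t j)"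
  have main: "integrable ?N (\<lambda>y. \<integral>x. ?f u y x \<partial>lborel_on u) \<and>
     (\<integral>y. (\<integral>x. ?f u y x \<partial>lborel_on u) \<partial>?N) = (\<integral>x. (\<Prod>j\<in>u. kap (t j) (x j)) * Mean u x \<partial>lborel_on u)"
    if u: "u \<subseteq> I" for u
  proof -
    let ?J = "I - u"
    let ?L = "lborel_on u" and ?Nu = "Pi\<^sub>M u (\<lambda>_. stdN)" and ?NJ = "Pi\<^sub>M ?J (\<lambda>_. stdN)"
    have UJ: "u \<union> ?J = I" and fu: "finite u" and fJ: "finite ?J" and dj: "u \<inter> ?J = {}"
      using u fin fin_sub[OF u] by auto
    interpret Lf: finite_product_sigma_finite "\<lambda>_. lborel" u by standard (rule fu)
    interpret Nu: prob_space ?Nu by (rule prob_space_PiM) (rule stdN.prob_space_axioms)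
    interpret NJ: prob_space ?NJ by (rule prob_space_PiM) (rule stdN.prob_space_axioms)
    interpret P: pair_sigma_finite ?N ?L
      by (simp add: pair_sigma_finite_def N.sigma_finite_measure_axioms PL.sigma_finite[OF fu])
    interpret A: product_sigma_finite "mu u" by (rule sf_mu)
    let ?h = "\<lambda>y x. g u (\<lambda>j. if j \<in> u then x j else if j \<in> I then y j else t j)"
    have mh: "(\<lambda>p. ?h (fst p) (snd p)) \<in> borel_measurable (?N \<Otimes>\<^sub>M ?L)"
    proof (rule measurable_comp_coords[OF g_borel[OF u]])
      show "(\<lambda>x. if j \<in> u then snd x j else if j \<in> I then fst x j else t j) \<in> borel_measurable (?N \<Otimes>\<^sub>M ?L)" for j
        using u by (cases "j \<in> u"; cases "j \<in> I") auto
    qed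
    have ms: "(\<lambda>p. \<Prod>j\<in>u. sg (fst p j) (t j) (snd p j)) \<in> borel_measurable (?N \<Otimes>\<^sub>M ?L)"
      using u by (intro borel_measurable_prod measurable_sg) auto
    have mf: "(\<lambda>p. ?f u (fst p) (snd p)) \<in> borel_measurable (?N \<Otimes>\<^sub>M ?L)"
      using mh ms by simp
    have gm: "?h (merge u ?J (a, b)) x = g u (merge u ?J (x, b))" for a b x
      using u by (intro loc) (auto simp: merge_def)
    have gx: "?h y x = g u (merge u ?J (x, y))" for y x
      using u by (intro loc) (auto simp: merge_def)
    have pm: "(\<Prod>j\<in>u. sg (merge u ?J (a, b) j) (t j) (x j)) = (\<Prod>j\<in>u. sg (a j) (t j) (x j))" for a b x
      by (intro prod.cong) (auto simp: merge_def)
    have sgp: "(\<integral>\<^sup>+a. ennreal \<bar>\<Prod>j\<in>u. sg (a j) (t j) (x j)\<bar> \<partial>?Nu) = ennreal (\<Prod>j\<in>u. \<bar>kap (t j) (x j)\<bar>)" for x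
    proof -
      have "(\<integral>\<^sup>+a. ennreal \<bar>\<Prod>j\<in>u. sg (a j) (t j) (x j)\<bar> \<partial>?Nu) = (\<integral>\<^sup>+a. (\<Prod>j\<in>u. ennreal \<bar>sg (a j) (t j) (x j)\<bar>) \<partial>?Nu)"
        by (simp add: abs_prod prod_ennreal)
      also have "\<dots> = (\<Prod>j\<in>u. \<integral>\<^sup>+a. ennreal \<bar>sg a (t j) (x j)\<bar> \<partial>stdN)"
        by (rule PN.product_nn_integral_prod[OF fu]) simp
      finally show ?thesis by (simp add: nn_integral_sg prod_ennreal)
    qed
    \<comment> \<open>The factor supplied by \<open>abs_kap_le\<close>: at the fixed point
      \<open>t\<close>, the product of kernels is at most \<open>Mt\<close> times the density of the
      product of the measures \<open>Cm\<close>.\<close>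
    define Mt where "Mt = (\<Prod>j\<in>u. 1 / ntail (t j))"
    have Mt: "Mt \<ge> 0" unfolding Mt_def using ntail_pos by (intro prod_nonneg) (simp add: less_imp_le)
    have kb: "(\<Prod>j\<in>u. \<bar>kap (t j) (x j)\<bar>) \<le> Mt * (\<Prod>j\<in>u. ncc (x j))" for x
    proof -
      have "(\<Prod>j\<in>u. \<bar>kap (t j) (x j)\<bar>) \<le> (\<Prod>j\<in>u. 1 / ntail (t j) * ncc (x j))"
        using abs_kap_le by (intro prod_mono) auto
      then show ?thesis unfolding prod.distrib Mt_def .
    qed
    have mfx: "(\<lambda>y. ?f u y x) \<in> borel_measurable ?N" for x
    proof -
      have "(\<lambda>y. ?h y x) \<in> borel_measurable ?N"
      proof (rule measurable_comp_coords[OF g_borel[OF u]])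
        show "(\<lambda>y. if j \<in> u then x j else if j \<in> I then y j else t j) \<in> borel_measurable ?N" for j
          by (cases "j \<in> u"; cases "j \<in> I") auto
      qed
      moreover have "(\<lambda>y. \<Prod>j\<in>u. sg (y j) (t j) (x j)) \<in> borel_measurable ?N"
        using u by (intro borel_measurable_prod measurable_sg) auto
      ultimately show ?thesis by simp
    qed
    have mgx: "(\<lambda>b. g u (merge u ?J (x, b))) \<in> borel_measurable ?NJ" for x
    proof (rule measurable_comp_coords[OF g_borel[OF u]])
      show "(\<lambda>b. merge u ?J (x, b) j) \<in> borel_measurable ?NJ" for j
        by (cases "j \<in> u"; cases "j \<in> ?J") (auto simp: merge_def)
    qed
    have inner: "(\<integral>\<^sup>+y. ennreal \<bar>?f u y x\<bar> \<partial>?N)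
       = ennreal (\<Prod>j\<in>u. \<bar>kap (t j) (x j)\<bar>) * (\<integral>\<^sup>+b. ennreal \<bar>g u (merge u ?J (x, b))\<bar> \<partial>?NJ)" for x
    proof -
      have "(\<lambda>y. ennreal \<bar>?f u y x\<bar>) \<in> borel_measurable (Pi\<^sub>M (u \<union> ?J) (\<lambda>_. stdN))"
        using mfx[of x] by (simp only: UJ) simp
      from PN.product_nn_integral_fold[OF dj fu fJ this]
      have "(\<integral>\<^sup>+y. ennreal \<bar>?f u y x\<bar> \<partial>?N)
        = (\<integral>\<^sup>+a. \<integral>\<^sup>+b. ennreal \<bar>\<Prod>j\<in>u. sg (a j) (t j) (x j)\<bar> * ennreal \<bar>g u (merge u ?J (x, b))\<bar> \<partial>?NJ \<partial>?Nu)"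
        by (simp only: UJ gm pm abs_mult ennreal_mult abs_ge_zero)
      also have "\<dots> = (\<integral>\<^sup>+a. ennreal \<bar>\<Prod>j\<in>u. sg (a j) (t j) (x j)\<bar> * (\<integral>\<^sup>+b. ennreal \<bar>g u (merge u ?J (x, b))\<bar> \<partial>?NJ) \<partial>?Nu)"
        using mgx[of x] by (simp add: nn_integral_cmult)
      also have "\<dots> = (\<integral>\<^sup>+a. ennreal \<bar>\<Prod>j\<in>u. sg (a j) (t j) (x j)\<bar> \<partial>?Nu) * (\<integral>\<^sup>+b. ennreal \<bar>g u (merge u ?J (x, b))\<bar> \<partial>?NJ)"
        by (rule nn_integral_multc) measurable
      finally show ?thesis by (simp only: sgp)
    qed
    have "(\<integral>\<^sup>+x. \<integral>\<^sup>+y. ennreal \<bar>?f u y x\<bar> \<partial>?N \<partial>?L)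
      \<le> (\<integral>\<^sup>+x. ennreal Mt * (ennreal (\<Prod>j\<in>u. ncc (x j)) * (\<integral>\<^sup>+b. ennreal \<bar>g u (merge u ?J (x, b))\<bar> \<partial>?NJ)) \<partial>?L)"
      unfolding inner
    proof (rule nn_integral_mono)
      fix x
      have "ennreal (\<Prod>j\<in>u. \<bar>kap (t j) (x j)\<bar>) \<le> ennreal Mt * ennreal (\<Prod>j\<in>u. ncc (x j))"
        using kb[of x] Mt by (subst ennreal_mult'[symmetric]) (auto intro: ennreal_leI)
      then show "ennreal (\<Prod>j\<in>u. \<bar>kap (t j) (x j)\<bar>) * (\<integral>\<^sup>+b. ennreal \<bar>g u (merge u ?J (x, b))\<bar> \<partial>?NJ)
        \<le> ennreal Mt * (ennreal (\<Prod>j\<in>u. ncc (x j)) * (\<integral>\<^sup>+b. ennreal \<bar>g u (merge u ?J (x, b))\<bar> \<partial>?NJ))"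
        unfolding mult.assoc[symmetric] by (rule mult_right_mono) simp
    qed
    also have "\<dots> = ennreal Mt * Abs u"
    proof -
      have Pu: "Pi\<^sub>M u (mu u) = Pi\<^sub>M u (\<lambda>_. Cm)" and PJ: "Pi\<^sub>M ?J (mu u) = ?NJ"
        by (rule PiM_cong; auto simp: mu_def)+
      have mg: "merge u ?J \<in> measurable (?L \<Otimes>\<^sub>M ?NJ) (Pi\<^sub>M I (mu u))"
      proof -
        have "sets (?L \<Otimes>\<^sub>M ?NJ) = sets (Pi\<^sub>M u (\<lambda>_. Cm) \<Otimes>\<^sub>M ?NJ)"
          by (intro sets_pair_measure_cong) (simp_all add: sets_PiM_lborel_like)
        from measurable_cong_sets[OF this refl] show ?thesis
          using measurable_merge[of u ?J "mu u"] unfolding UJ PJ Pu by blast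
      qed
      have mb: "(\<lambda>x. \<integral>\<^sup>+b. ennreal \<bar>g u (merge u ?J (x, b))\<bar> \<partial>?NJ) \<in> borel_measurable ?L"
        using NJ.borel_measurable_nn_integral_fst[of "\<lambda>p. ennreal \<bar>g u (merge u ?J p)\<bar>" ?L]
          measurable_comp_PiM[OF g_borel[OF u] mg] by simp
      have "(\<lambda>z. ennreal \<bar>g u z\<bar>) \<in> borel_measurable (Pi\<^sub>M (u \<union> ?J) (mu u))"
        using measurable_comp_PiM[OF g_borel[OF u] measurable_ident, of "u \<union> ?J" "mu u"] by simp
      from A.product_nn_integral_fold[OF dj fu fJ this]
      have "Abs u = (\<integral>\<^sup>+x. \<integral>\<^sup>+b. ennreal \<bar>g u (merge u ?J (x, b))\<bar> \<partial>?NJ \<partial>Pi\<^sub>M u (\<lambda>_. Cm))"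
        by (simp only: Abs_def UJ Pu PJ)
      also have "\<dots> = (\<integral>\<^sup>+x. ennreal (\<Prod>j\<in>u. ncc (x j)) * (\<integral>\<^sup>+b. ennreal \<bar>g u (merge u ?J (x, b))\<bar> \<partial>?NJ) \<partial>?L)"
        unfolding PiM_Cm[OF fu] by (rule nn_integral_density) (use mb in auto)
      finally show ?thesis using mb by (simp add: nn_integral_cmult)
    qed
    also have "\<dots> < \<infinity>" using Abs_finite[OF int D u] by (auto simp: ennreal_mult_less_top)
    finally have fin: "(\<integral>\<^sup>+x. \<integral>\<^sup>+y. ennreal \<bar>?f u y x\<bar> \<partial>?N \<partial>?L) < \<infinity>" .
    have I: "integrable (?N \<Otimes>\<^sub>M ?L) (\<lambda>p. ?f u (fst p) (snd p))"
    proof (rule integrableI_bounded)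
      have "(\<lambda>p. ennreal (norm (?f u (fst p) (snd p)))) \<in> borel_measurable (?N \<Otimes>\<^sub>M ?L)"
        using mf by simp
      from P.nn_integral_snd[OF this] fin
      show "(\<integral>\<^sup>+p. ennreal (norm (?f u (fst p) (snd p))) \<partial>(?N \<Otimes>\<^sub>M ?L)) < \<infinity>"
        unfolding fst_conv snd_conv real_norm_def by argo
    qed (rule mf)
    have I': "integrable (?N \<Otimes>\<^sub>M ?L) (\<lambda>(y, x). ?f u y x)" using I by (simp add: split_def)
    have 1: "integrable ?N (\<lambda>y. \<integral>x. ?f u y x \<partial>?L)" using P.integrable_fst[OF I'] .
    have "(\<integral>y. (\<integral>x. ?f u y x \<partial>?L) \<partial>?N) = (\<integral>x. (\<integral>y. ?f u y x \<partial>?N) \<partial>?L)"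
      by (rule P.Fubini_integral[OF I', symmetric])
    also have "\<dots> = (\<integral>x. (\<Prod>j\<in>u. kap (t j) (x j)) * Mean u x \<partial>?L)"
    proof (rule integral_cong_AE)
      show "(\<lambda>x. \<integral>y. ?f u y x \<partial>?N) \<in> borel_measurable ?L" using P.integrable_snd[OF I'] by auto
      show "(\<lambda>x. (\<Prod>j\<in>u. kap (t j) (x j)) * Mean u x) \<in> borel_measurable ?L"
        using Mean_measurable[OF u, of "\<lambda>_. lborel"] by simp
      show "AE x in ?L. (\<integral>y. ?f u y x \<partial>?N) = (\<Prod>j\<in>u. kap (t j) (x j)) * Mean u x"
        using P.AE_integrable_snd[OF I']
      proof eventually_elim
        case (elim x)
        have "integrable (Pi\<^sub>M (u \<union> ?J) (\<lambda>_. stdN)) (\<lambda>y. ?f u y x)" using elim by (simp only: UJ)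
        from PN.product_integral_fold[OF dj fu fJ this]
        have "(\<integral>y. ?f u y x \<partial>?N) = (\<integral>a. \<integral>b. (\<Prod>j\<in>u. sg (a j) (t j) (x j)) * g u (merge u ?J (x, b)) \<partial>?NJ \<partial>?Nu)"
          by (simp only: UJ gm pm)
        also have "\<dots> = (\<integral>a. (\<Prod>j\<in>u. sg (a j) (t j) (x j)) \<partial>?Nu) * Mean u x"
          by (simp add: Mean_def)
        also have "(\<integral>a. (\<Prod>j\<in>u. sg (a j) (t j) (x j)) \<partial>?Nu) = (\<Prod>j\<in>u. kap (t j) (x j))"
          by (subst PN.product_integral_prod[OF fu]) (auto simp: integral_sg integrable_sg)
        finally show ?case .
      qed
    qed
    finally show ?thesis using 1 by simp
  qed
  have "g {} t = (\<integral>y. g {} t \<partial>?N)" by (simp add: N.prob_space)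
  also have "\<dots> = (\<integral>y. (\<Sum>u\<in>Pow I. \<integral>x. ?f u y x \<partial>lborel_on u) \<partial>?N)"
    by (intro Bochner_Integration.integral_cong refl anchored) simp
  also have "\<dots> = (\<Sum>u\<in>Pow I. \<integral>y. (\<integral>x. ?f u y x \<partial>lborel_on u) \<partial>?N)"
    by (rule Bochner_Integration.integral_sum) (use main in auto)
  also have "\<dots> = (\<Sum>u\<in>Pow I. \<integral>x. (\<Prod>j\<in>u. kap (t j) (x j)) * Mean u x \<partial>lborel_on u)"
    by (intro sum.cong refl) (use main in auto)
  finally show ?thesis .
qed

end

section \<open>Mixed partial derivatives\<close>

text \<open>Schwarz's theorem. The second difference over a square of side \<open>h\<close>, divided
  by \<open>h\<^sup>2\<close>, is a value of either mixed derivative inside the square, by two mean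
  value theorems in either order; a small square and continuity contradict a gap at the
  corner.\<close>

lemma mixed_partials_commute:
  fixes f fx fy fxy fyx :: "real \<Rightarrow> real \<Rightarrow> real"
  assumes fx: "\<And>x y. ((\<lambda>x. f x y) has_real_derivative fx x y) (at x)"
    and fy: "\<And>x y. ((\<lambda>y. f x y) has_real_derivative fy x y) (at y)"
    and fxy: "\<And>x y. ((\<lambda>y. fx x y) has_real_derivative fxy x y) (at y)"
    and fyx: "\<And>x y. ((\<lambda>x. fy x y) has_real_derivative fyx x y) (at x)"
    and c: "continuous_on UNIV (\<lambda>p. fxy (fst p) (snd p))" "continuous_on UNIV (\<lambda>p. fyx (fst p) (snd p))"
  shows "fxy a b = fyx a b"
proof (rule ccontr)
  assume "fxy a b \<noteq> fyx a b"
  define e where "e = \<bar>fxy a b - fyx a b\<bar> / 2"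
  have e: "e > 0" using \<open>fxy a b \<noteq> fyx a b\<close> by (simp add: e_def)
  obtain d1 where d1: "d1 > 0" "\<And>x y. dist (x, y) (a, b) < d1 \<Longrightarrow> \<bar>fxy x y - fxy a b\<bar> < e"
    using c(1)[unfolded continuous_on_iff, rule_format, of "(a, b)" e] e by (auto simp: dist_real_def)
  obtain d2 where d2: "d2 > 0" "\<And>x y. dist (x, y) (a, b) < d2 \<Longrightarrow> \<bar>fyx x y - fyx a b\<bar> < e"
    using c(2)[unfolded continuous_on_iff, rule_format, of "(a, b)" e] e by (auto simp: dist_real_def)
  define h where "h = min d1 d2 / 2"
  have h: "h > 0" using d1 d2 by (simp add: h_def)
  have dd: "dist (x, y) (a, b) < min d1 d2" if "a < x" "x < a + h" "b < y" "y < b + h" for x y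
  proof -
    have "dist (x, y) (a, b) \<le> \<bar>x - a\<bar> + \<bar>y - b\<bar>"
      unfolding dist_Pair_Pair dist_real_def using sqrt_sum_squares_le_sum_abs[of "x - a" "y - b"] by simp
    also have "\<dots> < h + h" using that by (intro add_strict_mono) auto
    finally show ?thesis by (simp add: h_def)
  qed
  obtain \<xi> where \<xi>: "a < \<xi>" "\<xi> < a + h" and
    1: "(f (a + h) (b + h) - f (a + h) b) - (f a (b + h) - f a b) = (a + h - a) * (fx \<xi> (b + h) - fx \<xi> b)"
    using MVT2[of a "a + h" "\<lambda>x. f x (b + h) - f x b" "\<lambda>x. fx x (b + h) - fx x b", OF _ DERIV_diff[OF fx fx]] h
    by auto
  obtain \<eta> where \<eta>: "b < \<eta>" "\<eta> < b + h" and 2: "fx \<xi> (b + h) - fx \<xi> b = (b + h - b) * fxy \<xi> \<eta>"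
    using MVT2[of b "b + h" "fx \<xi>" "fxy \<xi>"] h fxy by auto
  obtain \<eta>' where \<eta>': "b < \<eta>'" "\<eta>' < b + h" and
    3: "(f (a + h) (b + h) - f a (b + h)) - (f (a + h) b - f a b) = (b + h - b) * (fy (a + h) \<eta>' - fy a \<eta>')"
    using MVT2[of b "b + h" "\<lambda>y. f (a + h) y - f a y" "\<lambda>y. fy (a + h) y - fy a y", OF _ DERIV_diff[OF fy fy]] h
    by auto
  obtain \<xi>' where \<xi>': "a < \<xi>'" "\<xi>' < a + h" and 4: "fy (a + h) \<eta>' - fy a \<eta>' = (a + h - a) * fyx \<xi>' \<eta>'"
    using MVT2[of a "a + h" "\<lambda>x. fy x \<eta>'" "\<lambda>x. fyx x \<eta>'"] h fyx by auto
  have "h * (h * fxy \<xi> \<eta>) = h * (h * fyx \<xi>' \<eta>')" using 1 2 3 4 by (simp add: algebra_simps)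
  then have "fxy \<xi> \<eta> = fyx \<xi>' \<eta>'" using h by simp
  moreover have "\<bar>fxy \<xi> \<eta> - fxy a b\<bar> < e" using d1 dd[OF \<xi> \<eta>] by auto
  moreover have "\<bar>fyx \<xi>' \<eta>' - fyx a b\<bar> < e" using d2 dd[OF \<xi>' \<eta>'] by auto
  ultimately show False unfolding e_def by (auto simp: abs_if split: if_splits)
qed

section \<open>Reordering partial derivatives on \<open>Rn d\<close>\<close>

lemma Rn_upd: "x \<in> Rn d \<Longrightarrow> j < d \<Longrightarrow> x(j := t) \<in> Rn d"
  by (auto simp: Rn_def)

lemma trunc_in_Rn: "trunc d x \<in> Rn d" by (simp add: trunc_def Rn_def)

lemma trunc_upd: "i < d \<Longrightarrow> trunc d (x(i := t)) = (trunc d x)(i := t)"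
  by (auto simp: trunc_def fun_eq_iff)

lemma partial_deriv_cong:
  assumes "\<And>x. x \<in> Rn d \<Longrightarrow> P x = Q x" "j < d" "x \<in> Rn d"
  shows "partial_deriv j P x = partial_deriv j Q x"
  using assms Rn_upd[OF assms(3,2)] by (simp add: partial_deriv_def)

lemma partial_derivs_Nil [simp]: "partial_derivs [] G = G"
  and partial_derivs_Cons: "partial_derivs (j # js) G = partial_deriv j (partial_derivs js G)"
  by (simp_all add: partial_derivs_def)

lemma mixed_differentiableD:
  assumes "mixed_differentiable d G" "distinct js" "set js \<subseteq> {..<d}"
  shows "continuous_on (Rn d) (partial_derivs js G)"
    and "j < d \<Longrightarrow> j \<notin> set js \<Longrightarrow> x \<in> Rn d \<Longrightarrow>
      ((\<lambda>t. partial_derivs js G (x(j := t))) has_real_derivative partial_derivs (j # js) G (x(j := t0))) (at t0)"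
proof -
  show "continuous_on (Rn d) (partial_derivs js G)" using assms by (auto simp: mixed_differentiable_def)
  assume j: "j < d" "j \<notin> set js" "x \<in> Rn d"
  have "\<forall>j\<in>{..<d} - set js. \<forall>x\<in>Rn d. (\<lambda>t. partial_derivs js G (x(j := t))) differentiable (at (x j))"
    using assms by (auto simp: mixed_differentiable_def)
  then have "(\<lambda>t. partial_derivs js G ((x(j := t0))(j := t))) differentiable (at ((x(j := t0)) j))"
    using j Rn_upd[OF j(3,1)] by blast
  then show "((\<lambda>t. partial_derivs js G (x(j := t))) has_real_derivative partial_derivs (j # js) G (x(j := t0))) (at t0)"
    by (simp add: partial_derivs_Cons partial_deriv_def DERIV_deriv_iff_real_differentiable)
qed

lemma continuous_on_Rn_comp:
  assumes "continuous_on (Rn d) P" "\<And>j. continuous_on S (\<lambda>p. f p j)" "\<And>p. p \<in> S \<Longrightarrow> f p \<in> Rn d"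
  shows "continuous_on S (\<lambda>p. P (f p))"
  by (rule continuous_on_compose2[OF assms(1)]) (auto intro!: continuous_on_coordinatewise_then_product assms)

lemma partial_derivs_swap:
  assumes md: "mixed_differentiable d G" and dist: "distinct (i # j # ks)" and sub: "set (i # j # ks) \<subseteq> {..<d}"
    and x: "x \<in> Rn d"
  shows "partial_derivs (i # j # ks) G x = partial_derivs (j # i # ks) G x"
proof -
  have ij: "i \<noteq> j" "i < d" "j < d" using dist sub by auto
  let ?H = "partial_derivs ks G"
  let ?x = "\<lambda>s t. x(i := s, j := t)"
  have sw: "?x s t = x(j := t, i := s)" for s t using ij by (auto simp: fun_upd_twist)
  have R: "?x s t \<in> Rn d" "x(i := s) \<in> Rn d" "x(j := t) \<in> Rn d" for s t using ij x by (auto intro: Rn_upd)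
  have c: "continuous_on UNIV (\<lambda>p. partial_derivs js G (?x (fst p) (snd p)))"
    if "distinct js" "set js \<subseteq> {..<d}" for js
  proof (rule continuous_on_Rn_comp[OF mixed_differentiableD(1)[OF md that]])
    show "continuous_on UNIV (\<lambda>p. ?x (fst p) (snd p) k)" for k
      by (cases "k = i"; cases "k = j") (auto intro!: continuous_intros)
  qed (rule R)
  have "partial_derivs (j # i # ks) G (?x (x i) (x j)) = partial_derivs (i # j # ks) G (?x (x i) (x j))"
  proof (rule mixed_partials_commute[of "\<lambda>s t. ?H (?x s t)" "\<lambda>s t. partial_derivs (i # ks) G (?x s t)" "\<lambda>s t. partial_derivs (j # ks) G (?x s t)"
     "\<lambda>s t. partial_derivs (j # i # ks) G (?x s t)" "\<lambda>s t. partial_derivs (i # j # ks) G (?x s t)"])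
    show "((\<lambda>s. ?H (?x s t)) has_real_derivative partial_derivs (i # ks) G (?x s t)) (at s)" for s t
      unfolding sw using dist sub R by (intro mixed_differentiableD(2)[OF md]) auto
    show "((\<lambda>t. ?H (?x s t)) has_real_derivative partial_derivs (j # ks) G (?x s t)) (at t)" for s t
      using dist sub R by (intro mixed_differentiableD(2)[OF md]) auto
    show "((\<lambda>t. partial_derivs (i # ks) G (?x s t)) has_real_derivative partial_derivs (j # i # ks) G (?x s t)) (at t)" for s t
      using dist sub R by (intro mixed_differentiableD(2)[OF md]) auto
    show "((\<lambda>s. partial_derivs (j # ks) G (?x s t)) has_real_derivative partial_derivs (i # j # ks) G (?x s t)) (at s)" for s t
      unfolding sw using dist sub R by (intro mixed_differentiableD(2)[OF md]) auto
  qed (use dist sub in \<open>auto intro!: c\<close>)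
  then show ?thesis by simp
qed

text \<open>\<open>multi_deriv\<close> lists the variables increasingly, whereas the fundamental
  theorem of calculus makes the newest variable the outermost derivative. Adjacent swaps bring it to
  the head of the list.\<close>

lemma partial_derivs_move_front:
  assumes md: "mixed_differentiable d G" and "distinct js" "set js \<subseteq> {..<d}" "i \<in> set js" "x \<in> Rn d"
  shows "partial_derivs js G x = partial_derivs (i # remove1 i js) G x"
  using assms(2-)
proof (induction js arbitrary: x)
  case (Cons k ks)
  show ?case
  proof (cases "k = i")
    case False
    have "partial_derivs (k # ks) G x = partial_deriv k (partial_derivs (i # remove1 i ks) G) x"
      unfolding partial_derivs_Cons[of k]
      by (rule partial_deriv_cong) (use Cons False in \<open>auto\<close>)
    also have "\<dots> = partial_derivs (k # i # remove1 i ks) G x" by (simp add: partial_derivs_Cons)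
    also have "\<dots> = partial_derivs (i # k # remove1 i ks) G x"
      using Cons.prems False by (intro partial_derivs_swap[OF md]) (auto dest: set_remove1_subset[THEN subsetD])
    finally show ?thesis using False by simp
  qed simp
qed simp

lemma multi_deriv_indicator:
  assumes "finite u" shows "multi_deriv (indicator u) G = partial_derivs (sorted_list_of_set u) G"
proof -
  have "{j. (indicator u j :: nat) \<noteq> 0} = u" by (auto simp: indicator_def)
  moreover have "concat (map (\<lambda>j. replicate (indicator u j) j) xs) = xs" if "set xs \<subseteq> u" for xs :: "nat list"
    using that by (induction xs) auto
  ultimately show ?thesis using assms by (simp add: multi_deriv_def)
qed

lemma multi_deriv_insert:
  assumes md: "mixed_differentiable d G" and "u \<subseteq> {..<d}" "i < d" "i \<notin> u" "x \<in> Rn d"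
  shows "multi_deriv (indicator (insert i u)) G x = partial_derivs (i # sorted_list_of_set u) G x"
proof -
  have f: "finite u" using assms(2) finite_subset by auto
  have "partial_derivs (sorted_list_of_set (insert i u)) G x = partial_derivs (i # remove1 i (sorted_list_of_set (insert i u))) G x"
  proof (rule partial_derivs_move_front[OF md distinct_sorted_list_of_set _ _ assms(5)])
    have "set (sorted_list_of_set (insert i u)) = insert i u" using f by (intro set_sorted_list_of_set) simp
    then show "set (sorted_list_of_set (insert i u)) \<subseteq> {..<d}" "i \<in> set (sorted_list_of_set (insert i u))"
      using assms by auto
  qed
  also have "remove1 i (sorted_list_of_set (insert i u)) = sorted_list_of_set u"
    using f assms(4) by (simp add: remove1_insort_key)
  finally show ?thesis using f by (simp add: multi_deriv_indicator)
qed

lemma FTC_sg: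
  assumes D: "\<And>t. (h has_real_derivative h' t) (at t)" and c: "continuous_on UNIV h'"
  shows "h b - h a = (\<integral>s. sg a b s * h' s \<partial>lborel)"
proof -
  have 1: "h b - h a = (\<integral>s. sg a b s * h' s \<partial>lborel)" if "a \<le> b" for a b
  proof -
    have "(\<integral>s. h' s * indicator {a..b} s \<partial>lborel) = h b - h a"
      using that D c by (intro integral_FTC_Icc_real) (auto simp: continuous_on_eq_continuous_at)
    also have "(\<integral>s. h' s * indicator {a..b} s \<partial>lborel) = (\<integral>s. sg a b s * h' s \<partial>lborel)"
    proof (rule integral_cong_AE)
      show "AE s in lborel. h' s * indicator {a..b} s = sg a b s * h' s"
        using AE_lborel_singleton[of b] by eventually_elim (use that in \<open>auto simp: sg_def indicator_def\<close>)
    qed (use borel_measurable_continuous_onI[OF c] in measurable)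
    finally show ?thesis by simp
  qed
  show ?thesis
  proof (cases "a \<le> b")
    case False
    have "sg a b s = - sg b a s" for s by (simp add: sg_def)
    then show ?thesis using 1[of b a] False by simp
  qed (rule 1)
qed

text \<open>The derivatives of \<open>G\<close> are controlled only on \<open>Rn d\<close>.
  Composing with \<open>trunc\<close> extends them to continuous functions on all sequences, as the
  locale demands, and makes them depend on the first \<open>d\<close> coordinates only.\<close>

lemma mixed_family_multi_deriv:
  assumes md: "mixed_differentiable d G"
  shows "mixed_family {..<d} (\<lambda>u x. multi_deriv (indicator u) G (trunc d x))"
proof
  fix u assume u: "u \<subseteq> {..<d}"
  then have f: "finite u" using finite_subset by auto
  show "continuous_on UNIV (\<lambda>x. multi_deriv (indicator u) G (trunc d x))"
    unfolding multi_deriv_indicator[OF f]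
  proof (rule continuous_on_Rn_comp[OF mixed_differentiableD(1)[OF md]])
    show "continuous_on UNIV (\<lambda>p. trunc d p j)" for j
      by (cases "j < d") (auto simp: trunc_def intro: continuous_on_product_coordinates)
  qed (use f u in \<open>auto simp: trunc_in_Rn\<close>)
  show "multi_deriv (indicator u) G (trunc d x) = multi_deriv (indicator u) G (trunc d y)"
    if "\<And>j. j \<in> {..<d} \<Longrightarrow> x j = y j" for x y
    using that by (intro arg_cong[where f="multi_deriv (indicator u) G"]) (auto simp: trunc_def)
  fix i x a b assume i: "i \<in> {..<d}" "i \<notin> u"
  let ?x = "trunc d x"
  let ?P = "partial_derivs (sorted_list_of_set u) G" and ?P' = "partial_derivs (i # sorted_list_of_set u) G"
  have "?P (?x(i := b)) - ?P (?x(i := a)) = (\<integral>s. sg a b s * ?P' (?x(i := s)) \<partial>lborel)"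
  proof (rule FTC_sg)
    show "((\<lambda>t. ?P (?x(i := t))) has_real_derivative ?P' (?x(i := t))) (at t)" for t
      using i u f by (intro mixed_differentiableD(2)[OF md]) (auto simp: trunc_in_Rn)
    show "continuous_on UNIV (\<lambda>t. ?P' (?x(i := t)))"
    proof (rule continuous_on_Rn_comp[OF mixed_differentiableD(1)[OF md]])
      show "continuous_on UNIV (\<lambda>t. (?x(i := t)) j)" for j by (cases "j = i") auto
    qed (use i u f in \<open>auto intro!: Rn_upd trunc_in_Rn\<close>)
  qed
  then show "multi_deriv (indicator u) G (trunc d (x(i := b))) - multi_deriv (indicator u) G (trunc d (x(i := a)))
    = (\<integral>s. sg a b s * multi_deriv (indicator (insert i u)) G (trunc d (x(i := s))) \<partial>lborel)"
    using i u by (simp add: trunc_upd multi_deriv_insert[OF md] multi_deriv_indicator[OF f] Rn_upd trunc_in_Rn)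
qed simp

section \<open>The worst-case error is bounded by the kernel sum\<close>

lemma ennsqrt_ennreal: "0 \<le> x \<Longrightarrow> ennsqrt (ennreal x) = ennreal (sqrt x)"
  by (simp add: ennsqrt_def)

lemma ennsqrt_less_top: "ennsqrt x < \<infinity> \<longleftrightarrow> x < \<infinity>"
  by (auto simp: ennsqrt_def top.not_eq_extremum)

lemma psi_exp: "(psi t x)\<^sup>2 * exp (2 * t * \<bar>x\<bar>) = 1"
  by (simp add: psi_def power2_eq_square exp_add[symmetric])

lemma psi_pos: "0 < psi t x" by (simp add: psi_def)

lemma measurable_psi [measurable]: "psi t \<in> borel_measurable borel"
  unfolding psi_def by measurable

text \<open>The discriminant form of the Cauchy-Schwarz inequality. It lets one quadratic in
  \<open>r\<close> handle a sum of integrals over spaces of different dimensions.\<close>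

lemma quadratic_discriminant:
  fixes A B C :: real
  assumes "\<And>r. 0 \<le> A + 2 * r * B + r\<^sup>2 * C" "0 \<le> A" "0 \<le> C"
  shows "B\<^sup>2 \<le> A * C"
proof (cases "C = 0")
  case True
  have "B = 0"
  proof (rule ccontr)
    assume "B \<noteq> 0"
    \<comment> \<open>For this \<open>r\<close> the affine expression equals -1.\<close>
    with assms(1)[of "- (A + 1) / (2 * B)"] True show False by (simp add: field_simps)
  qed
  then show ?thesis using True by simp
next
  case False
  then have "C > 0" using assms by simp
  with assms(1)[of "- B / C"] show ?thesis by (simp add: power2_eq_square field_simps)
qed

text \<open>Kept generic in \<open>a\<close>, \<open>b\<close> and \<open>e\<close>, so that exact
  kernels, cut-off kernels and products of one with the other are the same computation.\<close>

lemma tensor_inner_product: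
  fixes a b :: "nat \<Rightarrow> nat \<Rightarrow> real \<Rightarrow> real" and e :: "nat \<Rightarrow> real \<Rightarrow> real" and n :: nat
  assumes u: "finite u" and i: "\<And>k l j. j \<in> u \<Longrightarrow> integrable lborel (\<lambda>x. a k j x * b l j x * e j x)"
  defines "h \<equiv> \<lambda>x. (1 / real n * (\<Sum>k=1..n. \<Prod>j\<in>u. a k j (x j))) * (1 / real n * (\<Sum>k=1..n. \<Prod>j\<in>u. b k j (x j))) * (\<Prod>j\<in>u. e j (x j))"
  shows "integrable (lborel_on u) h"
    and "(\<integral>x. h x \<partial>lborel_on u) = 1 / (real n)\<^sup>2 * (\<Sum>k=1..n. \<Sum>l=1..n. \<Prod>j\<in>u. \<integral>x. a k j x * b l j x * e j x \<partial>lborel)"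
proof -
  have h: "h = (\<lambda>x. 1 / (real n)\<^sup>2 * (\<Sum>k=1..n. \<Sum>l=1..n. \<Prod>j\<in>u. a k j (x j) * b l j (x j) * e j (x j)))"
  proof
    fix x
    let ?A = "\<Sum>k=1..n. \<Prod>j\<in>u. a k j (x j)" and ?B = "\<Sum>l=1..n. \<Prod>j\<in>u. b l j (x j)" and ?E = "\<Prod>j\<in>u. e j (x j)"
    have "?A * ?B * ?E = (\<Sum>k=1..n. \<Sum>l=1..n. \<Prod>j\<in>u. a k j (x j) * b l j (x j) * e j (x j))"
      by (simp only: sum_distrib_left sum_distrib_right prod.distrib mult.assoc) (rule sum.swap)
    moreover have "h x = 1 / (real n)\<^sup>2 * (?A * ?B * ?E)" by (simp add: h_def power2_eq_square)
    ultimately show "h x = 1 / (real n)\<^sup>2 * (\<Sum>k=1..n. \<Sum>l=1..n. \<Prod>j\<in>u. a k j (x j) * b l j (x j) * e j (x j))" by simp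
  qed
  have I: "integrable (lborel_on u) (\<lambda>x. \<Prod>j\<in>u. a k j (x j) * b l j (x j) * e j (x j))" for k l
    by (rule PL.product_integrable_prod[OF u]) (rule i)
  show "integrable (lborel_on u) h" unfolding h
    by (intro integrable_mult_right Bochner_Integration.integrable_sum I)
  have "(\<integral>x. h x \<partial>lborel_on u) = 1 / (real n)\<^sup>2 * (\<Sum>k=1..n. \<Sum>l=1..n. \<integral>x. (\<Prod>j\<in>u. a k j (x j) * b l j (x j) * e j (x j)) \<partial>lborel_on u)"
    unfolding h by (subst integral_mult_right_zero) (simp only: Bochner_Integration.integral_sum Bochner_Integration.integrable_sum I)
  then show "(\<integral>x. h x \<partial>lborel_on u) = 1 / (real n)\<^sup>2 * (\<Sum>k=1..n. \<Sum>l=1..n. \<Prod>j\<in>u. \<integral>x. a k j x * b l j x * e j x \<partial>lborel)"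
    by (simp only: PL.product_integral_prod[OF u i])
qed

text \<open>The reproducing kernel of the mean-free part of the one-dimensional space with weight 1:
  \<open>kap t\<close> represents evaluation at \<open>t\<close> through the derivative, and the
  exponential is the reciprocal of \<open>psi\<^sup>2\<close>.\<close>

definition ker :: "real \<Rightarrow> real \<Rightarrow> real \<Rightarrow> real" where
  "ker \<tau> s t = (\<integral>x. kap s x * kap t x * exp (2 * \<tau> * \<bar>x\<bar>) \<partial>lborel)"

text \<open>The squared worst-case error of the equal-weight cubature rule with nodes \<open>T 1, \<dots>, T n\<close>.\<close>

definition E2 :: "nat \<Rightarrow> nat \<Rightarrow> (nat set \<Rightarrow> real) \<Rightarrow> (nat \<Rightarrow> real) \<Rightarrow> (nat \<Rightarrow> nat \<Rightarrow> real) \<Rightarrow> real" where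
  "E2 d n \<gamma> \<tau> T = (\<Sum>u\<in>Pow {..<d} - {{}}. \<gamma> u * (1 / (real n)\<^sup>2 *
     (\<Sum>k=1..n. \<Sum>l=1..n. \<Prod>j\<in>u. ker (\<tau> j) (T k j) (T l j))))"

text \<open>Represents the cubature rule on the averaged derivatives: by \<open>cub_err_eq\<close>,
  pairing with it gives, up to sign, the part of the error carried by \<open>u\<close>.\<close>

definition qf :: "nat \<Rightarrow> (nat \<Rightarrow> nat \<Rightarrow> real) \<Rightarrow> nat set \<Rightarrow> (nat \<Rightarrow> real) \<Rightarrow> real" where
  "qf n T u x = 1 / real n * (\<Sum>k=1..n. \<Prod>j\<in>u. kap (T k j) (x j))"

text \<open>The reciprocal of the weight \<open>pw\<close> of the norm, hence the dual weight in the
  Cauchy-Schwarz inequality.\<close>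

definition ew :: "(nat \<Rightarrow> real) \<Rightarrow> nat set \<Rightarrow> (nat \<Rightarrow> real) \<Rightarrow> real" where
  "ew \<tau> u x = (\<Prod>j\<in>u. exp (2 * \<tau> j * \<bar>x j\<bar>))"

definition pw :: "(nat \<Rightarrow> real) \<Rightarrow> nat set \<Rightarrow> (nat \<Rightarrow> real) \<Rightarrow> real" where
  "pw \<tau> u x = (\<Prod>j\<in>u. (psi (\<tau> j) (x j))\<^sup>2)"

lemma pw_ew: "pw \<tau> u x * ew \<tau> u x = 1"
  by (simp add: pw_def ew_def prod.distrib[symmetric] psi_exp)

lemma pw_pos: "0 < pw \<tau> u x" and ew_pos: "0 < ew \<tau> u x"
  by (auto simp: pw_def ew_def psi_def intro!: prod_pos)

lemma measurable_pw [measurable]: "pw \<tau> u \<in> borel_measurable (lborel_on u)"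
  unfolding pw_def by measurable

lemma measurable_ew [measurable]: "ew \<tau> u \<in> borel_measurable (lborel_on u)"
  unfolding ew_def by measurable

lemma qf_integral:
  assumes "finite u"
  shows "integrable (lborel_on u) (\<lambda>x. (qf n T u x)\<^sup>2 * ew \<tau> u x)"
    and "(\<integral>x. (qf n T u x)\<^sup>2 * ew \<tau> u x \<partial>lborel_on u)
       = 1 / (real n)\<^sup>2 * (\<Sum>k=1..n. \<Sum>l=1..n. \<Prod>j\<in>u. ker (\<tau> j) (T k j) (T l j))"
proof -
  note t = tensor_inner_product[where a="\<lambda>k j. kap (T k j)" and b="\<lambda>k j. kap (T k j)"
      and e="\<lambda>j x. exp (2 * \<tau> j * \<bar>x\<bar>)" and n=n, OF assms integrable_kap_kap]
  show "integrable (lborel_on u) (\<lambda>x. (qf n T u x)\<^sup>2 * ew \<tau> u x)"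
    using t(1) by (simp only: qf_def ew_def power2_eq_square)
  show "(\<integral>x. (qf n T u x)\<^sup>2 * ew \<tau> u x \<partial>lborel_on u)
       = 1 / (real n)\<^sup>2 * (\<Sum>k=1..n. \<Sum>l=1..n. \<Prod>j\<in>u. ker (\<tau> j) (T k j) (T l j))"
    using t(2) by (simp only: qf_def ew_def ker_def power2_eq_square)
qed

lemma E2_eq: "E2 d n \<gamma> \<tau> T = (\<Sum>u\<in>Pow {..<d} - {{}}. \<gamma> u * (\<integral>x. (qf n T u x)\<^sup>2 * ew \<tau> u x \<partial>lborel_on u))"
  unfolding E2_def by (intro sum.cong refl) (auto simp: qf_integral(2) finite_subset)

lemma E2_nonneg: assumes "\<And>u. \<gamma> u > 0" shows "0 \<le> E2 d n \<gamma> \<tau> T"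
  unfolding E2_eq using assms ew_pos
  by (intro sum_nonneg mult_nonneg_nonneg integral_nonneg) (auto simp: less_imp_le)

section \<open>The weighted norm in terms of averaged derivatives\<close>

definition WM :: "nat \<Rightarrow> nat set \<Rightarrow> ((nat \<Rightarrow> real) \<Rightarrow> real) \<Rightarrow> (nat \<Rightarrow> real) \<Rightarrow> real" where
  "WM d u G x = (\<integral>y. W_integrand d u G x y \<partial>lborel_on ({..<d} - u))"

abbreviation md_fam :: "nat \<Rightarrow> ((nat \<Rightarrow> real) \<Rightarrow> real) \<Rightarrow> nat set \<Rightarrow> (nat \<Rightarrow> real) \<Rightarrow> real" where
  "md_fam d G \<equiv> \<lambda>u x. multi_deriv (indicator u) G (trunc d x)"

lemma md_fam_measurable_merge:
  assumes md: "mixed_differentiable d G" and u: "u \<subseteq> {..<d}"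
  shows "(\<lambda>y. md_fam d G u (merge u ({..<d} - u) (x, y))) \<in> borel_measurable (lborel_on ({..<d} - u))"
proof -
  interpret mixed_family "{..<d}" "md_fam d G" by (rule mixed_family_multi_deriv[OF md])
  show ?thesis
  proof (rule measurable_comp_coords[OF g_borel[OF u]])
    show "(\<lambda>y. merge u ({..<d} - u) (x, y) j) \<in> borel_measurable (lborel_on ({..<d} - u))" for j
      by (cases "j \<in> u"; cases "j \<in> {..<d} - u") (auto simp: merge_def)
  qed
qed

lemma
  assumes md: "mixed_differentiable d G" and u: "u \<subseteq> {..<d}"
  shows W_integrand_integrable_iff: "integrable (lborel_on ({..<d} - u)) (W_integrand d u G x)
      \<longleftrightarrow> integrable (Pi\<^sub>M ({..<d} - u) (\<lambda>_. stdN)) (\<lambda>y. md_fam d G u (merge u ({..<d} - u) (x, y)))"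
    and WM_eq: "WM d u G x = mixed_family.Mean {..<d} (md_fam d G) u x"
proof -
  interpret mixed_family "{..<d}" "md_fam d G" by (rule mixed_family_multi_deriv[OF md])
  have f: "finite ({..<d} - u)" by simp
  note m = md_fam_measurable_merge[OF md u, of x]
  have m2: "(\<lambda>y. \<Prod>i\<in>{..<d} - u. std_normal_density (y i)) \<in> borel_measurable (lborel_on ({..<d} - u))"
    by measurable
  have p: "AE y in lborel_on ({..<d} - u). 0 \<le> (\<Prod>i\<in>{..<d} - u. std_normal_density (y i))"
    by (intro AE_I2 prod_nonneg) simp
  show "integrable (lborel_on ({..<d} - u)) (W_integrand d u G x)
      \<longleftrightarrow> integrable (Pi\<^sub>M ({..<d} - u) (\<lambda>_. stdN)) (\<lambda>y. md_fam d G u (merge u ({..<d} - u) (x, y)))"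
    unfolding PiM_stdN[OF f] integrable_density[OF m m2 p] by (simp add: W_integrand_def[abs_def] mult.commute)
  show "WM d u G x = Mean u x"
    unfolding Mean_def PiM_stdN[OF f] integral_density[OF m m2 p] WM_def by (simp add: W_integrand_def[abs_def] mult.commute)
qed

lemma WM_measurable:
  assumes md: "mixed_differentiable d G" and u: "u \<subseteq> {..<d}"
  shows "WM d u G \<in> borel_measurable (lborel_on u)"
proof -
  interpret mixed_family "{..<d}" "md_fam d G" by (rule mixed_family_multi_deriv[OF md])
  have "WM d u G = Mean u" by (rule ext) (rule WM_eq[OF md u])
  then show ?thesis using Mean_measurable[OF u, of "\<lambda>_. lborel"] by simp
qed

text \<open>A real-valued squared norm. As Bochner integrals default to 0, it agrees with the square
  of \<open>W_norm\<close> under the integrability assumed in \<open>W_norm_eq_N2\<close>.\<close>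

definition N2 :: "nat \<Rightarrow> (nat set \<Rightarrow> real) \<Rightarrow> (nat \<Rightarrow> real) \<Rightarrow> ((nat \<Rightarrow> real) \<Rightarrow> real) \<Rightarrow> real" where
  "N2 d \<gamma> \<tau> G = (\<Sum>u\<in>Pow {..<d}. 1 / \<gamma> u * (\<integral>x. (WM d u G x)\<^sup>2 * pw \<tau> u x \<partial>lborel_on u))"

lemma W_norm_eq_WM: "W_norm d \<gamma> \<tau> G = ennsqrt (\<Sum>u\<in>Pow {..<d}. ennreal (1 / \<gamma> u) *
     (\<integral>\<^sup>+x. ennreal ((WM d u G x)\<^sup>2 * pw \<tau> u x) \<partial>lborel_on u))"
  by (simp add: W_norm_def WM_def pw_def)

lemma N2_nonneg: assumes "\<And>u. \<gamma> u > 0" shows "0 \<le> N2 d \<gamma> \<tau> G"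
  unfolding N2_def using assms pw_pos
  by (intro sum_nonneg mult_nonneg_nonneg integral_nonneg) (auto simp: less_imp_le)

lemma W_norm_eq_N2:
  assumes \<gamma>: "\<And>u. \<gamma> u > 0"
    and i: "\<And>u. u \<subseteq> {..<d} \<Longrightarrow> integrable (lborel_on u) (\<lambda>x. (WM d u G x)\<^sup>2 * pw \<tau> u x)"
  shows "W_norm d \<gamma> \<tau> G = ennreal (sqrt (N2 d \<gamma> \<tau> G))"
proof -
  have "(\<Sum>u\<in>Pow {..<d}. ennreal (1 / \<gamma> u) * (\<integral>\<^sup>+x. ennreal ((WM d u G x)\<^sup>2 * pw \<tau> u x) \<partial>lborel_on u))
    = (\<Sum>u\<in>Pow {..<d}. ennreal (1 / \<gamma> u * (\<integral>x. (WM d u G x)\<^sup>2 * pw \<tau> u x \<partial>lborel_on u)))"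
  proof (intro sum.cong refl)
    fix u assume "u \<in> Pow {..<d}"
    then have u: "u \<subseteq> {..<d}" by simp
    show "ennreal (1 / \<gamma> u) * (\<integral>\<^sup>+x. ennreal ((WM d u G x)\<^sup>2 * pw \<tau> u x) \<partial>lborel_on u)
      = ennreal (1 / \<gamma> u * (\<integral>x. (WM d u G x)\<^sup>2 * pw \<tau> u x \<partial>lborel_on u))"
      using \<gamma>[of u] pw_pos by (subst nn_integral_eq_integral[OF i[OF u]])
        (auto simp: less_imp_le ennreal_mult'[symmetric] integral_nonneg)
  qed
  also have "\<dots> = ennreal (N2 d \<gamma> \<tau> G)"
    unfolding N2_def using \<gamma> pw_pos by (intro sum_ennreal mult_nonneg_nonneg integral_nonneg) (auto simp: less_imp_le)
  finally show ?thesis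
    unfolding W_norm_eq_WM using N2_nonneg[OF \<gamma>] by (simp add: ennsqrt_ennreal)
qed

lemma W_spaceD:
  assumes \<gamma>: "\<And>u. \<gamma> u > 0" and G: "G \<in> W_space d \<gamma> \<tau>"
  shows "mixed_differentiable d G"
    and "u \<subseteq> {..<d} \<Longrightarrow> AE x in lborel_on u. integrable (lborel_on ({..<d} - u)) (W_integrand d u G x)"
    and "u \<subseteq> {..<d} \<Longrightarrow> integrable (lborel_on u) (\<lambda>x. (WM d u G x)\<^sup>2 * pw \<tau> u x)"
proof -
  show md: "mixed_differentiable d G"
    and "u \<subseteq> {..<d} \<Longrightarrow> AE x in lborel_on u. integrable (lborel_on ({..<d} - u)) (W_integrand d u G x)"
    using G by (auto simp: W_space_def)
  assume u: "u \<subseteq> {..<d}"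
  have "W_norm d \<gamma> \<tau> G < \<infinity>" using G by (auto simp: W_space_def)
  then have "(\<Sum>u\<in>Pow {..<d}. ennreal (1 / \<gamma> u) * (\<integral>\<^sup>+x. ennreal ((WM d u G x)\<^sup>2 * pw \<tau> u x) \<partial>lborel_on u)) < \<infinity>"
    unfolding W_norm_eq_WM ennsqrt_less_top .
  then have "ennreal (1 / \<gamma> u) * (\<integral>\<^sup>+x. ennreal ((WM d u G x)\<^sup>2 * pw \<tau> u x) \<partial>lborel_on u) < \<infinity>"
    using u by simp
  then have "(\<integral>\<^sup>+x. ennreal ((WM d u G x)\<^sup>2 * pw \<tau> u x) \<partial>lborel_on u) < \<infinity>"
    using \<gamma>[of u] by (auto simp: ennreal_mult_less_top)
  then show "integrable (lborel_on u) (\<lambda>x. (WM d u G x)\<^sup>2 * pw \<tau> u x)"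
    using WM_measurable[OF md u] pw_pos by (intro integrableI_bounded) (auto simp: less_imp_le)
qed

text \<open>Since \<open>pw\<close> and \<open>ew\<close> are reciprocal, the inequality between
  arithmetic and geometric mean dominates the product by the sum of the two weighted
  squares.\<close>

lemma integrable_mult_weighted:
  fixes a b :: "(nat \<Rightarrow> real) \<Rightarrow> real"
  assumes a: "integrable (lborel_on u) (\<lambda>x. (a x)\<^sup>2 * pw \<tau> u x)" and b: "integrable (lborel_on u) (\<lambda>x. (b x)\<^sup>2 * ew \<tau> u x)"
    and [measurable]: "a \<in> borel_measurable (lborel_on u)" "b \<in> borel_measurable (lborel_on u)"
  shows "integrable (lborel_on u) (\<lambda>x. b x * a x)"
proof (rule Bochner_Integration.integrable_bound[OF Bochner_Integration.integrable_add[OF a b]])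
  show "AE x in lborel_on u. norm (b x * a x) \<le> norm ((a x)\<^sup>2 * pw \<tau> u x + (b x)\<^sup>2 * ew \<tau> u x)"
  proof (rule AE_I2)
    fix x
    let ?p = "pw \<tau> u x" and ?e = "ew \<tau> u x"
    have "0 \<le> (\<bar>a x\<bar> * sqrt ?p - \<bar>b x\<bar> * sqrt ?e)\<^sup>2" by simp
    also have "\<dots> = (a x)\<^sup>2 * ?p + (b x)\<^sup>2 * ?e - 2 * (\<bar>b x\<bar> * \<bar>a x\<bar>) * sqrt (?p * ?e)"
      using pw_pos[of \<tau> u x] ew_pos[of \<tau> u x]
      by (simp add: power2_diff power_mult_distrib real_sqrt_mult less_imp_le)
    finally have "2 * (\<bar>b x\<bar> * \<bar>a x\<bar>) \<le> (a x)\<^sup>2 * ?p + (b x)\<^sup>2 * ?e" by (simp add: pw_ew)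
    moreover have "0 \<le> \<bar>b x\<bar> * \<bar>a x\<bar>" by simp
    ultimately show "norm (b x * a x) \<le> norm ((a x)\<^sup>2 * ?p + (b x)\<^sup>2 * ?e)" by (simp add: abs_mult)
  qed
qed simp

lemma prod_kap_integrable:
  assumes "finite u"
  shows "integrable (lborel_on u) (\<lambda>x. (\<Prod>j\<in>u. kap (t j) (x j))\<^sup>2 * ew \<tau> u x)"
  using qf_integral(1)[OF assms, of 1 "\<lambda>_. t" \<tau>] by (simp add: qf_def)

text \<open>The norm gives weighted square integrability of \<open>WM\<close>. Since the product of
  \<open>ncc\<close> is square integrable for the dual weight, \<open>WM\<close> is also integrable
  for the product of the measures \<open>Cm\<close>, which is the hypothesis of
  \<open>representation\<close>. The term of the empty set is the Gaussian integral.\<close>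

lemma W_space_representation:
  assumes \<gamma>: "\<And>u. \<gamma> u > 0" and G: "G \<in> W_space d \<gamma> \<tau>"
  shows "u \<subseteq> {..<d} \<Longrightarrow> integrable (lborel_on u) (\<lambda>x. (\<Prod>j\<in>u. kap (t j) (x j)) * WM d u G x)" (is "_ \<Longrightarrow> ?I u")
    and "G (trunc d t) = gauss_integral d G + (\<Sum>u\<in>Pow {..<d} - {{}}. \<integral>x. (\<Prod>j\<in>u. kap (t j) (x j)) * WM d u G x \<partial>lborel_on u)"
proof -
  note W = W_spaceD[OF \<gamma> G]
  interpret mixed_family "{..<d}" "md_fam d G" by (rule mixed_family_multi_deriv[OF W(1)])
  show I: "?I u" if u: "u \<subseteq> {..<d}" for u
    using fin_sub[OF u] by (intro integrable_mult_weighted[OF W(3)[OF u]] prod_kap_integrable WM_measurable W(1) u) auto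
  have D: "(\<integral>\<^sup>+x. ennreal \<bar>Mean u x\<bar> \<partial>Pi\<^sub>M u (\<lambda>_. Cm)) < \<infinity>" if u: "u \<subseteq> {..<d}" for u
  proof -
    have fu: "finite u" by (rule fin_sub[OF u])
    have ci: "integrable (lborel_on u) (\<lambda>x. (\<Prod>j\<in>u. ncc (x j))\<^sup>2 * ew \<tau> u x)"
      using PL.product_integrable_prod[OF fu integrable_ncc_sq, of "\<lambda>j. \<tau> j"]
      by (simp add: ew_def prod.distrib prod_power_distrib)
    have "integrable (lborel_on u) (\<lambda>x. (\<Prod>j\<in>u. ncc (x j)) * WM d u G x)"
      by (intro integrable_mult_weighted[OF W(3)[OF u] ci] WM_measurable W(1) u) auto
    then have "(\<integral>\<^sup>+x. ennreal (norm ((\<Prod>j\<in>u. ncc (x j)) * WM d u G x)) \<partial>lborel_on u) < \<infinity>"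
      unfolding integrable_iff_bounded by simp
    also have "(\<integral>\<^sup>+x. ennreal (norm ((\<Prod>j\<in>u. ncc (x j)) * WM d u G x)) \<partial>lborel_on u)
      = (\<integral>\<^sup>+x. ennreal \<bar>Mean u x\<bar> \<partial>Pi\<^sub>M u (\<lambda>_. Cm))"
      unfolding PiM_Cm[OF fu] WM_eq[OF W(1) u] using Mean_measurable[OF u, of "\<lambda>_. lborel"] ncc_pos
      by (subst nn_integral_density) (auto simp: abs_mult ennreal_mult prod_nonneg abs_prod less_imp_le abs_of_pos)
    finally show ?thesis .
  qed
  have "G (trunc d t) = (\<Sum>u\<in>Pow {..<d}. \<integral>x. (\<Prod>j\<in>u. kap (t j) (x j)) * WM d u G x \<partial>lborel_on u)"
  proof -
    have "G (trunc d t) = md_fam d G {} t" by (simp add: multi_deriv_indicator)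
    also have "\<dots> = (\<Sum>u\<in>Pow {..<d}. \<integral>x. (\<Prod>j\<in>u. kap (t j) (x j)) * Mean u x \<partial>lborel_on u)"
    proof (rule representation[OF _ D])
      fix u assume u: "u \<subseteq> {..<d}"
      show "AE x in lborel_on u. integrable (Pi\<^sub>M ({..<d} - u) (\<lambda>_. stdN)) (\<lambda>y. md_fam d G u (merge u ({..<d} - u) (x, y)))"
        using W(2)[OF u] by (simp only: W_integrand_integrable_iff[OF W(1) u])
    qed
    finally show ?thesis by (simp add: WM_eq[OF W(1)])
  qed
  also have "\<dots> = (\<integral>x. (\<Prod>j\<in>{}. kap (t j) (x j)) * WM d {} G x \<partial>lborel_on {}) +
     (\<Sum>u\<in>Pow {..<d} - {{}}. \<integral>x. (\<Prod>j\<in>u. kap (t j) (x j)) * WM d u G x \<partial>lborel_on u)"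
    by (subst sum.remove[of _ "{}"]) auto
  also have "(\<integral>x. (\<Prod>j\<in>{}. kap (t j) (x j)) * WM d {} G x \<partial>lborel_on {}) = gauss_integral d G"
  proof -
    interpret E: prob_space "lborel_on {}" by (rule prob_space_PiM) auto
    have "WM d {} G x = gauss_integral d G" for x
    proof -
      have "trunc d (merge {} {..<d} (x, y)) = trunc d y" for y by (auto simp: trunc_def merge_def)
      then show ?thesis by (simp add: WM_def W_integrand_def[abs_def] gauss_integral_def multi_deriv_indicator)
    qed
    then show ?thesis by (simp add: E.prob_space)
  qed
  finally show "G (trunc d t) = gauss_integral d G + (\<Sum>u\<in>Pow {..<d} - {{}}. \<integral>x. (\<Prod>j\<in>u. kap (t j) (x j)) * WM d u G x \<partial>lborel_on u)" .
qed

section \<open>The cubature error as a functional on the weighted space\<close>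

definition cub_err :: "nat \<Rightarrow> nat \<Rightarrow> (nat \<Rightarrow> nat \<Rightarrow> real) \<Rightarrow> ((nat \<Rightarrow> real) \<Rightarrow> real) \<Rightarrow> real" where
  "cub_err d n T G = gauss_integral d G - 1 / real n * (\<Sum>k=1..n. G (trunc d (T k)))"

lemma measurable_qf [measurable]: "qf n T u \<in> borel_measurable (lborel_on u)"
  unfolding qf_def by measurable

text \<open>The \<open>n\<close> node weights \<open>1 / n\<close> add up to 1, so the Gaussian
  integral in the representation of each node value cancels and only nonempty \<open>u\<close>
  remain.\<close>

lemma cub_err_eq:
  assumes \<gamma>: "\<And>u. \<gamma> u > 0" and G: "G \<in> W_space d \<gamma> \<tau>" and n: "n \<ge> 1"
  shows "cub_err d n T G = - (\<Sum>u\<in>Pow {..<d} - {{}}. \<integral>x. qf n T u x * WM d u G x \<partial>lborel_on u)"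
proof -
  note R = W_space_representation[OF \<gamma> G]
  have "(\<Sum>k=1..n. G (trunc d (T k))) = real n * gauss_integral d G +
     (\<Sum>u\<in>Pow {..<d} - {{}}. \<Sum>k=1..n. \<integral>x. (\<Prod>j\<in>u. kap (T k j) (x j)) * WM d u G x \<partial>lborel_on u)"
    unfolding R(2) sum.distrib by (subst sum.swap) simp
  moreover have "(\<integral>x. qf n T u x * WM d u G x \<partial>lborel_on u)
     = 1 / real n * (\<Sum>k=1..n. \<integral>x. (\<Prod>j\<in>u. kap (T k j) (x j)) * WM d u G x \<partial>lborel_on u)" if "u \<in> Pow {..<d} - {{}}" for u
  proof -
    have u: "u \<subseteq> {..<d}" using that by auto
    have "(\<lambda>x. qf n T u x * WM d u G x) = (\<lambda>x. 1 / real n * (\<Sum>k=1..n. (\<Prod>j\<in>u. kap (T k j) (x j)) * WM d u G x))"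
      by (simp add: qf_def sum_distrib_right mult.assoc fun_eq_iff)
    then show ?thesis by (simp only: integral_mult_right_zero Bochner_Integration.integral_sum R(1)[OF u])
  qed
  ultimately show ?thesis using n
    by (simp add: cub_err_def sum_divide_distrib add_divide_distrib)
qed

lemma cub_err_bound:
  assumes \<gamma>: "\<And>u. \<gamma> u > 0" and G: "G \<in> W_space d \<gamma> \<tau>" and n: "n \<ge> 1"
  shows "(cub_err d n T G)\<^sup>2 \<le> N2 d \<gamma> \<tau> G * E2 d n \<gamma> \<tau> T"
proof -
  note W = W_spaceD[OF \<gamma> G]
  let ?P = "Pow {..<d} - {{}}"
  define A where "A u = (\<integral>x. (WM d u G x)\<^sup>2 * pw \<tau> u x \<partial>lborel_on u)" for u
  define B where "B u = (\<integral>x. qf n T u x * WM d u G x \<partial>lborel_on u)" for u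
  define C where "C u = (\<integral>x. (qf n T u x)\<^sup>2 * ew \<tau> u x \<partial>lborel_on u)" for u
  have key: "0 \<le> 1 / \<gamma> u * A u + 2 * r * B u + r\<^sup>2 * (\<gamma> u * C u)" if u: "u \<subseteq> {..<d}" for u r
  proof -
    have fu: "finite u" using u finite_subset by auto
    note iA = W(3)[OF u] and iC = qf_integral(1)[OF fu, of n T \<tau>]
    have iB: "integrable (lborel_on u) (\<lambda>x. qf n T u x * WM d u G x)"
      by (intro integrable_mult_weighted[OF iA iC] WM_measurable[OF W(1) u]) measurable
    have "0 \<le> (\<integral>x. 1 / \<gamma> u * ((WM d u G x)\<^sup>2 * pw \<tau> u x) + (2 * r * (qf n T u x * WM d u G x)
        + r\<^sup>2 * \<gamma> u * ((qf n T u x)\<^sup>2 * ew \<tau> u x)) \<partial>lborel_on u)"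
    proof (rule Bochner_Integration.integral_nonneg)
      fix x
      let ?p = "pw \<tau> u x" and ?e = "ew \<tau> u x"
      have e: "?e = 1 / ?p" using pw_ew[of \<tau> u x] pw_pos[of \<tau> u x] by (simp add: field_simps)
      \<comment> \<open>Divided by \<open>\<gamma> u * ?p\<close>, this square expands in
        \<open>r\<close> to the density of the norm, the pairing and the density of the kernel sum;
        the weights cancel from the middle coefficient.\<close>
      have "0 \<le> (WM d u G x * ?p + r * \<gamma> u * qf n T u x)\<^sup>2 / (\<gamma> u * ?p)"
        using \<gamma>[of u] pw_pos[of \<tau> u x] by simp
      also have "\<dots> = 1 / \<gamma> u * ((WM d u G x)\<^sup>2 * ?p) + (2 * r * (qf n T u x * WM d u G x) + r\<^sup>2 * \<gamma> u * ((qf n T u x)\<^sup>2 * ?e))"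
        unfolding e using \<gamma>[of u] pw_pos[of \<tau> u x] by (simp add: field_simps power2_eq_square)
      finally show "0 \<le> 1 / \<gamma> u * ((WM d u G x)\<^sup>2 * ?p) + (2 * r * (qf n T u x * WM d u G x) + r\<^sup>2 * \<gamma> u * ((qf n T u x)\<^sup>2 * ?e))" .
    qed
    also have "\<dots> = 1 / \<gamma> u * A u + (2 * r * B u + r\<^sup>2 * \<gamma> u * C u)"
      unfolding A_def B_def C_def using iA iB iC by (subst Bochner_Integration.integral_add; simp)+
    finally show ?thesis by (simp add: mult.assoc add.assoc)
  qed
  have A0: "0 \<le> A u" "0 \<le> C u" for u unfolding A_def C_def
    using pw_pos ew_pos by (auto intro!: integral_nonneg simp: less_imp_le)
  have "(\<Sum>u\<in>?P. B u)\<^sup>2 \<le> (\<Sum>u\<in>?P. 1 / \<gamma> u * A u) * (\<Sum>u\<in>?P. \<gamma> u * C u)"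
  proof (rule quadratic_discriminant)
    show "0 \<le> (\<Sum>u\<in>?P. 1 / \<gamma> u * A u) + 2 * r * (\<Sum>u\<in>?P. B u) + r\<^sup>2 * (\<Sum>u\<in>?P. \<gamma> u * C u)" for r
      unfolding sum_distrib_left sum.distrib[symmetric] using key by (intro sum_nonneg) auto
  qed (use A0 \<gamma> in \<open>auto intro!: sum_nonneg mult_nonneg_nonneg simp: less_imp_le\<close>)
  also have "\<dots> \<le> N2 d \<gamma> \<tau> G * E2 d n \<gamma> \<tau> T"
  proof -
    have "(\<Sum>u\<in>?P. 1 / \<gamma> u * A u) \<le> N2 d \<gamma> \<tau> G"
      unfolding N2_def A_def[symmetric] using A0 \<gamma>
      by (intro sum_mono2) (auto intro!: mult_nonneg_nonneg simp: less_imp_le)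
    then show ?thesis using E2_nonneg[OF \<gamma>] unfolding E2_eq C_def by (intro mult_right_mono) auto
  qed
  finally show ?thesis unfolding cub_err_eq[OF \<gamma> G n] B_def by simp
qed

section \<open>Test functions attaining the kernel sum\<close>

text \<open>The test functions have this form because both mixed derivatives and Gaussian means act
  factor by factor.\<close>

definition tens :: "nat \<Rightarrow> 'a set \<Rightarrow> ('a \<Rightarrow> real) \<Rightarrow> ('a \<Rightarrow> nat \<Rightarrow> real \<Rightarrow> real) \<Rightarrow> (nat \<Rightarrow> real) \<Rightarrow> real" where
  "tens d A c f x = (\<Sum>a\<in>A. c a * (\<Prod>j<d. f a j (x j)))"

lemma tens_deriv:
  assumes D: "\<And>a x. (f a i has_real_derivative f' a i x) (at x)" and i: "i < d"
    and h: "\<And>a j. j \<noteq> i \<Longrightarrow> h a j = f a j"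
  shows "((\<lambda>t. tens d A c f (x(i := t))) has_real_derivative tens d A c (\<lambda>a. (h a)(i := f' a i)) (x(i := t0))) (at t0)"
proof -
  have p: "(\<Prod>j<d. k j ((x(i := t)) j)) = k i t * (\<Prod>j\<in>{..<d} - {i}. k j (x j))" for k :: "nat \<Rightarrow> real \<Rightarrow> real" and t
    using i by (subst prod.remove[of _ i]) auto
  have q: "(\<Prod>j\<in>{..<d} - {i}. ((h a)(i := f' a i)) j (x j)) = (\<Prod>j\<in>{..<d} - {i}. f a j (x j))" for a
    by (intro prod.cong) (auto simp: h)
  show ?thesis unfolding tens_def p q
    by (auto intro!: DERIV_sum DERIV_cmult DERIV_cmult_right D)
qed

context
  fixes d :: nat and A :: "'a set" and c :: "'a \<Rightarrow> real" and f f' :: "'a \<Rightarrow> nat \<Rightarrow> real \<Rightarrow> real"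
  assumes D: "\<And>a j x. (f a j has_real_derivative f' a j x) (at x)"
    and cont': "\<And>a j. continuous_on UNIV (f' a j)"
begin

definition fS :: "nat set \<Rightarrow> 'a \<Rightarrow> nat \<Rightarrow> real \<Rightarrow> real" where
  "fS S a j = (if j \<in> S then f' a j else f a j)"

lemma fS_deriv:
  assumes "i < d" "i \<notin> S"
  shows "((\<lambda>t. tens d A c (fS S) (x(i := t))) has_real_derivative tens d A c (fS (insert i S)) (x(i := t0))) (at t0)"
proof -
  have "(fS S a)(i := f' a i) = fS (insert i S) a" for a by (auto simp: fS_def fun_eq_iff)
  moreover have "((\<lambda>t. tens d A c (fS S) (x(i := t))) has_real_derivative tens d A c (\<lambda>a. (fS S a)(i := f' a i)) (x(i := t0))) (at t0)"
    using assms D by (intro tens_deriv) (auto simp: fS_def)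
  ultimately show ?thesis by simp
qed

lemma partial_derivs_tens:
  "distinct js \<Longrightarrow> set js \<subseteq> {..<d} \<Longrightarrow> partial_derivs js (tens d A c f) = tens d A c (fS (set js))"
proof (induction js)
  case Nil
  have "fS {} = f" by (simp add: fS_def fun_eq_iff)
  then show ?case by simp
next
  case (Cons i js)
  have "partial_deriv i (tens d A c (fS (set js))) x = tens d A c (fS (insert i (set js))) x" for x
    unfolding partial_deriv_def using fS_deriv[of i "set js" x "x i"] Cons.prems by (auto intro!: DERIV_imp_deriv)
  then show ?case using Cons by (auto simp: partial_derivs_Cons)
qed

lemma continuous_fS: "continuous_on UNIV (fS S a j)"
proof (cases "j \<in> S")
  case False
  then show ?thesis
    by (intro continuous_at_imp_continuous_on ballI) (auto simp: fS_def intro: DERIV_isCont[OF D])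
qed (simp add: fS_def cont')

lemma mixed_differentiable_tens: "mixed_differentiable d (tens d A c f)"
  unfolding mixed_differentiable_def
proof (intro allI impI conjI ballI)
  fix js assume js: "distinct js \<and> set js \<subseteq> {..<d}"
  have co: "continuous_on U (\<lambda>x. fS (set js) a j (x j))" for a j and U :: "(nat \<Rightarrow> real) set"
    by (rule continuous_on_compose2[OF continuous_fS continuous_on_subset[OF continuous_on_product_coordinates]]) auto
  show "continuous_on (Rn d) (partial_derivs js (tens d A c f))"
    unfolding partial_derivs_tens[OF js[THEN conjunct1] js[THEN conjunct2]] unfolding tens_def[abs_def]
    by (intro continuous_intros co)
  fix i x assume i: "i \<in> {..<d} - set js"
  show "(\<lambda>t. partial_derivs js (tens d A c f) (x(i := t))) differentiable at (x i)"
    using fS_deriv[of i "set js" x "x i"] i js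
    by (auto simp: partial_derivs_tens real_differentiable_def)
qed

lemma md_fam_tens:
  assumes u: "u \<subseteq> {..<d}"
  shows "md_fam d (tens d A c f) u (merge u ({..<d} - u) (x, y))
    = (\<Sum>a\<in>A. c a * (\<Prod>j\<in>u. f' a j (x j)) * (\<Prod>j\<in>{..<d} - u. f a j (y j)))"
proof -
  have fu: "finite u" using u finite_subset by auto
  have "(\<Prod>j<d. fS u a j (trunc d (merge u ({..<d} - u) (x, y)) j)) = (\<Prod>j\<in>u. f' a j (x j)) * (\<Prod>j\<in>{..<d} - u. f a j (y j))" for a
  proof -
    have "(\<Prod>j<d. fS u a j (trunc d (merge u ({..<d} - u) (x, y)) j))
      = (\<Prod>j\<in>{..<d} - u. fS u a j (trunc d (merge u ({..<d} - u) (x, y)) j)) * (\<Prod>j\<in>u. fS u a j (trunc d (merge u ({..<d} - u) (x, y)) j))"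
      by (rule prod.subset_diff[OF u]) simp
    also have "(\<Prod>j\<in>{..<d} - u. fS u a j (trunc d (merge u ({..<d} - u) (x, y)) j)) = (\<Prod>j\<in>{..<d} - u. f a j (y j))"
      by (intro prod.cong) (auto simp: fS_def trunc_def merge_def)
    also have "(\<Prod>j\<in>u. fS u a j (trunc d (merge u ({..<d} - u) (x, y)) j)) = (\<Prod>j\<in>u. f' a j (x j))"
      using u by (intro prod.cong) (auto simp: fS_def trunc_def merge_def)
    finally show ?thesis by simp
  qed
  then show ?thesis
    using u fu by (simp add: multi_deriv_indicator partial_derivs_tens tens_def mult.assoc)
qed

lemma WM_tens:
  assumes u: "u \<subseteq> {..<d}" and int: "\<And>a j. a \<in> A \<Longrightarrow> integrable stdN (f a j)" and finA: "finite A"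
  shows "integrable (lborel_on ({..<d} - u)) (W_integrand d u (tens d A c f) x)"
    and "WM d u (tens d A c f) x = (\<Sum>a\<in>A. c a * (\<Prod>j\<in>u. f' a j (x j)) * (\<Prod>j\<in>{..<d} - u. \<integral>t. f a j t \<partial>stdN))"
proof -
  note md = mixed_differentiable_tens
  interpret mixed_family "{..<d}" "md_fam d (tens d A c f)" by (rule mixed_family_multi_deriv[OF md])
  have i: "integrable (Pi\<^sub>M ({..<d} - u) (\<lambda>_. stdN)) (\<lambda>y. \<Prod>j\<in>{..<d} - u. f a j (y j))" if "a \<in> A" for a
    using that by (intro PN.product_integrable_prod int) auto
  then show "integrable (lborel_on ({..<d} - u)) (W_integrand d u (tens d A c f) x)"
    unfolding W_integrand_integrable_iff[OF md u] md_fam_tens[OF u]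
    by (intro Bochner_Integration.integrable_sum integrable_mult_right) auto
  have "WM d u (tens d A c f) x = (\<integral>y. (\<Sum>a\<in>A. c a * (\<Prod>j\<in>u. f' a j (x j)) * (\<Prod>j\<in>{..<d} - u. f a j (y j))) \<partial>Pi\<^sub>M ({..<d} - u) (\<lambda>_. stdN))"
    unfolding WM_eq[OF md u] Mean_def md_fam_tens[OF u] ..
  also have "\<dots> = (\<Sum>a\<in>A. c a * (\<Prod>j\<in>u. f' a j (x j)) * (\<integral>y. (\<Prod>j\<in>{..<d} - u. f a j (y j)) \<partial>Pi\<^sub>M ({..<d} - u) (\<lambda>_. stdN)))"
    using i by (subst Bochner_Integration.integral_sum) auto
  also have "\<dots> = (\<Sum>a\<in>A. c a * (\<Prod>j\<in>u. f' a j (x j)) * (\<Prod>j\<in>{..<d} - u. \<integral>t. f a j t \<partial>stdN))"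
    using int by (intro sum.cong refl) (subst PN.product_integral_prod, auto)
  finally show "WM d u (tens d A c f) x = (\<Sum>a\<in>A. c a * (\<Prod>j\<in>u. f' a j (x j)) * (\<Prod>j\<in>{..<d} - u. \<integral>t. f a j t \<partial>stdN))" .
qed

end

text \<open>The cut-off makes \<open>kap t\<close> continuous and compactly supported.\<close>

definition kapN :: "nat \<Rightarrow> real \<Rightarrow> real \<Rightarrow> real" where
  "kapN m t x = kap t x * (min 1 (real m * \<bar>x - t\<bar>) * max 0 (min 1 (real m - \<bar>x\<bar>)))"

lemma abs_kapN_le: "\<bar>kapN m t x\<bar> \<le> \<bar>kap t x\<bar>"
  unfolding kapN_def abs_mult by (intro mult_left_le mult_le_one) auto

lemma kapN_0: "\<bar>x\<bar> \<ge> real m \<Longrightarrow> kapN m t x = 0"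
  by (simp add: kapN_def)

lemma continuous_kapN: "continuous_on UNIV (kapN m t)"
proof -
  \<comment> \<open>The unit jump of \<open>kap t\<close> sits at \<open>t\<close>, where the
    cut-off vanishes. Writing the jump times the cut-off with \<open>max 0 (t - x)\<close> removes
    the case distinction and exhibits continuity.\<close>
  have "kapN m t x = ((ncdf x - 1) * min 1 (real m * \<bar>x - t\<bar>) + min 1 (real m * max 0 (t - x))) * max 0 (min 1 (real m - \<bar>x\<bar>))" for x
    by (auto simp: kapN_def kap_def algebra_simps max_def)
  then have "kapN m t = (\<lambda>x. ((ncdf x - 1) * min 1 (real m * \<bar>x - t\<bar>) + min 1 (real m * max 0 (t - x))) * max 0 (min 1 (real m - \<bar>x\<bar>)))"
    by (rule ext)
  then show ?thesis by (simp only:) (intro continuous_intros continuous_ncdf)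
qed

lemma measurable_kapN [measurable]: "kapN m t \<in> borel_measurable borel"
  by (intro borel_measurable_continuous_onI continuous_kapN)

lemma kapN_tendsto: assumes "x \<noteq> t" shows "(\<lambda>m. kapN m t x) \<longlonglongrightarrow> kap t x"
proof -
  \<comment> \<open>From this index on both cut-off factors equal 1 at \<open>x\<close>.\<close>
  obtain M where M: "real M \<ge> 1 / \<bar>x - t\<bar> + \<bar>x\<bar> + 1" using real_arch_simple by blast
  have "kapN m t x = kap t x" if "m \<ge> M" for m
  proof -
    have pos: "0 \<le> 1 / \<bar>x - t\<bar>" by simp
    have m: "real m \<ge> 1 / \<bar>x - t\<bar> + \<bar>x\<bar> + 1" using M that by linarith
    then have "real m \<ge> 1 / \<bar>x - t\<bar>" by linarith
    then have "real m * \<bar>x - t\<bar> \<ge> 1" using assms by (simp add: field_simps)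
    moreover have "real m - \<bar>x\<bar> \<ge> 1" using m pos by linarith
    ultimately show ?thesis by (simp add: kapN_def)
  qed
  then show ?thesis by (intro tendsto_eventually) (auto simp: eventually_sequentially)
qed

lemma kapN_integral_tendsto:
  shows "(\<lambda>m. \<integral>x. kapN m s x * kap t x * exp (2 * \<tau> * \<bar>x\<bar>) \<partial>lborel) \<longlonglongrightarrow> ker \<tau> s t"
    and "(\<lambda>m. \<integral>x. kapN m s x * kapN m t x * exp (2 * \<tau> * \<bar>x\<bar>) \<partial>lborel) \<longlonglongrightarrow> ker \<tau> s t"
    and "integrable lborel (\<lambda>x. kapN m s x * kap t x * exp (2 * \<tau> * \<bar>x\<bar>))"
    and "integrable lborel (\<lambda>x. kapN m s x * kapN m t x * exp (2 * \<tau> * \<bar>x\<bar>))"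
proof -
  let ?w = "\<lambda>x. \<bar>kap s x * kap t x * exp (2 * \<tau> * \<bar>x\<bar>)\<bar>"
  have w: "integrable lborel ?w" by (intro integrable_abs integrable_kap_kap)
  have b1: "norm (kapN m s x * kap t x * exp (2 * \<tau> * \<bar>x\<bar>)) \<le> ?w x" for m x
    unfolding real_norm_def abs_mult by (intro mult_right_mono mult_mono abs_kapN_le) auto
  have b2: "norm (kapN m s x * kapN m t x * exp (2 * \<tau> * \<bar>x\<bar>)) \<le> ?w x" for m x
    unfolding real_norm_def abs_mult by (intro mult_right_mono mult_mono abs_kapN_le) auto
  have ae: "AE x in lborel. x \<noteq> s \<and> x \<noteq> t" using AE_lborel_singleton[of s] AE_lborel_singleton[of t] by eventually_elim simp
  show "(\<lambda>m. \<integral>x. kapN m s x * kap t x * exp (2 * \<tau> * \<bar>x\<bar>) \<partial>lborel) \<longlonglongrightarrow> ker \<tau> s t"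
    unfolding ker_def
  proof (rule integral_dominated_convergence[OF _ _ w])
    show "AE x in lborel. (\<lambda>m. kapN m s x * kap t x * exp (2 * \<tau> * \<bar>x\<bar>)) \<longlonglongrightarrow> kap s x * kap t x * exp (2 * \<tau> * \<bar>x\<bar>)"
      using ae by eventually_elim (intro tendsto_intros kapN_tendsto, auto)
  qed (use b1 in auto)
  show "(\<lambda>m. \<integral>x. kapN m s x * kapN m t x * exp (2 * \<tau> * \<bar>x\<bar>) \<partial>lborel) \<longlonglongrightarrow> ker \<tau> s t"
    unfolding ker_def
  proof (rule integral_dominated_convergence[OF _ _ w])
    show "AE x in lborel. (\<lambda>m. kapN m s x * kapN m t x * exp (2 * \<tau> * \<bar>x\<bar>)) \<longlonglongrightarrow> kap s x * kap t x * exp (2 * \<tau> * \<bar>x\<bar>)"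
      using ae by eventually_elim (intro tendsto_intros kapN_tendsto, auto)
  qed (use b2 in auto)
  show "integrable lborel (\<lambda>x. kapN m s x * kap t x * exp (2 * \<tau> * \<bar>x\<bar>))"
    by (rule Bochner_Integration.integrable_bound[OF w]) (use b1 in auto)
  show "integrable lborel (\<lambda>x. kapN m s x * kapN m t x * exp (2 * \<tau> * \<bar>x\<bar>))"
    by (rule Bochner_Integration.integrable_bound[OF w]) (use b2 in auto)
qed

text \<open>Integrability of \<open>h\<close> bounds its antiderivatives, so they have a Gaussian
  mean that can be subtracted. The vanishing mean keeps the contributions of different variable sets
  apart in \<open>test_function\<close>.\<close>

lemma bounded_antiderivative:
  fixes h :: "real \<Rightarrow> real"
  assumes c: "continuous_on UNIV h" and i: "integrable lborel h"
  shows "\<exists>\<phi>. (\<forall>x. (\<phi> has_real_derivative h x) (at x)) \<and> integrable stdN \<phi> \<and> (\<integral>x. \<phi> x \<partial>stdN) = 0"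
proof -
  obtain F where F: "\<And>x. (F has_real_derivative h x) (at x)"
    using einterval_antiderivative[of "-\<infinity>" "\<infinity>" h] c
    by (auto simp: continuous_on_eq_continuous_at has_real_derivative_iff_has_vector_derivative)
  have b: "\<bar>F x - F 0\<bar> \<le> (\<integral>s. \<bar>h s\<bar> \<partial>lborel)" for x
  proof -
    have "\<bar>F x - F 0\<bar> = \<bar>\<integral>s. sg 0 x s * h s \<partial>lborel\<bar>" by (subst FTC_sg[OF F c]) simp
    also have "\<dots> \<le> (\<integral>s. \<bar>sg 0 x s * h s\<bar> \<partial>lborel)" by (rule integral_abs_bound)
    also have "\<dots> \<le> (\<integral>s. \<bar>h s\<bar> \<partial>lborel)"
    proof (rule integral_mono)
      show le: "\<bar>sg 0 x s * h s\<bar> \<le> \<bar>h s\<bar>" for s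
        using mult_right_mono[OF abs_sg_le_1[of 0 x s], of "\<bar>h s\<bar>"] by (simp add: abs_mult)
      then show "integrable lborel (\<lambda>s. \<bar>sg 0 x s * h s\<bar>)"
        using i by (intro Bochner_Integration.integrable_bound[OF i]) auto
    qed (use i in simp)
    finally show ?thesis .
  qed
  have [measurable]: "F \<in> borel_measurable borel"
    by (intro borel_measurable_continuous_onI DERIV_continuous_on[of _ F h] DERIV_subset[OF F]) auto
  have iF: "integrable stdN F"
  proof (rule stdN.integrable_const_bound)
    show "AE x in stdN. norm (F x) \<le> \<bar>F 0\<bar> + (\<integral>s. \<bar>h s\<bar> \<partial>lborel)"
    proof (rule AE_I2)
      fix x show "norm (F x) \<le> \<bar>F 0\<bar> + (\<integral>s. \<bar>h s\<bar> \<partial>lborel)"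
        using b[of x] by (simp add: abs_if split: if_splits)
    qed
  qed simp
  define \<phi> where "\<phi> x = F x - (\<integral>x. F x \<partial>stdN)" for x
  have "(\<phi> has_real_derivative h x) (at x)" for x
    unfolding \<phi>_def[abs_def] using DERIV_diff[OF F DERIV_const] by simp
  moreover have "integrable stdN \<phi>" "(\<integral>x. \<phi> x \<partial>stdN) = 0"
    unfolding \<phi>_def[abs_def] using iF stdN.prob_space by simp_all
  ultimately show ?thesis by blast
qed

definition qfN :: "nat \<Rightarrow> nat \<Rightarrow> (nat \<Rightarrow> nat \<Rightarrow> real) \<Rightarrow> nat set \<Rightarrow> (nat \<Rightarrow> real) \<Rightarrow> real" where
  "qfN m n T u x = 1 / real n * (\<Sum>k=1..n. \<Prod>j\<in>u. kapN m (T k j) (x j))"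

text \<open>Equality in the Cauchy-Schwarz estimate asks for \<open>WM\<close> proportional to
  \<open>\<gamma> u * qf * ew\<close>, but the factors \<open>kap\<close> of \<open>qf\<close> jump.
  With \<open>kapN\<close> in their place the desired derivatives are continuous, and a sum over
  variable sets and nodes of products of mean-free antiderivatives realizes them.\<close>

lemma test_function:
  "\<exists>G. mixed_differentiable d G \<and> (\<forall>u x. u \<subseteq> {..<d} \<longrightarrow>
     integrable (lborel_on ({..<d} - u)) (W_integrand d u G x) \<and>
     WM d u G x = (if u = {} then 0 else L * \<gamma> u * qfN m n T u x * ew \<tau> u x))"
proof -
  let ?h = "\<lambda>k j x. kapN m (T k j) x * exp (2 * \<tau> j * \<bar>x\<bar>)"
  have hc: "continuous_on UNIV (?h k j)" for k j
    by (intro continuous_intros continuous_kapN)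
  have hi: "integrable lborel (?h k j)" for k j
  proof -
    have "integrable lborel (\<lambda>x. indicator {- real m..real m} x *\<^sub>R ?h k j x)"
      by (intro borel_integrable_compact continuous_on_subset[OF hc]) auto
    also have "(\<lambda>x. indicator {- real m..real m} x *\<^sub>R ?h k j x) = ?h k j"
    proof
      show "indicator {- real m..real m} x *\<^sub>R ?h k j x = ?h k j x" for x
        by (cases "real m \<le> \<bar>x\<bar>") (auto simp: indicator_def kapN_0)
    qed
    finally show ?thesis .
  qed
  have "\<forall>k j. \<exists>\<phi>. (\<forall>x. (\<phi> has_real_derivative ?h k j x) (at x)) \<and> integrable stdN \<phi> \<and> (\<integral>x. \<phi> x \<partial>stdN) = 0"
    by (intro allI bounded_antiderivative hc hi)
  then obtain \<phi> where \<phi>: "\<And>k j x. (\<phi> k j has_real_derivative ?h k j x) (at x)" "\<And>k j. integrable stdN (\<phi> k j)"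
      "\<And>k j. (\<integral>x. \<phi> k j x \<partial>stdN) = 0"
    by metis
  define A where "A = (Pow {..<d} - {{}}) \<times> {1..n}"
  define c where "c = (\<lambda>a::nat set \<times> nat. L * \<gamma> (fst a) / real n)"
  define f where "f = (\<lambda>a j x. if j \<in> fst a then \<phi> (snd a) j x else 1)"
  define f' where "f' = (\<lambda>a j x. if j \<in> fst a then ?h (snd a) j x else 0)"
  have D: "(f a j has_real_derivative f' a j x) (at x)" for a j x
    using \<phi>(1) by (auto simp: f_def f'_def)
  have c': "continuous_on UNIV (f' a j)" for a j
    using hc by (cases "j \<in> fst a") (auto simp: f'_def)
  have int: "integrable stdN (f a j)" for a j using \<phi>(2) by (cases "j \<in> fst a") (auto simp: f_def)
  have fA: "finite A" by (simp add: A_def)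
  let ?G = "tens d A c f"
  have "WM d u ?G x = (if u = {} then 0 else L * \<gamma> u * qfN m n T u x * ew \<tau> u x)" if u: "u \<subseteq> {..<d}" for u x
  proof -
    have ea: "(\<Prod>j\<in>u. f' a j (x j)) * (\<Prod>j\<in>{..<d} - u. \<integral>t. f a j t \<partial>stdN) = (if fst a = u then (\<Prod>j\<in>u. ?h (snd a) j (x j)) else 0)"
      if a: "fst a \<subseteq> {..<d}" for a
    proof (cases "fst a = u")
      case True
      have "(\<Prod>j\<in>{..<d} - u. \<integral>t. f a j t \<partial>stdN) = 1" using True stdN.prob_space by (intro prod.neutral) (auto simp: f_def)
      then show ?thesis using True by (auto simp: f'_def intro!: prod.cong)
    next
      case False
      \<comment> \<open>A variable of \<open>u\<close> outside \<open>fst a\<close> differentiates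
        the constant factor 1; a variable of \<open>fst a\<close> outside \<open>u\<close> averages
        a mean-free factor. Either way the term vanishes.\<close>
      then consider j where "j \<in> u" "j \<notin> fst a" | j where "j \<in> {..<d} - u" "j \<in> fst a" using a u by auto
      then show ?thesis
      proof cases
        case 1
        then have "(\<Prod>j\<in>u. f' a j (x j)) = 0" using u finite_subset by (intro prod_zero bexI[of _ j]) (auto simp: f'_def)
        then show ?thesis using False by simp
      next
        case 2
        then have "(\<Prod>j\<in>{..<d} - u. \<integral>t. f a j t \<partial>stdN) = 0" using \<phi>(3) by (intro prod_zero bexI[of _ j]) (auto simp: f_def)
        then show ?thesis using False by simp
      qed
    qed
    have "WM d u ?G x = (\<Sum>a\<in>A. c a * ((\<Prod>j\<in>u. f' a j (x j)) * (\<Prod>j\<in>{..<d} - u. \<integral>t. f a j t \<partial>stdN)))"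
      using WM_tens(2)[of f f', OF D c' u int fA, of c x] by (simp add: mult.assoc)
    also have "\<dots> = (\<Sum>a\<in>A. c a * (if fst a = u then (\<Prod>j\<in>u. ?h (snd a) j (x j)) else 0))"
      by (intro sum.cong refl arg_cong2[where f="(*)"] ea) (auto simp: A_def)
    also have "\<dots> = (\<Sum>v\<in>Pow {..<d} - {{}}. \<Sum>k=1..n. c (v, k) * (if v = u then (\<Prod>j\<in>u. ?h k j (x j)) else 0))"
      unfolding A_def by (subst sum.cartesian_product) (simp add: split_def)
    also have "\<dots> = (\<Sum>v\<in>Pow {..<d} - {{}}. if v = u then (\<Sum>k=1..n. c (u, k) * (\<Prod>j\<in>u. ?h k j (x j))) else 0)"
      by (intro sum.cong) auto
    also have "\<dots> = (if u = {} then 0 else (\<Sum>k=1..n. c (u, k) * (\<Prod>j\<in>u. ?h k j (x j))))"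
      using u by (simp add: sum.delta)
    also have "(\<Sum>k=1..n. c (u, k) * (\<Prod>j\<in>u. ?h k j (x j))) = L * \<gamma> u * qfN m n T u x * ew \<tau> u x"
      by (simp add: c_def qfN_def ew_def prod.distrib sum_distrib_left sum_distrib_right mult.assoc)
    finally show ?thesis .
  qed
  moreover have "integrable (lborel_on ({..<d} - u)) (W_integrand d u ?G x)" if u: "u \<subseteq> {..<d}" for u x
    using WM_tens(1)[of f f', OF D c' u int fA] .
  moreover have "mixed_differentiable d ?G" by (rule mixed_differentiable_tens[of f f', OF D c'])
  ultimately show ?thesis by blast
qed

lemma qfN_integral:
  assumes "finite u"
  shows "integrable (lborel_on u) (\<lambda>x. (qfN m n T u x)\<^sup>2 * ew \<tau> u x)"
    and "(\<integral>x. (qfN m n T u x)\<^sup>2 * ew \<tau> u x \<partial>lborel_on u) = 1 / (real n)\<^sup>2 *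
      (\<Sum>k=1..n. \<Sum>l=1..n. \<Prod>j\<in>u. \<integral>x. kapN m (T k j) x * kapN m (T l j) x * exp (2 * \<tau> j * \<bar>x\<bar>) \<partial>lborel)"
    and "(\<integral>x. qfN m n T u x * qf n T u x * ew \<tau> u x \<partial>lborel_on u) = 1 / (real n)\<^sup>2 *
      (\<Sum>k=1..n. \<Sum>l=1..n. \<Prod>j\<in>u. \<integral>x. kapN m (T k j) x * kap (T l j) x * exp (2 * \<tau> j * \<bar>x\<bar>) \<partial>lborel)"
proof -
  note t = tensor_inner_product[where a="\<lambda>k j. kapN m (T k j)" and b="\<lambda>k j. kapN m (T k j)"
      and e="\<lambda>j x. exp (2 * \<tau> j * \<bar>x\<bar>)" and n=n, OF assms kapN_integral_tendsto(4)]
  note t' = tensor_inner_product[where a="\<lambda>k j. kapN m (T k j)" and b="\<lambda>k j. kap (T k j)"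
      and e="\<lambda>j x. exp (2 * \<tau> j * \<bar>x\<bar>)" and n=n, OF assms kapN_integral_tendsto(3)]
  show "integrable (lborel_on u) (\<lambda>x. (qfN m n T u x)\<^sup>2 * ew \<tau> u x)"
    using t(1) by (simp only: qfN_def ew_def power2_eq_square)
  show "(\<integral>x. (qfN m n T u x)\<^sup>2 * ew \<tau> u x \<partial>lborel_on u) = 1 / (real n)\<^sup>2 *
      (\<Sum>k=1..n. \<Sum>l=1..n. \<Prod>j\<in>u. \<integral>x. kapN m (T k j) x * kapN m (T l j) x * exp (2 * \<tau> j * \<bar>x\<bar>) \<partial>lborel)"
    using t(2) by (simp only: qfN_def ew_def power2_eq_square)
  show "(\<integral>x. qfN m n T u x * qf n T u x * ew \<tau> u x \<partial>lborel_on u) = 1 / (real n)\<^sup>2 *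
      (\<Sum>k=1..n. \<Sum>l=1..n. \<Prod>j\<in>u. \<integral>x. kapN m (T k j) x * kap (T l j) x * exp (2 * \<tau> j * \<bar>x\<bar>) \<partial>lborel)"
    using t'(2) by (simp only: qfN_def qf_def ew_def)
qed

text \<open>For the test function with \<open>L = 1\<close>, \<open>ENN\<close> is the squared norm
  and \<open>EN1\<close> is minus the cubature error. Both tend to \<open>E2\<close>, so for
  \<open>E2 > 0\<close> the ratio of squared error to squared norm does too.\<close>

definition ENN where "ENN m d n \<gamma> \<tau> T = (\<Sum>u\<in>Pow {..<d} - {{}}. \<gamma> u * (\<integral>x. (qfN m n T u x)\<^sup>2 * ew \<tau> u x \<partial>lborel_on u))"
definition EN1 where "EN1 m d n \<gamma> \<tau> T = (\<Sum>u\<in>Pow {..<d} - {{}}. \<gamma> u * (\<integral>x. qfN m n T u x * qf n T u x * ew \<tau> u x \<partial>lborel_on u))"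

lemma ENN_tendsto: "(\<lambda>m. ENN m d n \<gamma> \<tau> T) \<longlonglongrightarrow> E2 d n \<gamma> \<tau> T"
proof -
  have "ENN m d n \<gamma> \<tau> T = (\<Sum>u\<in>Pow {..<d} - {{}}. \<gamma> u * (1 / (real n)\<^sup>2 *
      (\<Sum>k=1..n. \<Sum>l=1..n. \<Prod>j\<in>u. \<integral>x. kapN m (T k j) x * kapN m (T l j) x * exp (2 * \<tau> j * \<bar>x\<bar>) \<partial>lborel)))" for m
    unfolding ENN_def by (intro sum.cong refl) (auto simp: qfN_integral(2) finite_subset)
  then show ?thesis unfolding E2_def
    by (simp only:) (intro tendsto_intros kapN_integral_tendsto)
qed

lemma EN1_tendsto: "(\<lambda>m. EN1 m d n \<gamma> \<tau> T) \<longlonglongrightarrow> E2 d n \<gamma> \<tau> T"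
proof -
  have "EN1 m d n \<gamma> \<tau> T = (\<Sum>u\<in>Pow {..<d} - {{}}. \<gamma> u * (1 / (real n)\<^sup>2 *
      (\<Sum>k=1..n. \<Sum>l=1..n. \<Prod>j\<in>u. \<integral>x. kapN m (T k j) x * kap (T l j) x * exp (2 * \<tau> j * \<bar>x\<bar>) \<partial>lborel)))" for m
    unfolding EN1_def by (intro sum.cong refl) (auto simp: qfN_integral(3) finite_subset)
  then show ?thesis unfolding E2_def
    by (simp only:) (intro tendsto_intros kapN_integral_tendsto)
qed

lemma test_function_error:
  assumes \<gamma>: "\<And>u. \<gamma> u > 0" and n: "n \<ge> 1" and pos: "ENN m d n \<gamma> \<tau> T > 0"
  shows "\<exists>G \<in> W_space d \<gamma> \<tau>. W_norm d \<gamma> \<tau> G \<le> 1 \<and> (cub_err d n T G)\<^sup>2 = (EN1 m d n \<gamma> \<tau> T)\<^sup>2 / ENN m d n \<gamma> \<tau> T"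
proof -
  define L where "L = 1 / sqrt (ENN m d n \<gamma> \<tau> T)"
  obtain G where md: "mixed_differentiable d G"
    and int: "\<And>u x. u \<subseteq> {..<d} \<Longrightarrow> integrable (lborel_on ({..<d} - u)) (W_integrand d u G x)"
    and WM: "\<And>u x. u \<subseteq> {..<d} \<Longrightarrow> WM d u G x = (if u = {} then 0 else L * \<gamma> u * qfN m n T u x * ew \<tau> u x)"
    using test_function[of d L \<gamma> m n T \<tau>] by blast
  have e: "(WM d u G x)\<^sup>2 * pw \<tau> u x = (if u = {} then 0 else L\<^sup>2 * (\<gamma> u)\<^sup>2 * ((qfN m n T u x)\<^sup>2 * ew \<tau> u x))" if u: "u \<subseteq> {..<d}" for u x
  proof -
    have "(L * \<gamma> u * qfN m n T u x * ew \<tau> u x)\<^sup>2 * pw \<tau> u x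
      = L\<^sup>2 * (\<gamma> u)\<^sup>2 * ((qfN m n T u x)\<^sup>2 * ew \<tau> u x) * (pw \<tau> u x * ew \<tau> u x)"
      by (simp add: power2_eq_square mult_ac)
    then show ?thesis by (simp add: WM[OF u] pw_ew)
  qed
  have iN: "integrable (lborel_on u) (\<lambda>x. (WM d u G x)\<^sup>2 * pw \<tau> u x)" if u: "u \<subseteq> {..<d}" for u
    unfolding e[OF u] using qfN_integral(1)[of u m n T \<tau>] u finite_subset by (cases "u = {}") auto
  have N: "N2 d \<gamma> \<tau> G = L\<^sup>2 * ENN m d n \<gamma> \<tau> T"
  proof -
    have "N2 d \<gamma> \<tau> G = (\<Sum>u\<in>Pow {..<d}. if u = {} then 0 else L\<^sup>2 * (\<gamma> u * (\<integral>x. (qfN m n T u x)\<^sup>2 * ew \<tau> u x \<partial>lborel_on u)))"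
      unfolding N2_def
    proof (intro sum.cong refl)
      fix u assume "u \<in> Pow {..<d}"
      then have u: "u \<subseteq> {..<d}" by simp
      show "1 / \<gamma> u * (\<integral>x. (WM d u G x)\<^sup>2 * pw \<tau> u x \<partial>lborel_on u)
        = (if u = {} then 0 else L\<^sup>2 * (\<gamma> u * (\<integral>x. (qfN m n T u x)\<^sup>2 * ew \<tau> u x \<partial>lborel_on u)))"
        unfolding e[OF u] using \<gamma>[of u] by (simp add: power2_eq_square)
    qed
    also have "\<dots> = (\<Sum>u\<in>Pow {..<d} - {{}}. L\<^sup>2 * (\<gamma> u * (\<integral>x. (qfN m n T u x)\<^sup>2 * ew \<tau> u x \<partial>lborel_on u)))"
      by (subst sum.remove[of _ "{}"]) (auto intro!: sum.cong)
    finally show ?thesis by (simp add: ENN_def sum_distrib_left)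
  qed
  also have "\<dots> = 1" using pos by (simp add: L_def power_divide)
  finally have W1: "W_norm d \<gamma> \<tau> G = 1"
    using W_norm_eq_N2[of \<gamma>, OF \<gamma> iN] by simp
  have GW: "G \<in> W_space d \<gamma> \<tau>"
    unfolding W_space_def using md int W1 by (auto intro!: AE_I2)
  have "cub_err d n T G = - (\<Sum>u\<in>Pow {..<d} - {{}}. L * (\<gamma> u * (\<integral>x. qfN m n T u x * qf n T u x * ew \<tau> u x \<partial>lborel_on u)))"
    unfolding cub_err_eq[OF \<gamma> GW n]
  proof (intro arg_cong[where f=uminus] sum.cong refl)
    fix u assume u: "u \<in> Pow {..<d} - {{}}"
    then have eq: "qf n T u x * WM d u G x = L * \<gamma> u * (qfN m n T u x * qf n T u x * ew \<tau> u x)" for x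
      by (simp add: WM mult_ac)
    show "(\<integral>x. qf n T u x * WM d u G x \<partial>lborel_on u) = L * (\<gamma> u * (\<integral>x. qfN m n T u x * qf n T u x * ew \<tau> u x \<partial>lborel_on u))"
      by (simp only: eq integral_mult_right_zero mult.assoc)
  qed
  then have "cub_err d n T G = - (L * EN1 m d n \<gamma> \<tau> T)" by (simp add: EN1_def sum_distrib_left)
  then have "(cub_err d n T G)\<^sup>2 = (EN1 m d n \<gamma> \<tau> T)\<^sup>2 / ENN m d n \<gamma> \<tau> T"
    using pos by (simp add: L_def power_mult_distrib power_divide)
  then show ?thesis using GW W1 by (intro bexI[of _ G] conjI) simp_all
qed

lemma worst_case_error_eq:
  assumes \<gamma>: "\<And>u. \<gamma> u > 0" and n: "n \<ge> 1"
  shows "(SUP G\<in>{G \<in> W_space d \<gamma> \<tau>. W_norm d \<gamma> \<tau> G \<le> 1}. ennreal (\<bar>cub_err d n T G\<bar>\<^sup>2)) = ennreal (E2 d n \<gamma> \<tau> T)"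
    (is "?S = _")
proof (rule antisym)
  note E0 = E2_nonneg[of \<gamma> d n \<tau> T, OF \<gamma>]
  show "?S \<le> ennreal (E2 d n \<gamma> \<tau> T)"
  proof (rule SUP_least)
    fix G assume "G \<in> {G \<in> W_space d \<gamma> \<tau>. W_norm d \<gamma> \<tau> G \<le> 1}"
    then have G: "G \<in> W_space d \<gamma> \<tau>" "W_norm d \<gamma> \<tau> G \<le> 1" by auto
    have "ennreal (sqrt (N2 d \<gamma> \<tau> G)) \<le> 1"
      using W_norm_eq_N2[of \<gamma>, OF \<gamma> W_spaceD(3)[OF \<gamma> G(1)]] G(2) by simp
    then have "N2 d \<gamma> \<tau> G \<le> 1" by (simp add: ennreal_le_1)
    then have "(cub_err d n T G)\<^sup>2 \<le> 1 * E2 d n \<gamma> \<tau> T"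
      using cub_err_bound[OF \<gamma> G(1) n, of T] E0 by (meson mult_right_mono order_trans)
    then show "ennreal (\<bar>cub_err d n T G\<bar>\<^sup>2) \<le> ennreal (E2 d n \<gamma> \<tau> T)" by (intro ennreal_leI) simp
  qed
  show "ennreal (E2 d n \<gamma> \<tau> T) \<le> ?S"
  proof (cases "E2 d n \<gamma> \<tau> T = 0")
    case False
    then have pos: "E2 d n \<gamma> \<tau> T > 0" using E0 by simp
    have "(\<lambda>m. (EN1 m d n \<gamma> \<tau> T)\<^sup>2 / ENN m d n \<gamma> \<tau> T) \<longlonglongrightarrow> (E2 d n \<gamma> \<tau> T)\<^sup>2 / E2 d n \<gamma> \<tau> T"
      by (intro tendsto_intros EN1_tendsto ENN_tendsto False)
    then have "(\<lambda>m. (EN1 m d n \<gamma> \<tau> T)\<^sup>2 / ENN m d n \<gamma> \<tau> T) \<longlonglongrightarrow> E2 d n \<gamma> \<tau> T"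
      by (simp add: power2_eq_square)
    then have lim: "(\<lambda>m. ennreal ((EN1 m d n \<gamma> \<tau> T)\<^sup>2 / ENN m d n \<gamma> \<tau> T)) \<longlonglongrightarrow> ennreal (E2 d n \<gamma> \<tau> T)"
      by (rule tendsto_ennrealI)
    \<comment> \<open>Normalizing the test function requires a nonzero norm, which holds only from
      some \<open>m\<close> on; the supremum is approached along these \<open>m\<close>.\<close>
    have "eventually (\<lambda>m. ENN m d n \<gamma> \<tau> T > 0) sequentially"
      using order_tendstoD(1)[OF ENN_tendsto pos] .
    then have "eventually (\<lambda>m. ennreal ((EN1 m d n \<gamma> \<tau> T)\<^sup>2 / ENN m d n \<gamma> \<tau> T) \<le> ?S) sequentially"
    proof eventually_elim
      case (elim m)
      obtain G where "G \<in> W_space d \<gamma> \<tau>" "W_norm d \<gamma> \<tau> G \<le> 1" "(cub_err d n T G)\<^sup>2 = (EN1 m d n \<gamma> \<tau> T)\<^sup>2 / ENN m d n \<gamma> \<tau> T"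
        using test_function_error[of \<gamma>, OF \<gamma> n elim] by blast
      then show ?case by (intro SUP_upper2[of G]) auto
    qed
    then show ?thesis by (intro tendsto_upperbound[OF lim]) auto
  qed simp
qed

section \<open>Discrete Fourier coefficients of the shift-averaged kernel\<close>

text \<open>The standard additive character modulo \<open>n\<close>, on integers so that differences
  of indices may be negative.\<close>

definition en :: "nat \<Rightarrow> int \<Rightarrow> complex" where
  "en n k = cis (2 * pi * real_of_int k / real n)"

lemma en_add: "en n (k + l) = en n k * en n l"
  by (simp add: en_def cis_mult add_divide_distrib distrib_left)

lemma en_0 [simp]: "en n 0 = 1" by (simp add: en_def)

lemma cnj_en: "cnj (en n k) = en n (- k)" by (simp add: en_def cis_cnj)

lemma norm_en [simp]: "norm (en n k) = 1" by (simp add: en_def)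

lemma en_power: "en n (int m * k) = en n k ^ m"
proof (induction m)
  case (Suc m)
  have "int (Suc m) * k = k + int m * k" by (simp add: algebra_simps)
  then show ?case using Suc by (simp only: en_add power_Suc)
qed simp

lemma en_eq_1_iff: "n \<ge> 1 \<Longrightarrow> en n k = 1 \<longleftrightarrow> int n dvd k"
proof -
  assume n: "n \<ge> 1"
  have "en n k = 1 \<longleftrightarrow> (\<exists>j::int. 2 * pi * real_of_int k / real n = 2 * pi * real_of_int j)"
  proof -
    have "cis x = 1 \<longleftrightarrow> cos x = 1" for x
      using sin_squared_eq[of x] by (auto simp: complex_eq_iff)
    then show ?thesis unfolding en_def cos_one_2pi_int by (simp only: mult_ac)
  qed
  also have "\<dots> \<longleftrightarrow> (\<exists>j::int. k = int n * j)"
  proof -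
    have "2 * pi * real_of_int k / real n = 2 * pi * real_of_int j \<longleftrightarrow> real_of_int k = real_of_int (int n * j)" for j
      using n by (auto simp: field_simps)
    then show ?thesis by (simp only: of_int_eq_iff)
  qed
  finally show ?thesis by (auto simp: dvd_def)
qed

lemma sum_en:
  assumes n: "n \<ge> 1"
  shows "(\<Sum>h<n. en n (int h * k)) = (if int n dvd k then of_nat n else 0)"
proof (cases "int n dvd k")
  case True
  then have "en n k = 1" using en_eq_1_iff[OF n] by simp
  then show ?thesis using True by (simp add: en_power)
next
  case False
  then have ne: "en n k \<noteq> 1" using en_eq_1_iff[OF n] by simp
  have "en n k ^ n = 1" using en_eq_1_iff[OF n, of "int n * k"] by (simp add: en_power)
  then show ?thesis using ne False by (simp add: en_power sum_gp_strict)
qed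

lemma sum_periodic_int:
  fixes f :: "int \<Rightarrow> 'a::comm_monoid_add"
  assumes n: "n \<ge> 1" and per: "\<And>r. f (r mod int n) = f r"
  shows "(\<Sum>r\<in>{0..<int n}. f (r + t)) = (\<Sum>r\<in>{0..<int n}. f r)"
proof (rule sum.reindex_bij_witness[of _ "\<lambda>r. (r - t) mod int n" "\<lambda>r. (r + t) mod int n"])
  fix r assume "r \<in> {0..<int n}"
  then show "((r + t) mod int n - t) mod int n = r" "((r - t) mod int n + t) mod int n = r"
    by (simp_all add: mod_diff_left_eq mod_add_left_eq)
qed (use n per in auto)

section \<open>The discrete Fourier transform and autocorrelations\<close>

definition dft :: "nat \<Rightarrow> (int \<Rightarrow> real) \<Rightarrow> nat \<Rightarrow> complex" where
  "dft n a h = 1 / of_nat n * (\<Sum>r\<in>{0..<int n}. of_real (a r) * en n (- (int h * r)))"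

text \<open>The discrete Wiener-Khinchin theorem. Orthogonality of the characters collapses the
  double sum over \<open>r\<close> and \<open>s\<close> to one diagonal. The squared moduli are
  nonnegative, which the later step from a power of a sum to a sum of powers relies on.\<close>

lemma autocorrelation_dft:
  assumes n: "n \<ge> 1" and per: "\<And>r. a (r mod int n) = a r"
  shows "complex_of_real (1 / real n * (\<Sum>r\<in>{0..<int n}. a (p + r) * a (q + r)))
    = (\<Sum>h<n. of_real ((cmod (dft n a h))\<^sup>2) * en n (int h * (p - q)))"
proof -
  let ?I = "{0..<int n}"
  have inner: "(\<Sum>s\<in>?I. if int n dvd (s - t) then f s else 0) = f (t mod int n)" for t and f :: "int \<Rightarrow> complex"
  proof -
    have "int n dvd (s - t) \<longleftrightarrow> s = t mod int n" if "s \<in> ?I" for s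
      using that by (simp add: mod_eq_dvd_iff[symmetric])
    then have "(\<Sum>s\<in>?I. if int n dvd (s - t) then f s else 0) = (\<Sum>s\<in>?I. if s = t mod int n then f s else 0)"
      by (intro sum.cong) auto
    then show ?thesis using n by simp
  qed
  have "(\<Sum>h<n. of_real ((cmod (dft n a h))\<^sup>2) * en n (int h * (p - q)))
    = (\<Sum>h<n. 1 / (of_nat n)\<^sup>2 * (\<Sum>r\<in>?I. \<Sum>s\<in>?I. of_real (a r) * of_real (a s) * en n (int h * (s - (r - p + q)))))"
  proof (intro sum.cong refl)
    fix h
    have "of_real ((cmod (dft n a h))\<^sup>2) = dft n a h * cnj (dft n a h)"
      by (simp add: complex_norm_square[symmetric])
    also have "cnj (dft n a h) = 1 / of_nat n * (\<Sum>s\<in>?I. of_real (a s) * en n (int h * s))"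
      by (simp add: dft_def cnj_en)
    finally have "of_real ((cmod (dft n a h))\<^sup>2)
      = 1 / (of_nat n)\<^sup>2 * (\<Sum>r\<in>?I. \<Sum>s\<in>?I. (of_real (a r) * en n (- (int h * r))) * (of_real (a s) * en n (int h * s)))"
      by (simp add: dft_def power2_eq_square sum_product)
    then have "of_real ((cmod (dft n a h))\<^sup>2) * en n (int h * (p - q)) = 1 / (of_nat n)\<^sup>2 *
       (\<Sum>r\<in>?I. \<Sum>s\<in>?I. ((of_real (a r) * en n (- (int h * r))) * (of_real (a s) * en n (int h * s))) * en n (int h * (p - q)))"
      by (simp only: sum_distrib_right mult.assoc)
    moreover have "((of_real (a r) * en n (- (int h * r))) * (of_real (a s) * en n (int h * s))) * en n (int h * (p - q))
       = of_real (a r) * of_real (a s) * en n (int h * (s - (r - p + q)))" for r s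
    proof -
      have "int h * (s - (r - p + q)) = - (int h * r) + int h * s + int h * (p - q)" by (simp add: algebra_simps)
      then show ?thesis by (simp only: en_add mult_ac)
    qed
    ultimately show "of_real ((cmod (dft n a h))\<^sup>2) * en n (int h * (p - q))
      = 1 / (of_nat n)\<^sup>2 * (\<Sum>r\<in>?I. \<Sum>s\<in>?I. of_real (a r) * of_real (a s) * en n (int h * (s - (r - p + q))))"
      by simp
  qed
  also have "\<dots> = 1 / (of_nat n)\<^sup>2 * (\<Sum>h<n. \<Sum>r\<in>?I. \<Sum>s\<in>?I. of_real (a r) * of_real (a s) * en n (int h * (s - (r - p + q))))"
    by (rule sum_distrib_left[symmetric])
  also have "(\<Sum>h<n. \<Sum>r\<in>?I. \<Sum>s\<in>?I. complex_of_real (a r) * of_real (a s) * en n (int h * (s - (r - p + q))))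
    = (\<Sum>r\<in>?I. \<Sum>s\<in>?I. \<Sum>h<n. of_real (a r) * of_real (a s) * en n (int h * (s - (r - p + q))))"
    by (subst sum.swap) (intro sum.cong refl sum.swap)
  also have "\<dots> = (\<Sum>r\<in>?I. \<Sum>s\<in>?I. if int n dvd (s - (r - p + q)) then of_nat n * (of_real (a r) * of_real (a s)) else 0)"
    unfolding sum_distrib_left[symmetric] sum_en[OF n] by (intro sum.cong refl) simp
  also have "\<dots> = (\<Sum>r\<in>?I. of_nat n * (of_real (a r) * of_real (a (r - p + q))))"
    unfolding inner per ..
  also have "1 / (of_nat n)\<^sup>2 * (\<Sum>r\<in>?I. of_nat n * (complex_of_real (a r) * of_real (a (r - p + q)))) = complex_of_real (1 / real n * (\<Sum>r\<in>?I. a r * a (r - p + q)))"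
    using n by (simp add: sum_distrib_left[symmetric] power2_eq_square)
  also have "(\<Sum>r\<in>?I. a r * a (r - p + q)) = (\<Sum>r\<in>?I. a (r + p) * a ((r + p) - p + q))"
  proof (rule sum_periodic_int[OF n, symmetric])
    fix r
    have "a (r mod int n - p + q) = a ((r mod int n - p + q) mod int n)" by (rule per[symmetric])
    also have "(r mod int n - p + q) mod int n = (r - p + q) mod int n"
      by (metis diff_add_eq mod_add_left_eq add_diff_eq diff_conv_add_uminus)
    finally show "a (r mod int n) * a (r mod int n - p + q) = a r * a (r - p + q)" by (simp add: per)
  qed
  finally show ?thesis by (simp add: add.commute)
qed

text \<open>Jordan's inequality with half its slope. Up to \<open>pi / 6\<close>,
  \<open>sin x - x * cos x\<close> is nonnegative and the cosine is at least 1/2; beyond, the sine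
  is at least 1/2 and \<open>x / pi\<close> at most 1/2.\<close>

lemma sin_ge: assumes "0 \<le> x" "x \<le> pi / 2" shows "x / pi \<le> sin x"
proof (cases "x \<le> pi / 6")
  case True
  have "sin 0 - 0 * cos 0 \<le> sin x - x * cos x"
  proof (rule DERIV_nonneg_imp_nondecreasing[OF assms(1)])
    fix y assume y: "0 \<le> y" "y \<le> x"
    have "((\<lambda>x. sin x - x * cos x) has_real_derivative y * sin y) (at y)"
      by (auto intro!: derivative_eq_intros)
    moreover have "0 \<le> y * sin y" using y assms by (intro mult_nonneg_nonneg sin_ge_zero) auto
    ultimately show "\<exists>z. ((\<lambda>x. sin x - x * cos x) has_real_derivative z) (at y) \<and> 0 \<le> z" by blast
  qed
  moreover have "cos (pi / 3) \<le> cos x" using True assms by (intro cos_monotone_0_pi_le) auto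
  then have "x * (1 / 2) \<le> x * cos x" using assms by (intro mult_left_mono) (simp_all add: cos_60)
  moreover have "x / pi \<le> x * (1 / 2)" using mult_right_mono[of 2 pi x] assms pi_gt3 by (simp add: field_simps)
  ultimately show ?thesis by (simp only: sin_zero mult_zero_left diff_zero)
next
  case False
  have "sin (pi / 6) \<le> sin x" using False assms by (intro sin_monotone_2pi_le) auto
  moreover have "x / pi \<le> 1 / 2" using assms by (simp add: field_simps)
  ultimately show ?thesis unfolding sin_30 by linarith
qed

text \<open>The size of a frequency modulo \<open>n\<close>; the zero frequency aliases with the multiples of \<open>n\<close>.\<close>

definition fsz :: "nat \<Rightarrow> nat \<Rightarrow> nat" where
  "fsz n h = (if h = 0 then n else min h (n - h))"

lemma fsz_pos: "n \<ge> 1 \<Longrightarrow> h < n \<Longrightarrow> fsz n h \<ge> 1" by (auto simp: fsz_def)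

text \<open>The chord has length \<open>2 * sin (pi * h / n)\<close>. Replacing \<open>h\<close> by
  \<open>n - h\<close> leaves the sine unchanged, which folds the angle into the range of
  \<open>sin_ge\<close>.\<close>

lemma norm_1_minus_en:
  assumes "0 < h" "h < n"
  shows "2 * real (fsz n h) / real n \<le> norm (1 - en n (- int h))"
proof -
  define y where "y = pi * real h / real n"
  have y: "0 < y" "y < pi" using assms by (auto simp: y_def field_simps)
  have "(norm (1 - en n (- int h)))\<^sup>2 = (2 * sin y)\<^sup>2"
  proof -
    have e: "2 * pi * real_of_int (- int h) / real n = - (2 * y)" by (simp add: y_def)
    have "(norm (1 - en n (- int h)))\<^sup>2 = (1 - cos (2 * y))\<^sup>2 + (sin (2 * y))\<^sup>2"
      unfolding en_def e cmod_power2 by simp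
    also have "\<dots> = 1 - 2 * cos (2 * y) + ((cos (2 * y))\<^sup>2 + (sin (2 * y))\<^sup>2)" by (simp add: power2_diff)
    also have "\<dots> = 2 - 2 * cos (2 * y)" by simp
    also have "\<dots> = (2 * sin y)\<^sup>2" by (simp add: cos_double_sin power2_eq_square)
    finally show ?thesis .
  qed
  then have nn: "norm (1 - en n (- int h)) = 2 * sin y"
    using sin_gt_zero[OF y] by (subst (asm) power2_eq_iff_nonneg) auto
  have "real (fsz n h) / real n \<le> sin y"
  proof (cases "h \<le> n - h")
    case True
    then have "y \<le> pi / 2" using assms by (auto simp: y_def field_simps of_nat_diff)
    then show ?thesis using sin_ge[of y] y assms True by (simp add: fsz_def y_def min_absorb1)
  next
    case False
    then have "pi - y \<le> pi / 2" using assms by (auto simp: y_def field_simps of_nat_diff)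
    then have "(pi - y) / pi \<le> sin (pi - y)" using y by (intro sin_ge) auto
    moreover have "(pi - y) / pi = real (n - h) / real n" using assms by (simp add: y_def field_simps of_nat_diff)
    ultimately show ?thesis using assms False by (simp add: fsz_def min_absorb2)
  qed
  then show ?thesis unfolding nn by simp
qed

text \<open>Geometric interpolation between two bounds of the same number, applied with tail
  probabilities for \<open>A\<close> and a reciprocal frequency for \<open>B\<close>.\<close>

lemma square_le_powr:
  fixes x A B q :: real
  assumes "0 \<le> x" "x \<le> A" "x \<le> B" "0 < q" "q < 2"
  shows "x\<^sup>2 \<le> A powr q * B powr (2 - q)"
proof (cases "x = 0")
  case False
  then have "x\<^sup>2 = x powr q * x powr (2 - q)" using assms by (simp add: powr_add[symmetric] powr_numeral)
  also have "\<dots> \<le> A powr q * B powr (2 - q)" using assms by (intro mult_mono powr_mono2) auto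
  finally show ?thesis .
qed simp

text \<open>The kernel \<open>kap\<close> in the unit cube: \<open>kap (Phi_inv v) x = hc (ncdf x) v\<close>.\<close>

definition hc :: "real \<Rightarrow> real \<Rightarrow> real" where
  "hc c v = (if c < v then 1 else 0) - (1 - c)"

lemma kap_Phi_inv: "0 < v \<Longrightarrow> v < 1 \<Longrightarrow> kap (Phi_inv v) x = hc (ncdf x) v"
  by (simp add: kap_def hc_def less_Phi_inv_iff)

lemma abs_hc_le: "0 < c \<Longrightarrow> c < 1 \<Longrightarrow> \<bar>hc c v\<bar> \<le> 1" by (auto simp: hc_def)

definition pts :: "nat \<Rightarrow> real \<Rightarrow> int \<Rightarrow> real" where
  "pts n \<Delta> r = frac (real_of_int r / real n + \<Delta>)"

lemma pts_mod: "n \<ge> 1 \<Longrightarrow> pts n \<Delta> (r mod int n) = pts n \<Delta> r"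
proof -
  assume n: "n \<ge> 1"
  have "real_of_int r / real n = real_of_int (r mod int n) / real n + real_of_int (r div int n)"
  proof -
    have "real_of_int r = real_of_int (r div int n * int n + r mod int n)" by (simp only: div_mult_mod_eq)
    also have "\<dots> = real_of_int (r div int n) * real n + real_of_int (r mod int n)"
      by (simp only: of_int_add of_int_mult of_int_of_nat_eq)
    finally show ?thesis using n by (simp add: field_simps)
  qed
  then have "pts n \<Delta> r = frac ((real_of_int (r mod int n) / real n + \<Delta>) + real_of_int (r div int n))"
    by (simp add: pts_def add_ac)
  then show ?thesis by (simp only: frac_add_of_int_right pts_def)
qed

definition Ncnt :: "nat \<Rightarrow> real \<Rightarrow> real \<Rightarrow> real" where
  "Ncnt n c \<Delta> = (\<Sum>r\<in>{0..<int n}. if pts n \<Delta> r \<le> c then 1 else 0)"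

text \<open>The sequence is a step of height 1 after \<open>N\<close> places. At a nonzero frequency
  its constant part drops out and a geometric sum over \<open>N\<close> terms remains: bounded by
  \<open>N\<close>, by \<open>n - N\<close> because the full sum vanishes, and by
  \<open>2 / cmod (1 - z)\<close> in closed form. At frequency 0 the coefficient is
  \<open>c - N / n\<close>, of modulus at most \<open>1 / n\<close>.\<close>

lemma dft_bound_aux:
  assumes n: "n \<ge> 1" and N: "N \<le> n" and h: "h < n" and q: "0 < q" "q < 1"
    and c: "\<bar>real n * c - real N\<bar> \<le> 1" "0 < c" "c < 1"
    and a: "\<And>m. m < n \<Longrightarrow> a m = (if m < N then c - 1 else c)"
  shows "(cmod (1 / of_nat n * (\<Sum>m<n. of_real (a m) * en n (- (int h * int m)))))\<^sup>2
      \<le> (c powr q + (real N / real n) powr q) * real (fsz n h) powr (q - 2)" (is ?A)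
    and "(cmod (1 / of_nat n * (\<Sum>m<n. of_real (a m) * en n (- (int h * int m)))))\<^sup>2
      \<le> ((1 - c) powr q + (1 - real N / real n) powr q) * real (fsz n h) powr (q - 2)" (is ?B)
proof -
  let ?S = "1 / of_nat n * (\<Sum>m<n. of_real (a m) * en n (- (int h * int m)))"
  let ?z = "en n (- int h)"
  have zp: "en n (- (int h * int m)) = ?z ^ m" for m
    using en_power[of n m "- int h"] by (simp add: mult.commute)
  have split: "(\<Sum>m<n. of_real (a m) * ?z ^ m) = of_real c * (\<Sum>m<n. ?z ^ m) - (\<Sum>m<N. ?z ^ m)"
  proof -
    have "(\<Sum>m<n. of_real (a m) * ?z ^ m) = (\<Sum>m<n. of_real c * ?z ^ m - (if m < N then ?z ^ m else 0))"
      by (intro sum.cong refl) (auto simp: a algebra_simps)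
    also have "\<dots> = of_real c * (\<Sum>m<n. ?z ^ m) - (\<Sum>m<n. if m < N then ?z ^ m else 0)"
      by (simp add: sum_subtractf sum_distrib_left)
    also have "(\<Sum>m<n. if m < N then ?z ^ m else 0) = (\<Sum>m<N. ?z ^ m)"
      using N by (intro sum.mono_neutral_cong_right) auto
    finally show ?thesis .
  qed
  have szp: "1 \<le> fsz n h" by (rule fsz_pos[OF n h])
  have pe: "(1 / real (fsz n h)) powr (2 - q) = real (fsz n h) powr (q - 2)"
    using szp by (simp add: powr_divide powr_minus_divide[symmetric])
  \<comment> \<open>The witnesses differ: \<open>N / n\<close> and its complement at nonzero
    frequencies, but maxima with \<open>c\<close> and \<open>1 - c\<close> at frequency 0. Hence
    both powers appear in the common bound.\<close>
  have main: "\<exists>A B. cmod ?S \<le> A \<and> A powr q \<le> c powr q + (real N / real n) powr q \<and>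
      cmod ?S \<le> B \<and> B powr q \<le> (1 - c) powr q + (1 - real N / real n) powr q \<and> cmod ?S \<le> 1 / real (fsz n h)"
  proof (cases "h = 0")
    case True
    have Nn: "real N / real n \<le> 1" "0 \<le> real N / real n" using N n by auto
    have "?S = of_real (c - real N / real n)" unfolding zp split using True n by (simp add: field_simps)
    then have S: "cmod ?S = \<bar>c - real N / real n\<bar>" by (simp only: norm_of_real)
    have "\<bar>c - real N / real n\<bar> = \<bar>real n * c - real N\<bar> / real n" using n by (simp add: abs_if field_simps)
    also have "\<dots> \<le> 1 / real n" using c n by (intro divide_right_mono) auto
    finally have "cmod ?S \<le> 1 / real (fsz n h)" using S True by (simp add: fsz_def)
    moreover have "max c (real N / real n) powr q \<le> c powr q + (real N / real n) powr q"
      by (simp add: max_def)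
    moreover have "max (1 - c) (1 - real N / real n) powr q \<le> (1 - c) powr q + (1 - real N / real n) powr q"
      by (simp add: max_def)
    moreover have "cmod ?S \<le> max c (real N / real n)" "cmod ?S \<le> max (1 - c) (1 - real N / real n)"
      unfolding S using c Nn by linarith+
    ultimately show ?thesis by blast
  next
    case False
    then have hp: "0 < h" by simp
    have low: "2 * real (fsz n h) / real n \<le> norm (1 - ?z)" by (rule norm_1_minus_en[OF hp h])
    have lp: "0 < 2 * real (fsz n h) / real n" using szp n by simp
    have ne: "?z \<noteq> 1" using low lp by auto
    have zn: "?z ^ n = 1" using en_eq_1_iff[OF n, of "int n * (- int h)"] unfolding en_power by simp
    have full: "(\<Sum>m<n. ?z ^ m) = 0" using ne zn by (simp add: sum_gp_strict)
    have S: "?S = - (1 / of_nat n) * (\<Sum>m<N. ?z ^ m)" unfolding zp split full by simp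
    have nS: "cmod ?S = 1 / real n * cmod (\<Sum>m<N. ?z ^ m)" unfolding S by (simp add: norm_mult norm_divide)
    have "cmod (\<Sum>m<N. ?z ^ m) \<le> (\<Sum>m<N. cmod (?z ^ m))" by (rule norm_sum)
    then have "cmod (\<Sum>m<N. ?z ^ m) \<le> real N" by (simp add: norm_power)
    then have 1: "cmod ?S \<le> real N / real n" unfolding nS using n by (simp add: field_simps)
    have "(\<Sum>m<n. ?z ^ m) = (\<Sum>m<N. ?z ^ m) + (\<Sum>m=N..<n. ?z ^ m)"
      using N by (simp add: lessThan_atLeast0 sum.atLeastLessThan_concat)
    then have "cmod (\<Sum>m<N. ?z ^ m) = cmod (\<Sum>m=N..<n. ?z ^ m)"
      using full by (metis add_eq_0_iff norm_minus_cancel)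
    also have "\<dots> \<le> (\<Sum>m=N..<n. cmod (?z ^ m))" by (rule norm_sum)
    also have "\<dots> = real n - real N" using N by (simp add: norm_power of_nat_diff)
    finally have 2: "cmod ?S \<le> 1 - real N / real n" unfolding nS using n by (simp add: field_simps)
    have "cmod (\<Sum>m<N. ?z ^ m) = cmod (1 - ?z ^ N) / cmod (1 - ?z)"
      using ne by (simp add: sum_gp_strict norm_divide)
    also have "\<dots> \<le> 2 / cmod (1 - ?z)"
    proof (rule divide_right_mono)
      show "cmod (1 - ?z ^ N) \<le> 2" using norm_triangle_ineq4[of 1 "?z ^ N"] by (simp add: norm_power)
    qed simp
    also have "\<dots> \<le> 2 / (2 * real (fsz n h) / real n)" using low lp by (intro divide_left_mono mult_pos_pos) auto
    finally have 3: "cmod ?S \<le> 1 / real (fsz n h)" unfolding nS using n szp by (simp add: field_simps)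
    show ?thesis
      by (rule exI[of _ "real N / real n"], rule exI[of _ "1 - real N / real n"]) (use 1 2 3 c in simp)
  qed
  then obtain A B where A: "cmod ?S \<le> A" "A powr q \<le> c powr q + (real N / real n) powr q"
    and B: "cmod ?S \<le> B" "B powr q \<le> (1 - c) powr q + (1 - real N / real n) powr q"
    and C: "cmod ?S \<le> 1 / real (fsz n h)" by blast
  have "(cmod ?S)\<^sup>2 \<le> A powr q * (1 / real (fsz n h)) powr (2 - q)"
    using A C q by (intro square_le_powr) auto
  also have "\<dots> \<le> (c powr q + (real N / real n) powr q) * (1 / real (fsz n h)) powr (2 - q)"
    using A by (intro mult_right_mono) auto
  finally show ?A unfolding pe .
  have "(cmod ?S)\<^sup>2 \<le> B powr q * (1 / real (fsz n h)) powr (2 - q)"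
    using B C q by (intro square_le_powr) auto
  also have "\<dots> \<le> ((1 - c) powr q + (1 - real N / real n) powr q) * (1 / real (fsz n h)) powr (2 - q)"
    using B by (intro mult_right_mono) auto
  finally show ?B unfolding pe .
qed

section \<open>The uniform shift of a one-dimensional grid\<close>

abbreviation "U01 \<equiv> uniform_measure lborel {0<..<1::real}"

interpretation U01: prob_space U01
  by (rule prob_space_uniform_measure) auto

lemma nn_integral_U01:
  assumes "f \<in> borel_measurable borel"
  shows "(\<integral>\<^sup>+x. f x \<partial>U01) = (\<integral>\<^sup>+x. f x * indicator {0<..<1} x \<partial>lborel)"
  using assms by (subst nn_integral_uniform_measure) (auto simp: divide_ennreal_def)

lemma AE_U01: "AE v in U01. 0 < v \<and> v < 1"
  by (rule AE_uniform_measureI) auto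

lemma measurable_frac [measurable]: "(frac :: real \<Rightarrow> real) \<in> borel_measurable borel"
  unfolding frac_def by measurable

text \<open>Rotation invariance of the circle. The interval is cut where the fractional part wraps
  around; the two pieces are translated by \<open>b\<close> and \<open>b - 1\<close> and together
  cover the unit interval up to finitely many points.\<close>

lemma distr_U01_frac: "distr U01 borel (\<lambda>v. frac (a + v)) = U01"
proof (rule measure_eqI)
  fix A assume "A \<in> sets (distr U01 borel (\<lambda>v. frac (a + v)))"
  then have A [measurable]: "A \<in> sets borel" by simp
  define b where "b = frac a"
  have b: "0 \<le> b" "b < 1" by (auto simp: b_def frac_lt_1)
  have fr: "frac (a + v) = (if b + v < 1 then b + v else b + v - 1)" if "0 < v" "v < 1" for v
  proof -
    have "frac v = v" using that by (simp add: frac_eq)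
    then show ?thesis unfolding frac_add b_def by simp
  qed
  have "emeasure (distr U01 borel (\<lambda>v. frac (a + v))) A = (\<integral>\<^sup>+v. indicator A v \<partial>distr U01 borel (\<lambda>v. frac (a + v)))"
    by simp
  also have "\<dots> = (\<integral>\<^sup>+v. indicator A (frac (a + v)) \<partial>U01)"
    by (rule nn_integral_distr) measurable
  also have "\<dots> = (\<integral>\<^sup>+v. indicator A (frac (a + v)) * indicator {0<..<1} v \<partial>lborel)"
    by (rule nn_integral_U01) measurable
  also have "\<dots> = (\<integral>\<^sup>+v. indicator A (b + v) * indicator {b<..<1} (b + v) + indicator A (b - 1 + v) * indicator {0..<b} (b - 1 + v) \<partial>lborel)"
    by (rule nn_integral_cong) (use b fr in \<open>auto simp: indicator_def algebra_simps\<close>)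
  also have "\<dots> = (\<integral>\<^sup>+v. indicator A (b + v) * indicator {b<..<1} (b + v) \<partial>lborel)
      + (\<integral>\<^sup>+v. indicator A (b - 1 + v) * indicator {0..<b} (b - 1 + v) \<partial>lborel)"
    by (rule nn_integral_add) measurable
  also have "(\<integral>\<^sup>+v. indicator A (b + v) * indicator {b<..<1} (b + v) \<partial>lborel) = (\<integral>\<^sup>+v. indicator A v * indicator {b<..<1} v \<partial>lborel)"
    using nn_integral_real_affine[of "\<lambda>v. indicator A v * indicator {b<..<1} v :: ennreal" 1 b] by simp
  also have "(\<integral>\<^sup>+v. indicator A (b - 1 + v) * indicator {0..<b} (b - 1 + v) \<partial>lborel) = (\<integral>\<^sup>+v. indicator A v * indicator {0..<b} v \<partial>lborel)"
    using nn_integral_real_affine[of "\<lambda>v. indicator A v * indicator {0..<b} v :: ennreal" 1 "b - 1"] by simp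
  also have "(\<integral>\<^sup>+v. indicator A v * indicator {b<..<1} v \<partial>lborel) + (\<integral>\<^sup>+v. indicator A v * indicator {0..<b} v \<partial>lborel)
     = (\<integral>\<^sup>+v. indicator A v * indicator {b<..<1} v + indicator A v * indicator {0..<b} v \<partial>lborel)"
    by (rule nn_integral_add[symmetric]) measurable
  also have "\<dots> = (\<integral>\<^sup>+v. indicator A v * indicator {0<..<1} v \<partial>lborel)"
    by (rule nn_integral_cong_AE, use AE_lborel_singleton[of 0] AE_lborel_singleton[of b] in eventually_elim)
      (use b in \<open>auto simp: indicator_def\<close>)
  also have "\<dots> = (\<integral>\<^sup>+v. indicator A v \<partial>U01)" by (rule nn_integral_U01[symmetric]) measurable
  also have "\<dots> = emeasure U01 A" by simp
  finally show "emeasure (distr U01 borel (\<lambda>v. frac (a + v))) A = emeasure U01 A" .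
qed simp

lemma integral_U01_frac:
  fixes f :: "real \<Rightarrow> 'b::{banach, second_countable_topology}"
  assumes "f \<in> borel_measurable borel"
  shows "(\<integral>v. f (frac (a + v)) \<partial>U01) = (\<integral>v. f v \<partial>U01)"
proof -
  have "(\<integral>v. f v \<partial>distr U01 borel (\<lambda>v. frac (a + v))) = (\<integral>v. f (frac (a + v)) \<partial>U01)"
    using assms by (intro integral_distr) auto
  then show ?thesis by (simp add: distr_U01_frac)
qed

lemma AE_U01_frac: "AE v in U01. 0 < frac (a + v) \<and> frac (a + v) < 1"
proof -
  have "AE v in distr U01 borel (\<lambda>v. frac (a + v)). 0 < v \<and> v < 1"
    unfolding distr_U01_frac by (rule AE_U01)
  then show ?thesis by (subst (asm) AE_distr_iff) auto
qed

lemma measurable_hc [measurable (raw)]: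
  assumes [measurable]: "f \<in> borel_measurable M" "g \<in> borel_measurable M"
  shows "(\<lambda>x. hc (f x) (g x)) \<in> borel_measurable M"
  unfolding hc_def by measurable

lemma measurable_pts [measurable (raw)]:
  assumes [measurable]: "f \<in> borel_measurable M"
  shows "(\<lambda>x. pts n (f x) r) \<in> borel_measurable M"
  unfolding pts_def by measurable

lemma measure_U01: assumes "0 < c" "c < 1" shows "measure U01 {..c} = c" "measure U01 {c<..} = 1 - c"
proof -
  show 1: "measure U01 {..c} = c"
  proof -
    have "emeasure U01 {..c} = (\<integral>\<^sup>+v. indicator {..c} v * indicator {0<..<1} v \<partial>lborel)"
      by (subst nn_integral_U01[symmetric]) auto
    also have "\<dots> = (\<integral>\<^sup>+v. indicator {0<..c} v \<partial>lborel)"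
      by (rule nn_integral_cong) (use assms in \<open>auto simp: indicator_def\<close>)
    also have "\<dots> = ennreal c" using assms by simp
    finally show ?thesis using assms by (simp add: measure_def)
  qed
  have "measure U01 (space U01 - {..c}) = 1 - measure U01 {..c}" by (rule U01.prob_compl) auto
  moreover have "space U01 - {..c} = {c<..}" by auto
  ultimately show "measure U01 {c<..} = 1 - c" using 1 by simp
qed

lemma integral_hc_sq: assumes "0 < c" "c < 1" shows "(\<integral>v. (hc c v)\<^sup>2 \<partial>U01) = c * (1 - c)"
proof -
  have "(hc c v)\<^sup>2 = c\<^sup>2 * indicator {c<..} v + (1 - c)\<^sup>2 * indicator {..c} v" for v
    by (auto simp: hc_def indicator_def power2_eq_square algebra_simps)
  then have "(\<integral>v. (hc c v)\<^sup>2 \<partial>U01) = c\<^sup>2 * measure U01 {c<..} + (1 - c)\<^sup>2 * measure U01 {..c}"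
    by (simp add: U01.emeasure_eq_measure)
  also have "\<dots> = c\<^sup>2 * (1 - c) + (1 - c)\<^sup>2 * c" by (simp only: measure_U01[OF assms])
  also have "\<dots> = c * (1 - c)" by (simp add: power2_eq_square algebra_simps)
  finally show ?thesis .
qed

text \<open>Jensen's inequality for a concave power, obtained by integrating its tangent line at the
  mean. That the tangent lies above the graph is Young's inequality.\<close>

lemma (in prob_space) expectation_powr_le:
  fixes X :: "'a \<Rightarrow> real" and c q :: real
  assumes [measurable]: "X \<in> borel_measurable M" and X: "\<And>x. 0 \<le> X x" "\<And>x. X x \<le> 1"
    and c: "expectation X = c" "c > 0" and q: "0 < q" "q < 1"
  shows "expectation (\<lambda>x. X x powr q) \<le> c powr q"
proof -
  have iX: "integrable M X" by (rule integrable_const_bound[of _ 1]) (auto intro!: AE_I2 simp: X)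
  have "X x powr q \<le> q * c powr (q - 1) * X x + (1 - q) * c powr q" for x
  proof (cases "X x = 0")
    case False
    then have "X x > 0" using X(1)[of x] by simp
    then have "X x powr q * c powr (1 - q) \<le> q * X x + (1 - q) * c"
      using q c by (intro Youngs_inequality_0) auto
    then have "(X x powr q * c powr (1 - q)) * c powr (q - 1) \<le> (q * X x + (1 - q) * c) * c powr (q - 1)"
      by (rule mult_right_mono) simp
    moreover have "c powr (1 - q) * c powr (q - 1) = 1" "c * c powr (q - 1) = c powr q"
      using c powr_add[of c 1 "q - 1"] by (simp_all add: powr_add[symmetric])
    moreover have "(q * X x + (1 - q) * c) * c powr (q - 1) = q * c powr (q - 1) * X x + (1 - q) * (c * c powr (q - 1))"
      by (simp add: algebra_simps)
    ultimately show ?thesis by (simp add: mult.assoc)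
  qed (use q in simp)
  then have "expectation (\<lambda>x. X x powr q) \<le> expectation (\<lambda>x. q * c powr (q - 1) * X x + (1 - q) * c powr q)"
  proof (intro integral_mono)
    show "integrable M (\<lambda>x. X x powr q)"
      by (rule integrable_const_bound[of _ 1]) (use X q in \<open>auto intro!: AE_I2 powr_le1\<close>)
  qed (use iX in auto)
  also have "\<dots> = q * c powr (q - 1) * c + (1 - q) * c powr q" using iX c by (simp add: prob_space)
  also have "\<dots> = q * (c powr (q - 1) * c) + (1 - q) * c powr q" by (simp only: mult.assoc)
  also have "c powr (q - 1) * c = c powr q" using c powr_add[of c "q - 1" 1] by simp
  also have "q * c powr q + (1 - q) * c powr q = c powr q" by (simp add: algebra_simps)
  finally show ?thesis .
qed

lemma measurable_Ncnt [measurable]: "Ncnt n c \<in> borel_measurable borel"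
  unfolding Ncnt_def by measurable

lemma Ncnt_bounds: "0 \<le> Ncnt n c \<Delta>" "Ncnt n c \<Delta> \<le> real n"
proof -
  show "0 \<le> Ncnt n c \<Delta>" unfolding Ncnt_def by (intro sum_nonneg) auto
  have "Ncnt n c \<Delta> \<le> (\<Sum>r\<in>{0..<int n}. 1)" unfolding Ncnt_def by (intro sum_mono) auto
  then show "Ncnt n c \<Delta> \<le> real n" by simp
qed

text \<open>Each single point of the shifted grid is uniformly distributed, whatever its
  index.\<close>

lemma Ncnt_mean:
  assumes "0 < c" "c < 1" "n \<ge> 1" shows "(\<integral>\<Delta>. Ncnt n c \<Delta> / real n \<partial>U01) = c"
proof -
  have i: "integrable U01 (\<lambda>\<Delta>. if pts n \<Delta> r \<le> c then 1 else 0 :: real)" for r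
    by (rule U01.integrable_const_bound[of _ 1]) auto
  have "(\<integral>\<Delta>. (if pts n \<Delta> r \<le> c then 1 else 0 :: real) \<partial>U01) = c" for r
  proof -
    have "(\<integral>\<Delta>. (if pts n \<Delta> r \<le> c then 1 else 0 :: real) \<partial>U01) = (\<integral>\<Delta>. (if \<Delta> \<le> c then 1 else 0 :: real) \<partial>U01)"
      unfolding pts_def by (rule integral_U01_frac) measurable
    also have "\<dots> = (\<integral>\<Delta>. indicator {..c} \<Delta> \<partial>U01)"
      by (intro Bochner_Integration.integral_cong) (auto simp: indicator_def)
    also have "\<dots> = measure U01 {..c}"
      by (rule trans[OF Bochner_Integration.integral_indicator]) simp
    also have "\<dots> = c" by (rule measure_U01[OF assms(1,2)])
    finally show ?thesis .
  qed
  then show ?thesis using assms unfolding Ncnt_def by (simp add: Bochner_Integration.integral_sum i)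
qed

lemma sum_int_nat: "(\<Sum>r\<in>{0..<int n}. f r) = (\<Sum>m<n. f (int m))"
proof -
  have "{0..<int n} = int ` {..<n}" by (auto simp: image_iff) (metis lessThan_iff nat_less_iff nonneg_int_cases of_nat_less_iff)
  then show ?thesis by (simp add: sum.reindex)
qed

lemma en_mod: "n \<ge> 1 \<Longrightarrow> en n (k * (r mod int n)) = en n (k * r)"
proof -
  assume n: "n \<ge> 1"
  have "k * r = k * (r mod int n) + int n * (k * (r div int n))"
    by (metis div_mult_mod_eq distrib_left add.commute mult.left_commute mult.commute)
  moreover have "en n (int n * (k * (r div int n))) = 1" using en_eq_1_iff[OF n] by simp
  ultimately show ?thesis by (metis en_add mult.right_neutral)
qed

text \<open>Rotating the indices so that the smallest grid point comes first turns the sequence into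
  the step of \<open>dft_bound_aux\<close>. A rotation multiplies a Fourier coefficient by a number
  of modulus 1.\<close>

lemma dft_hc_bound:
  assumes n: "n \<ge> 1" and h: "h < n" and q: "0 < q" "q < 1" and c: "0 < c" "c < 1" 
  shows "(cmod (dft n (\<lambda>r. hc c (pts n \<Delta> r)) h))\<^sup>2 \<le> (c powr q + (Ncnt n c \<Delta> / real n) powr q) * real (fsz n h) powr (q - 2)" (is ?A)
    and "(cmod (dft n (\<lambda>r. hc c (pts n \<Delta> r)) h))\<^sup>2 \<le> ((1 - c) powr q + (1 - Ncnt n c \<Delta> / real n) powr q) * real (fsz n h) powr (q - 2)" (is ?B)
proof -
  \<comment> \<open>The number of whole grid steps in the shift. The remainder
    \<open>\<Delta>0\<close> lies in \<open>[0, 1 / n)\<close>, so the points with index 0 to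
    \<open>n - 1\<close> increase without wrapping around.\<close>
  define r0 where "r0 = \<lfloor>real n * \<Delta>\<rfloor>"
  define \<Delta>0 where "\<Delta>0 = \<Delta> - real_of_int r0 / real n"
  have np: "real n > 0" using n by simp
  have D0: "0 \<le> real n * \<Delta>0" "real n * \<Delta>0 < 1"
    unfolding \<Delta>0_def r0_def using np by (simp_all add: algebra_simps) linarith+
  then have D1: "0 \<le> \<Delta>0" "\<Delta>0 < 1 / real n" using np by (simp_all add: field_simps zero_le_mult_iff)
  have p0: "pts n \<Delta> (r + - r0) = pts n \<Delta>0 r" for r
    by (simp add: pts_def \<Delta>0_def diff_divide_distrib algebra_simps)
  have pm: "pts n \<Delta>0 (int m) = real m / real n + \<Delta>0" if "m < n" for m
  proof -
    have "real m \<le> real n - 1" using that by linarith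
    then have "real m / real n \<le> 1 - 1 / real n" using np by (simp add: field_simps)
    then show ?thesis unfolding pts_def using D1 by (subst frac_eq_id) auto
  qed
  \<comment> \<open>Counts the indices \<open>m \<ge> 0\<close> with
    \<open>m / n + \<Delta>0 \<le> c\<close>. The floor can be -1, in which case no point qualifies
    and \<open>N = 0\<close>.\<close>
  define N where "N = nat (\<lfloor>real n * (c - \<Delta>0)\<rfloor> + 1)"
  have nc: "0 < real n * c" "real n * c < real n" using c np by auto
  have fl: "-1 \<le> \<lfloor>real n * (c - \<Delta>0)\<rfloor>" "\<lfloor>real n * (c - \<Delta>0)\<rfloor> < int n"
    using D0 nc by (simp_all add: le_floor_iff floor_less_iff algebra_simps)
  have Nn: "N \<le> n" using fl by (simp add: N_def)
  have Nr: "real N = real_of_int \<lfloor>real n * (c - \<Delta>0)\<rfloor> + 1" using fl by (simp add: N_def)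
  have dist: "\<bar>real n * c - real N\<bar> \<le> 1"
    unfolding Nr using D0 by (simp add: algebra_simps abs_le_iff) linarith
  have iff: "real m / real n + \<Delta>0 \<le> c \<longleftrightarrow> m < N" for m
  proof -
    have "real m / real n + \<Delta>0 \<le> c \<longleftrightarrow> real m \<le> real n * (c - \<Delta>0)" using np by (simp add: field_simps)
    also have "\<dots> \<longleftrightarrow> int m \<le> \<lfloor>real n * (c - \<Delta>0)\<rfloor>" by (simp add: le_floor_iff)
    also have "\<dots> \<longleftrightarrow> m < N" using fl by (auto simp: N_def)
    finally show ?thesis .
  qed
  have Nc: "Ncnt n c \<Delta> = real N"
  proof -
    have "Ncnt n c \<Delta> = (\<Sum>r\<in>{0..<int n}. if pts n \<Delta> (r + - r0) \<le> c then 1 else 0)"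
      unfolding Ncnt_def by (rule sum_periodic_int[OF n, symmetric]) (simp add: pts_mod[OF n])
    also have "\<dots> = (\<Sum>m<n. if m < N then 1 else 0)"
      unfolding p0 sum_int_nat using iff pm by (intro sum.cong) auto
    also have "\<dots> = (\<Sum>m<N. 1)" using Nn by (intro sum.mono_neutral_cong_right) auto
    finally show ?thesis by simp
  qed
  define a where "a m = hc c (real m / real n + \<Delta>0)" for m :: nat
  have a: "a m = (if m < N then c - 1 else c)" for m
    using iff[of m] by (auto simp: a_def hc_def)
  have "(\<Sum>r\<in>{0..<int n}. of_real (hc c (pts n \<Delta> r)) * en n (- (int h * r)))
    = (\<Sum>r\<in>{0..<int n}. of_real (hc c (pts n \<Delta> (r + - r0))) * en n (- (int h * (r + - r0))))"
  proof (rule sum_periodic_int[OF n, symmetric])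
    show "of_real (hc c (pts n \<Delta> (r mod int n))) * en n (- (int h * (r mod int n))) = of_real (hc c (pts n \<Delta> r)) * en n (- (int h * r))" for r
      using en_mod[OF n, of "- int h" r] by (simp add: pts_mod[OF n])
  qed
  also have "\<dots> = (\<Sum>r\<in>{0..<int n}. en n (int h * r0) * (of_real (hc c (pts n \<Delta>0 r)) * en n (- (int h * r))))"
  proof (intro sum.cong refl)
    fix r
    have "- (int h * (r + - r0)) = int h * r0 + - (int h * r)" by (simp add: algebra_simps)
    then show "of_real (hc c (pts n \<Delta> (r + - r0))) * en n (- (int h * (r + - r0)))
      = en n (int h * r0) * (of_real (hc c (pts n \<Delta>0 r)) * en n (- (int h * r)))"
      unfolding p0 by (simp only: en_add mult_ac)
  qed
  also have "\<dots> = en n (int h * r0) * (\<Sum>m<n. of_real (a m) * en n (- (int h * int m)))"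
    unfolding sum_distrib_left[symmetric] sum_int_nat using pm by (intro arg_cong2[where f="(*)"] sum.cong) (auto simp: a_def)
  finally have eq: "cmod (dft n (\<lambda>r. hc c (pts n \<Delta> r)) h) = cmod (1 / of_nat n * (\<Sum>m<n. of_real (a m) * en n (- (int h * int m))))"
    unfolding dft_def by (simp add: norm_mult norm_divide)
  show ?A ?B unfolding eq Nc using dft_bound_aux[OF n Nn h q dist c a] by auto
qed

definition ahat2 :: "nat \<Rightarrow> nat \<Rightarrow> real \<Rightarrow> real" where
  "ahat2 n h c = (\<integral>\<Delta>. (cmod (dft n (\<lambda>r. hc c (pts n \<Delta> r)) h))\<^sup>2 \<partial>U01)"

lemma measurable_dft [measurable (raw)]:
  assumes [measurable]: "f \<in> borel_measurable M" "g \<in> borel_measurable M"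
  shows "(\<lambda>x. (cmod (dft n (\<lambda>r. hc (f x) (pts n (g x) r)) h))\<^sup>2) \<in> borel_measurable M"
  unfolding dft_def by measurable

lemma ahat2_nonneg: "0 \<le> ahat2 n h c"
  unfolding ahat2_def by (rule Bochner_Integration.integral_nonneg) simp

lemma measurable_ahat2 [measurable]: "ahat2 n h \<in> borel_measurable borel"
  unfolding ahat2_def by measurable

lemma cmod_dft_sq_le: assumes "0 < c" "c < 1" shows "(cmod (dft n (\<lambda>r. hc c (pts n \<Delta> r)) h))\<^sup>2 \<le> 1"
proof (cases "n = 0")
  case False
  have "cmod (\<Sum>r\<in>{0..<int n}. of_real (hc c (pts n \<Delta> r)) * en n (- (int h * r))) \<le> (\<Sum>r\<in>{0..<int n}. 1)"
    using abs_hc_le[OF assms] by (intro sum_norm_le) (auto simp: norm_mult)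
  then have "cmod (dft n (\<lambda>r. hc c (pts n \<Delta> r)) h) \<le> 1"
    using False by (simp add: dft_def norm_mult norm_divide field_simps)
  then show ?thesis by (simp add: power_le_one)
qed (simp add: dft_def)

lemma integrable_dft_sq: "0 < c \<Longrightarrow> c < 1 \<Longrightarrow> integrable U01 (\<lambda>\<Delta>. (cmod (dft n (\<lambda>r. hc c (pts n \<Delta> r)) h))\<^sup>2)"
  by (rule U01.integrable_const_bound[of _ 1]) (auto simp: cmod_dft_sq_le)

text \<open>The bounds for a fixed shift contain the random fraction of points below
  \<open>c\<close>. Its mean is \<open>c\<close>, so Jensen's inequality returns the same power of
  \<open>c\<close>, and likewise of \<open>1 - c\<close>.\<close>

lemma ahat2_le:
  assumes n: "n \<ge> 1" and h: "h < n" and q: "0 < q" "q < 1" and c: "0 < c" "c < 1"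
  shows "ahat2 n h c \<le> 2 * min c (1 - c) powr q * real (fsz n h) powr (q - 2)"
proof -
  let ?X = "\<lambda>\<Delta>. Ncnt n c \<Delta> / real n"
  have X: "0 \<le> ?X \<Delta>" "?X \<Delta> \<le> 1" for \<Delta> using Ncnt_bounds[of n c \<Delta>] n by (auto simp: field_simps)
  have iX: "integrable U01 ?X"
    by (rule U01.integrable_const_bound[of _ 1]) (use X Ncnt_bounds(1) in \<open>auto simp: abs_of_nonneg\<close>)
  have e1: "(\<integral>\<Delta>. ?X \<Delta> powr q \<partial>U01) \<le> c powr q"
    using Ncnt_mean[OF c n] c q X by (intro U01.expectation_powr_le) auto
  have e2: "(\<integral>\<Delta>. (1 - ?X \<Delta>) powr q \<partial>U01) \<le> (1 - c) powr q"
    using Ncnt_mean[OF c n] c q X iX U01.prob_space by (intro U01.expectation_powr_le) auto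
  have i1: "integrable U01 (\<lambda>\<Delta>. ?X \<Delta> powr q)"
    by (rule U01.integrable_const_bound[of _ 1]) (use X q Ncnt_bounds(1) in \<open>auto intro!: AE_I2 powr_le1 simp: abs_of_nonneg\<close>)
  have i2: "integrable U01 (\<lambda>\<Delta>. (1 - ?X \<Delta>) powr q)"
    by (rule U01.integrable_const_bound[of _ 1]) (use X q Ncnt_bounds(1) in \<open>auto intro!: AE_I2 powr_le1 simp: abs_of_nonneg\<close>)
  let ?f = "real (fsz n h) powr (q - 2)"
  have "ahat2 n h c \<le> (\<integral>\<Delta>. (c powr q + ?X \<Delta> powr q) * ?f \<partial>U01)"
    unfolding ahat2_def using dft_hc_bound(1)[OF n h q c] i1 by (intro integral_mono integrable_dft_sq c) auto
  also have "\<dots> = (c powr q + (\<integral>\<Delta>. ?X \<Delta> powr q \<partial>U01)) * ?f" using i1 U01.prob_space by simp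
  also have "\<dots> \<le> (c powr q + c powr q) * ?f" using e1 by (intro mult_right_mono add_left_mono) auto
  finally have A: "ahat2 n h c \<le> 2 * c powr q * ?f" by simp
  have "ahat2 n h c \<le> (\<integral>\<Delta>. ((1 - c) powr q + (1 - ?X \<Delta>) powr q) * ?f \<partial>U01)"
    unfolding ahat2_def using dft_hc_bound(2)[OF n h q c] i2 by (intro integral_mono integrable_dft_sq c) auto
  also have "\<dots> = ((1 - c) powr q + (\<integral>\<Delta>. (1 - ?X \<Delta>) powr q \<partial>U01)) * ?f" using i2 U01.prob_space by simp
  also have "\<dots> \<le> ((1 - c) powr q + (1 - c) powr q) * ?f" using e2 by (intro mult_right_mono add_left_mono) auto
  finally have B: "ahat2 n h c \<le> 2 * (1 - c) powr q * ?f" by simp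
  show ?thesis using A B by (simp add: min_def)
qed

text \<open>The uniform shift absorbs any number of grid steps. Averaging over all \<open>n\<close>
  of them turns the integrand into an autocorrelation, to which \<open>autocorrelation_dft\<close>
  applies for each shift.\<close>

lemma integral_hc_hc:
  assumes n: "n \<ge> 1" and c: "0 < c" "c < 1"
  shows "complex_of_real (\<integral>\<Delta>. hc c (pts n \<Delta> p) * hc c (pts n \<Delta> q) \<partial>U01)
    = (\<Sum>h<n. of_real (ahat2 n h c) * en n (int h * (p - q)))"
proof -
  have bnd: "\<bar>hc c v * hc c w\<bar> \<le> 1" for v w
    using abs_hc_le[OF c] by (simp add: abs_mult mult_le_one)
  have i: "integrable U01 (\<lambda>\<Delta>. hc c (pts n \<Delta> p) * hc c (pts n \<Delta> q))" for p q
    by (rule U01.integrable_const_bound[of _ 1]) (auto simp: bnd)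
  have sh: "(\<integral>\<Delta>. hc c (pts n \<Delta> (p + r)) * hc c (pts n \<Delta> (q + r)) \<partial>U01) = (\<integral>\<Delta>. hc c (pts n \<Delta> p) * hc c (pts n \<Delta> q) \<partial>U01)" for r
  proof -
    have "pts n \<Delta> (p + r) = pts n (frac (real_of_int r / real n + \<Delta>)) p" for \<Delta> p
    proof -
      have "real_of_int (p + r) / real n + \<Delta> = (real_of_int p / real n + frac (real_of_int r / real n + \<Delta>)) + real_of_int \<lfloor>real_of_int r / real n + \<Delta>\<rfloor>"
        by (simp add: frac_def add_divide_distrib)
      then show ?thesis unfolding pts_def by (simp only: frac_add_of_int_right)
    qed
    then show ?thesis
      using integral_U01_frac[of "\<lambda>\<Delta>. hc c (pts n \<Delta> p) * hc c (pts n \<Delta> q)" "real_of_int r / real n"] by simp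
  qed
  have "(\<integral>\<Delta>. hc c (pts n \<Delta> p) * hc c (pts n \<Delta> q) \<partial>U01)
    = 1 / real n * (\<Sum>r\<in>{0..<int n}. \<integral>\<Delta>. hc c (pts n \<Delta> (p + r)) * hc c (pts n \<Delta> (q + r)) \<partial>U01)"
    unfolding sh using n by simp
  also have "\<dots> = (\<integral>\<Delta>. 1 / real n * (\<Sum>r\<in>{0..<int n}. hc c (pts n \<Delta> (p + r)) * hc c (pts n \<Delta> (q + r))) \<partial>U01)"
    by (simp only: integral_mult_right_zero Bochner_Integration.integral_sum i)
  finally have "complex_of_real (\<integral>\<Delta>. hc c (pts n \<Delta> p) * hc c (pts n \<Delta> q) \<partial>U01)
    = (\<integral>\<Delta>. complex_of_real (1 / real n * (\<Sum>r\<in>{0..<int n}. hc c (pts n \<Delta> (p + r)) * hc c (pts n \<Delta> (q + r)))) \<partial>U01)"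
    by (simp only: integral_complex_of_real)
  also have "\<dots> = (\<integral>\<Delta>. (\<Sum>h<n. of_real ((cmod (dft n (\<lambda>r. hc c (pts n \<Delta> r)) h))\<^sup>2) * en n (int h * (p - q))) \<partial>U01)"
    by (intro Bochner_Integration.integral_cong refl autocorrelation_dft[OF n]) (simp add: pts_mod[OF n])
  also have "\<dots> = (\<Sum>h<n. (\<integral>\<Delta>. of_real ((cmod (dft n (\<lambda>r. hc c (pts n \<Delta> r)) h))\<^sup>2) * en n (int h * (p - q)) \<partial>U01))"
    by (intro Bochner_Integration.integral_sum integrable_mult_left integrable_of_real integrable_dft_sq c)
  also have "\<dots> = (\<Sum>h<n. of_real (ahat2 n h c) * en n (int h * (p - q)))"
    unfolding ahat2_def by (simp only: integral_mult_left_zero integral_complex_of_real)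
  finally show ?thesis .
qed

text \<open>The discrete Fourier coefficients of the shift-averaged kernel on the \<open>n\<close>-point grid.\<close>

definition Cf :: "real \<Rightarrow> nat \<Rightarrow> nat \<Rightarrow> real" where
  "Cf \<tau> n h = (\<integral>x. exp (2 * \<tau> * \<bar>x\<bar>) * ahat2 n h (ncdf x) \<partial>lborel)"

lemma Cf_nonneg: "0 \<le> Cf \<tau> n h"
  unfolding Cf_def using ahat2_nonneg by (intro Bochner_Integration.integral_nonneg) simp

lemma Cf_integrable_le:
  assumes n: "n \<ge> 1" and h: "h < n" and q: "0 < q" "q < 1"
  shows "integrable lborel (\<lambda>x. exp (2 * \<tau> * \<bar>x\<bar>) * ahat2 n h (ncdf x))"
    and "Cf \<tau> n h \<le> 2 * (\<integral>x. ntail x powr q * exp (2 * \<tau> * \<bar>x\<bar>) \<partial>lborel) * real (fsz n h) powr (q - 2)"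
proof -
  let ?f = "real (fsz n h) powr (q - 2)"
  have b: "exp (2 * \<tau> * \<bar>x\<bar>) * ahat2 n h (ncdf x) \<le> 2 * ?f * (ntail x powr q * exp (2 * \<tau> * \<bar>x\<bar>))" for x
  proof -
    have "exp (2 * \<tau> * \<bar>x\<bar>) * ahat2 n h (ncdf x) \<le> exp (2 * \<tau> * \<bar>x\<bar>) * (2 * ntail x powr q * ?f)"
      unfolding ntail_def using ncdf_pos ncdf_less_1 by (intro mult_left_mono ahat2_le n h q) auto
    then show ?thesis by (simp add: mult_ac)
  qed
  have i: "integrable lborel (\<lambda>x. 2 * ?f * (ntail x powr q * exp (2 * \<tau> * \<bar>x\<bar>)))"
    by (intro integrable_mult_right integrable_ntail_exp q)
  show I: "integrable lborel (\<lambda>x. exp (2 * \<tau> * \<bar>x\<bar>) * ahat2 n h (ncdf x))"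
    by (rule Bochner_Integration.integrable_bound[OF i]) (use b ahat2_nonneg in \<open>auto simp: abs_mult\<close>)
  show "Cf \<tau> n h \<le> 2 * (\<integral>x. ntail x powr q * exp (2 * \<tau> * \<bar>x\<bar>) \<partial>lborel) * ?f"
  proof -
    have "Cf \<tau> n h \<le> (\<integral>x. 2 * ?f * (ntail x powr q * exp (2 * \<tau> * \<bar>x\<bar>)) \<partial>lborel)"
      unfolding Cf_def by (rule integral_mono[OF I i b])
    also have "\<dots> = 2 * ?f * (\<integral>x. ntail x powr q * exp (2 * \<tau> * \<bar>x\<bar>) \<partial>lborel)"
      by (rule integral_mult_right_zero)
    finally show ?thesis by (simp only: mult_ac)
  qed
qed

lemma measurable_ker [measurable (raw)]:
  assumes [measurable]: "f \<in> borel_measurable M" "g \<in> borel_measurable M"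
  shows "(\<lambda>x. ker \<tau> (f x) (g x)) \<in> borel_measurable M"
proof -
  have "(\<lambda>p. ker \<tau> (fst p) (snd p)) \<in> borel_measurable (borel \<Otimes>\<^sub>M borel)"
    unfolding ker_def kap_def by measurable
  from measurable_compose[OF _ this, of "\<lambda>x. (f x, g x)"] show ?thesis by simp
qed

text \<open>The shift average is moved inside the integral over \<open>x\<close>, where
  \<open>integral_hc_hc\<close> evaluates it. Fubini is justified by bounding the product by the sum
  of squares, whose shift average is \<open>2 * ncc x\<close>, small enough for the exponential
  weight.\<close>

lemma ker_average:
  assumes n: "n \<ge> 1"
  shows "integrable U01 (\<lambda>\<Delta>. ker \<tau> (Phi_inv (pts n \<Delta> p)) (Phi_inv (pts n \<Delta> q)))" (is "integrable U01 ?K")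
    and "complex_of_real (\<integral>\<Delta>. ker \<tau> (Phi_inv (pts n \<Delta> p)) (Phi_inv (pts n \<Delta> q)) \<partial>U01)
      = (\<Sum>h<n. of_real (Cf \<tau> n h) * en n (int h * (p - q)))"
proof -
  interpret P: pair_sigma_finite U01 lborel
    by (simp add: pair_sigma_finite_def U01.sigma_finite_measure_axioms lborel.sigma_finite_measure_axioms)
  let ?H = "\<lambda>\<Delta> x. hc (ncdf x) (pts n \<Delta> p) * hc (ncdf x) (pts n \<Delta> q) * exp (2 * \<tau> * \<bar>x\<bar>)"
  have c: "0 < ncdf x" "ncdf x < 1" for x by (rule ncdf_pos, rule ncdf_less_1)
  have i2: "integrable U01 (\<lambda>\<Delta>. (hc (ncdf x) (pts n \<Delta> r))\<^sup>2)" for x r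
    by (rule U01.integrable_const_bound[of _ 1]) (auto intro!: power_le_one simp: abs_hc_le[OF c] abs_square_le_1)
  have s2: "(\<integral>\<Delta>. (hc (ncdf x) (pts n \<Delta> r))\<^sup>2 \<partial>U01) = ncc x" for x r
    unfolding pts_def using integral_U01_frac[of "\<lambda>v. (hc (ncdf x) v)\<^sup>2" "real_of_int r / real n"]
    by (simp add: integral_hc_sq[OF c] ncc_def)
  have "(\<integral>\<^sup>+x. \<integral>\<^sup>+\<Delta>. ennreal (norm (?H \<Delta> x)) \<partial>U01 \<partial>lborel)
    \<le> (\<integral>\<^sup>+x. ennreal (2 * (ntail x powr 1 * exp (2 * \<tau> * \<bar>x\<bar>))) \<partial>lborel)"
  proof (rule nn_integral_mono)
    fix x
    have "(\<integral>\<^sup>+\<Delta>. ennreal (norm (?H \<Delta> x)) \<partial>U01)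
      \<le> (\<integral>\<^sup>+\<Delta>. ennreal (((hc (ncdf x) (pts n \<Delta> p))\<^sup>2 + (hc (ncdf x) (pts n \<Delta> q))\<^sup>2) * exp (2 * \<tau> * \<bar>x\<bar>)) \<partial>U01)"
    proof (intro nn_integral_mono ennreal_leI)
      fix \<Delta>
      have "\<bar>a * b\<bar> \<le> a\<^sup>2 + b\<^sup>2" for a b :: real
      proof -
        have "0 \<le> (\<bar>a\<bar> - \<bar>b\<bar>)\<^sup>2" "0 \<le> \<bar>a\<bar> * \<bar>b\<bar>" by simp_all
        moreover have "(\<bar>a\<bar> - \<bar>b\<bar>)\<^sup>2 = a\<^sup>2 + b\<^sup>2 - 2 * (\<bar>a\<bar> * \<bar>b\<bar>)" by (simp add: power2_diff)
        ultimately have "\<bar>a\<bar> * \<bar>b\<bar> \<le> a\<^sup>2 + b\<^sup>2" by linarith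
        then show ?thesis by (simp add: abs_mult)
      qed
      then show "norm (?H \<Delta> x) \<le> ((hc (ncdf x) (pts n \<Delta> p))\<^sup>2 + (hc (ncdf x) (pts n \<Delta> q))\<^sup>2) * exp (2 * \<tau> * \<bar>x\<bar>)"
        unfolding real_norm_def abs_mult[of _ "exp _"] by (intro mult_mono) auto
    qed
    also have "\<dots> = ennreal (\<integral>\<Delta>. ((hc (ncdf x) (pts n \<Delta> p))\<^sup>2 + (hc (ncdf x) (pts n \<Delta> q))\<^sup>2) * exp (2 * \<tau> * \<bar>x\<bar>) \<partial>U01)"
      by (intro nn_integral_eq_integral integrable_mult_left Bochner_Integration.integrable_add i2) auto
    also have "(\<integral>\<Delta>. ((hc (ncdf x) (pts n \<Delta> p))\<^sup>2 + (hc (ncdf x) (pts n \<Delta> q))\<^sup>2) * exp (2 * \<tau> * \<bar>x\<bar>) \<partial>U01)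
      = (ncc x + ncc x) * exp (2 * \<tau> * \<bar>x\<bar>)"
      by (simp only: integral_mult_left_zero Bochner_Integration.integral_add i2 s2)
    also have "ennreal ((ncc x + ncc x) * exp (2 * \<tau> * \<bar>x\<bar>)) \<le> ennreal (2 * (ntail x powr 1 * exp (2 * \<tau> * \<bar>x\<bar>)))"
      using ncc_le_ntail[of x] ntail_pos[of x] by (intro ennreal_leI) simp
    finally show "(\<integral>\<^sup>+\<Delta>. ennreal (norm (?H \<Delta> x)) \<partial>U01) \<le> ennreal (2 * (ntail x powr 1 * exp (2 * \<tau> * \<bar>x\<bar>)))" .
  qed
  also have "\<dots> < \<infinity>"
    using integrable_mult_right[OF integrable_ntail_exp(1)[of 1 \<tau>], of 2] ntail_pos
    by (subst nn_integral_eq_integral) auto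
  finally have fin: "(\<integral>\<^sup>+x. \<integral>\<^sup>+\<Delta>. ennreal (norm (?H \<Delta> x)) \<partial>U01 \<partial>lborel) < \<infinity>" .
  have mH: "(\<lambda>p. ?H (fst p) (snd p)) \<in> borel_measurable (U01 \<Otimes>\<^sub>M lborel)" by measurable
  have I: "integrable (U01 \<Otimes>\<^sub>M lborel) (\<lambda>p. ?H (fst p) (snd p))"
  proof (rule integrableI_bounded[OF mH])
    have "(\<lambda>p. ennreal (norm (?H (fst p) (snd p)))) \<in> borel_measurable (U01 \<Otimes>\<^sub>M lborel)" using mH by simp
    from P.nn_integral_snd[OF this] fin
    show "(\<integral>\<^sup>+p. ennreal (norm (?H (fst p) (snd p))) \<partial>(U01 \<Otimes>\<^sub>M lborel)) < \<infinity>"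
      unfolding fst_conv snd_conv by argo
  qed
  then have I': "integrable (U01 \<Otimes>\<^sub>M lborel) (\<lambda>(\<Delta>, x). ?H \<Delta> x)" by (simp add: split_def)
  \<comment> \<open>Only almost every shift qualifies: \<open>kap_Phi_inv\<close> needs both
    fractional parts strictly inside the unit interval, since \<open>Phi_inv\<close> is unspecified
    at 0.\<close>
  have ae: "AE \<Delta> in U01. ?K \<Delta> = (\<integral>x. ?H \<Delta> x \<partial>lborel)"
    using AE_U01_frac[of "real_of_int p / real n"] AE_U01_frac[of "real_of_int q / real n"]
    by eventually_elim (simp add: ker_def pts_def kap_Phi_inv)
  have mK: "?K \<in> borel_measurable U01" by measurable
  have mI: "(\<lambda>\<Delta>. \<integral>x. ?H \<Delta> x \<partial>lborel) \<in> borel_measurable U01" using P.integrable_fst[OF I'] by auto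
  show "integrable U01 ?K"
    using P.integrable_fst[OF I'] integrable_cong_AE[OF mK mI ae] by simp
  have "(\<integral>\<Delta>. ?K \<Delta> \<partial>U01) = (\<integral>\<Delta>. (\<integral>x. ?H \<Delta> x \<partial>lborel) \<partial>U01)"
    by (rule integral_cong_AE[OF mK mI ae])
  also have "\<dots> = (\<integral>x. (\<integral>\<Delta>. ?H \<Delta> x \<partial>U01) \<partial>lborel)" by (rule P.Fubini_integral[OF I', symmetric])
  finally have "complex_of_real (\<integral>\<Delta>. ?K \<Delta> \<partial>U01) = (\<integral>x. complex_of_real (\<integral>\<Delta>. ?H \<Delta> x \<partial>U01) \<partial>lborel)"
    by (simp only: integral_complex_of_real)
  also have "\<dots> = (\<integral>x. (\<Sum>h<n. of_real (exp (2 * \<tau> * \<bar>x\<bar>) * ahat2 n h (ncdf x)) * en n (int h * (p - q))) \<partial>lborel)"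
  proof (rule Bochner_Integration.integral_cong[OF refl])
    fix x
    have "complex_of_real (\<integral>\<Delta>. ?H \<Delta> x \<partial>U01) = of_real (exp (2 * \<tau> * \<bar>x\<bar>)) *
       complex_of_real (\<integral>\<Delta>. hc (ncdf x) (pts n \<Delta> p) * hc (ncdf x) (pts n \<Delta> q) \<partial>U01)"
      unfolding integral_mult_left_zero of_real_mult by (rule mult.commute)
    also have "\<dots> = (\<Sum>h<n. of_real (exp (2 * \<tau> * \<bar>x\<bar>) * ahat2 n h (ncdf x)) * en n (int h * (p - q)))"
      unfolding integral_hc_hc[OF n c] by (simp add: sum_distrib_left mult.assoc)
    finally show "complex_of_real (\<integral>\<Delta>. ?H \<Delta> x \<partial>U01) = (\<Sum>h<n. of_real (exp (2 * \<tau> * \<bar>x\<bar>) * ahat2 n h (ncdf x)) * en n (int h * (p - q)))" .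
  qed
  \<comment> \<open>Only integrability of the summands matters here; \<open>1/2\<close> stands for
    an arbitrary exponent between 0 and 1.\<close>
  also have "\<dots> = (\<Sum>h<n. \<integral>x. of_real (exp (2 * \<tau> * \<bar>x\<bar>) * ahat2 n h (ncdf x)) * en n (int h * (p - q)) \<partial>lborel)"
    by (intro Bochner_Integration.integral_sum integrable_mult_left integrable_of_real Cf_integrable_le(1)[OF n, of _ "1/2"]) auto
  also have "\<dots> = (\<Sum>h<n. of_real (Cf \<tau> n h) * en n (int h * (p - q)))"
    unfolding Cf_def by (simp only: integral_mult_left_zero integral_complex_of_real)
  finally show "complex_of_real (\<integral>\<Delta>. ?K \<Delta> \<partial>U01) = (\<Sum>h<n. of_real (Cf \<tau> n h) * en n (int h * (p - q)))" .
qed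

section \<open>Component-by-component construction\<close>

text \<open>After scaling the sum to 1, both parts lie in the unit interval, where a power with
  exponent at most 1 does not decrease them.\<close>

lemma powr_add_le:
  fixes a b t :: real
  assumes "0 \<le> a" "0 \<le> b" "0 < t" "t \<le> 1"
  shows "(a + b) powr t \<le> a powr t + b powr t"
proof (cases "a + b = 0")
  case False
  then have s: "0 < a + b" using assms by simp
  have *: "x / (a + b) \<le> (x / (a + b)) powr t" if "0 \<le> x" "x \<le> a + b" for x
  proof (cases "x = 0")
    case False
    then have "(x / (a + b)) powr 1 \<le> (x / (a + b)) powr t" using that s assms by (intro powr_mono') auto
    then show ?thesis using that s by simp
  qed simp
  have "1 = a / (a + b) + b / (a + b)" using s by (simp add: add_divide_distrib[symmetric])
  also have "\<dots> \<le> (a / (a + b)) powr t + (b / (a + b)) powr t" using assms by (intro add_mono *) auto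
  also have "\<dots> = (a powr t + b powr t) / (a + b) powr t" using assms s by (simp add: powr_divide add_divide_distrib)
  finally show ?thesis using s by (simp add: field_simps)
qed (use assms in auto)

lemma sum_powr_le:
  fixes a :: "'a \<Rightarrow> real"
  assumes "0 < t" "t \<le> 1" "\<And>i. i \<in> A \<Longrightarrow> 0 \<le> a i"
  shows "(\<Sum>i\<in>A. a i) powr t \<le> (\<Sum>i\<in>A. a i powr t)"
  using assms(3)
proof (induction A rule: infinite_finite_induct)
  case (insert i A)
  have "(a i + (\<Sum>i\<in>A. a i)) powr t \<le> a i powr t + (\<Sum>i\<in>A. a i) powr t"
    using insert.prems assms by (intro powr_add_le) (auto intro: sum_nonneg)
  also have "\<dots> \<le> a i powr t + (\<Sum>i\<in>A. a i powr t)" using insert by simp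
  finally show ?case using insert.hyps by simp
qed auto

text \<open>With \<open>g = gcd h n\<close>, any two solutions agree modulo \<open>n div g\<close>,
  because \<open>h div g\<close> is invertible there. A range of \<open>n\<close> integers meets
  such a residue class \<open>g\<close> times.\<close>

lemma card_linear_congruence_le:
  fixes n h t :: nat
  assumes n: "n \<ge> 1"
  shows "card {k \<in> {..<n}. n dvd t + h * k} \<le> gcd h n"
proof -
  define g where "g = gcd h n"
  define n' where "n' = n div g"
  have g: "0 < g" using n by (simp add: g_def)
  have nn: "n = n' * g" by (simp add: n'_def g_def)
  have n': "0 < n'" using nn n by (cases "n' = 0") auto
  obtain h' where h': "h = h' * g" by (metis g_def gcd_dvd1 dvd_def mult.commute)
  have cop: "coprime n' h'"
  proof -
    have "gcd h n = g * gcd h' n'" unfolding h' nn by (metis gcd_mult_distrib_nat mult.commute)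
    then have "gcd h' n' = 1" using g by (simp add: g_def[symmetric])
    then show ?thesis by (simp add: coprime_iff_gcd_eq_1 gcd.commute)
  qed
  let ?S = "{k \<in> {..<n}. n dvd t + h * k}"
  have cong: "k mod n' = l mod n'" if "k \<in> ?S" "l \<in> ?S" for k l
  proof -
    have "int n dvd int (t + h * k) - int (t + h * l)" using that by (intro dvd_diff) (simp_all only: int_dvd_int_iff mem_Collect_eq)
    also have "int (t + h * k) - int (t + h * l) = int g * (int h' * (int k - int l))" by (simp add: h' algebra_simps)
    finally have "int g * int n' dvd int g * (int h' * (int k - int l))" by (simp add: nn mult.commute)
    then have "int n' dvd int h' * (int k - int l)" using g by simp
    then have "int n' dvd int k - int l" using cop by (simp add: coprime_dvd_mult_right_iff)
    then have "int k mod int n' = int l mod int n'" by (simp add: mod_eq_dvd_iff)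
    then show ?thesis by (metis of_nat_eq_iff zmod_int)
  qed
  have "inj_on (\<lambda>k. k div n') ?S"
  proof (rule inj_onI)
    fix k l assume kl: "k \<in> ?S" "l \<in> ?S" "k div n' = l div n'"
    have "k = l div n' * n' + l mod n'" using div_mult_mod_eq[of k n'] cong[OF kl(1,2)] kl(3) by simp
    then show "k = l" by simp
  qed
  then have "card ?S = card ((\<lambda>k. k div n') ` ?S)" by (simp add: card_image)
  also have "\<dots> \<le> card {..<g}"
    using n' nn by (intro card_mono) (auto simp: div_less_iff_less_mult mult.commute)
  finally show ?thesis by (simp add: g_def)
qed

lemma en_sum: "(\<Prod>j\<in>u. en n (f j)) = en n (\<Sum>j\<in>u. f j)"
  by (induction u rule: infinite_finite_induct) (auto simp: en_add)

lemma double_character_sum: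
  assumes n: "n \<ge> 1"
  shows "(\<Sum>k=1..n. \<Sum>l=1..n. en n ((int k - int l) * m)) = (if int n dvd m then (of_nat n)\<^sup>2 else 0)"
proof -
  have S: "(\<Sum>k=1..n. en n (int k * m)) = (if int n dvd m then of_nat n else 0)" for m
  proof -
    have "(\<Sum>k=1..n. en n (int k * m)) = (\<Sum>k<n. en n (int (Suc k) * m))"
      by (simp only: One_nat_def sum.atLeast1_atMost_eq)
    also have "\<dots> = (\<Sum>k<n. en n m * en n (int k * m))"
      by (intro sum.cong refl) (simp add: en_add[symmetric] algebra_simps)
    also have "\<dots> = en n m * (if int n dvd m then of_nat n else 0)"
      by (simp only: sum_distrib_left[symmetric] sum_en[OF n])
    finally show ?thesis using en_eq_1_iff[OF n, of m] by auto
  qed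
  have "(\<Sum>k=1..n. \<Sum>l=1..n. en n ((int k - int l) * m)) = (\<Sum>k=1..n. \<Sum>l=1..n. en n (int k * m) * en n (int l * (- m)))"
    by (intro sum.cong refl) (simp add: en_add[symmetric] algebra_simps)
  also have "\<dots> = (\<Sum>k=1..n. en n (int k * m)) * (\<Sum>l=1..n. en n (int l * (- m)))"
    by (simp only: sum_product)
  also have "\<dots> = (if int n dvd m then (of_nat n)\<^sup>2 else 0)" unfolding S by (simp add: power2_eq_square)
  finally show ?thesis .
qed

text \<open>The zero vector is included. Its coefficient need not vanish: on \<open>n\<close> points
  the zero frequency also carries the multiples of \<open>n\<close>, and accordingly counts as a
  frequency of size \<open>n\<close> in \<open>fsz\<close>.\<close>

definition dual :: "nat \<Rightarrow> (nat \<Rightarrow> nat) \<Rightarrow> nat set \<Rightarrow> (nat \<Rightarrow> nat) set" where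
  "dual n z u = {h \<in> PiE u (\<lambda>_. {..<n}). n dvd (\<Sum>j\<in>u. h j * z j)}"

text \<open>The contribution of the variables in \<open>u\<close> to the shift-averaged squared error is a sum over the dual lattice.\<close>

definition RC :: "nat \<Rightarrow> (nat \<Rightarrow> nat) \<Rightarrow> (nat \<Rightarrow> real) \<Rightarrow> nat set \<Rightarrow> real" where
  "RC n z \<tau> u = (\<Sum>h\<in>dual n z u. \<Prod>j\<in>u. Cf (\<tau> j) n (h j))"

definition lattice_pts :: "nat \<Rightarrow> (nat \<Rightarrow> nat) \<Rightarrow> (nat \<Rightarrow> real) \<Rightarrow> nat \<Rightarrow> nat \<Rightarrow> real" where
  "lattice_pts n z \<Delta> k i = Phi_inv (frac (real k * real (z i) / real n + \<Delta> i))"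

lemma lattice_pts_eq: "lattice_pts n z \<Delta> k i = Phi_inv (pts n (\<Delta> i) (int k * int (z i)))"
  by (simp add: lattice_pts_def pts_def)

interpretation PU: product_sigma_finite "\<lambda>_::nat. U01"
  by (simp add: product_sigma_finite_def U01.sigma_finite_measure_axioms)

lemma integral_PiM_subset:
  fixes f :: "nat \<Rightarrow> real \<Rightarrow> real"
  assumes u: "u \<subseteq> {..<d}" and f: "\<And>j. j \<in> u \<Longrightarrow> integrable U01 (f j)"
  shows "integrable (unif_shift d) (\<lambda>\<Delta>. \<Prod>j\<in>u. f j (\<Delta> j))"
    and "(\<integral>\<Delta>. (\<Prod>j\<in>u. f j (\<Delta> j)) \<partial>unif_shift d) = (\<Prod>j\<in>u. \<integral>v. f j v \<partial>U01)"
proof -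
  let ?g = "\<lambda>j. if j \<in> u then f j else (\<lambda>_. 1)"
  have e: "(\<Prod>j\<in>u. F j) = (\<Prod>j<d. if j \<in> u then F j else 1)" for F :: "nat \<Rightarrow> real"
    using u by (simp add: prod.If_cases Int_absorb1)
  have eq: "(\<Prod>j\<in>u. f j (\<Delta> j)) = (\<Prod>j<d. ?g j (\<Delta> j))" for \<Delta>
    unfolding e[of "\<lambda>j. f j (\<Delta> j)"] by (intro prod.cong) auto
  have i: "integrable U01 (?g j)" for j using f by auto
  show "integrable (unif_shift d) (\<lambda>\<Delta>. \<Prod>j\<in>u. f j (\<Delta> j))"
    unfolding eq unif_shift_def by (intro PU.product_integrable_prod i) auto
  have "(\<integral>\<Delta>. (\<Prod>j\<in>u. f j (\<Delta> j)) \<partial>unif_shift d) = (\<Prod>j<d. \<integral>v. ?g j v \<partial>U01)"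
    unfolding eq unif_shift_def by (intro PU.product_integral_prod i) auto
  also have "\<dots> = (\<Prod>j<d. if j \<in> u then (\<integral>v. f j v \<partial>U01) else 1)"
    by (intro prod.cong refl) (use U01.prob_space in auto)
  finally show "(\<integral>\<Delta>. (\<Prod>j\<in>u. f j (\<Delta> j)) \<partial>unif_shift d) = (\<Prod>j\<in>u. \<integral>v. f j v \<partial>U01)"
    by (simp only: e)
qed

text \<open>Multiplying out the one-dimensional Fourier sums gives one character per frequency
  vector. Its double sum over the nodes is \<open>n\<^sup>2\<close> on the dual lattice and 0
  elsewhere.\<close>

lemma RC_eq:
  assumes n: "n \<ge> 1" and u: "finite u"
  shows "1 / (real n)\<^sup>2 * (\<Sum>k=1..n. \<Sum>l=1..n. \<Prod>j\<in>u. \<integral>v. ker (\<tau> j) (Phi_inv (pts n v (int k * int (z j)))) (Phi_inv (pts n v (int l * int (z j)))) \<partial>U01)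
    = RC n z \<tau> u" (is "1 / (real n)\<^sup>2 * (\<Sum>k=1..n. \<Sum>l=1..n. \<Prod>j\<in>u. ?K k l j) = _")
proof -
  let ?P = "PiE u (\<lambda>_. {..<n})"
  have fP: "finite ?P" using u by (intro finite_PiE) auto
  have "complex_of_real (\<Prod>j\<in>u. ?K k l j)
    = (\<Sum>h\<in>?P. of_real (\<Prod>j\<in>u. Cf (\<tau> j) n (h j)) * en n ((int k - int l) * (\<Sum>j\<in>u. int (h j) * int (z j))))" for k l
  proof -
    have "complex_of_real (\<Prod>j\<in>u. ?K k l j)
      = (\<Prod>j\<in>u. \<Sum>h<n. of_real (Cf (\<tau> j) n h) * en n (int h * (int k * int (z j) - int l * int (z j))))"
      by (simp only: of_real_prod ker_average(2)[OF n])
    also have "\<dots> = (\<Sum>h\<in>?P. \<Prod>j\<in>u. of_real (Cf (\<tau> j) n (h j)) * en n (int (h j) * (int k * int (z j) - int l * int (z j))))"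
      by (rule prod_sum_PiE) (use u in auto)
    also have "\<dots> = (\<Sum>h\<in>?P. of_real (\<Prod>j\<in>u. Cf (\<tau> j) n (h j)) * en n ((int k - int l) * (\<Sum>j\<in>u. int (h j) * int (z j))))"
    proof (intro sum.cong refl)
      fix h
      have "(\<Sum>j\<in>u. int (h j) * (int k * int (z j) - int l * int (z j))) = (int k - int l) * (\<Sum>j\<in>u. int (h j) * int (z j))"
        unfolding sum_distrib_left by (intro sum.cong refl) (simp add: algebra_simps)
      then show "(\<Prod>j\<in>u. of_real (Cf (\<tau> j) n (h j)) * en n (int (h j) * (int k * int (z j) - int l * int (z j))))
        = of_real (\<Prod>j\<in>u. Cf (\<tau> j) n (h j)) * en n ((int k - int l) * (\<Sum>j\<in>u. int (h j) * int (z j)))"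
        by (simp only: prod.distrib en_sum of_real_prod)
    qed
    finally show ?thesis .
  qed
  then have "complex_of_real (1 / (real n)\<^sup>2 * (\<Sum>k=1..n. \<Sum>l=1..n. \<Prod>j\<in>u. ?K k l j))
    = 1 / (of_nat n)\<^sup>2 * (\<Sum>k=1..n. \<Sum>l=1..n. \<Sum>h\<in>?P. of_real (\<Prod>j\<in>u. Cf (\<tau> j) n (h j)) * en n ((int k - int l) * (\<Sum>j\<in>u. int (h j) * int (z j))))"
    by (simp only: of_real_mult of_real_divide of_real_1 of_real_power of_real_of_nat_eq of_real_sum)
  also have "(\<Sum>k=1..n. \<Sum>l=1..n. \<Sum>h\<in>?P. complex_of_real (\<Prod>j\<in>u. Cf (\<tau> j) n (h j)) * en n ((int k - int l) * (\<Sum>j\<in>u. int (h j) * int (z j))))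
    = (\<Sum>h\<in>?P. \<Sum>k=1..n. \<Sum>l=1..n. of_real (\<Prod>j\<in>u. Cf (\<tau> j) n (h j)) * en n ((int k - int l) * (\<Sum>j\<in>u. int (h j) * int (z j))))"
    by (subst sum.swap, subst (2) sum.swap) (rule refl)
  also have "\<dots> = (\<Sum>h\<in>?P. of_real (\<Prod>j\<in>u. Cf (\<tau> j) n (h j)) * (if n dvd (\<Sum>j\<in>u. h j * z j) then (of_nat n)\<^sup>2 else 0))"
  proof (intro sum.cong refl)
    fix h
    have "(\<Sum>j\<in>u. int (h j) * int (z j)) = int (\<Sum>j\<in>u. h j * z j)" by simp
    then have "int n dvd (\<Sum>j\<in>u. int (h j) * int (z j)) \<longleftrightarrow> n dvd (\<Sum>j\<in>u. h j * z j)" by (simp only: int_dvd_int_iff)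
    then show "(\<Sum>k=1..n. \<Sum>l=1..n. complex_of_real (\<Prod>j\<in>u. Cf (\<tau> j) n (h j)) * en n ((int k - int l) * (\<Sum>j\<in>u. int (h j) * int (z j))))
      = of_real (\<Prod>j\<in>u. Cf (\<tau> j) n (h j)) * (if n dvd (\<Sum>j\<in>u. h j * z j) then (of_nat n)\<^sup>2 else 0)"
      by (simp only: sum_distrib_left[symmetric] double_character_sum[OF n])
  qed
  also have "1 / (of_nat n)\<^sup>2 * \<dots> = complex_of_real (RC n z \<tau> u)"
  proof -
    have "(\<Sum>h\<in>?P. complex_of_real (\<Prod>j\<in>u. Cf (\<tau> j) n (h j)) * (if n dvd (\<Sum>j\<in>u. h j * z j) then (of_nat n)\<^sup>2 else 0))
      = (\<Sum>h\<in>dual n z u. of_real (\<Prod>j\<in>u. Cf (\<tau> j) n (h j)) * (of_nat n)\<^sup>2)"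
      unfolding dual_def using fP by (intro sum.mono_neutral_cong_right) auto
    then show ?thesis using n by (simp add: RC_def sum_distrib_right[symmetric] del: of_real_prod)
  qed
  finally show ?thesis by (simp only: of_real_eq_iff)
qed

lemma RC_nonneg: "0 \<le> RC n z \<tau> u"
  unfolding RC_def by (intro sum_nonneg prod_nonneg) (auto simp: Cf_nonneg)

text \<open>The square of the shift-averaged worst-case error, by
  \<open>shift_avg_wce_eq\<close>.\<close>

definition V :: "nat \<Rightarrow> nat \<Rightarrow> (nat set \<Rightarrow> real) \<Rightarrow> (nat \<Rightarrow> real) \<Rightarrow> (nat \<Rightarrow> nat) \<Rightarrow> real" where
  "V d n \<gamma> \<tau> z = (\<Sum>u\<in>Pow {..<d} - {{}}. \<gamma> u * RC n z \<tau> u)"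

lemma V_nonneg: "(\<And>u. \<gamma> u > 0) \<Longrightarrow> 0 \<le> V d n \<gamma> \<tau> z"
  unfolding V_def by (intro sum_nonneg mult_nonneg_nonneg RC_nonneg) (auto simp: less_imp_le)

lemma E2_average:
  assumes n: "n \<ge> 1" and \<gamma>: "\<And>u. \<gamma> u > 0"
  shows "(\<integral>\<^sup>+\<Delta>. ennreal (E2 d n \<gamma> \<tau> (lattice_pts n z \<Delta>)) \<partial>unif_shift d) = ennreal (V d n \<gamma> \<tau> z)"
proof -
  let ?k = "\<lambda>k l j v. ker (\<tau> j) (Phi_inv (pts n v (int k * int (z j)))) (Phi_inv (pts n v (int l * int (z j))))"
  note ik = ker_average(1)[OF n]
  have E: "E2 d n \<gamma> \<tau> (lattice_pts n z \<Delta>) = (\<Sum>u\<in>Pow {..<d} - {{}}. \<gamma> u * (1 / (real n)\<^sup>2 *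
     (\<Sum>k=1..n. \<Sum>l=1..n. \<Prod>j\<in>u. ?k k l j (\<Delta> j))))" for \<Delta>
    unfolding E2_def lattice_pts_eq ..
  have ip: "integrable (unif_shift d) (\<lambda>\<Delta>. \<Prod>j\<in>u. ?k k l j (\<Delta> j))" if "u \<in> Pow {..<d} - {{}}" for u k l
    using that by (intro integral_PiM_subset ik) auto
  have i: "integrable (unif_shift d) (\<lambda>\<Delta>. E2 d n \<gamma> \<tau> (lattice_pts n z \<Delta>))"
    unfolding E by (intro Bochner_Integration.integrable_sum integrable_mult_right ip)
  have "(\<integral>\<Delta>. E2 d n \<gamma> \<tau> (lattice_pts n z \<Delta>) \<partial>unif_shift d)
    = (\<Sum>u\<in>Pow {..<d} - {{}}. \<integral>\<Delta>. \<gamma> u * (1 / (real n)\<^sup>2 * (\<Sum>k=1..n. \<Sum>l=1..n. \<Prod>j\<in>u. ?k k l j (\<Delta> j))) \<partial>unif_shift d)"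
    unfolding E by (intro Bochner_Integration.integral_sum Bochner_Integration.integrable_sum integrable_mult_right ip)
  also have "\<dots> = V d n \<gamma> \<tau> z"
    unfolding V_def
  proof (intro sum.cong refl)
    fix u assume u: "u \<in> Pow {..<d} - {{}}"
    then have us: "u \<subseteq> {..<d}" and fu: "finite u" by (auto intro: finite_subset)
    have "(\<integral>\<Delta>. (\<Sum>k=1..n. \<Sum>l=1..n. \<Prod>j\<in>u. ?k k l j (\<Delta> j)) \<partial>unif_shift d)
      = (\<Sum>k=1..n. \<Sum>l=1..n. \<integral>\<Delta>. (\<Prod>j\<in>u. ?k k l j (\<Delta> j)) \<partial>unif_shift d)"
      by (simp only: Bochner_Integration.integral_sum Bochner_Integration.integrable_sum ip[OF u])
    also have "\<dots> = (\<Sum>k=1..n. \<Sum>l=1..n. \<Prod>j\<in>u. \<integral>v. ?k k l j v \<partial>U01)"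
      by (intro sum.cong refl integral_PiM_subset(2)[OF us] ik)
    finally show "(\<integral>\<Delta>. \<gamma> u * (1 / (real n)\<^sup>2 * (\<Sum>k=1..n. \<Sum>l=1..n. \<Prod>j\<in>u. ?k k l j (\<Delta> j))) \<partial>unif_shift d) = \<gamma> u * RC n z \<tau> u"
      by (simp only: integral_mult_right_zero RC_eq[OF n fu])
  qed
  finally show ?thesis
    using nn_integral_eq_integral[OF i] E2_nonneg[of \<gamma>, OF \<gamma>] by simp
qed

lemma shift_avg_wce_eq:
  assumes n: "n \<ge> 1" and \<gamma>: "\<And>u. \<gamma> u > 0"
  shows "shift_avg_wce d n \<gamma> \<tau> z = ennreal (sqrt (V d n \<gamma> \<tau> z))"
proof -
  have "gauss_integral d G - lattice_rule d n z \<Delta> G = cub_err d n (lattice_pts n z \<Delta>) G" for G \<Delta>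
    by (simp add: cub_err_def lattice_rule_def lattice_pts_def[abs_def])
  then show ?thesis
    unfolding shift_avg_wce_def by (simp only: worst_case_error_eq[of \<gamma>, OF \<gamma> n] E2_average[of n \<gamma>, OF n \<gamma>] ennsqrt_ennreal V_nonneg[of \<gamma>, OF \<gamma>])
qed

lemma RC_cong: "(\<And>j. j \<in> u \<Longrightarrow> z j = z' j) \<Longrightarrow> RC n z \<tau> u = RC n z' \<tau> u"
  unfolding RC_def dual_def by (intro sum.cong refl Collect_cong conj_cong arg_cong[where f="(dvd) n"] sum.cong) auto

lemma V_Suc: "V (Suc d) n \<gamma> \<tau> (z(d := k)) = V d n \<gamma> \<tau> z + (\<Sum>u\<in>Pow {..<d}. \<gamma> (insert d u) * RC n (z(d := k)) \<tau> (insert d u))"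
proof -
  have P: "Pow {..<Suc d} - {{}} = (Pow {..<d} - {{}}) \<union> insert d ` Pow {..<d}"
    by (auto simp: lessThan_Suc Pow_insert)
  have "V (Suc d) n \<gamma> \<tau> (z(d := k)) = (\<Sum>u\<in>Pow {..<d} - {{}}. \<gamma> u * RC n (z(d := k)) \<tau> u) + (\<Sum>u\<in>insert d ` Pow {..<d}. \<gamma> u * RC n (z(d := k)) \<tau> u)"
    unfolding V_def P by (rule sum.union_disjoint) auto
  also have "(\<Sum>u\<in>Pow {..<d} - {{}}. \<gamma> u * RC n (z(d := k)) \<tau> u) = V d n \<gamma> \<tau> z"
    unfolding V_def by (intro sum.cong refl arg_cong2[where f="(*)"] RC_cong) auto
  also have "(\<Sum>u\<in>insert d ` Pow {..<d}. \<gamma> u * RC n (z(d := k)) \<tau> u) = (\<Sum>u\<in>Pow {..<d}. \<gamma> (insert d u) * RC n (z(d := k)) \<tau> (insert d u))"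
    by (subst sum.reindex) (auto simp: inj_on_def)
  finally show ?thesis .
qed

text \<open>After passing to powers of the summands, the sums over candidates and frequencies are
  exchanged. For fixed frequencies the dual condition is a linear congruence in the new component
  \<open>k\<close>, with at most \<open>gcd (h d) n\<close> solutions. The sum then factors over the
  variables; the other factors are enlarged by the same gcd so that one \<open>B\<close> serves them
  all.\<close>

lemma sum_RC_powr_le:
  assumes n: "n \<ge> 1" and \<theta>: "0 < \<theta>" "\<theta> \<le> 1" and u: "u \<subseteq> {..<d}"
    and B: "\<And>j. (\<Sum>h<n. Cf (\<tau> j) n h powr \<theta> * real (gcd h n)) \<le> B" and K: "K \<subseteq> {..<n}"
  shows "(\<Sum>k\<in>K. RC n (z(d := k)) \<tau> (insert d u) powr \<theta>) \<le> B ^ card (insert d u)"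
proof -
  let ?w = "insert d u"
  let ?P = "PiE ?w (\<lambda>_. {..<n})"
  have fu: "finite u" using u finite_subset by auto
  have du: "d \<notin> u" using u by auto
  have fw: "finite ?w" using fu by simp
  have fP: "finite ?P" by (rule finite_PiE) (use fw in auto)
  have fK: "finite K" using K finite_subset by auto
  define c where "c h = (\<Prod>j\<in>?w. Cf (\<tau> j) n (h j) powr \<theta>)" for h
  have c0: "0 \<le> c h" for h by (auto simp: c_def intro!: prod_nonneg)
  have "(\<Sum>k\<in>K. RC n (z(d := k)) \<tau> ?w powr \<theta>) \<le> (\<Sum>k\<in>K. \<Sum>h\<in>?P. if n dvd (\<Sum>j\<in>?w. h j * (z(d := k)) j) then c h else 0)"
  proof (rule sum_mono)
    fix k
    have "RC n (z(d := k)) \<tau> ?w powr \<theta> \<le> (\<Sum>h\<in>dual n (z(d := k)) ?w. (\<Prod>j\<in>?w. Cf (\<tau> j) n (h j)) powr \<theta>)"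
      unfolding RC_def using \<theta> by (intro sum_powr_le prod_nonneg) (auto simp: Cf_nonneg)
    also have "\<dots> = (\<Sum>h\<in>dual n (z(d := k)) ?w. c h)"
      unfolding c_def by (intro sum.cong refl prod_powr_distrib)
    also have "\<dots> = (\<Sum>h\<in>?P. if n dvd (\<Sum>j\<in>?w. h j * (z(d := k)) j) then c h else 0)"
      unfolding dual_def by (rule sum.mono_neutral_cong_left) (use fP in auto)
    finally show "RC n (z(d := k)) \<tau> ?w powr \<theta> \<le> (\<Sum>h\<in>?P. if n dvd (\<Sum>j\<in>?w. h j * (z(d := k)) j) then c h else 0)" .
  qed
  also have "\<dots> = (\<Sum>h\<in>?P. \<Sum>k\<in>K. if n dvd (\<Sum>j\<in>?w. h j * (z(d := k)) j) then c h else 0)" by (rule sum.swap)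
  also have "\<dots> \<le> (\<Sum>h\<in>?P. \<Prod>j\<in>?w. Cf (\<tau> j) n (h j) powr \<theta> * (if j = d then real (gcd (h j) n) else 1))"
  proof (rule sum_mono)
    fix h assume h: "h \<in> ?P"
    let ?t = "\<Sum>j\<in>u. h j * z j"
    have "(\<Sum>j\<in>?w. h j * (z(d := k)) j) = ?t + h d * k" for k
    proof -
      have "(\<Sum>j\<in>u. h j * (z(d := k)) j) = ?t" using du by (intro sum.cong) auto
      then show ?thesis using fu du by simp
    qed
    then have "(\<Sum>k\<in>K. if n dvd (\<Sum>j\<in>?w. h j * (z(d := k)) j) then c h else 0) = (\<Sum>k\<in>K. if n dvd ?t + h d * k then c h else 0)"
      by (simp only:)
    also have "\<dots> = c h * real (card {k \<in> K. n dvd ?t + h d * k})"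
      using fK by (simp add: sum.If_cases Int_def)
    also have "\<dots> \<le> c h * real (gcd (h d) n)"
    proof (intro mult_left_mono c0)
      have "card {k \<in> K. n dvd ?t + h d * k} \<le> card {k \<in> {..<n}. n dvd ?t + h d * k}"
        using K by (intro card_mono) auto
      also have "\<dots> \<le> gcd (h d) n" by (rule card_linear_congruence_le[OF n])
      finally show "real (card {k \<in> K. n dvd ?t + h d * k}) \<le> real (gcd (h d) n)" by simp
    qed
    also have "\<dots> = (\<Prod>j\<in>?w. Cf (\<tau> j) n (h j) powr \<theta> * (if j = d then real (gcd (h j) n) else 1))"
      using fw by (simp add: prod.distrib c_def prod.delta)
    finally show "(\<Sum>k\<in>K. if n dvd (\<Sum>j\<in>?w. h j * (z(d := k)) j) then c h else 0)
      \<le> (\<Prod>j\<in>?w. Cf (\<tau> j) n (h j) powr \<theta> * (if j = d then real (gcd (h j) n) else 1))" .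
  qed
  also have "\<dots> = (\<Prod>j\<in>?w. \<Sum>h<n. Cf (\<tau> j) n h powr \<theta> * (if j = d then real (gcd h n) else 1))"
    by (rule prod_sum_PiE[symmetric]) (use fw in auto)
  also have "\<dots> \<le> (\<Prod>j\<in>?w. B)"
  proof (rule prod_mono, intro conjI)
    fix j
    show "0 \<le> (\<Sum>h<n. Cf (\<tau> j) n h powr \<theta> * (if j = d then real (gcd h n) else 1))"
      by (intro sum_nonneg) auto
    have "(\<Sum>h<n. Cf (\<tau> j) n h powr \<theta> * (if j = d then real (gcd h n) else 1)) \<le> (\<Sum>h<n. Cf (\<tau> j) n h powr \<theta> * real (gcd h n))"
    proof (intro sum_mono mult_left_mono)
      fix h
      have "gcd h n \<ge> 1" using n by (simp add: Suc_le_eq)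
      then show "(if j = d then real (gcd h n) else 1) \<le> real (gcd h n)" by simp
    qed auto
    also have "\<dots> \<le> B" by (rule B)
    finally show "(\<Sum>h<n. Cf (\<tau> j) n h powr \<theta> * (if j = d then real (gcd h n) else 1)) \<le> B" .
  qed
  finally show ?thesis by simp
qed

lemma units_pow2: assumes "m \<ge> 1" "n = 2 ^ m"
  shows "real (card {k \<in> {1..n - 1}. coprime k n}) = real n / 2"
proof -
  obtain m' where m': "m = Suc m'" using assms by (cases m) auto
  have "{k \<in> {1..n - 1}. coprime k n} = (\<lambda>i::nat. 2 * i + 1) ` {..<2 ^ m'}"
  proof (intro equalityI subsetI)
    fix k assume "k \<in> {k \<in> {1..n - 1}. coprime k n}"
    then have k: "k < n" "odd k" using assms by auto
    then show "k \<in> (\<lambda>i::nat. 2 * i + 1) ` {..<2 ^ m'}"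
      using assms m' by (auto elim!: oddE)
  next
    fix k assume "k \<in> (\<lambda>i::nat. 2 * i + 1) ` {..<2 ^ m'}"
    then obtain i where "k = 2 * i + 1" "i < 2 ^ m'" by auto
    then show "k \<in> {k \<in> {1..n - 1}. coprime k n}"
      using assms m' by (auto simp: coprime_commute)
  qed
  moreover have "card ((\<lambda>i::nat. 2 * i + 1) ` {..<2 ^ m'}) = 2 ^ m'" by (subst card_image) (auto simp: inj_on_def)
  ultimately show ?thesis using assms m' by simp
qed

text \<open>The chosen component does no worse than the average candidate; subadditivity of \<open>x powr \<theta>\<close> makes that average linear in the summands.\<close>

lemma cbc_bound:
  assumes m: "m \<ge> 1" "n = 2 ^ m" and \<gamma>: "\<And>u. \<gamma> u > 0" and \<theta>: "0 < \<theta>" "\<theta> \<le> 1"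
    and B: "\<And>j. (\<Sum>h<n. Cf (\<tau> j) n h powr \<theta> * real (gcd h n)) \<le> B"
    and cbc: "cbc_vector s n \<gamma> \<tau> z" and d: "d \<le> s"
  shows "V d n \<gamma> \<tau> z powr \<theta> \<le> 2 / real n * (\<Sum>u\<in>Pow {..<d} - {{}}. \<gamma> u powr \<theta> * B ^ card u)"
  using d
proof (induction d)
  case 0
  show ?case by (simp add: V_def)
next
  case (Suc d)
  have n: "n \<ge> 1" using m by simp
  let ?K = "{k \<in> {1..n - 1}. coprime k n}"
  define T where "T k = (\<Sum>u\<in>Pow {..<d}. \<gamma> (insert d u) * RC n (z(d := k)) \<tau> (insert d u))" for k
  have T0: "0 \<le> T k" for k unfolding T_def
    using \<gamma> by (intro sum_nonneg mult_nonneg_nonneg RC_nonneg) (auto simp: less_imp_le)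
  have VS: "V (Suc d) n \<gamma> \<tau> (z(d := k)) = V d n \<gamma> \<tau> z + T k" for k unfolding T_def by (rule V_Suc)
  have K: "?K \<subseteq> {..<n}" using n by auto
  have min: "T (z d) \<le> T k" if k: "k \<in> ?K" for k
  proof (cases "d = 0")
    case True
    have z0: "z 0 = 1" using cbc by (simp add: cbc_vector_def)
    \<comment> \<open>The first component is prescribed instead of minimized. Multiplication by a
      unit does not change the one-dimensional dual lattice, so every candidate has the same
      value.\<close>
    have "dual n (z(0 := k)) {0} = dual n (z(0 := 1)) {0}"
      unfolding dual_def using k by (auto simp: coprime_dvd_mult_left_iff coprime_commute)
    then show ?thesis by (simp add: T_def True RC_def z0)
  next
    case False
    then have "is_arg_min (\<lambda>k. shift_avg_wce (Suc d) n \<gamma> \<tau> (z(d := k))) (\<lambda>k. k \<in> {1..n - 1} \<and> coprime k n) (z d)"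
      using cbc Suc.prems by (simp add: cbc_vector_def)
    then have "\<not> shift_avg_wce (Suc d) n \<gamma> \<tau> (z(d := k)) < shift_avg_wce (Suc d) n \<gamma> \<tau> (z(d := z d))"
      using k by (auto simp: is_arg_min_def)
    then have "V (Suc d) n \<gamma> \<tau> (z(d := z d)) \<le> V (Suc d) n \<gamma> \<tau> (z(d := k))"
      unfolding shift_avg_wce_eq[of n \<gamma>, OF n \<gamma>]
      using V_nonneg[of \<gamma>, OF \<gamma>] by (simp del: fun_upd_triv add: ennreal_less_iff not_less)
    then show ?thesis unfolding VS by simp
  qed
  \<comment> \<open>Half of the residues modulo a power of two are units; this is the origin of the
    factor \<open>2 / n\<close>.\<close>
  have "real n / 2 * T (z d) powr \<theta> = (\<Sum>k\<in>?K. T (z d) powr \<theta>)" using units_pow2[OF m] by simp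
  also have "\<dots> \<le> (\<Sum>k\<in>?K. T k powr \<theta>)" using min T0 \<theta> by (intro sum_mono powr_mono2) auto
  also have "\<dots> \<le> (\<Sum>k\<in>?K. \<Sum>u\<in>Pow {..<d}. \<gamma> (insert d u) powr \<theta> * RC n (z(d := k)) \<tau> (insert d u) powr \<theta>)"
  proof (rule sum_mono)
    fix k
    have "T k powr \<theta> \<le> (\<Sum>u\<in>Pow {..<d}. (\<gamma> (insert d u) * RC n (z(d := k)) \<tau> (insert d u)) powr \<theta>)"
      unfolding T_def using \<theta> \<gamma> RC_nonneg by (intro sum_powr_le) (auto simp: less_imp_le)
    then show "T k powr \<theta> \<le> (\<Sum>u\<in>Pow {..<d}. \<gamma> (insert d u) powr \<theta> * RC n (z(d := k)) \<tau> (insert d u) powr \<theta>)"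
      using \<gamma> RC_nonneg by (simp add: powr_mult less_imp_le)
  qed
  also have "\<dots> = (\<Sum>u\<in>Pow {..<d}. \<gamma> (insert d u) powr \<theta> * (\<Sum>k\<in>?K. RC n (z(d := k)) \<tau> (insert d u) powr \<theta>))"
    by (subst sum.swap) (simp add: sum_distrib_left)
  also have "\<dots> \<le> (\<Sum>u\<in>Pow {..<d}. \<gamma> (insert d u) powr \<theta> * B ^ card (insert d u))"
    by (intro sum_mono mult_left_mono sum_RC_powr_le[OF n \<theta> _ B K]) auto
  finally have Tb: "T (z d) powr \<theta> \<le> 2 / real n * (\<Sum>u\<in>Pow {..<d}. \<gamma> (insert d u) powr \<theta> * B ^ card (insert d u))"
    using n by (simp add: field_simps)
  have P: "Pow {..<Suc d} - {{}} = (Pow {..<d} - {{}}) \<union> insert d ` Pow {..<d}"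
    by (auto simp: lessThan_Suc Pow_insert)
  have "V (Suc d) n \<gamma> \<tau> z powr \<theta> = (V d n \<gamma> \<tau> z + T (z d)) powr \<theta>" using VS[of "z d"] by simp
  also have "\<dots> \<le> V d n \<gamma> \<tau> z powr \<theta> + T (z d) powr \<theta>"
    using V_nonneg[of \<gamma>, OF \<gamma>] T0 \<theta> by (intro powr_add_le) auto
  also have "\<dots> \<le> 2 / real n * (\<Sum>u\<in>Pow {..<d} - {{}}. \<gamma> u powr \<theta> * B ^ card u)
     + 2 / real n * (\<Sum>u\<in>Pow {..<d}. \<gamma> (insert d u) powr \<theta> * B ^ card (insert d u))"
    using Suc Tb by (intro add_mono) auto
  also have "\<dots> = 2 / real n * ((\<Sum>u\<in>Pow {..<d} - {{}}. \<gamma> u powr \<theta> * B ^ card u) + (\<Sum>u\<in>insert d ` Pow {..<d}. \<gamma> u powr \<theta> * B ^ card u))"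
    by (subst sum.reindex) (auto simp: inj_on_def distrib_left)
  also have "(\<Sum>u\<in>Pow {..<d} - {{}}. \<gamma> u powr \<theta> * B ^ card u) + (\<Sum>u\<in>insert d ` Pow {..<d}. \<gamma> u powr \<theta> * B ^ card u)
     = (\<Sum>u\<in>Pow {..<Suc d} - {{}}. \<gamma> u powr \<theta> * B ^ card u)"
    unfolding P by (rule sum.union_disjoint[symmetric]) auto
  finally show ?case .
qed

section \<open>Uniform bounds for sums\<close>

lemma gcd_fsz: "h < n \<Longrightarrow> h \<noteq> 0 \<Longrightarrow> gcd (fsz n h) n = gcd h n"
  by (auto simp: fsz_def min_def gcd_diff1_nat) (metis gcd.commute gcd_diff2_nat less_imp_le)

text \<open>The gcd is a power \<open>2 ^ i\<close> dividing \<open>h\<close>; summing over all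
  \<open>i\<close> with \<open>2 ^ i\<close> dividing \<open>h\<close> only increases the value.
  Writing \<open>h = 2 ^ i * l\<close> separates a geometric series with ratio
  \<open>2 powr (1 - a) < 1\<close> from the series over \<open>l\<close>.\<close>

lemma sum_powr_gcd_le:
  fixes a :: real
  assumes a: "1 < a"
  shows "(\<Sum>h=1..<2 ^ m. real h powr (- a) * real (gcd h (2 ^ m))) \<le> (\<Sum>l. real l powr (- a)) / (1 - 2 powr (1 - a))"
proof -
  let ?Z = "\<Sum>l. real l powr (- a)"
  let ?n = "2 ^ m :: nat"
  have sZ: "summable (\<lambda>l. real l powr (- a))" using a by (simp add: summable_real_powr_iff)
  have fin_le: "(\<Sum>l\<in>L. real l powr (- a)) \<le> ?Z" if "finite L" for L
    by (rule sum_le_suminf[OF sZ that]) auto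
  have r: "0 < 2 powr (1 - a)" "2 powr (1 - a) < 1" using a by (auto simp: powr_less_one)
  have "(\<Sum>h=1..<?n. real h powr (- a) * real (gcd h ?n)) \<le> (\<Sum>h=1..<?n. \<Sum>i\<le>m. if 2 ^ i dvd h then real h powr (- a) * 2 ^ i else 0)"
  proof (rule sum_mono)
    fix h
    obtain i where i: "i \<le> m" "gcd h ?n = 2 ^ i" using divides_primepow_nat[of 2 "gcd h ?n" m] by auto
    then have "2 ^ i dvd h" by (metis gcd_dvd1)
    have "real h powr (- a) * real (gcd h ?n) = (if 2 ^ i dvd h then real h powr (- a) * 2 ^ i else 0)"
      using i \<open>2 ^ i dvd h\<close> by simp
    also have "\<dots> \<le> (\<Sum>i\<le>m. if 2 ^ i dvd h then real h powr (- a) * 2 ^ i else 0)"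
      using i by (intro member_le_sum[of i "{..m}" "\<lambda>i. if 2 ^ i dvd h then real h powr (- a) * 2 ^ i else 0"]) auto
    finally show "real h powr (- a) * real (gcd h ?n) \<le> (\<Sum>i\<le>m. if 2 ^ i dvd h then real h powr (- a) * 2 ^ i else 0)" .
  qed
  also have "\<dots> = (\<Sum>i\<le>m. \<Sum>h=1..<?n. if 2 ^ i dvd h then real h powr (- a) * 2 ^ i else 0)" by (rule sum.swap)
  also have "\<dots> \<le> (\<Sum>i\<le>m. (2 powr (1 - a)) ^ i * ?Z)"
  proof (rule sum_mono)
    fix i
    let ?L = "{h \<in> {1..<?n}. 2 ^ i dvd h}"
    have inj: "inj_on (\<lambda>h. h div 2 ^ i) ?L" by (rule inj_onI) (auto elim!: dvdE)
    have "(\<Sum>h=1..<?n. if 2 ^ i dvd h then real h powr (- a) * 2 ^ i else 0) = (\<Sum>h\<in>?L. real h powr (- a) * 2 ^ i)"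
      by (rule sum.mono_neutral_cong_right) auto
    also have "\<dots> = (\<Sum>h\<in>?L. (2 powr (1 - a)) ^ i * real (h div 2 ^ i) powr (- a))"
    proof (intro sum.cong refl)
      fix h assume "h \<in> ?L"
      then obtain l where l: "h = 2 ^ i * l" by auto
      have "real h powr (- a) * 2 ^ i = ((2 ^ i) powr (- a) * 2 ^ i) * real l powr (- a)"
        by (simp add: l powr_mult)
      also have "(2 ^ i) powr (- a) * 2 ^ i = (2 powr (1 - a)) ^ i"
      proof -
        have "(2 powr (1 - a)) ^ i = (2 powr (- a) * 2) ^ i" using powr_add[of 2 "- a" 1] by simp
        also have "\<dots> = (2 powr (- a)) ^ i * 2 ^ i" by (rule power_mult_distrib)
        also have "(2 powr (- a)) ^ i = (2 ^ i) powr (- a)"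
          by (simp add: powr_realpow[symmetric] powr_powr mult.commute)
        finally show ?thesis by simp
      qed
      finally show "real h powr (- a) * 2 ^ i = (2 powr (1 - a)) ^ i * real (h div 2 ^ i) powr (- a)" by (simp add: l)
    qed
    also have "\<dots> = (2 powr (1 - a)) ^ i * (\<Sum>l\<in>(\<lambda>h. h div 2 ^ i) ` ?L. real l powr (- a))"
      by (subst sum.reindex[OF inj]) (simp add: sum_distrib_left)
    also have "\<dots> \<le> (2 powr (1 - a)) ^ i * ?Z" by (intro mult_left_mono fin_le) auto
    finally show "(\<Sum>h=1..<?n. if 2 ^ i dvd h then real h powr (- a) * 2 ^ i else 0) \<le> (2 powr (1 - a)) ^ i * ?Z" .
  qed
  also have "\<dots> = (\<Sum>i\<le>m. (2 powr (1 - a)) ^ i) * ?Z" by (rule sum_distrib_right[symmetric])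
  also have "\<dots> \<le> 1 / (1 - 2 powr (1 - a)) * ?Z"
  proof (rule mult_right_mono)
    have "(\<Sum>i\<le>m. (2 powr (1 - a)) ^ i) \<le> (\<Sum>i. (2 powr (1 - a)) ^ i)"
      using r by (intro sum_le_suminf summable_geometric) auto
    then show "(\<Sum>i\<le>m. (2 powr (1 - a)) ^ i) \<le> 1 / (1 - 2 powr (1 - a))" using r by (simp add: suminf_geometric)
    show "0 \<le> ?Z" using fin_le[of "{}"] by simp
  qed
  finally show ?thesis by simp
qed

text \<open>The folded frequency is \<open>h\<close> or \<open>n - h\<close>, with unchanged gcd, so
  the nonzero frequencies cost at most twice the unfolded sum. Frequency 0 contributes
  \<open>n powr (1 - a) \<le> 1\<close>.\<close>

lemma sum_fsz_gcd_le:
  fixes a :: real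
  assumes a: "1 < a" and n: "n = 2 ^ m"
  shows "(\<Sum>h<n. real (fsz n h) powr (- a) * real (gcd h n)) \<le> 1 + 2 * ((\<Sum>l. real l powr (- a)) / (1 - 2 powr (1 - a)))"
proof -
  let ?F = "\<lambda>h. real h powr (- a) * real (gcd h n)"
  have n1: "n \<ge> 1" using n by simp
  have "(\<Sum>h<n. real (fsz n h) powr (- a) * real (gcd h n)) = real (fsz n 0) powr (- a) * real (gcd 0 n) + (\<Sum>h=1..<n. real (fsz n h) powr (- a) * real (gcd h n))"
    using n1 by (simp add: lessThan_atLeast0 sum.atLeast_Suc_lessThan)
  also have "real (fsz n 0) powr (- a) * real (gcd 0 n) = real n powr (1 - a)"
    using n1 powr_add[of "real n" "- a" 1] by (simp add: fsz_def)
  also have "\<dots> \<le> 1" using n1 a powr_mono[of "1 - a" 0 "real n"] by simp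
  also have "(\<Sum>h=1..<n. real (fsz n h) powr (- a) * real (gcd h n)) \<le> (\<Sum>h=1..<n. ?F h + ?F (n - h))"
  proof (rule sum_mono)
    fix h assume h: "h \<in> {1..<n}"
    have "real (fsz n h) powr (- a) * real (gcd h n) = ?F (fsz n h)" using h by (simp add: gcd_fsz)
    also have "\<dots> \<le> ?F h + ?F (n - h)" using h by (simp add: fsz_def min_def)
    finally show "real (fsz n h) powr (- a) * real (gcd h n) \<le> ?F h + ?F (n - h)" .
  qed
  also have "\<dots> = (\<Sum>h=1..<n. ?F h) + (\<Sum>h=1..<n. ?F (n - h))" by (rule sum.distrib)
  also have "(\<Sum>h=1..<n. ?F (n - h)) = (\<Sum>h=1..<n. ?F h)"
    by (rule sum.reindex_bij_witness[of _ "\<lambda>h. n - h" "\<lambda>h. n - h"]) auto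
  finally show ?thesis using sum_powr_gcd_le[OF a, of m] by (simp add: n)
qed

lemma Cf_sum_bounded:
  assumes \<theta>: "1 / 2 < \<theta>" "\<theta> \<le> 1"
  shows "\<exists>B>0. \<forall>\<tau> m. 0 \<le> \<tau> \<longrightarrow> \<tau> \<le> L \<longrightarrow> (\<Sum>h<2 ^ m. Cf \<tau> (2 ^ m) h powr \<theta> * real (gcd h (2 ^ m))) \<le> B"
proof -
  \<comment> \<open>The share of the tail probability in the interpolation. It makes
    \<open>(q - 2) * \<theta>\<close> equal to \<open>- (\<theta> + 1 / 2)\<close>, which is below
    -1, while \<open>q > 0\<close> keeps the Gaussian integral finite. Both rest on
    \<open>\<theta> > 1 / 2\<close>.\<close>
  define q where "q = 1 - 1 / (2 * \<theta>)"
  have q: "0 < q" "q < 1" using \<theta> by (auto simp: q_def field_simps)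
  define a where "a = \<theta> + 1 / 2"
  have a: "1 < a" using \<theta> by (simp add: a_def)
  have qa: "(q - 2) * \<theta> = - a" using \<theta> by (simp add: q_def a_def field_simps)
  define c0 where "c0 = exp (4 * L\<^sup>2 / q) * (\<integral>x. exp (- (q / 4) * x\<^sup>2) \<partial>lborel)"
  have c0: "0 \<le> c0" unfolding c0_def by (intro mult_nonneg_nonneg Bochner_Integration.integral_nonneg) auto
  \<comment> \<open>The added 1 makes \<open>B\<close> positive with only \<open>0 \<le> c0\<close>
    at hand.\<close>
  define B where "B = (2 * c0) powr \<theta> * (1 + 2 * ((\<Sum>l. real l powr (- a)) / (1 - 2 powr (1 - a)))) + 1"
  have main: "(\<Sum>h<2 ^ m. Cf \<tau> (2 ^ m) h powr \<theta> * real (gcd h (2 ^ m))) \<le> B" if t: "0 \<le> \<tau>" "\<tau> \<le> L" for \<tau> m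
  proof -
    let ?n = "2 ^ m :: nat"
    have I: "(\<integral>x. ntail x powr q * exp (2 * \<tau> * \<bar>x\<bar>) \<partial>lborel) \<le> c0"
    proof -
      have "exp (4 * \<tau>\<^sup>2 / q) \<le> exp (4 * L\<^sup>2 / q)" using t q by (simp add: divide_right_mono power_mono)
      then have "exp (4 * \<tau>\<^sup>2 / q) * (\<integral>x. exp (- (q / 4) * x\<^sup>2) \<partial>lborel) \<le> c0"
        unfolding c0_def by (intro mult_right_mono Bochner_Integration.integral_nonneg) auto
      then show ?thesis using integrable_ntail_exp(2)[OF q(1), of \<tau>] by linarith
    qed
    have "(\<Sum>h<?n. Cf \<tau> ?n h powr \<theta> * real (gcd h ?n)) \<le> (\<Sum>h<?n. (2 * c0) powr \<theta> * (real (fsz ?n h) powr (- a) * real (gcd h ?n)))"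
    proof (rule sum_mono)
      fix h assume h: "h \<in> {..<?n}"
      have "Cf \<tau> ?n h \<le> 2 * (\<integral>x. ntail x powr q * exp (2 * \<tau> * \<bar>x\<bar>) \<partial>lborel) * real (fsz ?n h) powr (q - 2)"
        using h by (intro Cf_integrable_le(2) q) auto
      also have "\<dots> \<le> 2 * c0 * real (fsz ?n h) powr (q - 2)" using I by (intro mult_right_mono) auto
      finally have "Cf \<tau> ?n h powr \<theta> \<le> (2 * c0 * real (fsz ?n h) powr (q - 2)) powr \<theta>"
        using \<theta> Cf_nonneg by (intro powr_mono2) auto
      also have "\<dots> = (2 * c0) powr \<theta> * real (fsz ?n h) powr (- a)" using c0 by (simp add: powr_mult powr_powr qa)
      finally show "Cf \<tau> ?n h powr \<theta> * real (gcd h ?n) \<le> (2 * c0) powr \<theta> * (real (fsz ?n h) powr (- a) * real (gcd h ?n))"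
        by (simp add: mult.assoc[symmetric] mult_right_mono)
    qed
    also have "\<dots> = (2 * c0) powr \<theta> * (\<Sum>h<?n. real (fsz ?n h) powr (- a) * real (gcd h ?n))"
      by (rule sum_distrib_left[symmetric])
    also have "\<dots> \<le> (2 * c0) powr \<theta> * (1 + 2 * ((\<Sum>l. real l powr (- a)) / (1 - 2 powr (1 - a))))"
      by (intro mult_left_mono sum_fsz_gcd_le[OF a]) auto
    finally show ?thesis by (simp add: B_def)
  qed
  have "0 < B"
  proof -
    have "2 powr (1 - a) < 1" using a by (simp add: powr_less_one)
    moreover have "0 \<le> (\<Sum>l. real l powr (- a))" by (rule suminf_nonneg) (use a in \<open>auto simp: summable_real_powr_iff\<close>)
    ultimately have "0 \<le> (\<Sum>l. real l powr (- a)) / (1 - 2 powr (1 - a))" by simp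
    then show ?thesis unfolding B_def by (intro add_nonneg_pos mult_nonneg_nonneg) auto
  qed
  then show ?thesis using main by blast
qed

text \<open>The inner sum is an elementary symmetric polynomial; expanding the power of the sum
  produces each squarefree product \<open>k!\<close> times. The induction adds one variable and
  compares with the first two terms of the binomial expansion.\<close>

lemma card_sum_le:
  fixes a :: "nat \<Rightarrow> real"
  assumes a: "\<And>j. 0 \<le> a j"
  shows "fact k * (\<Sum>u | u \<subseteq> {..<s} \<and> card u = k. \<Prod>j\<in>u. a j) \<le> (\<Sum>j<s. a j) ^ k"
proof (induction s arbitrary: k)
  case 0
  have "{u. u \<subseteq> {..<0::nat} \<and> card u = k} = (if k = 0 then {{}} else {})" by auto
  then show ?case by simp
next
  case (Suc s)
  let ?S = "\<lambda>s k. \<Sum>u | u \<subseteq> {..<s} \<and> card u = k. \<Prod>j\<in>u. a j"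
  let ?A = "\<Sum>j<s. a j"
  have A: "0 \<le> ?A" using a by (intro sum_nonneg) auto
  show ?case
  proof (cases k)
    case 0
    have "{u. u \<subseteq> {..<Suc s} \<and> card u = 0} = {{}}" by (auto simp: finite_subset card_eq_0_iff)
    then show ?thesis using 0 by simp
  next
    case (Suc k')
    have e: "{u. u \<subseteq> {..<Suc s} \<and> card u = k} = {u. u \<subseteq> {..<s} \<and> card u = k} \<union> insert s ` {u. u \<subseteq> {..<s} \<and> card u = k'}"
    proof (intro equalityI subsetI)
      fix u assume u: "u \<in> {u. u \<subseteq> {..<Suc s} \<and> card u = k}"
      then have fu: "finite u" using finite_subset by auto
      show "u \<in> {u. u \<subseteq> {..<s} \<and> card u = k} \<union> insert s ` {u. u \<subseteq> {..<s} \<and> card u = k'}"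
      proof (cases "s \<in> u")
        case True
        then have "u = insert s (u - {s})" "u - {s} \<subseteq> {..<s}" "card (u - {s}) = k'" using u fu Suc by (auto simp: lessThan_Suc)
        then show ?thesis by blast
      qed (use u in \<open>auto simp: lessThan_Suc\<close>)
    next
      fix u assume "u \<in> {u. u \<subseteq> {..<s} \<and> card u = k} \<union> insert s ` {u. u \<subseteq> {..<s} \<and> card u = k'}"
      then consider "u \<subseteq> {..<s}" "card u = k" | v where "u = insert s v" "v \<subseteq> {..<s}" "card v = k'" by auto
      then show "u \<in> {u. u \<subseteq> {..<Suc s} \<and> card u = k}"
      proof cases
        case 2
        then have "finite v" "s \<notin> v" by (auto intro: finite_subset)
        then show ?thesis using 2 Suc by (auto simp: lessThan_Suc)
      qed (auto simp: lessThan_Suc)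
    qed
    have "?S (Suc s) k = ?S s k + (\<Sum>u\<in>insert s ` {u. u \<subseteq> {..<s} \<and> card u = k'}. \<Prod>j\<in>u. a j)"
      unfolding e by (rule sum.union_disjoint) auto
    also have "(\<Sum>u\<in>insert s ` {u. u \<subseteq> {..<s} \<and> card u = k'}. \<Prod>j\<in>u. a j) = (\<Sum>u | u \<subseteq> {..<s} \<and> card u = k'. \<Prod>j\<in>insert s u. a j)"
      by (subst sum.reindex) (auto simp: inj_on_def)
    also have "\<dots> = (\<Sum>u | u \<subseteq> {..<s} \<and> card u = k'. a s * (\<Prod>j\<in>u. a j))"
    proof (intro sum.cong refl)
      fix u assume "u \<in> {u. u \<subseteq> {..<s} \<and> card u = k'}"
      then have "finite u" "s \<notin> u" by (auto intro: finite_subset)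
      then show "(\<Prod>j\<in>insert s u. a j) = a s * (\<Prod>j\<in>u. a j)" by simp
    qed
    also have "\<dots> = a s * ?S s k'" by (rule sum_distrib_left[symmetric])
    finally have "fact k * ?S (Suc s) k = fact k * ?S s k + real k * a s * (fact k' * ?S s k')"
      by (simp add: Suc algebra_simps)
    also have "\<dots> \<le> ?A ^ k + real k * a s * ?A ^ k'"
      using Suc.IH[of k] Suc.IH[of k'] a by (intro add_mono mult_left_mono) auto
    also have "\<dots> \<le> (?A + a s) ^ k"
    proof -
      have "A ^ k + real k * x * A ^ (k - 1) \<le> (A + x) ^ k" if "0 \<le> A" "0 \<le> x" for A x :: real and k
      proof (induction k)
        case (Suc k)
        have "A ^ Suc k + real (Suc k) * x * A ^ k \<le> (A + x) * (A ^ k + real k * x * A ^ (k - 1))"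
        proof (cases k)
          case (Suc k')
          have "0 \<le> x * (real k * x * A ^ k')" using that by simp
          then show ?thesis by (simp add: Suc algebra_simps)
        qed simp
        also have "\<dots> \<le> (A + x) * (A + x) ^ k" using Suc that by (intro mult_left_mono) auto
        finally show ?case by simp
      qed simp
      from this[OF A a, of k s] show ?thesis by (simp add: Suc)
    qed
    finally show ?thesis by simp
  qed
qed

lemma summable_power_fact_powr:
  fixes A r :: real
  assumes "0 \<le> A" "r < 1"
  shows "summable (\<lambda>k. fact k powr (r - 1) * A ^ k)"
proof -
  have "(\<lambda>k. real (Suc k) powr (r - 1) * A) \<longlonglongrightarrow> 0 * A"
  proof (intro tendsto_intros)
    have "filterlim (\<lambda>k. real (Suc k)) at_top sequentially"
      by (rule filterlim_compose[OF filterlim_real_sequentially filterlim_Suc])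
    then show "(\<lambda>k. real (Suc k) powr (r - 1)) \<longlonglongrightarrow> 0" using assms by (intro tendsto_neg_powr) auto
  qed
  then have "eventually (\<lambda>k. real (Suc k) powr (r - 1) * A < 1 / 2) sequentially"
    by (intro order_tendstoD(2)) auto
  then obtain N where N: "\<And>k. k \<ge> N \<Longrightarrow> real (Suc k) powr (r - 1) * A < 1 / 2" by (auto simp: eventually_sequentially)
  show ?thesis
  proof (rule summable_ratio_test[of "1/2" N])
    fix k assume k: "N \<le> k"
    have "fact (Suc k) powr (r - 1) * A ^ Suc k = (real (Suc k) powr (r - 1) * A) * (fact k powr (r - 1) * A ^ k)"
      by (simp add: powr_mult fact_Suc del: of_nat_Suc)
    also have "\<dots> \<le> 1 / 2 * (fact k powr (r - 1) * A ^ k)"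
      using N[OF k] assms by (intro mult_right_mono) auto
    finally show "norm (fact (Suc k) powr (r - 1) * A ^ Suc k) \<le> 1 / 2 * norm (fact k powr (r - 1) * A ^ k)"
      using assms by (simp add: abs_mult)
  qed simp
qed

text \<open>Grouping by cardinality, \<open>card_sum_le\<close> provides a division by one
  factorial. The factor \<open>fact k powr (r - 1)\<close> that remains outweighs any geometric
  growth because \<open>r < 1\<close>, however large the sum of \<open>a\<close> is.\<close>

lemma sum_fact_prod_bounded:
  fixes a :: "nat \<Rightarrow> real" and r :: real
  assumes a: "\<And>j. 0 \<le> a j" "summable a" and r: "r < 1"
  shows "\<exists>M. \<forall>s. (\<Sum>u\<in>Pow {..<s}. fact (card u) powr r * (\<Prod>j\<in>u. a j)) \<le> M"
proof -
  define A where "A = suminf a"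
  have A: "(\<Sum>j<s. a j) \<le> A" for s unfolding A_def using a by (intro sum_le_suminf) auto
  have A0: "0 \<le> A" using A[of 0] by simp
  have "(\<Sum>u\<in>Pow {..<s}. fact (card u) powr r * (\<Prod>j\<in>u. a j)) \<le> (\<Sum>k. fact k powr (r - 1) * A ^ k)" for s
  proof -
    have "(\<Sum>u\<in>Pow {..<s}. fact (card u) powr r * (\<Prod>j\<in>u. a j))
      = (\<Sum>k\<le>s. \<Sum>u\<in>{u \<in> Pow {..<s}. card u = k}. fact (card u) powr r * (\<Prod>j\<in>u. a j))"
    proof (rule sum.group[symmetric])
      show "card ` Pow {..<s} \<subseteq> {..s}" using card_mono[of "{..<s}"] by auto
    qed auto
    also have "\<dots> = (\<Sum>k\<le>s. fact k powr r * (\<Sum>u | u \<subseteq> {..<s} \<and> card u = k. \<Prod>j\<in>u. a j))"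
      by (intro sum.cong refl) (simp add: sum_distrib_left)
    also have "\<dots> \<le> (\<Sum>k\<le>s. fact k powr (r - 1) * A ^ k)"
    proof (rule sum_mono)
      fix k
      let ?S = "\<Sum>u | u \<subseteq> {..<s} \<and> card u = k. \<Prod>j\<in>u. a j"
      have "fact k powr r * ?S = fact k powr (r - 1) * (fact k * ?S)"
        using powr_add[of "fact k :: real" "r - 1" 1] by simp
      also have "\<dots> \<le> fact k powr (r - 1) * (\<Sum>j<s. a j) ^ k"
        using card_sum_le[of a k s] a by (intro mult_left_mono) auto
      also have "\<dots> \<le> fact k powr (r - 1) * A ^ k"
        using A[of s] a by (intro mult_left_mono power_mono sum_nonneg) auto
      finally show "fact k powr r * ?S \<le> fact k powr (r - 1) * A ^ k" .
    qed
    also have "\<dots> \<le> (\<Sum>k. fact k powr (r - 1) * A ^ k)"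
      using A0 by (intro sum_le_suminf summable_power_fact_powr[OF A0 r]) auto
    finally show ?thesis .
  qed
  then show ?thesis by blast
qed

section \<open>Membership of the integrand in the weighted space\<close>

text \<open>Integrability over \<open>lebesgue\<close> gives measurability only for the completion,
  while the product spaces are built from \<open>lborel\<close>. A Borel version, set to infinity on
  a Borel null set covering all disagreement, dominates everywhere and has the same
  integral.\<close>

lemma lebesgue_borel_majorant:
  assumes i: "integrable lebesgue f" and f: "\<And>x. 0 \<le> f x"
  shows "\<exists>g. g \<in> borel_measurable borel \<and> (\<forall>x. ennreal (f x) \<le> g x) \<and> (\<integral>\<^sup>+x. g x \<partial>lborel) = ennreal (\<integral>x. f x \<partial>lebesgue)"
proof -
  have "(\<lambda>x. ennreal (f x)) \<in> borel_measurable lebesgue" using i by auto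
  then obtain g0 where g0: "g0 \<in> borel_measurable lborel" "AE x in lborel. ennreal (f x) = g0 x"
    using completion_ex_borel_measurable by blast
  then obtain N where N: "N \<in> null_sets lborel" "{x \<in> space lborel. \<not> ennreal (f x) = g0 x} \<subseteq> N"
    by (auto simp: eventually_ae_filter)
  have [measurable]: "N \<in> sets borel" "g0 \<in> borel_measurable borel" using N g0 by auto
  define g where "g x = (if x \<in> N then \<infinity> else g0 x)" for x
  have "g \<in> borel_measurable borel" unfolding g_def by measurable
  moreover have "ennreal (f x) \<le> g x" for x
  proof (cases "x \<in> N")
    case False
    then have "ennreal (f x) = g0 x" using N(2) by auto
    then show ?thesis using False by (simp add: g_def)
  qed (simp add: g_def)
  moreover have "(\<integral>\<^sup>+x. g x \<partial>lborel) = ennreal (\<integral>x. f x \<partial>lebesgue)"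
  proof -
    have "AE x in lborel. g x = ennreal (f x)"
      using AE_not_in[OF N(1)] g0(2) by eventually_elim (simp add: g_def)
    then have "(\<integral>\<^sup>+x. g x \<partial>lborel) = (\<integral>\<^sup>+x. ennreal (f x) \<partial>lborel)" by (rule nn_integral_cong_AE)
    also have "\<dots> = (\<integral>\<^sup>+x. ennreal (f x) \<partial>lebesgue)" by (rule nn_integral_completion[symmetric])
    also have "\<dots> = ennreal (\<integral>x. f x \<partial>lebesgue)" by (rule nn_integral_eq_integral[OF i]) (simp add: f)
    finally show ?thesis .
  qed
  ultimately show ?thesis by blast
qed

lemma lebesgue_integral_pos:
  fixes f :: "real \<Rightarrow> real"
  assumes i: "integrable lebesgue f" and f: "\<And>x. 0 < f x"
  shows "0 < (\<integral>x. f x \<partial>lebesgue)"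
proof (rule ccontr)
  have "0 \<le> (\<integral>x. f x \<partial>lebesgue)" using f by (intro Bochner_Integration.integral_nonneg) (simp add: less_imp_le)
  moreover assume "\<not> ?thesis"
  ultimately have "(\<integral>x. f x \<partial>lebesgue) = 0" by simp
  then have "AE x in lebesgue. f x = 0"
    using f by (subst (asm) integral_nonneg_eq_0_iff_AE[OF i]) (auto simp: less_imp_le)
  then have "AE x::real in lebesgue. False"
    by eventually_elim (use f in \<open>auto simp: less_le\<close>)
  then obtain N :: "real set" where N: "N \<in> null_sets lebesgue" "{x \<in> space lebesgue. \<not> False} \<subseteq> N"
    unfolding eventually_ae_filter by blast
  then have "N = UNIV" by auto
  then have "emeasure lebesgue (UNIV :: real set) = 0" using N(1) null_setsD1 by blast
  then show False by simp
qed

text \<open>Were \<open>C\<close> strictly below its mean everywhere, integrating the positive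
  difference against the density would give a positive number equal to 0.\<close>

lemma gaussian_mean_attained:
  assumes i: "integrable lebesgue (\<lambda>t. C t * std_normal_density t)"
  shows "\<exists>t. (\<integral>t. C t * std_normal_density t \<partial>lebesgue) \<le> C t"
proof (rule ccontr)
  define \<mu> where "\<mu> = (\<integral>t. C t * std_normal_density t \<partial>lebesgue)"
  assume "\<not> ?thesis"
  then have lt: "C t < \<mu>" for t by (auto simp: not_le \<mu>_def)
  have w: "integrable lebesgue std_normal_density" "(\<integral>t. std_normal_density t \<partial>lebesgue) = 1"
    by (simp_all add: integrable_completion integral_completion)
  have "0 < (\<integral>t. \<mu> * std_normal_density t - C t * std_normal_density t \<partial>lebesgue)"
  proof (rule lebesgue_integral_pos)
    show "integrable lebesgue (\<lambda>t. \<mu> * std_normal_density t - C t * std_normal_density t)" using i w by auto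
    show "0 < \<mu> * std_normal_density t - C t * std_normal_density t" for t
      using mult_strict_right_mono[OF lt normal_density_pos[of 1 0 t]] by simp
  qed
  moreover have "(\<integral>t. \<mu> * std_normal_density t - C t * std_normal_density t \<partial>lebesgue) = 0"
    using i w by (simp add: \<mu>_def)
  ultimately show False by simp
qed

lemma partial_prod_le_prodinf:
  fixes f :: "nat \<Rightarrow> real"
  assumes "convergent_prod f" "\<And>j. 1 \<le> f j"
  shows "(\<Prod>j<s. f j) \<le> prodinf f"
  using assms by (intro prod_le_prodinf convergent_prod_has_prod) (auto intro: order_trans[OF zero_le_one])

lemma mixed_differentiable_infinitely:
  "infinitely_differentiable F \<Longrightarrow> mixed_differentiable d F"
  unfolding infinitely_differentiable_def mixed_differentiable_def
  by (blast intro: continuous_on_subset)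

section \<open>Consequences of the derivative bounds for \<open>F\<close>\<close>

context
  fixes F :: "(nat \<Rightarrow> real) \<Rightarrow> real" and \<delta> \<rho> :: real and b \<tau> :: "nat \<Rightarrow> real" and \<beta> C :: "nat \<Rightarrow> real \<Rightarrow> real"
  assumes F_smooth: "infinitely_differentiable F"
    and b_pos: "\<And>j. b j > 0" and beta_pos: "\<And>j t. \<beta> j t > 0" and C_ge_1: "\<And>j t. C j t \<ge> 1"
    and C_F_finite: "\<And>\<xi>. convergent_prod (\<lambda>j. C j (\<xi> j))"
    and deriv_bound: "\<And>\<xi> \<nu>. finite {j. \<nu> j \<noteq> 0} \<Longrightarrow>
        \<bar>multi_deriv \<nu> F \<xi>\<bar> \<le> (\<Prod>j. C j (\<xi> j))
          * (\<Prod>j | \<nu> j \<noteq> 0. \<beta> j (\<xi> j) ^ \<nu> j) * (\<Prod>j | \<nu> j \<noteq> 0. b j ^ \<nu> j)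
          * fact (\<Sum>j | \<nu> j \<noteq> 0. \<nu> j) powr \<delta>"
    and rho_integrable: "\<And>j. integrable lebesgue (\<lambda>t. (C j t)\<^sup>2 * (\<beta> j t)\<^sup>2 * (psi (\<tau> j) t)\<^sup>2)"
    and rho_le: "\<And>j. sqrt (\<integral>t. (C j t)\<^sup>2 * (\<beta> j t)\<^sup>2 * (psi (\<tau> j) t)\<^sup>2 \<partial>lebesgue) \<le> \<rho>"
begin

text \<open>Past \<open>s\<close> all factors are values at 0. Being at least 1, they are bounded by
  the whole product at the origin, a constant that does not see \<open>s\<close>.\<close>

lemma prodinf_trunc_le:
  assumes "\<And>j. j \<ge> s \<Longrightarrow> \<xi> j = 0"
  shows "(\<Prod>j. C j (\<xi> j)) \<le> (\<Prod>j<s. C j (\<xi> j)) * (\<Prod>j. C j 0)"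
proof -
  have C0: "0 \<le> C j t" for j t using C_ge_1[of j t] by simp
  have lim: "(\<lambda>n. \<Prod>j\<le>n. C j (\<xi> j)) \<longlonglongrightarrow> (\<Prod>j. C j (\<xi> j))"
    by (rule convergent_prod_LIMSEQ[OF C_F_finite])
  have "(\<Prod>j\<le>n. C j (\<xi> j)) \<le> (\<Prod>j<s. C j (\<xi> j)) * (\<Prod>j. C j 0)" for n
  proof -
    have "(\<Prod>j\<le>n. C j (\<xi> j)) = (\<Prod>j\<in>{..n} \<inter> {..<s}. C j (\<xi> j)) * (\<Prod>j\<in>{..n} - {..<s}. C j (\<xi> j))"
      by (subst prod.union_disjoint[symmetric]) (auto intro!: prod.cong)
    also have "(\<Prod>j\<in>{..n} - {..<s}. C j (\<xi> j)) = (\<Prod>j\<in>{..n} - {..<s}. C j 0)"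
      using assms by (intro prod.cong) auto
    also have "\<dots> \<le> (\<Prod>j<Suc n. C j 0)"
      using C_ge_1 C0 by (intro prod_mono2) auto
    also have "\<dots> \<le> (\<Prod>j. C j 0)"
      using partial_prod_le_prodinf[OF C_F_finite[of "\<lambda>_. 0"]] C_ge_1 by (simp del: prod.lessThan_Suc)
    also have "(\<Prod>j\<in>{..n} \<inter> {..<s}. C j (\<xi> j)) \<le> (\<Prod>j<s. C j (\<xi> j))"
      using C_ge_1 C0 by (intro prod_mono2) auto
    finally show ?thesis
      using C0 partial_prod_le_prodinf[OF C_F_finite[of "\<lambda>_. 0"], of 0] C_ge_1 by (simp add: mult_right_mono mult_left_mono prod_nonneg)
  qed
  then show ?thesis by (intro LIMSEQ_le_const2[OF lim]) auto
qed

definition P0 where "P0 = (\<Prod>j. C j 0)"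

definition wt :: "nat set \<Rightarrow> real" where "wt u = fact (card u) powr \<delta> * (\<Prod>j\<in>u. b j)"

lemma P0_ge_1: "1 \<le> P0"
  using partial_prod_le_prodinf[OF C_F_finite[of "\<lambda>_. 0"], of 0] C_ge_1 by (simp add: P0_def)

lemma wt_pos: "0 < wt u"
  unfolding wt_def using b_pos by (intro mult_pos_pos prod_pos) auto

lemma md_fam_bound:
  assumes u: "u \<subseteq> {..<s}"
  shows "\<bar>md_fam s F u (merge u ({..<s} - u) (x, y))\<bar>
    \<le> P0 * wt u * (\<Prod>j\<in>u. C j (x j) * \<beta> j (x j)) * (\<Prod>j\<in>{..<s} - u. C j (y j))"
proof -
  let ?\<xi> = "trunc s (merge u ({..<s} - u) (x, y))"
  have fu: "finite u" using u finite_subset by auto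
  have C0: "0 \<le> C j t" for j t using C_ge_1[of j t] by simp
  have iu: "{j. (indicator u j :: nat) \<noteq> 0} = u" by (auto simp: indicator_def)
  have xi_u: "?\<xi> j = x j" if "j \<in> u" for j using that u by (auto simp: trunc_def merge_def)
  have xi_n: "?\<xi> j = y j" if "j \<in> {..<s} - u" for j using that by (auto simp: trunc_def merge_def)
  have "(\<Prod>j. C j (?\<xi> j)) \<le> (\<Prod>j<s. C j (?\<xi> j)) * P0"
    unfolding P0_def by (rule prodinf_trunc_le) (auto simp: trunc_def)
  also have "(\<Prod>j<s. C j (?\<xi> j)) = (\<Prod>j\<in>{..<s} - u. C j (?\<xi> j)) * (\<Prod>j\<in>u. C j (?\<xi> j))"
    by (rule prod.subset_diff[OF u]) simp
  also have "(\<Prod>j\<in>{..<s} - u. C j (?\<xi> j)) = (\<Prod>j\<in>{..<s} - u. C j (y j))" by (intro prod.cong refl) (simp only: xi_n)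
  also have "(\<Prod>j\<in>u. C j (?\<xi> j)) = (\<Prod>j\<in>u. C j (x j))" by (intro prod.cong refl) (simp only: xi_u)
  finally have 1: "(\<Prod>j. C j (?\<xi> j)) \<le> (\<Prod>j\<in>{..<s} - u. C j (y j)) * (\<Prod>j\<in>u. C j (x j)) * P0" .
  have "\<bar>multi_deriv (indicator u) F ?\<xi>\<bar> \<le> (\<Prod>j. C j (?\<xi> j)) * (\<Prod>j\<in>u. \<beta> j (?\<xi> j) ^ indicator u j) * (\<Prod>j\<in>u. b j ^ indicator u j)
      * fact (\<Sum>j\<in>u. indicator u j) powr \<delta>"
    using deriv_bound[of "indicator u" ?\<xi>] fu unfolding iu by simp
  also have "(\<Prod>j\<in>u. \<beta> j (?\<xi> j) ^ indicator u j) = (\<Prod>j\<in>u. \<beta> j (x j))" by (intro prod.cong refl) (simp add: xi_u)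
  also have "(\<Prod>j\<in>u. b j ^ indicator u j) = (\<Prod>j\<in>u. b j)" by (intro prod.cong refl) simp
  also have "(\<Sum>j\<in>u. indicator u j) = card u" by simp
  also have "(\<Prod>j. C j (?\<xi> j)) * (\<Prod>j\<in>u. \<beta> j (x j)) * (\<Prod>j\<in>u. b j) * fact (card u) powr \<delta>
    \<le> ((\<Prod>j\<in>{..<s} - u. C j (y j)) * (\<Prod>j\<in>u. C j (x j)) * P0) * (\<Prod>j\<in>u. \<beta> j (x j)) * (\<Prod>j\<in>u. b j) * fact (card u) powr \<delta>"
    using 1 beta_pos b_pos by (intro mult_right_mono prod_nonneg) (auto simp: less_imp_le)
  finally show ?thesis by (simp add: wt_def prod.distrib mult_ac)
qed

definition Cmean :: "nat \<Rightarrow> real" where "Cmean j = (\<integral>t. C j t * std_normal_density t \<partial>lebesgue)"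

text \<open>Each Gaussian mean \<open>Cmean j\<close> is attained or exceeded by \<open>C j\<close> at some point, so the convergence of the product at one sequence of points bounds the products of the means for all dimensions. Where the mean does not exist the point is arbitrary.\<close>

definition Kc :: real where
  "Kc = (\<Prod>j. C j (if integrable lebesgue (\<lambda>t. C j t * std_normal_density t) then (SOME t. Cmean j \<le> C j t) else 0))"

lemma Cmean_ge_1: "integrable lebesgue (\<lambda>t. C j t * std_normal_density t) \<Longrightarrow> 1 \<le> Cmean j"
proof -
  assume i: "integrable lebesgue (\<lambda>t. C j t * std_normal_density t)"
  have "(\<integral>t. std_normal_density t \<partial>lebesgue) \<le> Cmean j"
    unfolding Cmean_def using i C_ge_1 mult_right_mono[OF C_ge_1, of "std_normal_density _"]
    by (intro integral_mono) (auto simp: integrable_completion)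
  then show ?thesis by (simp add: integral_completion)
qed

lemma prod_Cmean_le:
  assumes "\<forall>j<s. integrable lebesgue (\<lambda>t. C j t * std_normal_density t)"
  shows "(\<Prod>j<s. Cmean j) \<le> Kc"
proof -
  let ?x = "\<lambda>j. if integrable lebesgue (\<lambda>t. C j t * std_normal_density t) then (SOME t. Cmean j \<le> C j t) else 0"
  have "(\<Prod>j<s. Cmean j) \<le> (\<Prod>j<s. C j (?x j))"
  proof (rule prod_mono, intro conjI)
    fix j assume "j \<in> {..<s}"
    then have i: "integrable lebesgue (\<lambda>t. C j t * std_normal_density t)" using assms by auto
    show "0 \<le> Cmean j" using Cmean_ge_1[OF i] by simp
    have "Cmean j \<le> C j (SOME t. Cmean j \<le> C j t)"
      using gaussian_mean_attained[OF i] unfolding Cmean_def[symmetric] by (rule someI_ex)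
    then show "Cmean j \<le> C j (?x j)" using i by simp
  qed
  also have "\<dots> \<le> Kc"
    unfolding Kc_def using C_ge_1 by (intro partial_prod_le_prodinf[of "\<lambda>j. C j (?x j)", OF C_F_finite]) auto
  finally show ?thesis .
qed

text \<open>The bound \<open>md_fam_bound\<close> is a product over coordinates, so integrating out
  those outside \<open>u\<close> leaves a product of means, bounded by \<open>Kc\<close> in every
  dimension. The Borel majorants stand in for the factors \<open>C j\<close>, whose product with the
  density is only Lebesgue measurable.\<close>

lemma W_integrand_F:
  assumes u: "u \<subseteq> {..<s}" and i: "\<forall>j<s. integrable lebesgue (\<lambda>t. C j t * std_normal_density t)"
  shows "integrable (lborel_on ({..<s} - u)) (W_integrand s u F x)"
    and "\<bar>WM s u F x\<bar> \<le> P0 * Kc * wt u * (\<Prod>j\<in>u. C j (x j) * \<beta> j (x j))"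
proof -
  let ?J = "{..<s} - u"
  have C0: "0 \<le> C j t" for j t using C_ge_1[of j t] by simp
  have md: "mixed_differentiable s F" by (rule mixed_differentiable_infinitely[OF F_smooth])
  have "\<forall>j\<in>?J. \<exists>g. g \<in> borel_measurable borel \<and> (\<forall>t. ennreal (C j t * std_normal_density t) \<le> g t) \<and> (\<integral>\<^sup>+t. g t \<partial>lborel) = ennreal (Cmean j)"
    unfolding Cmean_def using i C0 by (intro ballI lebesgue_borel_majorant) auto
  then obtain g where g: "\<And>j. j \<in> ?J \<Longrightarrow> g j \<in> borel_measurable borel"
    "\<And>j t. j \<in> ?J \<Longrightarrow> ennreal (C j t * std_normal_density t) \<le> g j t" "\<And>j. j \<in> ?J \<Longrightarrow> (\<integral>\<^sup>+t. g j t \<partial>lborel) = ennreal (Cmean j)"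
    by metis
  define c where "c = P0 * wt u * (\<Prod>j\<in>u. C j (x j) * \<beta> j (x j))"
  have c: "0 \<le> c" unfolding c_def using P0_ge_1 wt_pos[of u] C0 beta_pos by (intro mult_nonneg_nonneg prod_nonneg) (auto simp: less_imp_le)
  have "(\<integral>\<^sup>+y. ennreal \<bar>W_integrand s u F x y\<bar> \<partial>lborel_on ?J) \<le> (\<integral>\<^sup>+y. ennreal c * (\<Prod>j\<in>?J. g j (y j)) \<partial>lborel_on ?J)"
  proof (rule nn_integral_mono)
    fix y
    have "\<bar>W_integrand s u F x y\<bar> \<le> (c * (\<Prod>j\<in>?J. C j (y j))) * (\<Prod>j\<in>?J. std_normal_density (y j))"
      unfolding W_integrand_def abs_mult abs_prod c_def using md_fam_bound[OF u, of x y]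
      by (simp add: mult_right_mono prod_nonneg)
    then have "\<bar>W_integrand s u F x y\<bar> \<le> c * (\<Prod>j\<in>?J. C j (y j) * std_normal_density (y j))"
      by (simp add: prod.distrib mult.assoc)
    then have "ennreal \<bar>W_integrand s u F x y\<bar> \<le> ennreal c * ennreal (\<Prod>j\<in>?J. C j (y j) * std_normal_density (y j))"
      using c by (subst ennreal_mult'[symmetric]) (auto intro: ennreal_leI)
    also have "ennreal (\<Prod>j\<in>?J. C j (y j) * std_normal_density (y j)) = (\<Prod>j\<in>?J. ennreal (C j (y j) * std_normal_density (y j)))"
      using C0 by (intro prod_ennreal[symmetric]) auto
    also have "ennreal c * \<dots> \<le> ennreal c * (\<Prod>j\<in>?J. g j (y j))"
      using g(2) by (intro mult_left_mono prod_mono_ennreal) auto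
    finally show "ennreal \<bar>W_integrand s u F x y\<bar> \<le> ennreal c * (\<Prod>j\<in>?J. g j (y j))" .
  qed
  also have "\<dots> = ennreal c * (\<integral>\<^sup>+y. (\<Prod>j\<in>?J. g j (y j)) \<partial>lborel_on ?J)"
    using g(1) by (intro nn_integral_cmult borel_measurable_prod_ennreal) auto
  also have "(\<integral>\<^sup>+y. (\<Prod>j\<in>?J. g j (y j)) \<partial>lborel_on ?J) = (\<Prod>j\<in>?J. \<integral>\<^sup>+t. g j t \<partial>lborel)"
    using g(1) by (intro PL.product_nn_integral_prod) auto
  also have "\<dots> = (\<Prod>j\<in>?J. ennreal (Cmean j))" using g(3) by (intro prod.cong) auto
  also have "\<dots> \<le> ennreal Kc"
  proof -
    have c1: "1 \<le> Cmean j" if "j < s" for j using that i by (intro Cmean_ge_1) auto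
    have c0: "0 \<le> Cmean j" if "j < s" for j using c1[OF that] by simp
    \<comment> \<open>The means are at least 1, so the product may be enlarged from the complement
      of \<open>u\<close> to all coordinates below \<open>s\<close>.\<close>
    have "(\<Prod>j\<in>?J. Cmean j) \<le> (\<Prod>j<s. Cmean j)"
      using c1 c0 by (intro prod_mono2) auto
    also have "\<dots> \<le> Kc" by (rule prod_Cmean_le[OF i])
    finally show ?thesis using c0 by (subst prod_ennreal) (auto intro: ennreal_leI)
  qed
  finally have b: "(\<integral>\<^sup>+y. ennreal \<bar>W_integrand s u F x y\<bar> \<partial>lborel_on ?J) \<le> ennreal c * ennreal Kc"
    by (simp add: mult_left_mono)
  have m: "W_integrand s u F x \<in> borel_measurable (lborel_on ?J)"
    using md_fam_measurable_merge[OF md u, of x] by (simp add: W_integrand_def[abs_def])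
  show "integrable (lborel_on ?J) (W_integrand s u F x)"
    using b m by (intro integrableI_bounded) (auto simp: ennreal_mult_less_top intro: le_less_trans)
  have Kc0: "0 \<le> Kc" using prod_Cmean_le[of 0] by simp
  have "ennreal \<bar>WM s u F x\<bar> \<le> ennreal (c * Kc)"
    unfolding WM_def using order_trans[OF ennreal_abs_integral_le b] c Kc0 by (simp add: ennreal_mult)
  then have "\<bar>WM s u F x\<bar> \<le> c * Kc" using c Kc0 by (simp add: ennreal_le_iff)
  then show "\<bar>WM s u F x\<bar> \<le> P0 * Kc * wt u * (\<Prod>j\<in>u. C j (x j) * \<beta> j (x j))" by (simp add: c_def mult_ac)
qed

text \<open>The square of the pointwise bound, times the weight, factors into one-dimensional
  integrals, each at most \<open>\<rho>\<^sup>2\<close> by hypothesis.\<close>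

lemma F_square_integral:
  assumes u: "u \<subseteq> {..<s}" and i: "\<forall>j<s. integrable lebesgue (\<lambda>t. C j t * std_normal_density t)"
  shows "integrable (lborel_on u) (\<lambda>x. (WM s u F x)\<^sup>2 * pw \<tau> u x)"
    and "(\<integral>x. (WM s u F x)\<^sup>2 * pw \<tau> u x \<partial>lborel_on u) \<le> (P0 * Kc * (wt u * \<rho> ^ card u))\<^sup>2"
proof -
  have md: "mixed_differentiable s F" by (rule mixed_differentiable_infinitely[OF F_smooth])
  have fu: "finite u" using u finite_subset by auto
  let ?k = "\<lambda>j t. (C j t)\<^sup>2 * (\<beta> j t)\<^sup>2 * (psi (\<tau> j) t)\<^sup>2"
  let ?I = "\<lambda>j. \<integral>t. ?k j t \<partial>lebesgue"
  have "\<forall>j. \<exists>g. g \<in> borel_measurable borel \<and> (\<forall>t. ennreal (?k j t) \<le> g t) \<and> (\<integral>\<^sup>+t. g t \<partial>lborel) = ennreal (?I j)"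
    by (intro allI lebesgue_borel_majorant rho_integrable) auto
  then obtain g where g: "\<And>j. g j \<in> borel_measurable borel" "\<And>j t. ennreal (?k j t) \<le> g j t"
     "\<And>j. (\<integral>\<^sup>+t. g j t \<partial>lborel) = ennreal (?I j)"
    by metis
  define c where "c = (P0 * Kc * wt u)\<^sup>2"
  have I0: "0 \<le> ?I j" for j by (rule Bochner_Integration.integral_nonneg) simp
  have I: "?I j \<le> \<rho>\<^sup>2" for j
  proof -
    have "(sqrt (?I j))\<^sup>2 \<le> \<rho>\<^sup>2" using rho_le[of j] I0 by (intro power_mono) auto
    then show ?thesis using I0 by simp
  qed
  have "(\<integral>\<^sup>+x. ennreal ((WM s u F x)\<^sup>2 * pw \<tau> u x) \<partial>lborel_on u) \<le> (\<integral>\<^sup>+x. ennreal c * (\<Prod>j\<in>u. g j (x j)) \<partial>lborel_on u)"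
  proof (rule nn_integral_mono)
    fix x
    have "(WM s u F x)\<^sup>2 \<le> (P0 * Kc * wt u * (\<Prod>j\<in>u. C j (x j) * \<beta> j (x j)))\<^sup>2"
      using W_integrand_F(2)[OF u i, of x] by (metis abs_ge_zero power2_abs power_mono)
    then have "(WM s u F x)\<^sup>2 * pw \<tau> u x \<le> (P0 * Kc * wt u * (\<Prod>j\<in>u. C j (x j) * \<beta> j (x j)))\<^sup>2 * pw \<tau> u x"
      using pw_pos[of \<tau> u x] by (intro mult_right_mono) auto
    also have "\<dots> = c * (\<Prod>j\<in>u. ?k j (x j))"
      by (simp add: c_def pw_def power_mult_distrib prod_power_distrib prod.distrib mult_ac)
    finally have "ennreal ((WM s u F x)\<^sup>2 * pw \<tau> u x) \<le> ennreal (c * (\<Prod>j\<in>u. ?k j (x j)))" by (rule ennreal_leI)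
    also have "\<dots> = ennreal c * (\<Prod>j\<in>u. ennreal (?k j (x j)))"
      by (subst prod_ennreal) (auto simp: ennreal_mult' c_def)
    also have "\<dots> \<le> ennreal c * (\<Prod>j\<in>u. g j (x j))"
      using g(2) by (intro mult_left_mono prod_mono_ennreal) auto
    finally show "ennreal ((WM s u F x)\<^sup>2 * pw \<tau> u x) \<le> ennreal c * (\<Prod>j\<in>u. g j (x j))" .
  qed
  also have "\<dots> = ennreal c * (\<integral>\<^sup>+x. (\<Prod>j\<in>u. g j (x j)) \<partial>lborel_on u)"
    using g(1) by (intro nn_integral_cmult borel_measurable_prod_ennreal) auto
  also have "(\<integral>\<^sup>+x. (\<Prod>j\<in>u. g j (x j)) \<partial>lborel_on u) = (\<Prod>j\<in>u. \<integral>\<^sup>+t. g j t \<partial>lborel)"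
    using g(1) by (intro PL.product_nn_integral_prod fu) auto
  also have "\<dots> = (\<Prod>j\<in>u. ennreal (?I j))" by (simp only: g(3))
  also have "\<dots> = ennreal (\<Prod>j\<in>u. ?I j)" using I0 by (intro prod_ennreal) auto
  also have "\<dots> \<le> ennreal ((\<rho> ^ card u)\<^sup>2)"
  proof (rule ennreal_leI)
    have "(\<Prod>j\<in>u. ?I j) \<le> (\<Prod>j\<in>u. \<rho>\<^sup>2)" using I I0 by (intro prod_mono) auto
    then show "(\<Prod>j\<in>u. ?I j) \<le> (\<rho> ^ card u)\<^sup>2" by (simp add: power_mult[symmetric] mult.commute)
  qed
  finally have "(\<integral>\<^sup>+x. ennreal ((WM s u F x)\<^sup>2 * pw \<tau> u x) \<partial>lborel_on u) \<le> ennreal c * ennreal ((\<rho> ^ card u)\<^sup>2)"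
    by (simp add: mult_left_mono)
  also have "\<dots> = ennreal ((P0 * Kc * (wt u * \<rho> ^ card u))\<^sup>2)"
    by (subst ennreal_mult'[symmetric]) (auto simp: c_def power_mult_distrib mult.assoc)
  finally have b: "(\<integral>\<^sup>+x. ennreal ((WM s u F x)\<^sup>2 * pw \<tau> u x) \<partial>lborel_on u) \<le> ennreal ((P0 * Kc * (wt u * \<rho> ^ card u))\<^sup>2)" .
  have m: "WM s u F \<in> borel_measurable (lborel_on u)" by (rule WM_measurable[OF md u])
  show I: "integrable (lborel_on u) (\<lambda>x. (WM s u F x)\<^sup>2 * pw \<tau> u x)"
    using m b pw_pos by (intro integrableI_bounded) (auto simp: less_imp_le intro: le_less_trans)
  have "ennreal (\<integral>x. (WM s u F x)\<^sup>2 * pw \<tau> u x \<partial>lborel_on u) \<le> ennreal ((P0 * Kc * (wt u * \<rho> ^ card u))\<^sup>2)"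
    using b pw_pos by (subst (asm) nn_integral_eq_integral[OF I]) (auto simp: less_imp_le)
  then show "(\<integral>x. (WM s u F x)\<^sup>2 * pw \<tau> u x \<partial>lborel_on u) \<le> (P0 * Kc * (wt u * \<rho> ^ card u))\<^sup>2"
    by (simp add: ennreal_le_iff)
qed

lemma F_in_W_space:
  assumes i: "\<forall>j<s. integrable lebesgue (\<lambda>t. C j t * std_normal_density t)" and \<gamma>: "\<And>u. \<gamma> u > 0"
  shows "F \<in> W_space s \<gamma> \<tau>"
    and "N2 s \<gamma> \<tau> F \<le> (P0 * Kc)\<^sup>2 * (\<Sum>u\<in>Pow {..<s}. 1 / \<gamma> u * (wt u * \<rho> ^ card u)\<^sup>2)"
proof -
  have md: "mixed_differentiable s F" by (rule mixed_differentiable_infinitely[OF F_smooth])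
  have "W_norm s \<gamma> \<tau> F < \<infinity>" using W_norm_eq_N2[of \<gamma>, OF \<gamma> F_square_integral(1)[OF _ i]] by simp
  then show "F \<in> W_space s \<gamma> \<tau>"
    unfolding W_space_def using md W_integrand_F(1)[OF _ i] by (auto intro!: AE_I2)
  have "N2 s \<gamma> \<tau> F \<le> (\<Sum>u\<in>Pow {..<s}. 1 / \<gamma> u * (P0 * Kc * (wt u * \<rho> ^ card u))\<^sup>2)"
    unfolding N2_def using \<gamma> by (intro sum_mono mult_left_mono F_square_integral(2)[OF _ i]) (auto simp: less_imp_le)
  also have "\<dots> = (P0 * Kc)\<^sup>2 * (\<Sum>u\<in>Pow {..<s}. 1 / \<gamma> u * (wt u * \<rho> ^ card u)\<^sup>2)"
    unfolding sum_distrib_left by (intro sum.cong refl) (simp add: power_mult_distrib mult_ac)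
  finally show "N2 s \<gamma> \<tau> F \<le> (P0 * Kc)\<^sup>2 * (\<Sum>u\<in>Pow {..<s}. 1 / \<gamma> u * (wt u * \<rho> ^ card u)\<^sup>2)" .
qed

text \<open>The point is the order of quantifiers: \<open>K\<close> comes from products over all
  coordinates and is fixed before the dimension and the weights.\<close>

lemma F_error_bound:
  "\<exists>K\<ge>0. \<forall>s \<gamma>. (\<forall>j<s. integrable lebesgue (\<lambda>t. C j t * std_normal_density t)) \<longrightarrow> (\<forall>u. \<gamma> u > 0) \<longrightarrow>
     F \<in> W_space s \<gamma> \<tau> \<and>
     N2 s \<gamma> \<tau> F \<le> K * (\<Sum>u\<in>Pow {..<s}. 1 / \<gamma> u * (fact (card u) powr \<delta> * (\<Prod>j\<in>u. \<rho> * b j))\<^sup>2)"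
proof (rule exI[of _ "(P0 * Kc)\<^sup>2"], intro conjI allI impI)
  fix s and \<gamma> :: "nat set \<Rightarrow> real"
  assume i: "\<forall>j<s. integrable lebesgue (\<lambda>t. C j t * std_normal_density t)" and g: "\<forall>u. \<gamma> u > 0"
  have \<gamma>: "\<gamma> u > 0" for u using g by simp
  show "F \<in> W_space s \<gamma> \<tau>" by (rule F_in_W_space(1)[OF i \<gamma>])
  have "wt u * \<rho> ^ card u = fact (card u) powr \<delta> * (\<Prod>j\<in>u. \<rho> * b j)" if "u \<in> Pow {..<s}" for u
    by (simp add: wt_def prod.distrib)
  then show "N2 s \<gamma> \<tau> F \<le> (P0 * Kc)\<^sup>2 * (\<Sum>u\<in>Pow {..<s}. 1 / \<gamma> u * (fact (card u) powr \<delta> * (\<Prod>j\<in>u. \<rho> * b j))\<^sup>2)"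
    using F_in_W_space(2)[of s \<gamma>, OF i \<gamma>] by simp
qed simp

end

section \<open>The error bound\<close>

lemma real_zeta_pos: assumes "1 < x" shows "0 < real_zeta x"
proof -
  have "summable (\<lambda>k. real k powr (- x))" using assms by (simp add: summable_real_powr_iff)
  then have "summable (\<lambda>k. real (Suc k) powr (- x))" by (subst summable_Suc_iff)
  then have s: "summable (\<lambda>k. 1 / real (Suc k) powr x)" by (simp add: powr_minus_divide)
  show ?thesis unfolding real_zeta_def by (rule suminf_pos[OF s]) simp
qed

text \<open>The parameter enters only through the exponential of a multiple of
  \<open>t\<^sup>2\<close>. The value at 0 is therefore a positive lower bound for all parameters,
  and an upper bound for \<open>varrho\<close> limits \<open>t\<close>.\<close>

lemma
  assumes \<theta>: "1 / 2 < \<theta>" "\<theta> \<le> 1"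
  shows varrho_0_pos: "0 < varrho 0 \<theta>"
    and varrho_eq: "varrho t \<theta> = varrho 0 \<theta> * exp (\<theta> * (4 * \<theta> / (2 * \<theta> - 1)) * t\<^sup>2)"
proof -
  define \<sigma> where "\<sigma> = (2 * \<theta> - 1) / (4 * \<theta>)"
  have s: "0 < \<sigma>" "\<sigma> < 1" using \<theta> by (auto simp: \<sigma>_def field_simps)
  define D where "D = sqrt (2 * pi) / (pi powr (2 - 2 * \<sigma>) * (1 - \<sigma>) * \<sigma>)"
  have D: "0 < D" using s by (simp add: D_def)
  have v: "varrho t \<theta> = 2 * (D * exp (t\<^sup>2 / \<sigma>)) powr \<theta> * real_zeta (\<theta> + 1 / 2)" for t
    by (simp add: varrho_def Let_def \<sigma>_def[symmetric] D_def)
  have z: "0 < real_zeta (\<theta> + 1 / 2)" using \<theta> by (intro real_zeta_pos) simp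
  show "0 < varrho 0 \<theta>" unfolding v using z D by simp
  have "(D * exp (t\<^sup>2 / \<sigma>)) powr \<theta> = D powr \<theta> * exp (\<theta> * (4 * \<theta> / (2 * \<theta> - 1)) * t\<^sup>2)"
    using D \<theta> by (simp add: powr_mult exp_powr_real \<sigma>_def field_simps)
  then show "varrho t \<theta> = varrho 0 \<theta> * exp (\<theta> * (4 * \<theta> / (2 * \<theta> - 1)) * t\<^sup>2)"
    unfolding v by simp
qed

lemma varrho_bounds:
  assumes \<theta>: "1 / 2 < \<theta>" "\<theta> \<le> 1"
  shows "varrho 0 \<theta> \<le> varrho t \<theta>" "\<theta> * (4 * \<theta> / (2 * \<theta> - 1)) * t\<^sup>2 \<le> varrho t \<theta> / varrho 0 \<theta>"
proof -
  note v0 = varrho_0_pos[OF \<theta>]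
  have "0 \<le> \<theta> * (4 * \<theta> / (2 * \<theta> - 1)) * t\<^sup>2" using \<theta> by simp
  then show "varrho 0 \<theta> \<le> varrho t \<theta>"
    unfolding varrho_eq[OF \<theta>, of t] using v0 by (simp add: mult_le_cancel_left1)
  have "\<theta> * (4 * \<theta> / (2 * \<theta> - 1)) * t\<^sup>2 \<le> exp (\<theta> * (4 * \<theta> / (2 * \<theta> - 1)) * t\<^sup>2)"
    using exp_ge_add_one_self[of "\<theta> * (4 * \<theta> / (2 * \<theta> - 1)) * t\<^sup>2"] by linarith
  also have "\<dots> = varrho t \<theta> / varrho 0 \<theta>" unfolding varrho_eq[OF \<theta>, of t] using v0 by simp
  finally show "\<theta> * (4 * \<theta> / (2 * \<theta> - 1)) * t\<^sup>2 \<le> varrho t \<theta> / varrho 0 \<theta>" .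
qed

lemma ennsqrt_mono_ennreal: "x \<le> ennreal y \<Longrightarrow> 0 \<le> y \<Longrightarrow> ennsqrt x \<le> ennreal (sqrt y)"
  by (cases x) (auto simp: ennsqrt_def top_unique ennreal_le_iff intro!: ennreal_leI)

lemma measurable_E2:
  "(\<lambda>\<Delta>. E2 d n \<gamma> \<tau> (lattice_pts n z \<Delta>)) \<in> borel_measurable (unif_shift d)"
proof -
  have "(\<lambda>\<Delta>. ker (\<tau> j) (Phi_inv (pts n (\<Delta> j) k)) (Phi_inv (pts n (\<Delta> j) l))) \<in> borel_measurable (unif_shift d)"
    if "j < d" for j k l
  proof -
    have [measurable]: "(\<lambda>\<Delta>. \<Delta> j) \<in> borel_measurable (unif_shift d)"
      using measurable_PiM_coord[OF measurable_ident, of "{..<d}" "\<lambda>_. U01" j] by (simp add: unif_shift_def)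
    show ?thesis by measurable
  qed
  then show ?thesis unfolding E2_def lattice_pts_eq
    by (intro borel_measurable_sum borel_measurable_times borel_measurable_const borel_measurable_prod) auto
qed

text \<open>The Cauchy-Schwarz bound holds for each shift with the same norm of \<open>F\<close>, so
  averaging acts on \<open>E2\<close> alone.\<close>

lemma root_mean_square_error_le:
  assumes n: "n \<ge> 1" and \<gamma>: "\<And>u. \<gamma> u > 0" and F: "F \<in> W_space s \<gamma> \<tau>"
  shows "ennsqrt (\<integral>\<^sup>+\<Delta>. ennreal (\<bar>gauss_integral s F - lattice_rule s n z \<Delta> F\<bar>\<^sup>2) \<partial>unif_shift s)
    \<le> ennreal (sqrt (N2 s \<gamma> \<tau> F * V s n \<gamma> \<tau> z))"
proof (rule ennsqrt_mono_ennreal)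
  have N0: "0 \<le> N2 s \<gamma> \<tau> F" by (rule N2_nonneg[OF \<gamma>])
  have eq: "gauss_integral s F - lattice_rule s n z \<Delta> F = cub_err s n (lattice_pts n z \<Delta>) F" for \<Delta>
    by (simp add: cub_err_def lattice_rule_def lattice_pts_def[abs_def])
  have "(\<integral>\<^sup>+\<Delta>. ennreal (\<bar>gauss_integral s F - lattice_rule s n z \<Delta> F\<bar>\<^sup>2) \<partial>unif_shift s)
    \<le> (\<integral>\<^sup>+\<Delta>. ennreal (N2 s \<gamma> \<tau> F) * ennreal (E2 s n \<gamma> \<tau> (lattice_pts n z \<Delta>)) \<partial>unif_shift s)"
  proof (rule nn_integral_mono)
    fix \<Delta>
    have "\<bar>gauss_integral s F - lattice_rule s n z \<Delta> F\<bar>\<^sup>2 \<le> N2 s \<gamma> \<tau> F * E2 s n \<gamma> \<tau> (lattice_pts n z \<Delta>)"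
      unfolding eq power2_abs by (rule cub_err_bound[OF \<gamma> F n])
    then show "ennreal (\<bar>gauss_integral s F - lattice_rule s n z \<Delta> F\<bar>\<^sup>2) \<le> ennreal (N2 s \<gamma> \<tau> F) * ennreal (E2 s n \<gamma> \<tau> (lattice_pts n z \<Delta>))"
      using N0 by (subst ennreal_mult'[symmetric]) (auto intro: ennreal_leI)
  qed
  also have "\<dots> = ennreal (N2 s \<gamma> \<tau> F) * ennreal (V s n \<gamma> \<tau> z)"
    using measurable_E2 by (simp add: nn_integral_cmult E2_average[of n \<gamma>, OF n \<gamma>])
  also have "\<dots> = ennreal (N2 s \<gamma> \<tau> F * V s n \<gamma> \<tau> z)" using N0 by (simp add: ennreal_mult')
  finally show "(\<integral>\<^sup>+\<Delta>. ennreal (\<bar>gauss_integral s F - lattice_rule s n z \<Delta> F\<bar>\<^sup>2) \<partial>unif_shift s)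
    \<le> ennreal (N2 s \<gamma> \<tau> F * V s n \<gamma> \<tau> z)" .
  show "0 \<le> N2 s \<gamma> \<tau> F * V s n \<gamma> \<tau> z" using N0 V_nonneg[of \<gamma>, OF \<gamma>] by simp
qed

text \<open>The weights balance the two sums. With \<open>Y\<close> and \<open>S\<close> as in the
  proof, \<open>\<gamma> u = (Y / S) powr e\<close>, and since
  \<open>e * \<theta> = 2 - e = q\<close>, both \<open>\<gamma> u powr \<theta>\<close> and
  \<open>Y\<^sup>2 / \<gamma> u\<close> contain \<open>Y powr q\<close>. This has the factorial to
  the power \<open>\<delta> * q < 1\<close> and the sequence \<open>b j powr q\<close>, summable
  because \<open>q \<ge> p\<close>.\<close>

lemma weight_sums_bounded:
  fixes b \<tau> r :: "nat \<Rightarrow> real" and \<rho> \<delta> p \<theta> B v0 v1 :: real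
  assumes b: "\<And>j. b j > 0" "summable (\<lambda>j. b j powr p)" and p: "0 < p"
    and \<theta>: "0 < \<theta>" and q: "p \<le> 2 * \<theta> / (1 + \<theta>)" "\<delta> * (2 * \<theta> / (1 + \<theta>)) < 1"
    and \<rho>: "0 < \<rho>" and r: "\<And>j. v0 \<le> r j" "\<And>j. r j \<le> v1" "0 < v0" and B: "0 < B"
    and gamma: "\<And>u. \<gamma> u = (fact (card u) powr \<delta> * (\<Prod>j\<in>u. \<rho> * b j / sqrt (r j))) powr (2 / (1 + \<theta>))"
  shows "\<exists>M>0. \<forall>s. (\<Sum>u\<in>Pow {..<s}. \<gamma> u powr \<theta> * B ^ card u) \<le> M \<and>
     (\<Sum>u\<in>Pow {..<s}. 1 / \<gamma> u * (fact (card u) powr \<delta> * (\<Prod>j\<in>u. \<rho> * b j))\<^sup>2) \<le> M"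
proof -
  define q where "q = 2 * \<theta> / (1 + \<theta>)"
  define e where "e = 2 / (1 + \<theta>)"
  have q0: "0 < q" and e0: "0 < e" using \<theta> by (simp_all add: q_def e_def)
  have eq: "e * \<theta> = q" "2 - e = q" using \<theta> by (simp_all add: q_def e_def field_simps)
  have rp: "0 < r j" for j using r(1)[of j] r(3) by simp
  \<comment> \<open>The sum of the constants per variable of the two sums, so that one sequence
    \<open>a\<close> dominates both.\<close>
  define D where "D = (\<rho> / sqrt v0) powr q * B + \<rho> powr q * sqrt v1 powr e"
  have D: "0 \<le> D" using B by (simp add: D_def)
  define a where "a j = D * b j powr q" for j
  have a0: "0 \<le> a j" for j using D by (simp add: a_def)
  have sa: "summable a"
  proof -
    \<comment> \<open>A larger exponent gives a smaller power only for bases at most 1, which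
      summability ensures from some index on.\<close>
    have "eventually (\<lambda>j. b j powr p < 1) sequentially"
      using summable_LIMSEQ_zero[OF b(2)] by (rule order_tendstoD(2)) simp
    then have "eventually (\<lambda>j. norm (b j powr q) \<le> b j powr p) sequentially"
    proof eventually_elim
      case (elim j)
      have "b j \<le> 1"
      proof (rule ccontr)
        assume "\<not> b j \<le> 1"
        then have "1 \<le> b j powr p" using p by (simp add: ge_one_powr_ge_zero)
        then show False using elim by simp
      qed
      then show ?case using b(1)[of j] assms(5) by (simp add: q_def powr_mono')
    qed
    then have "summable (\<lambda>j. b j powr q)" by (rule summable_comparison_test_ev[OF _ b(2)])
    then show ?thesis unfolding a_def by (rule summable_mult)
  qed
  obtain M where M: "\<And>s. (\<Sum>u\<in>Pow {..<s}. fact (card u) powr (\<delta> * q) * (\<Prod>j\<in>u. a j)) \<le> M"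
    using sum_fact_prod_bounded[of a "\<delta> * q", OF a0 sa] assms(6) by (auto simp: q_def)
  have Mpos: "0 < M" using M[of 0] by simp
  have g1: "\<gamma> u powr \<theta> * B ^ card u \<le> fact (card u) powr (\<delta> * q) * (\<Prod>j\<in>u. a j)" for u
  proof -
    have "\<gamma> u powr \<theta> * B ^ card u = fact (card u) powr (\<delta> * q) * (\<Prod>j\<in>u. (\<rho> * b j / sqrt (r j)) powr q * B)"
      using b(1) \<rho> rp unfolding gamma e_def[symmetric] powr_powr eq
      by (simp add: powr_mult powr_powr prod_powr_distrib prod.distrib prod_nonneg less_imp_le)
    also have "\<dots> \<le> fact (card u) powr (\<delta> * q) * (\<Prod>j\<in>u. a j)"
    proof (intro mult_left_mono prod_mono conjI)
      fix j
      have "\<rho> * b j / sqrt (r j) \<le> \<rho> * b j / sqrt v0"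
        using \<rho> b(1)[of j] r(1)[of j] r(3) rp[of j] by (intro divide_left_mono) auto
      then have "(\<rho> * b j / sqrt (r j)) powr q \<le> (\<rho> / sqrt v0 * b j) powr q"
        using \<rho> b(1)[of j] rp[of j] q0 by (intro powr_mono2) (auto simp: less_imp_le)
      also have "\<dots> = (\<rho> / sqrt v0) powr q * b j powr q" by (rule powr_mult)
      finally have "(\<rho> * b j / sqrt (r j)) powr q * B \<le> (\<rho> / sqrt v0) powr q * b j powr q * B"
        using B by (intro mult_right_mono) auto
      also have "\<dots> \<le> a j" by (simp add: a_def D_def algebra_simps)
      finally show "(\<rho> * b j / sqrt (r j)) powr q * B \<le> a j" .
      show "0 \<le> (\<rho> * b j / sqrt (r j)) powr q * B" using B by simp
    qed auto
    finally show ?thesis .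
  qed
  have g2: "1 / \<gamma> u * (fact (card u) powr \<delta> * (\<Prod>j\<in>u. \<rho> * b j))\<^sup>2 \<le> fact (card u) powr (\<delta> * q) * (\<Prod>j\<in>u. a j)" for u
  proof -
    define Y where "Y = fact (card u) powr \<delta> * (\<Prod>j\<in>u. \<rho> * b j)"
    define S where "S = (\<Prod>j\<in>u. sqrt (r j))"
    have Y: "0 < Y" using \<rho> b(1) by (auto simp: Y_def intro!: mult_pos_pos prod_pos)
    have S: "0 < S" using rp by (auto simp: S_def intro!: prod_pos)
    have "\<gamma> u = (Y / S) powr e" unfolding gamma e_def[symmetric] Y_def S_def by (simp add: prod_dividef)
    then have "1 / \<gamma> u * Y\<^sup>2 = Y powr (2 - e) * S powr e"
      using Y S by (simp add: powr_divide powr_diff powr_numeral)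
    also have "\<dots> = fact (card u) powr (\<delta> * q) * (\<Prod>j\<in>u. (\<rho> * b j) powr q * sqrt (r j) powr e)"
      unfolding eq Y_def S_def using \<rho> b(1) rp
      by (simp add: powr_mult powr_powr prod_powr_distrib prod.distrib prod_nonneg less_imp_le del: prod_constant)
    also have "\<dots> \<le> fact (card u) powr (\<delta> * q) * (\<Prod>j\<in>u. a j)"
    proof (intro mult_left_mono prod_mono conjI)
      fix j
      have "(\<rho> * b j) powr q * sqrt (r j) powr e \<le> (\<rho> powr q * b j powr q) * sqrt v1 powr e"
        using \<rho> b(1)[of j] rp[of j] r(2)[of j] e0 by (simp add: powr_mult powr_mono2 mult_left_mono)
      also have "\<dots> \<le> a j" using B by (simp add: a_def D_def algebra_simps)
      finally show "(\<rho> * b j) powr q * sqrt (r j) powr e \<le> a j" .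
    qed auto
    finally show ?thesis by (simp add: Y_def)
  qed
  show ?thesis
  proof (intro exI[of _ M] conjI allI Mpos)
    fix s
    show "(\<Sum>u\<in>Pow {..<s}. \<gamma> u powr \<theta> * B ^ card u) \<le> M"
      by (rule order_trans[OF sum_mono M]) (rule g1)
    show "(\<Sum>u\<in>Pow {..<s}. 1 / \<gamma> u * (fact (card u) powr \<delta> * (\<Prod>j\<in>u. \<rho> * b j))\<^sup>2) \<le> M"
      by (rule order_trans[OF sum_mono M]) (rule g2)
  qed
qed

theorem theorem5p3:
  fixes F :: "(nat \<Rightarrow> real) \<Rightarrow> real"
    and \<delta> p \<theta> \<rho> :: real
    and b \<tau> :: "nat \<Rightarrow> real"
    and \<beta> C :: "nat \<Rightarrow> real \<Rightarrow> real"
    and \<gamma> :: "nat set \<Rightarrow> real"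
  assumes F_smooth: "infinitely_differentiable F"
    and delta: "1 \<le> \<delta>" "\<delta> < 3 / 2"
    and p: "0 < p" "p < 1 / \<delta>"
    and b_pos: "\<And>j. b j > 0"
    and b_lp: "summable (\<lambda>j. b j powr p)"
    and beta_pos: "\<And>j t. \<beta> j t > 0"
    and C_ge_1: "\<And>j t. C j t \<ge> 1"
    and C_F_finite: "\<And>\<xi>. convergent_prod (\<lambda>j. C j (\<xi> j))"
    and deriv_bound: "\<And>\<xi> \<nu>. finite {j. \<nu> j \<noteq> 0} \<Longrightarrow>
        \<bar>multi_deriv \<nu> F \<xi>\<bar> \<le> (\<Prod>j. C j (\<xi> j))
          * (\<Prod>j | \<nu> j \<noteq> 0. \<beta> j (\<xi> j) ^ \<nu> j) * (\<Prod>j | \<nu> j \<noteq> 0. b j ^ \<nu> j)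
          * fact (\<Sum>j | \<nu> j \<noteq> 0. \<nu> j) powr \<delta>"
    and tau_pos: "\<And>j. \<tau> j > 0"
    and rho_integrable:
      "\<And>j. integrable lebesgue (\<lambda>t. (C j t)\<^sup>2 * (\<beta> j t)\<^sup>2 * (psi (\<tau> j) t)\<^sup>2)"
    and rho_bdd: "bdd_above (range (\<lambda>j.
        sqrt (\<integral>t. (C j t)\<^sup>2 * (\<beta> j t)\<^sup>2 * (psi (\<tau> j) t)\<^sup>2 \<partial>lebesgue)))"
    and rho: "\<rho> = (SUP j. sqrt (\<integral>t. (C j t)\<^sup>2 * (\<beta> j t)\<^sup>2 * (psi (\<tau> j) t)\<^sup>2 \<partial>lebesgue))"
    and theta: "if p \<le> 2 / 3 then 1 / 2 < \<theta> \<and> \<theta> < 1 / (2 * \<delta> - 1) else \<theta> = p / (2 - p)"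
    and varrho_bdd: "bdd_above (range (\<lambda>j. varrho (\<tau> j) \<theta>))"
    and gamma: "\<And>u. \<gamma> u =
        (fact (card u) powr \<delta> * (\<Prod>j\<in>u. \<rho> * b j / sqrt (varrho (\<tau> j) \<theta>))) powr (2 / (1 + \<theta>))"
  shows "\<exists>C\<^sub>\<gamma>>0. \<forall>s\<ge>1.
    (\<forall>j<s. integrable lebesgue (\<lambda>t. C j t * std_normal_density t)) \<longrightarrow>
      F \<in> W_space s \<gamma> \<tau> \<and>
      (\<forall>m\<ge>1. \<forall>n z. n = 2 ^ m \<longrightarrow> cbc_vector s n \<gamma> \<tau> z \<longrightarrow>
        ennsqrt (\<integral>\<^sup>+\<Delta>. ennreal (\<bar>gauss_integral s F - lattice_rule s n z \<Delta> F\<bar>\<^sup>2) \<partial>unif_shift s)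
          \<le> ennreal (sqrt C\<^sub>\<gamma> * real n powr (- 1 / (2 * \<theta>))))"
proof -
  have pd: "p * \<delta> < 1" "p < 1"
  proof -
    show "p * \<delta> < 1" using p delta by (simp add: field_simps)
    moreover have "p * 1 \<le> p * \<delta>" using p delta by (intro mult_left_mono) auto
    ultimately show "p < 1" by simp
  qed
  \<comment> \<open>Both branches are reduced to the exponent
    \<open>2 * \<theta> / (1 + \<theta>)\<close>, increasing in \<open>\<theta>\<close>:
    \<open>\<theta> > 1 / 2\<close> puts it above 2/3, and
    \<open>\<theta> < 1 / (2 * \<delta> - 1)\<close> puts it below \<open>1 / \<delta>\<close>. In
    the second branch it is exactly \<open>p\<close>.\<close>
  have th: "1 / 2 < \<theta>" "\<theta> < 1" "p \<le> 2 * \<theta> / (1 + \<theta>)" "\<delta> * (2 * \<theta> / (1 + \<theta>)) < 1"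
  proof -
    have "1 / 2 < \<theta> \<and> \<theta> < 1 \<and> p \<le> 2 * \<theta> / (1 + \<theta>) \<and> \<delta> * (2 * \<theta> / (1 + \<theta>)) < 1"
    proof (cases "p \<le> 2 / 3")
      case True
      then have t: "1 / 2 < \<theta>" "\<theta> < 1 / (2 * \<delta> - 1)" using theta by auto
      then have t2: "\<theta> * (2 * \<delta> - 1) < 1" using delta by (simp add: field_simps)
      moreover have "\<theta> * 1 \<le> \<theta> * (2 * \<delta> - 1)" using t delta by (intro mult_left_mono) auto
      ultimately have "\<theta> < 1" by linarith
      moreover have "2 / 3 \<le> 2 * \<theta> / (1 + \<theta>)" using t by (simp add: field_simps)
      moreover have "\<delta> * (2 * \<theta> / (1 + \<theta>)) < 1" using t t2 by (simp add: field_simps)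
      ultimately show ?thesis using t True by auto
    next
      case False
      then have t: "\<theta> = p / (2 - p)" using theta by simp
      have "2 * \<theta> / (1 + \<theta>) = p" using pd unfolding t by (simp add: field_simps)
      moreover have "1 / 2 < \<theta>" "\<theta> < 1" using False pd unfolding t by (simp_all add: field_simps)
      ultimately show ?thesis using pd by (simp add: mult.commute)
    qed
    then show "1 / 2 < \<theta>" "\<theta> < 1" "p \<le> 2 * \<theta> / (1 + \<theta>)" "\<delta> * (2 * \<theta> / (1 + \<theta>)) < 1" by auto
  qed
  have th1: "\<theta> \<le> 1" "0 < \<theta>" using th by auto
  have rho_le: "sqrt (\<integral>t. (C j t)\<^sup>2 * (\<beta> j t)\<^sup>2 * (psi (\<tau> j) t)\<^sup>2 \<partial>lebesgue) \<le> \<rho>" for j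
    unfolding rho by (rule cSUP_upper[OF UNIV_I rho_bdd])
  have rho_pos: "0 < \<rho>"
  proof -
    have "0 < (C 0 t)\<^sup>2 * (\<beta> 0 t)\<^sup>2 * (psi (\<tau> 0) t)\<^sup>2" for t
      using C_ge_1[of 0 t] beta_pos[of 0 t] psi_pos[of "\<tau> 0" t] by (intro mult_pos_pos zero_less_power) auto
    then have "0 < sqrt (\<integral>t. (C 0 t)\<^sup>2 * (\<beta> 0 t)\<^sup>2 * (psi (\<tau> 0) t)\<^sup>2 \<partial>lebesgue)"
      using lebesgue_integral_pos[OF rho_integrable[of 0]] by simp
    then show ?thesis using rho_le[of 0] by linarith
  qed
  obtain v1 where v1: "\<And>j. varrho (\<tau> j) \<theta> \<le> v1" using varrho_bdd by (auto simp: bdd_above_def)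
  note v0 = varrho_0_pos[OF th(1) th1(1)] and vb = varrho_bounds[OF th(1) th1(1)]
  define c where "c = \<theta> * (4 * \<theta> / (2 * \<theta> - 1))"
  have c: "0 < c" using th by (simp add: c_def)
  \<comment> \<open>By \<open>varrho_bounds\<close> the bound \<open>v1\<close> limits the squares
    of the \<open>\<tau> j\<close>; the inequality
    \<open>\<tau> j \<le> 1 + (\<tau> j)\<^sup>2\<close> passes to \<open>\<tau> j\<close>
    itself.\<close>
  define L where "L = 1 + v1 / varrho 0 \<theta> / c"
  have tau_le: "\<tau> j \<le> L" for j
  proof -
    have "c * (\<tau> j)\<^sup>2 \<le> varrho (\<tau> j) \<theta> / varrho 0 \<theta>" using vb(2)[of "\<tau> j"] by (simp add: c_def)
    also have "\<dots> \<le> v1 / varrho 0 \<theta>" using v1 v0 by (intro divide_right_mono) auto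
    finally have "(\<tau> j)\<^sup>2 * c \<le> v1 / varrho 0 \<theta>" by (simp only: mult.commute)
    then have "(\<tau> j)\<^sup>2 \<le> v1 / varrho 0 \<theta> / c" by (simp only: pos_le_divide_eq[OF c])
    moreover have "\<tau> j \<le> 1 + (\<tau> j)\<^sup>2"
    proof -
      have "0 \<le> (\<tau> j - 1 / 2)\<^sup>2" by simp
      then show ?thesis by (simp add: power2_eq_square algebra_simps)
    qed
    ultimately show ?thesis by (simp add: L_def)
  qed
  obtain B where B: "0 < B" "\<And>\<tau> m. 0 \<le> \<tau> \<Longrightarrow> \<tau> \<le> L \<Longrightarrow> (\<Sum>h<2 ^ m. Cf \<tau> (2 ^ m) h powr \<theta> * real (gcd h (2 ^ m))) \<le> B"
    using Cf_sum_bounded[OF th(1) th1(1), of L] by blast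
  obtain M where M: "0 < M" "\<And>s. (\<Sum>u\<in>Pow {..<s}. \<gamma> u powr \<theta> * B ^ card u) \<le> M"
    "\<And>s. (\<Sum>u\<in>Pow {..<s}. 1 / \<gamma> u * (fact (card u) powr \<delta> * (\<Prod>j\<in>u. \<rho> * b j))\<^sup>2) \<le> M"
    using weight_sums_bounded[OF b_pos b_lp p(1) th1(2) th(3,4) rho_pos vb(1) v1 v0 B(1) gamma] by blast
  have gamma_pos: "\<gamma> u > 0" for u
  proof -
    have "0 < varrho (\<tau> j) \<theta>" for j using vb(1)[of "\<tau> j"] v0 by simp
    then have "0 < fact (card u) powr \<delta> * (\<Prod>j\<in>u. \<rho> * b j / sqrt (varrho (\<tau> j) \<theta>))"
      using rho_pos b_pos by (intro mult_pos_pos prod_pos) auto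
    then show ?thesis unfolding gamma powr_gt_zero by linarith
  qed
  obtain K where K: "0 \<le> K" "\<And>s. \<forall>j<s. integrable lebesgue (\<lambda>t. C j t * std_normal_density t) \<Longrightarrow> F \<in> W_space s \<gamma> \<tau>"
    "\<And>s. \<forall>j<s. integrable lebesgue (\<lambda>t. C j t * std_normal_density t) \<Longrightarrow>
      N2 s \<gamma> \<tau> F \<le> K * (\<Sum>u\<in>Pow {..<s}. 1 / \<gamma> u * (fact (card u) powr \<delta> * (\<Prod>j\<in>u. \<rho> * b j))\<^sup>2)"
    using F_error_bound[of F b \<beta> C \<delta> \<tau> \<rho>, OF F_smooth b_pos beta_pos C_ge_1 C_F_finite deriv_bound rho_integrable rho_le] gamma_pos
    by blast
  \<comment> \<open>\<open>K * M\<close> bounds the squared norm of \<open>F\<close>;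
    \<open>(2 * M) powr (1 / \<theta>)\<close> arises from taking the root
    \<open>1 / \<theta>\<close> in \<open>cbc_bound\<close>. The added 1 keeps the constant positive
    if \<open>K = 0\<close>.\<close>
  define D where "D = (K * M + 1) * (2 * M) powr (1 / \<theta>)"
  have KM: "0 < K * M + 1" using K(1) M(1) by (simp add: add_nonneg_pos)
  have D: "0 < D" unfolding D_def using KM M(1) by simp
  show ?thesis
  proof (intro exI[of _ D] conjI D allI impI)
    fix s :: nat assume i: "\<forall>j<s. integrable lebesgue (\<lambda>t. C j t * std_normal_density t)"
    show FW: "F \<in> W_space s \<gamma> \<tau>" by (rule K(2)[OF i])
    fix m n :: nat and z assume m: "1 \<le> m" and n: "n = 2 ^ m" and cbc: "cbc_vector s n \<gamma> \<tau> z"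
    have n1: "1 \<le> n" using n by simp
    have "N2 s \<gamma> \<tau> F \<le> K * M" using K(3)[OF i] mult_left_mono[OF M(3) K(1)] by (rule order_trans)
    then have N: "N2 s \<gamma> \<tau> F \<le> K * M + 1" by simp
    have V0: "0 \<le> V s n \<gamma> \<tau> z" by (rule V_nonneg[OF gamma_pos])
    have "V s n \<gamma> \<tau> z powr \<theta> \<le> 2 / real n * (\<Sum>u\<in>Pow {..<s} - {{}}. \<gamma> u powr \<theta> * B ^ card u)"
      using B(2)[of "\<tau> _" m] tau_pos tau_le n by (intro cbc_bound[OF m n gamma_pos th1(2,1) _ cbc]) (auto simp: less_imp_le)
    also have "\<dots> \<le> 2 / real n * (\<Sum>u\<in>Pow {..<s}. \<gamma> u powr \<theta> * B ^ card u)"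
      using B(1) by (intro mult_left_mono sum_mono2) auto
    also have "\<dots> \<le> 2 / real n * M" by (intro mult_left_mono M(2)) simp
    finally have "(V s n \<gamma> \<tau> z powr \<theta>) powr (1 / \<theta>) \<le> (2 * M / real n) powr (1 / \<theta>)"
      using th1 by (intro powr_mono2) auto
    then have V: "V s n \<gamma> \<tau> z \<le> (2 * M) powr (1 / \<theta>) * real n powr (- (1 / \<theta>))"
      using V0 th1 M(1) n1 by (simp add: powr_powr powr_divide powr_minus_divide)
    have "N2 s \<gamma> \<tau> F * V s n \<gamma> \<tau> z \<le> (K * M + 1) * ((2 * M) powr (1 / \<theta>) * real n powr (- (1 / \<theta>)))"
      using N V V0 KM by (intro mult_mono) auto
    also have "\<dots> = D * (real n powr (- 1 / (2 * \<theta>)))\<^sup>2"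
      by (simp add: D_def power2_eq_square powr_add[symmetric] field_simps)
    finally have "sqrt (N2 s \<gamma> \<tau> F * V s n \<gamma> \<tau> z) \<le> sqrt (D * (real n powr (- 1 / (2 * \<theta>)))\<^sup>2)"
      by (rule real_sqrt_le_mono)
    also have "\<dots> = sqrt D * real n powr (- 1 / (2 * \<theta>))" by (simp add: real_sqrt_mult)
    finally have "ennreal (sqrt (N2 s \<gamma> \<tau> F * V s n \<gamma> \<tau> z)) \<le> ennreal (sqrt D * real n powr (- 1 / (2 * \<theta>)))"
      by (rule ennreal_leI)
    with root_mean_square_error_le[OF n1 gamma_pos FW]
    show "ennsqrt (\<integral>\<^sup>+\<Delta>. ennreal (\<bar>gauss_integral s F - lattice_rule s n z \<Delta> F\<bar>\<^sup>2) \<partial>unif_shift s)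
      \<le> ennreal (sqrt D * real n powr (- 1 / (2 * \<theta>)))" by (rule order_trans)
  qed
qed

end
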